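(* Let $K,L$ be $p$-adic fields and let $\alpha:G_K\to G_L$ be an isomorphism of topological groups. Let $W_K,W_L$ be the Weil groups and $W_K',W_L'$ the Weil-Deligne groups of $K$ and $L$. Then $\alpha$ induces natural topological isomorphisms (1) $W_K\simeq W_L$, and (2) $W_K'\simeq W_L'$, such that a Frobenius element of $W_K$ maps to a Frobenius element of $W_L$ (and similarly for the Weil-Deligne groups).
   Context: A $p$-adic field is a finite extension of $\mathbb{Q}_p$; $G_K$ is its absolute Galois group, $I_K$ its inertia subgroup. The Weil group $W_K\subset G_K$ is the subgroup of elements whose image in $G_K/I_K\simeq\widehat{\mathbb{Z}}$ is an integral power of Frobenius, topologized so that $I_K$ is open with its profinite topology. The Weil-Deligne group is the semidirect product $W_K'=W_K\ltimes\mathbb{C}$ (with $\mathbb{C}$ viewed as the additive group), where $w\,x\,w^{-1}=\|w\|\,x$ for $w\in W_K$, $x\in\mathbb{C}$, and $\|\cdot\|$ is the norm character of $W_K$, i.e. the character corresponding by local class field theory to $x\mapsto q_K^{-\mathrm{ord}_K(x)}$ on $K^*$, with $q_K$ the cardinality of the residue field. *)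

theory Defs
  imports "HOL-Analysis.Analysis" "HOL-Algebra.Algebra"
begin

section \<open>The field of \<open>p\<close>-adic numbers\<close>

definition padic_abs :: "nat \<Rightarrow> rat \<Rightarrow> real" where
  "padic_abs p r = (if r = 0 then 0
     else real p powi (int (multiplicity (int p) (snd (quotient_of r)))
                       - int (multiplicity (int p) (fst (quotient_of r)))))"

definition padic_cauchy :: "nat \<Rightarrow> (nat \<Rightarrow> rat) \<Rightarrow> bool" where
  "padic_cauchy p f \<longleftrightarrow> (\<forall>e>0. \<exists>N. \<forall>m\<ge>N. \<forall>n\<ge>N. padic_abs p (f m - f n) < e)"

definition padic_null :: "nat \<Rightarrow> (nat \<Rightarrow> rat) \<Rightarrow> bool" where
  "padic_null p f \<longleftrightarrow> (\<forall>e>0. \<exists>N. \<forall>n\<ge>N. padic_abs p (f n) < e)"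

definition padic_cauchy_ring :: "nat \<Rightarrow> (nat \<Rightarrow> rat) ring" where
  "padic_cauchy_ring p =
     \<lparr>carrier = Collect (padic_cauchy p), mult = (\<lambda>f g n. f n * g n), one = (\<lambda>_. 1),
      ring.zero = (\<lambda>_. 0), ring.add = (\<lambda>f g n. f n + g n)\<rparr>"

definition Qp :: "nat \<Rightarrow> (nat \<Rightarrow> rat) set ring" where
  "Qp p = padic_cauchy_ring p Quot Collect (padic_null p)"

text \<open>A class of absolute value at most \<open>1\<close> has a representative all of whose terms have absolute
  value at most \<open>1\<close>, since \<open>padic_abs p\<close> is discrete.\<close>

definition Zp :: "nat \<Rightarrow> (nat \<Rightarrow> rat) set set" where
  "Zp p = {x \<in> carrier (Qp p). \<exists>f\<in>x. \<forall>n. padic_abs p (f n) \<le> 1}"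


section \<open>\<open>p\<close>-adic fields and their absolute Galois groups\<close>

text \<open>A \<open>p\<close>-adic field comes with its structure map from \<open>Qp p\<close> and with the algebraic closure
  that is used to form its absolute Galois group; the field itself is a subfield of that closure.\<close>

record 'a padic_ext =
  res_char :: nat
  alg_cl :: "'a ring"
  base_field :: "'a set"
  qp_emb :: "(nat \<Rightarrow> rat) set \<Rightarrow> 'a"

definition padic_field :: "'a padic_ext \<Rightarrow> bool" where
  "padic_field K \<longleftrightarrow>
     normalization_semidom_class.prime (res_char K) \<and>
     algebraic_closure (alg_cl K) (base_field K) \<and>
     qp_emb K \<in> ring_hom (Qp (res_char K)) (alg_cl K) \<and>
     qp_emb K ` carrier (Qp (res_char K)) \<subseteq> base_field K \<and>
     ring.finite_dimension (alg_cl K) (qp_emb K ` carrier (Qp (res_char K))) (base_field K)"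

definition mult_group :: "'a padic_ext \<Rightarrow> 'a monoid" where
  "mult_group K = units_of (alg_cl K\<lparr>carrier := base_field K\<rparr>)"

definition galois_group :: "'a padic_ext \<Rightarrow> ('a \<Rightarrow> 'a) monoid" where
  "galois_group K = BijGroup (carrier (alg_cl K))
     \<lparr>carrier := {\<sigma> \<in> ring_hom (alg_cl K) (alg_cl K) \<inter> Bij (carrier (alg_cl K)).
                   \<forall>x\<in>base_field K. \<sigma> x = x}\<rparr>"

definition finite_ext :: "'a padic_ext \<Rightarrow> 'a set \<Rightarrow> bool" where
  "finite_ext K E \<longleftrightarrow> subfield E (alg_cl K) \<and> base_field K \<subseteq> E \<and>
     ring.finite_dimension (alg_cl K) (base_field K) E"

definition fixing_subgroup :: "'a padic_ext \<Rightarrow> 'a set \<Rightarrow> ('a \<Rightarrow> 'a) set" where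
  "fixing_subgroup K E = {\<sigma> \<in> carrier (galois_group K). \<forall>x\<in>E. \<sigma> x = x}"

text \<open>The Krull topology.\<close>

definition galois_topology :: "'a padic_ext \<Rightarrow> ('a \<Rightarrow> 'a) topology" where
  "galois_topology K = topology_generated_by
     {\<sigma> <#\<^bsub>galois_group K\<^esub> fixing_subgroup K E |\<sigma> E.
        \<sigma> \<in> carrier (galois_group K) \<and> finite_ext K E}"


section \<open>Integers, inertia and Frobenius elements\<close>

text \<open>The ring of integers of the algebraic closure is the integral closure of \<open>Zp\<close>. Polynomials
  are coefficient lists with the leading coefficient first. The maximal ideals of the local rings
  below are their sets of non-units.\<close>

definition integers_cl :: "'a padic_ext \<Rightarrow> 'a ring" where
  "integers_cl K = alg_cl K\<lparr>carrier := {x \<in> carrier (alg_cl K).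
     \<exists>P. P \<noteq> [] \<and> hd P = \<one>\<^bsub>alg_cl K\<^esub> \<and> set P \<subseteq> qp_emb K ` Zp (res_char K) \<and>
         ring.eval (alg_cl K) P x = \<zero>\<^bsub>alg_cl K\<^esub>}\<rparr>"

definition integers :: "'a padic_ext \<Rightarrow> 'a ring" where
  "integers K = alg_cl K\<lparr>carrier := carrier (integers_cl K) \<inter> base_field K\<rparr>"

definition nonunits :: "'a ring \<Rightarrow> 'a set" where
  "nonunits R = carrier R - Units R"

definition residue_card :: "'a padic_ext \<Rightarrow> nat" where
  "residue_card K = card (carrier (integers K Quot nonunits (integers K)))"

definition uniformizer :: "'a padic_ext \<Rightarrow> 'a \<Rightarrow> bool" where
  "uniformizer K \<pi> \<longleftrightarrow> \<pi> \<in> carrier (integers K) \<and> PIdl\<^bsub>integers K\<^esub> \<pi> = nonunits (integers K)"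

definition ord_val :: "'a padic_ext \<Rightarrow> 'a \<Rightarrow> int" where
  "ord_val K x = (THE n. \<exists>\<pi> u. uniformizer K \<pi> \<and> u \<in> Units (integers K) \<and>
     x = u \<otimes>\<^bsub>alg_cl K\<^esub> (\<pi> [^]\<^bsub>alg_cl K\<^esub> n))"

text \<open>The inertia subgroup is the kernel of the action on the residue field of the algebraic
  closure; a Frobenius element acts on that residue field as the \<open>q\<close>-th power map.\<close>

definition inertia :: "'a padic_ext \<Rightarrow> ('a \<Rightarrow> 'a) set" where
  "inertia K = {\<sigma> \<in> carrier (galois_group K).
     \<forall>x\<in>carrier (integers_cl K). \<sigma> x \<ominus>\<^bsub>alg_cl K\<^esub> x \<in> nonunits (integers_cl K)}"

definition frobenius_element :: "'a padic_ext \<Rightarrow> ('a \<Rightarrow> 'a) \<Rightarrow> bool" where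
  "frobenius_element K \<phi> \<longleftrightarrow> \<phi> \<in> carrier (galois_group K) \<and>
     (\<forall>x\<in>carrier (integers_cl K).
        \<phi> x \<ominus>\<^bsub>alg_cl K\<^esub> (x [^]\<^bsub>alg_cl K\<^esub> residue_card K) \<in> nonunits (integers_cl K))"


section \<open>The Weil group\<close>

definition weil_group :: "'a padic_ext \<Rightarrow> ('a \<Rightarrow> 'a) monoid" where
  "weil_group K = galois_group K
     \<lparr>carrier := {\<sigma> \<in> carrier (galois_group K). \<exists>\<phi>. \<exists>n::int. frobenius_element K \<phi> \<and>
        inertia K #>\<^bsub>galois_group K\<^esub> \<sigma> =
          (inertia K #>\<^bsub>galois_group K\<^esub> \<phi>) [^]\<^bsub>galois_group K Mod inertia K\<^esub> n}\<rparr>"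

text \<open>The basic open sets are the translates of the open subsets of the inertia subgroup for the
  Krull topology. This is finer than the topology induced from the absolute Galois group.\<close>

definition weil_topology :: "'a padic_ext \<Rightarrow> ('a \<Rightarrow> 'a) topology" where
  "weil_topology K = topology_generated_by
     {w <#\<^bsub>galois_group K\<^esub> V |w V. w \<in> carrier (weil_group K) \<and>
        openin (subtopology (galois_topology K) (inertia K)) V}"


section \<open>Local class field theory and the norm character\<close>

definition weil_ab :: "'a padic_ext \<Rightarrow> ('a \<Rightarrow> 'a) set monoid" where
  "weil_ab K = weil_group K Mod
     (weil_topology K closure_of derived (weil_group K) (carrier (weil_group K)))"

definition abelian_ext :: "'a padic_ext \<Rightarrow> 'a set \<Rightarrow> bool" where
  "abelian_ext K E \<longleftrightarrow> finite_ext K E \<and>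
     (\<forall>\<sigma>\<in>carrier (galois_group K). \<sigma> ` E = E) \<and>
     (\<forall>\<sigma>\<in>carrier (galois_group K). \<forall>\<tau>\<in>carrier (galois_group K). \<forall>x\<in>E. \<sigma> (\<tau> x) = \<tau> (\<sigma> x))"

text \<open>The product over all embeddings of \<open>E\<close> over the base field, which are the restrictions to
  \<open>E\<close> of elements of the absolute Galois group.\<close>

definition field_norm :: "'a padic_ext \<Rightarrow> 'a set \<Rightarrow> 'a \<Rightarrow> 'a" where
  "field_norm K E y =
     (\<Otimes>\<^bsub>alg_cl K\<^esub> s \<in> (\<lambda>\<sigma>. restrict \<sigma> E) ` carrier (galois_group K). s y)"

text \<open>The reciprocity isomorphism of local class field theory, given by its usual characterization:
  uniformizers go to Frobenius elements (\<open>s = 1\<close>) or to inverses of Frobenius elements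
  (\<open>s = - 1\<close>), and for every finite abelian extension the elements acting trivially on it
  correspond to the norms from it. Values are cosets in the Weil group, so \<open>w \<in> art x\<close> says that
  \<open>w\<close> represents the image of \<open>x\<close>.\<close>

definition local_reciprocity ::
    "int \<Rightarrow> 'a padic_ext \<Rightarrow> ('a \<Rightarrow> ('a \<Rightarrow> 'a) set) \<Rightarrow> bool" where
  "local_reciprocity s K art \<longleftrightarrow>
     art \<in> iso (mult_group K) (weil_ab K) \<and>
     (\<forall>\<pi>. uniformizer K \<pi> \<longrightarrow>
        (\<forall>w\<in>art \<pi>. frobenius_element K (w [^]\<^bsub>weil_group K\<^esub> s))) \<and>
     (\<forall>E. abelian_ext K E \<longrightarrow> (\<forall>x\<in>carrier (mult_group K).
        x \<in> field_norm K E ` (E - {\<zero>\<^bsub>alg_cl K\<^esub>}) \<longleftrightarrow> (\<forall>w\<in>art x. \<forall>e\<in>E. w e = e)))"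

definition norm_character ::
    "'a padic_ext \<Rightarrow> ('a \<Rightarrow> ('a \<Rightarrow> 'a) set) \<Rightarrow> ('a \<Rightarrow> 'a) \<Rightarrow> real" where
  "norm_character K art w = real (residue_card K) powi
     (- ord_val K (THE x. x \<in> carrier (mult_group K) \<and> w \<in> art x))"


section \<open>The Weil-Deligne group\<close>

text \<open>The pair \<open>(w, x)\<close> stands for the product \<open>x w\<close> of \<open>x\<close> in the normal subgroup of complex
  numbers and \<open>w\<close> in the Weil group, so the multiplication below encodes
  \<open>w x w\<^sup>-\<^sup>1 = norm_character K art w * x\<close>.\<close>

definition weil_deligne_group ::
    "'a padic_ext \<Rightarrow> ('a \<Rightarrow> ('a \<Rightarrow> 'a) set) \<Rightarrow> (('a \<Rightarrow> 'a) \<times> complex) monoid" where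
  "weil_deligne_group K art =
     \<lparr>carrier = carrier (weil_group K) \<times> UNIV,
      mult = (\<lambda>(w, x) (w', x').
        (w \<otimes>\<^bsub>weil_group K\<^esub> w', x + complex_of_real (norm_character K art w) * x')),
      one = (\<one>\<^bsub>weil_group K\<^esub>, 0)\<rparr>"

definition weil_deligne_topology :: "'a padic_ext \<Rightarrow> (('a \<Rightarrow> 'a) \<times> complex) topology" where
  "weil_deligne_topology K = prod_topology (weil_topology K) euclidean"

text \<open>The elements lying over a Frobenius element of the Weil group.\<close>

definition wd_frobenius_element :: "'a padic_ext \<Rightarrow> ('a \<Rightarrow> 'a) \<times> complex \<Rightarrow> bool" where
  "wd_frobenius_element K z \<longleftrightarrow> frobenius_element K (fst z)"


definition top_group_iso ::
    "('a, 'm) monoid_scheme \<Rightarrow> 'a topology \<Rightarrow> ('b, 'n) monoid_scheme \<Rightarrow> 'b topology \<Rightarrow>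
     ('a \<Rightarrow> 'b) \<Rightarrow> bool" where
  "top_group_iso G S H T f \<longleftrightarrow> f \<in> iso G H \<and> homeomorphic_map S T f"

end

theory Submission
  imports Defs "HOL-Number_Theory.Residues"
begin

text \<open>
The integral closure \<open>O\<close> of \<open>Zp\<close> in the algebraic closure is a valuation ring, because \<open>Zp\<close> is complete.
By Teichmueller representatives, inertia elements and Frobenius elements are those automorphisms that act
on the roots of unity of order prime to \<open>p\<close> trivially, respectively by \<open>q\<close>-th powers. Hence it suffices
that the isomorphism preserves \<open>q\<close> and the action on roots of unity of order prime to both residue
characteristics. For the second point this action is read off from the topological group. If an automorphism
raises \<open>n\<close>-th roots of unity to the power \<open>c\<close>, then Kummer theory and the commutativity of the
residual Galois group give a relation for all homomorphisms modulo \<open>n\<close> with open kernel on normal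
subgroups. Conversely, for \<open>n = l ^ k\<close> this relation, applied to the cocycle of an \<open>n\<close>-th root
of \<open>p\<close>, determines \<open>c\<close> modulo \<open>l ^ (k - 2 j)\<close> with \<open>j\<close> independent of \<open>k\<close>.
Since some automorphism acts by \<open>q\<close>-th powers, the two residue cardinalities are powers of each other
modulo every such order, so they are equal. Finally, local reciprocity sends uniformizers to Frobenius elements
or to their inverses, so the norm character of a Weil group element only depends on its degree on the residue
field.
\<close>

text \<open>The isomorphism knows nothing of the fields: neither the residue characteristics nor the
  integers nor the roots of unity are visible in the group. The relation is therefore imposed on all
  normal subgroups, but only for those of their elements that are commutators, because commutators
  fix every root of unity whatever the field is. The Kummer generator of a homomorphism and its
  image under an automorphism differ by a unit, and this unit is the unknown error in the relation.
  Its residue does not change when a commutator is replaced by a conjugate, so the error cancels in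
  a difference; this is why each side of the relation compares a commutator with a conjugate of it.
  The loss of \<open>2 j\<close> has two sources, neither divisible by \<open>l ^ j\<close>: the
  number \<open>q - 1\<close>, and the value of the cocycle on a commutator, which is controlled by
  the bounded ramification of the base field over \<open>Q\<close>. As \<open>k\<close> is
  arbitrary, the loss can be made up for in advance. Equality of the residue cardinalities also
  gives equality of the residue characteristics, so that roots of unity of order prime to both are
  all that matter.\<close>

abbreviation nat_prime :: "nat \<Rightarrow> bool" where
 "nat_prime \<equiv> normalization_semidom_class.prime"

section \<open>The \<open>p\<close>-adic absolute value\<close>

lemma padic_abs_frac:
 assumes p: "nat_prime p" and a: "a \<noteq> 0" and b: "b \<noteq> 0"
 shows "padic_abs p (of_int a / of_int b)
      = real p powi (int (multiplicity (int p) b) - int (multiplicity (int p) a))"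
proof -
 define r where "r = (of_int a / of_int b :: rat)"
 obtain c d where cd: "quotient_of r = (c, d)" by (metis surj_pair)
 have r0: "r \<noteq> 0" using a b by (simp add: r_def)
 have d: "d > 0" using quotient_of_denom_pos[OF cd] .
 have rcd: "r = of_int c / of_int d" using quotient_of_div[OF cd] .
 have c: "c \<noteq> 0" using r0 rcd by auto
 have "of_int (a * d) = (of_int (c * b) :: rat)"
  using rcd a b c d unfolding r_def by (simp add: field_simps)
 hence eq: "a * d = c * b" using of_int_eq_iff by blast
 have pp: "prime_elem (int p)" using p by simp
 have "multiplicity (int p) (a * d) = multiplicity (int p) a + multiplicity (int p) d"
  using a d pp by (simp add: prime_elem_multiplicity_mult_distrib)
 moreover have "multiplicity (int p) (c * b) = multiplicity (int p) c + multiplicity (int p) b"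
  using c b pp by (simp add: prime_elem_multiplicity_mult_distrib)
 ultimately have "int (multiplicity (int p) d) - int (multiplicity (int p) c)
    = int (multiplicity (int p) b) - int (multiplicity (int p) a)" using eq by simp
 thus ?thesis using r0 cd unfolding r_def[symmetric] padic_abs_def by simp
qed

lemma rat_fracE:
 obtains a b where "r = (of_int a / of_int b :: rat)" "b > 0"
 using quotient_of_div quotient_of_denom_pos by (metis surj_pair)

lemma padic_abs_0 [simp]: "padic_abs p 0 = 0"
 by (simp add: padic_abs_def)

context
 fixes p :: nat
 assumes p: "nat_prime p"
begin

lemma p_gt_1: "real p > 1" using p prime_gt_1_nat by simp

lemma padic_abs_nonzero: "r \<noteq> 0 ==> \<exists>k::int. padic_abs p r = real p powi k"
 unfolding padic_abs_def by auto

lemma padic_abs_pos: "r \<noteq> 0 ==> padic_abs p r > 0"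
 using padic_abs_nonzero p_gt_1 by (metis less_trans zero_less_one zero_less_power_int)

lemma padic_abs_nonneg [simp]: "padic_abs p r \<ge> 0"
 using padic_abs_pos[of r] by (cases "r = 0") auto

lemma padic_abs_eq_0 [simp]: "padic_abs p r = 0 \<longleftrightarrow> r = 0"
 using padic_abs_pos[of r] by force

lemma padic_abs_mult: "padic_abs p (r * s) = padic_abs p r * padic_abs p s"
proof (cases "r = 0 \<or> s = 0")
 case False
 obtain a b where r: "r = of_int a / of_int b" "b > 0" by (rule rat_fracE)
 obtain c d where s: "s = of_int c / of_int d" "d > 0" by (rule rat_fracE)
 have nz: "a \<noteq> 0" "b \<noteq> 0" "c \<noteq> 0" "d \<noteq> 0" using False r s by auto
 have pp: "prime_elem (int p)" using p by simp
 have "r * s = of_int (a * c) / of_int (b * d)" using r s by simp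
 hence "padic_abs p (r * s) = real p powi (int (multiplicity (int p) (b * d)) - int (multiplicity (int p) (a * c)))"
  using padic_abs_frac[OF p, of "a * c" "b * d"] nz by simp
 also have "\<dots> = real p powi (int (multiplicity (int p) b) - int (multiplicity (int p) a)
    + (int (multiplicity (int p) d) - int (multiplicity (int p) c)))"
  using nz pp by (simp add: prime_elem_multiplicity_mult_distrib algebra_simps)
 also have "\<dots> = padic_abs p r * padic_abs p s"
  unfolding r(1) s(1) padic_abs_frac[OF p nz(1,2)] padic_abs_frac[OF p nz(3,4)]
  by (rule power_int_add) (use p_gt_1 in auto)
 finally show ?thesis .
qed auto

lemma padic_abs_1 [simp]: "padic_abs p 1 = 1"
 using padic_abs_mult[of 1 1] by simp

lemma padic_abs_minus [simp]: "padic_abs p (- r) = padic_abs p r"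
proof -
 have "padic_abs p (-1) * padic_abs p (-1) = 1" using padic_abs_mult[of "-1" "-1"] by simp
 hence "(padic_abs p (-1))\<^sup>2 = 1" by (simp add: power2_eq_square)
 hence "padic_abs p (-1) = 1" using padic_abs_nonneg[of "-1"] by (simp add: power2_eq_1_iff)
 thus ?thesis using padic_abs_mult[of "-1" r] by simp
qed

lemma padic_abs_diff_commute: "padic_abs p (r - s) = padic_abs p (s - r)"
 using padic_abs_minus[of "r - s"] by simp

lemma padic_abs_inverse: "padic_abs p (inverse r) = inverse (padic_abs p r)"
proof (cases "r = 0")
 case False
 hence "padic_abs p r * padic_abs p (inverse r) = 1" using padic_abs_mult[of r "inverse r"] by simp
 thus ?thesis by (metis inverse_unique)
qed auto

lemma padic_abs_of_int: "a \<noteq> 0 ==> padic_abs p (of_int a) = real p powi (- int (multiplicity (int p) a))"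
 using padic_abs_frac[OF p, of a 1] by simp

lemma padic_abs_of_int_le: "padic_abs p (of_int a) \<le> 1"
proof (cases "a = 0")
 case False
 thus ?thesis using padic_abs_of_int[OF False] p_gt_1 by (simp add: power_int_minus one_le_power inverse_le_1_iff)
qed auto

lemma padic_abs_of_nat_le: "padic_abs p (of_nat a) \<le> 1"
 using padic_abs_of_int_le[of "int a"] by simp

lemma padic_abs_p: "padic_abs p (of_nat p) = inverse (real p)"
proof -
 have "padic_abs p (of_int (int p)) = real p powi (- int (multiplicity (int p) (int p)))"
  by (rule padic_abs_of_int) (use p in auto)
 thus ?thesis using p by (simp add: multiplicity_self power_int_minus)
qed

lemma padic_abs_power: "padic_abs p (r ^ n) = padic_abs p r ^ n"
 by (induction n) (auto simp: padic_abs_mult)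

lemma padic_abs_powi: "padic_abs p (of_nat p powi k) = real p powi (- k)"
 by (cases k rule: int_cases2)
   (auto simp: power_int_minus padic_abs_inverse padic_abs_power padic_abs_p power_inverse)

text \<open>This is the ultrametric inequality with the larger term scaled to \<open>1\<close>. If
  \<open>r = a / b\<close> has absolute value at most \<open>1\<close>, the power of
  \<open>p\<close> in \<open>b\<close> divides both \<open>a\<close> and \<open>b\<close>, hence
  their sum.\<close>

lemma padic_abs_le_1_add:
 assumes "padic_abs p r \<le> 1" shows "padic_abs p (1 + r) \<le> 1"
proof (cases "r = 0 \<or> 1 + r = 0")
 case False
 obtain a b where r: "r = of_int a / of_int b" "b > 0" by (rule rat_fracE)
 have nz: "a \<noteq> 0" "b \<noteq> 0" using False r by auto
 have s: "1 + r = of_int (a + b) / of_int b" using r by (simp add: field_simps)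
 have nz': "a + b \<noteq> 0" using s False by (metis divide_eq_0_iff of_int_0)
 have le: "multiplicity (int p) b \<le> multiplicity (int p) a"
 proof (rule ccontr)
  assume "\<not> ?thesis"
  hence "real p powi (int (multiplicity (int p) b) - int (multiplicity (int p) a)) > 1"
   using p_gt_1 power_int_strict_increasing[of 0 "int (multiplicity (int p) b) - int (multiplicity (int p) a)" "real p"] by simp
  thus False using assms padic_abs_frac[OF p nz] r by simp
 qed
 have "int p ^ multiplicity (int p) b dvd a + b"
  using le by (intro dvd_add multiplicity_dvd' multiplicity_dvd)
 hence "multiplicity (int p) b \<le> multiplicity (int p) (a + b)"
  by (intro multiplicity_geI) (use nz' p in "auto simp: zdvd1_eq")
 hence "real p powi (int (multiplicity (int p) b) - int (multiplicity (int p) (a + b))) \<le> 1"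
  using p_gt_1 power_int_increasing[of "int (multiplicity (int p) b) - int (multiplicity (int p) (a + b))" 0 "real p"] by simp
 thus ?thesis using padic_abs_frac[OF p nz' nz(2)] s by simp
qed auto

lemma padic_abs_add_le: "padic_abs p (r + s) \<le> max (padic_abs p r) (padic_abs p s)"
proof -
 have *: "padic_abs p (r + s) \<le> padic_abs p r" if "padic_abs p s \<le> padic_abs p r" for r s
 proof (cases "r = 0")
  case True
  thus ?thesis using that by (metis padic_abs_eq_0 padic_abs_nonneg add_0 order_antisym padic_abs_0)
 next
  case False
  have "padic_abs p (s / r) = padic_abs p s / padic_abs p r"
   by (simp add: divide_inverse padic_abs_mult padic_abs_inverse)
  hence "padic_abs p (s / r) \<le> 1" using that padic_abs_pos[OF False] by simp
  hence "padic_abs p (1 + s / r) \<le> 1" by (rule padic_abs_le_1_add)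
  moreover have "r + s = r * (1 + s / r)" using False by (simp add: field_simps)
  ultimately show ?thesis using padic_abs_pos[OF False] by (simp add: padic_abs_mult mult_left_le)
 qed
 show ?thesis using *[of s r] *[of r s] by (cases "padic_abs p s \<le> padic_abs p r") (auto simp: add.commute max_def)
qed

lemma padic_abs_add_less: "padic_abs p r < e ==> padic_abs p s < e ==> padic_abs p (r + s) < e"
 using padic_abs_add_le[of r s] by (simp add: max_def split: if_splits)

lemma padic_abs_diff_less: "padic_abs p r < e ==> padic_abs p s < e ==> padic_abs p (r - s) < e"
 using padic_abs_add_less[of r e "-s"] by simp

lemma padic_abs_add_eq:
 assumes "padic_abs p s < padic_abs p r" shows "padic_abs p (r + s) = padic_abs p r"
proof -
 have "padic_abs p r \<le> max (padic_abs p (r + s)) (padic_abs p s)"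
  using padic_abs_add_le[of "r + s" "-s"] by simp
 thus ?thesis using padic_abs_add_le[of r s] assms by (auto simp: max_def split: if_splits)
qed

text \<open>All nonzero values are powers of \<open>p\<close>, so nothing lies strictly between
  \<open>1 / p\<close> and \<open>1\<close>. This allows a sequence that is small modulo
  \<open>p\<close> to be divided by \<open>p\<close> and stay integral.\<close>

lemma padic_abs_lt_1: "padic_abs p r < 1 ==> padic_abs p r \<le> inverse (real p)"
proof (cases "r = 0")
 case False
 assume lt: "padic_abs p r < 1"
 obtain k where k: "padic_abs p r = real p powi k" using padic_abs_nonzero[OF False] by blast
 have "k < 0"
 proof (rule ccontr)
  assume "\<not> k < 0"
  hence "real p powi k \<ge> 1" using p_gt_1 by (intro one_le_power_int) auto
  thus False using lt k by simp
 qed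
 hence "real p powi k \<le> real p powi (-1)" using p_gt_1 by (intro power_int_increasing) auto
 thus ?thesis using k by (simp add: power_int_minus)
qed (use p_gt_1 in auto)

section \<open>Cauchy sequences of rationals\<close>

lemma padic_cauchyD: "padic_cauchy p f ==> e > 0 ==> \<exists>N. \<forall>m\<ge>N. \<forall>n\<ge>N. padic_abs p (f m - f n) < e"
 unfolding padic_cauchy_def by blast

lemma padic_cauchyI:
 assumes "\<And>e. e > 0 ==> \<exists>N. \<forall>m\<ge>N. padic_abs p (f m - f N) < e"
 shows "padic_cauchy p f"
 unfolding padic_cauchy_def
proof (intro allI impI)
 fix e :: real assume "e > 0"
 then obtain N where N: "\<And>m. m \<ge> N ==> padic_abs p (f m - f N) < e" using assms by blast
 have "padic_abs p (f m - f n) < e" if "m \<ge> N" "n \<ge> N" for m n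
  using padic_abs_diff_less[OF N[OF that(1)] N[OF that(2)]] by simp
 thus "\<exists>N. \<forall>m\<ge>N. \<forall>n\<ge>N. padic_abs p (f m - f n) < e" by blast
qed

lemma padic_nullD: "padic_null p f ==> e > 0 ==> \<exists>N. \<forall>n\<ge>N. padic_abs p (f n) < e"
 unfolding padic_null_def by blast

lemma padic_null_eventually_0: "(\<And>n. n \<ge> N ==> f n = 0) ==> padic_null p f"
 unfolding padic_null_def by (intro allI impI exI[of _ N]) auto

lemma padic_null_imp_cauchy: "padic_null p f ==> padic_cauchy p f"
 unfolding padic_null_def padic_cauchy_def using padic_abs_diff_less by meson

lemma padic_cauchy_const: "padic_cauchy p (\<lambda>_. r)"
 unfolding padic_cauchy_def by auto

lemma padic_null_add:
 assumes "padic_null p f" "padic_null p g" shows "padic_null p (\<lambda>n. f n + g n)"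
 unfolding padic_null_def
proof (intro allI impI)
 fix e :: real assume e: "e > 0"
 obtain N M where "\<forall>n\<ge>N. padic_abs p (f n) < e" "\<forall>n\<ge>M. padic_abs p (g n) < e"
  using padic_nullD[OF assms(1) e] padic_nullD[OF assms(2) e] by blast
 thus "\<exists>N. \<forall>n\<ge>N. padic_abs p (f n + g n) < e"
  by (intro exI[of _ "max N M"]) (auto intro: padic_abs_add_less)
qed

lemma padic_null_minus: "padic_null p f ==> padic_null p (\<lambda>n. - f n)"
 unfolding padic_null_def by simp

lemma padic_cauchy_minus: "padic_cauchy p f ==> padic_cauchy p (\<lambda>n. - f n)"
proof -
 have *: "padic_abs p (f n - f m) = padic_abs p (f m - f n)" for m n by (rule padic_abs_diff_commute)
 show "padic_cauchy p f ==> ?thesis" unfolding padic_cauchy_def by (simp add: *)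
qed

lemma padic_cauchy_add:
 assumes "padic_cauchy p f" "padic_cauchy p g" shows "padic_cauchy p (\<lambda>n. f n + g n)"
 unfolding padic_cauchy_def
proof (intro allI impI)
 fix e :: real assume e: "e > 0"
 obtain N M where N: "\<And>m n. m \<ge> N ==> n \<ge> N ==> padic_abs p (f m - f n) < e"
   and M: "\<And>m n. m \<ge> M ==> n \<ge> M ==> padic_abs p (g m - g n) < e"
  using padic_cauchyD[OF assms(1) e] padic_cauchyD[OF assms(2) e] by meson
 have "padic_abs p (f m + g m - (f n + g n)) < e" if "m \<ge> max N M" "n \<ge> max N M" for m n
  using padic_abs_add_less[OF N M, of m n m n] that by (simp add: algebra_simps)
 thus "\<exists>N. \<forall>m\<ge>N. \<forall>n\<ge>N. padic_abs p (f m + g m - (f n + g n)) < e" by blast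
qed

lemma padic_cauchy_bounded:
 assumes "padic_cauchy p f" shows "\<exists>B>0. \<forall>n. padic_abs p (f n) < B"
proof -
 obtain N where N: "\<And>m. m \<ge> N ==> padic_abs p (f m - f N) < 1"
  using padic_cauchyD[OF assms, of 1] by (metis order_refl zero_less_one)
 define B where "B = Max (insert 1 ((\<lambda>n. padic_abs p (f n)) ` {..N})) + 1"
 have B1: "B > 1" unfolding B_def
  using Max_ge[of "insert 1 ((\<lambda>n. padic_abs p (f n)) ` {..N})" 1] by simp
 have BN: "padic_abs p (f n) < B" if "n \<le> N" for n
  unfolding B_def using Max_ge[of "insert 1 ((\<lambda>n. padic_abs p (f n)) ` {..N})" "padic_abs p (f n)"] that by simp
 have "padic_abs p (f n) < B" for n
 proof (cases "n \<le> N")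
  case False
  hence "padic_abs p (f n - f N + f N) < B"
   using N[of n] BN[of N] B1 by (intro padic_abs_add_less) auto
  thus ?thesis by simp
 qed (use BN in auto)
 thus ?thesis using B1 by (intro exI[of _ B]) auto
qed

lemma padic_null_mult:
 assumes f: "padic_cauchy p f" and g: "padic_null p g" shows "padic_null p (\<lambda>n. f n * g n)"
 unfolding padic_null_def
proof (intro allI impI)
 fix e :: real assume e: "e > 0"
 obtain B where B: "B > 0" "\<And>n. padic_abs p (f n) < B" using padic_cauchy_bounded[OF f] by blast
 obtain N where N: "\<forall>n\<ge>N. padic_abs p (g n) < e / B" using padic_nullD[OF g, of "e / B"] e B by auto
 have "padic_abs p (f n * g n) < e" if "n \<ge> N" for n
 proof -
  have "padic_abs p (f n * g n) \<le> B * padic_abs p (g n)"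
   using B(2)[of n] by (simp add: padic_abs_mult mult_right_mono)
  also have "\<dots> < B * (e / B)" using N that B(1) by (intro mult_strict_left_mono) auto
  finally show ?thesis using B by simp
 qed
 thus "\<exists>N. \<forall>n\<ge>N. padic_abs p (f n * g n) < e" by blast
qed

lemma padic_cauchy_mult:
 assumes f: "padic_cauchy p f" and g: "padic_cauchy p g" shows "padic_cauchy p (\<lambda>n. f n * g n)"
proof (rule padic_cauchyI)
 fix e :: real assume e: "e > 0"
 obtain B where B: "B > 0" "\<And>n. padic_abs p (f n) < B" using padic_cauchy_bounded[OF f] by blast
 obtain C where C: "C > 0" "\<And>n. padic_abs p (g n) < C" using padic_cauchy_bounded[OF g] by blast
 obtain N where N: "\<And>m n. m \<ge> N ==> n \<ge> N ==> padic_abs p (f m - f n) < e / C"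
  using padic_cauchyD[OF f, of "e / C"] e C by (meson divide_pos_pos)
 obtain M where M: "\<And>m n. m \<ge> M ==> n \<ge> M ==> padic_abs p (g m - g n) < e / B"
  using padic_cauchyD[OF g, of "e / B"] e B by (meson divide_pos_pos)
 let ?K = "max N M"
 have "padic_abs p (f m * g m - f ?K * g ?K) < e" if m: "m \<ge> ?K" for m
 proof -
  have "padic_abs p (f m * (g m - g ?K)) \<le> B * padic_abs p (g m - g ?K)"
   using B(2)[of m] by (simp add: padic_abs_mult mult_right_mono)
  also have "\<dots> < B * (e / B)" using M[of m ?K] m B(1) by (intro mult_strict_left_mono) auto
  finally have 1: "padic_abs p (f m * (g m - g ?K)) < e" using B by simp
  have "padic_abs p ((f m - f ?K) * g ?K) \<le> padic_abs p (f m - f ?K) * C"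
   using C(2)[of ?K] by (simp add: padic_abs_mult mult_left_mono)
  also have "\<dots> < (e / C) * C" using N[of m ?K] m C(1) by (intro mult_strict_right_mono) auto
  finally have 2: "padic_abs p ((f m - f ?K) * g ?K) < e" using C by simp
  show ?thesis using padic_abs_add_less[OF 1 2] by (simp add: algebra_simps)
 qed
 thus "\<exists>N. \<forall>m\<ge>N. padic_abs p (f m * g m - f N * g N) < e" by blast
qed

text \<open>Once the oscillation is below a bound \<open>e\<close> that infinitely many terms reach,
  the ultrametric inequality makes the absolute value constant, not merely convergent. Inverses and
  valuations of Cauchy sequences rest on this.\<close>

lemma padic_cauchy_not_null:
 assumes f: "padic_cauchy p f" and nn: "\<not> padic_null p f"
 shows "\<exists>N. f N \<noteq> 0 \<and> (\<forall>n\<ge>N. padic_abs p (f n) = padic_abs p (f N))"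
proof -
 obtain e where e: "e > 0" and big: "\<And>N. \<exists>n\<ge>N. padic_abs p (f n) \<ge> e"
  using nn unfolding padic_null_def by (meson not_le)
 obtain N where N: "\<And>m n. m \<ge> N ==> n \<ge> N ==> padic_abs p (f m - f n) < e"
  using padic_cauchyD[OF f e] by blast
 obtain n where n: "n \<ge> N" "padic_abs p (f n) \<ge> e" using big by blast
 have "padic_abs p (f m) = padic_abs p (f n)" if "m \<ge> n" for m
 proof -
  have "padic_abs p (f m - f n) < padic_abs p (f n)" using N[of m n] that n by simp
  thus ?thesis using padic_abs_add_eq[of "f m - f n" "f n"] by simp
 qed
 moreover have "f n \<noteq> 0" using n e by auto
 ultimately show ?thesis by blast
qed

text \<open>Finitely many initial terms may vanish, hence the default value \<open>1\<close>. The
  estimate uses \<open>1 / f m - 1 / f K = (f K - f m) / (f m * f K)\<close>, whose denominator has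
  constant absolute value.\<close>

lemma padic_cauchy_inverse:
 assumes f: "padic_cauchy p f" and N: "f N \<noteq> 0" "\<And>n. n \<ge> N ==> padic_abs p (f n) = padic_abs p (f N)"
 shows "padic_cauchy p (\<lambda>n. if n \<ge> N then inverse (f n) else 1)"
proof (rule padic_cauchyI)
 fix e :: real assume e: "e > 0"
 define B where "B = padic_abs p (f N)"
 have B: "B > 0" unfolding B_def using padic_abs_pos[OF N(1)] .
 have nz: "f n \<noteq> 0" if "n \<ge> N" for n using N(2)[OF that] B unfolding B_def by auto
 obtain M where M: "\<And>m n. m \<ge> M ==> n \<ge> M ==> padic_abs p (f m - f n) < e * (B * B)"
  using padic_cauchyD[OF f, of "e * (B * B)"] e B by (meson mult_pos_pos)
 let ?K = "max N M"
 have "padic_abs p (inverse (f m) - inverse (f ?K)) < e" if m: "m \<ge> ?K" for m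
 proof -
  have "inverse (f m) - inverse (f ?K) = (f ?K - f m) * inverse (f m * f ?K)"
   using nz[of m] nz[of ?K] m by (simp add: field_simps)
  hence "padic_abs p (inverse (f m) - inverse (f ?K)) = padic_abs p (f ?K - f m) * inverse (B * B)"
   using N(2)[of m] N(2)[of ?K] m by (simp add: padic_abs_mult padic_abs_inverse B_def)
  also have "\<dots> < e * (B * B) * inverse (B * B)" using M[of ?K m] m B by (intro mult_strict_right_mono) auto
  also have "\<dots> = e" using B by (simp add: field_simps)
  finally show ?thesis .
 qed
 thus "\<exists>K. \<forall>m\<ge>K. padic_abs p ((if m \<ge> N then inverse (f m) else 1) - (if K \<ge> N then inverse (f K) else 1)) < e"
  by (intro exI[of _ ?K]) auto
qed

lemma padic_cauchy_cong:
 assumes f: "padic_cauchy p f" and eq: "\<And>n. n \<ge> N ==> g n = f n"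
 shows "padic_cauchy p g" "padic_null p (\<lambda>n. g n - f n)"
proof -
 show n: "padic_null p (\<lambda>n. g n - f n)" by (rule padic_null_eventually_0[of N]) (simp add: eq)
 show "padic_cauchy p g" using padic_cauchy_add[OF f padic_null_imp_cauchy[OF n]] by simp
qed

end

section \<open>Integers in a field\<close>

definition (in ring) natc :: "nat \<Rightarrow> 'a" where "natc n = [n] \<cdot> \<one>"

context ring
begin

lemma natc_closed [simp, intro]: "natc n \<in> carrier R" by (simp add: natc_def)
lemma natc_0 [simp]: "natc 0 = \<zero>" by (simp add: natc_def)
lemma natc_1 [simp]: "natc (Suc 0) = \<one>" by (simp add: natc_def)
lemma natc_add: "natc (m + n) = natc m \<oplus> natc n" by (simp add: natc_def add.nat_pow_mult)
lemma natc_Suc: "natc (Suc n) = \<one> \<oplus> natc n" using natc_add[of 1 n] by simp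
lemma natc_mult: "natc (m * n) = natc m \<otimes> natc n"
 by (induction m) (simp_all add: natc_add natc_Suc l_distr)
lemma natc_power: "natc (a ^ n) = natc a [^] n"
 by (induction n) (simp_all add: natc_mult power_Suc2 del: power_Suc)

end

section \<open>The base of a \<open>p\<close>-adic field\<close>

text \<open>The valuation theory below uses only these properties of the \<open>p\<close>-adic
  numbers. \<open>Q_val\<close> writes a nonzero element as a unit times a power of
  \<open>p\<close>, with two cases in place of a negative exponent. \<open>Z_complete\<close> is
  completeness in algebraic form: a series in powers of \<open>p\<close> with natural coefficients
  has a value whose remainder after \<open>M\<close> terms is divisible by \<open>p ^ M\<close>, so
  convergence is expressed by divisibility.\<close>

locale padic_base = field F for F (structure) +
 fixes p :: nat and Z Q :: "'a set"
 assumes p_prime: "nat_prime p"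
  and char0: "natc n = \<zero> ==> n = 0"
  and Z_subring: "subring Z F"
  and Q_subfield: "subfield Q F"
  and Z_sub_Q: "Z \<subseteq> Q"
  and Q_val: "x \<in> Q ==> x \<noteq> \<zero> ==> \<exists>u\<in>Z. \<exists>u'\<in>Z. \<exists>k::nat. u \<otimes> u' = \<one> \<and>
     (x = u \<otimes> natc p [^] k \<or> x \<otimes> natc p [^] k = u)"
  and Z_digit: "x \<in> Z ==> \<exists>a<p. \<exists>y\<in>Z. x = natc a \<oplus> natc p \<otimes> y"
  and Z_complete: "\<exists>c\<in>Z. \<forall>M. \<exists>y\<in>Z. c = natc (\<Sum>n<M. b n * p ^ n) \<oplus> natc p [^] M \<otimes> y"
  and p_nonunit_Z: "y \<in> Z ==> natc p \<otimes> y \<noteq> \<one>"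

section \<open>The ring of Cauchy sequences\<close>

lemma padic_cauchy_ring_cring:
 assumes p: "nat_prime p" shows "cring (padic_cauchy_ring p)"
proof (rule cringI)
 show "abelian_group (padic_cauchy_ring p)"
 proof (rule abelian_groupI)
  fix x assume "x \<in> carrier (padic_cauchy_ring p)"
  thus "\<exists>y\<in>carrier (padic_cauchy_ring p). y \<oplus>\<^bsub>padic_cauchy_ring p\<^esub> x = \<zero>\<^bsub>padic_cauchy_ring p\<^esub>"
   by (intro bexI[of _ "\<lambda>n. - x n"]) (auto simp: padic_cauchy_ring_def padic_cauchy_minus[OF p])
 qed (auto simp: padic_cauchy_ring_def padic_cauchy_add[OF p] padic_cauchy_const[OF p] algebra_simps)
 show "Group.comm_monoid (padic_cauchy_ring p)"
  by (rule comm_monoidI) (auto simp: padic_cauchy_ring_def padic_cauchy_mult[OF p] padic_cauchy_const[OF p] algebra_simps)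
qed (auto simp: padic_cauchy_ring_def algebra_simps)

lemma padic_null_ideal:
 assumes p: "nat_prime p" shows "ideal (Collect (padic_null p)) (padic_cauchy_ring p)"
proof -
 interpret cring "padic_cauchy_ring p" by (rule padic_cauchy_ring_cring[OF p])
 show ?thesis
 proof (rule idealI)
  show "ring (padic_cauchy_ring p)" by unfold_locales
  show "subgroup (Collect (padic_null p)) (add_monoid (padic_cauchy_ring p))"
  proof (rule group.subgroupI)
   show "Group.group (add_monoid (padic_cauchy_ring p))" by (rule add.group_axioms)
   show "Collect (padic_null p) \<subseteq> carrier (add_monoid (padic_cauchy_ring p))"
    by (auto simp: padic_cauchy_ring_def padic_null_imp_cauchy[OF p])
   show "Collect (padic_null p) \<noteq> {}" using padic_null_eventually_0[OF p, of 0 "\<lambda>_. 0"] by auto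
  next
   fix a assume a: "a \<in> Collect (padic_null p)"
   have c: "padic_cauchy p a" using a padic_null_imp_cauchy[OF p] by auto
   have "\<ominus>\<^bsub>padic_cauchy_ring p\<^esub> a = (\<lambda>n. - a n)"
    by (rule minus_equality)
     (auto simp: padic_cauchy_ring_def c padic_cauchy_minus[OF p])
   thus "inv\<^bsub>add_monoid (padic_cauchy_ring p)\<^esub> a \<in> Collect (padic_null p)"
    using a padic_null_minus[OF p] by (simp add: a_inv_def)
  next
   fix a b assume "a \<in> Collect (padic_null p)" "b \<in> Collect (padic_null p)"
   thus "a \<otimes>\<^bsub>add_monoid (padic_cauchy_ring p)\<^esub> b \<in> Collect (padic_null p)"
    using padic_null_add[OF p, of a b] by (simp add: padic_cauchy_ring_def)
  qed
 next
  fix a x assume "a \<in> Collect (padic_null p)" "x \<in> carrier (padic_cauchy_ring p)"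
  hence "padic_null p (\<lambda>n. x n * a n)" using padic_null_mult[OF p, of x a] by (auto simp: padic_cauchy_ring_def)
  thus "x \<otimes>\<^bsub>padic_cauchy_ring p\<^esub> a \<in> Collect (padic_null p)"
    "a \<otimes>\<^bsub>padic_cauchy_ring p\<^esub> x \<in> Collect (padic_null p)"
   by (simp_all add: padic_cauchy_ring_def mult.commute)
 qed
qed

text \<open>\<open>ph\<close> acts on Cauchy sequences rather than on their classes, so that
  representatives can be manipulated directly; \<open>ph_null\<close> makes it factor through the
  quotient.\<close>

locale padic_emb = field F for F (structure) +
 fixes p :: nat and ph :: "(nat \<Rightarrow> rat) \<Rightarrow> 'a"
 assumes p_prime: "nat_prime p"
  and ph_closed: "padic_cauchy p f ==> ph f \<in> carrier F"
  and ph_add: "padic_cauchy p f ==> padic_cauchy p g ==> ph (\<lambda>n. f n + g n) = ph f \<oplus> ph g"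
  and ph_mult: "padic_cauchy p f ==> padic_cauchy p g ==> ph (\<lambda>n. f n * g n) = ph f \<otimes> ph g"
  and ph_one: "ph (\<lambda>_. 1) = \<one>"
  and ph_null: "padic_null p f ==> ph f = \<zero>"
begin

lemmas c_const = padic_cauchy_const[OF p_prime]
 and c_add = padic_cauchy_add[OF p_prime]
 and c_mult = padic_cauchy_mult[OF p_prime]
 and c_minus = padic_cauchy_minus[OF p_prime]
 and pabs_mult = padic_abs_mult[OF p_prime]
 and pabs_inverse = padic_abs_inverse[OF p_prime]

lemma c_diff: "padic_cauchy p f ==> padic_cauchy p g ==> padic_cauchy p (\<lambda>n. f n - g n)"
 using c_add[of f "\<lambda>n. - g n"] c_minus[of g] by simp

lemma ph_zero: "ph (\<lambda>_. 0) = \<zero>"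
 by (rule ph_null, rule padic_null_eventually_0[OF p_prime, of 0]) auto

lemma ph_cong:
 assumes f: "padic_cauchy p f" and eq: "\<And>n. n \<ge> N ==> g n = f n"
 shows "ph g = ph f"
proof -
 have n: "padic_null p (\<lambda>n. g n - f n)" and g: "padic_cauchy p g"
  using padic_cauchy_cong[OF p_prime f, of N g, OF eq] by auto
 have "ph (\<lambda>n. f n + (g n - f n)) = ph f \<oplus> ph (\<lambda>n. g n - f n)"
  by (rule ph_add[OF f padic_null_imp_cauchy[OF p_prime n]])
 thus ?thesis using ph_null[OF n] ph_closed[OF f] by simp
qed

lemma ph_nat: "ph (\<lambda>_. of_nat n) = natc n"
proof (induction n)
 case (Suc n)
 have "ph (\<lambda>_. 1 + of_nat n) = ph (\<lambda>_. 1) \<oplus> ph (\<lambda>_. of_nat n)" by (intro ph_add c_const)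
 thus ?case using Suc by (simp add: natc_Suc ph_one)
qed (simp add: ph_zero)

lemma ph_minus:
 assumes f: "padic_cauchy p f" shows "ph (\<lambda>n. - f n) = \<ominus> ph f"
proof -
 have "ph (\<lambda>n. - f n + f n) = ph (\<lambda>n. - f n) \<oplus> ph f" by (intro ph_add c_minus f)
 hence "ph (\<lambda>n. - f n) \<oplus> ph f = \<zero>" by (simp add: ph_zero)
 thus ?thesis using f c_minus[OF f] by (metis ph_closed minus_equality)
qed

lemma not_null_inverse:
 assumes f: "padic_cauchy p f" and n: "\<not> padic_null p f"
 shows "\<exists>g. padic_cauchy p g \<and> ph f \<otimes> ph g = \<one>"
proof -
 obtain N where N: "f N \<noteq> 0" "\<And>n. n \<ge> N ==> padic_abs p (f n) = padic_abs p (f N)"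
  using padic_cauchy_not_null[OF p_prime f n] by blast
 define g where "g = (\<lambda>n. if n \<ge> N then inverse (f n) else 1)"
 have g: "padic_cauchy p g" unfolding g_def by (rule padic_cauchy_inverse[OF p_prime f N])
 have nz: "f n \<noteq> 0" if "n \<ge> N" for n
  using N(2)[OF that] N(1) padic_abs_eq_0[OF p_prime] by metis
 have "ph (\<lambda>n. f n * g n) = ph (\<lambda>_. 1)"
  by (rule ph_cong[OF c_const, of N]) (simp add: g_def nz)
 thus ?thesis using ph_mult[OF f g] g ph_one by auto
qed

lemma ph_eq_0:
 assumes f: "padic_cauchy p f" shows "ph f = \<zero> \<longleftrightarrow> padic_null p f"
proof
 assume z: "ph f = \<zero>"
 show "padic_null p f"
 proof (rule ccontr)
  assume "\<not> padic_null p f"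
  then obtain g where "padic_cauchy p g" "ph f \<otimes> ph g = \<one>" using not_null_inverse[OF f] by blast
  thus False using z ph_closed by simp
 qed
qed (rule ph_null)

definition "Zset = ph ` {f. padic_cauchy p f \<and> (\<forall>n. padic_abs p (f n) \<le> 1)}"
definition "Qset = ph ` Collect (padic_cauchy p)"

lemma ZsetI: "padic_cauchy p f ==> (\<And>n. padic_abs p (f n) \<le> 1) ==> ph f \<in> Zset"
 unfolding Zset_def by blast

lemma padic_abs_of_int_not_dvd: "\<not> int p dvd t ==> padic_abs p (of_int t) = 1"
 using padic_abs_of_int[OF p_prime, of t] by (cases "t = 0") (auto simp: not_dvd_imp_multiplicity_0)

lemma padic_abs_of_int_dvd: "int p dvd t ==> padic_abs p (of_int t) < 1"
proof (elim dvdE)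
 fix k assume "t = int p * k"
 hence "padic_abs p (of_int t) = inverse (real p) * padic_abs p (of_int k)"
  using padic_abs_p[OF p_prime] by (simp add: pabs_mult)
 also have "\<dots> \<le> inverse (real p) * 1"
  using padic_abs_of_int_le[OF p_prime] p_gt_1[OF p_prime] by (intro mult_left_mono) auto
 also have "\<dots> < 1" using p_gt_1[OF p_prime] by (simp add: inverse_less_1_iff)
 finally show ?thesis .
qed

text \<open>The denominator \<open>t\<close> is prime to \<open>p\<close>, since otherwise the
  absolute value would exceed \<open>1\<close>. The digit is the residue of \<open>s * t'\<close>
  with \<open>t'\<close> inverse to \<open>t\<close> modulo \<open>p\<close>, which makes
  \<open>s - a * t\<close> divisible by \<open>p\<close>.\<close>

lemma rat_digit:
 assumes "padic_abs p r \<le> 1" shows "\<exists>a<p. padic_abs p (r - of_nat a) < 1"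
proof -
 obtain s t where st: "quotient_of r = (s, t)" by (metis surj_pair)
 have r: "r = of_int s / of_int t" and t0: "t > 0" and cop: "coprime s t"
  using quotient_of_div[OF st] quotient_of_denom_pos[OF st] quotient_of_coprime[OF st] by auto
 have ndvd: "\<not> int p dvd t"
 proof
  assume d: "int p dvd t"
  hence "\<not> int p dvd s" using cop p_prime
   by (metis coprime_common_divisor not_prime_unit prime_nat_int_transfer)
  hence 1: "padic_abs p (of_int s) = 1" by (rule padic_abs_of_int_not_dvd)
  have "padic_abs p (r * of_int t) = padic_abs p r * padic_abs p (of_int t)" by (rule pabs_mult)
  hence "1 = padic_abs p r * padic_abs p (of_int t)" using r t0 1 by simp
  also have "\<dots> \<le> 1 * padic_abs p (of_int t)"
   using assms padic_abs_nonneg[OF p_prime] by (intro mult_right_mono) auto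
  also have "\<dots> < 1" using padic_abs_of_int_dvd[OF d] by simp
  finally show False by simp
 qed
 have "coprime t (int p)" using ndvd p_prime
  by (metis coprime_commute prime_imp_coprime prime_nat_int_transfer)
 then obtain t' where t': "[t * t' = 1] (mod int p)" using cong_solve_coprime_int by blast
 define a where "a = (s * t') mod int p"
 have p0: "int p > 0" using p_gt_1[OF p_prime] by simp
 have a: "0 \<le> a" "a < int p" unfolding a_def using p0 by auto
 have "[s - a * t = s - (s * t') * t] (mod int p)" unfolding a_def
  by (intro cong_diff cong_mult cong_refl) (simp add: cong_def)
 moreover have "[s - s * (t * t') = s - s * 1] (mod int p)" by (intro cong_diff cong_mult cong_refl t')
 ultimately have "[s - a * t = 0] (mod int p)" by (simp add: algebra_simps cong_trans)
 hence d: "int p dvd s - a * t" by (simp add: cong_0_iff)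
 have "r - of_nat (nat a) = of_int (s - a * t) / of_int t"
  using a t0 unfolding r by (simp add: field_simps)
 hence "padic_abs p (r - of_nat (nat a)) = padic_abs p (of_int (s - a * t))"
  using padic_abs_of_int_not_dvd[OF ndvd] by (simp only: divide_inverse pabs_mult pabs_inverse) simp
 thus ?thesis using padic_abs_of_int_dvd[OF d] a by (intro exI[of _ "nat a"]) auto
qed

lemma Zset_digit:
 assumes "x \<in> Zset" shows "\<exists>a<p. \<exists>y\<in>Zset. x = natc a \<oplus> natc p \<otimes> y"
proof -
 obtain f where x: "x = ph f" and f: "padic_cauchy p f" "\<And>n. padic_abs p (f n) \<le> 1"
  using assms unfolding Zset_def by auto
 obtain N where N: "\<And>m n. m \<ge> N ==> n \<ge> N ==> padic_abs p (f m - f n) < 1"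
  using padic_cauchyD[OF p_prime f(1), of 1] by auto
 \<comment> \<open>One term fixes the digit for the whole sequence, because all terms from
   \<open>N\<close> on are congruent to it modulo \<open>p\<close>.\<close>
 obtain a where a: "a < p" "padic_abs p (f N - of_nat a) < 1" using rat_digit[OF f(2)] by blast
 \<comment> \<open>The value \<open>0\<close> before \<open>N\<close> keeps these terms integral:
   \<open>Zset\<close> asks for a representative all of whose terms are bounded.\<close>
 define g where "g = (\<lambda>n. if n \<ge> N then (f n + - of_nat a) * inverse (of_nat p) else 0)"
 have g: "padic_cauchy p g"
  by (rule padic_cauchy_cong[OF p_prime, of "\<lambda>n. (f n + - of_nat a) * inverse (of_nat p)" N])
    (auto simp: g_def intro!: c_mult c_add c_diff c_const f)
 have p0: "real p > 1" by (rule p_gt_1[OF p_prime])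
 have g1: "padic_abs p (g n) \<le> 1" for n
 proof (cases "n \<ge> N")
  case True
  have "padic_abs p ((f n - f N) + (f N - of_nat a)) < 1"
   by (intro padic_abs_add_less[OF p_prime] N True a) auto
  hence "padic_abs p (f n - of_nat a) \<le> inverse (real p)"
   by (intro padic_abs_lt_1[OF p_prime]) simp
  hence "padic_abs p (f n - of_nat a) * real p \<le> inverse (real p) * real p"
   using p0 by (intro mult_right_mono) auto
  thus ?thesis using True p0 by (simp add: g_def pabs_mult pabs_inverse padic_abs_p[OF p_prime])
 qed (auto simp: g_def)
 have "ph f = ph (\<lambda>n. of_nat a + of_nat p * g n)"
  by (rule ph_cong[OF c_add[OF c_const c_mult[OF c_const g]], of N]) (use p0 in "simp add: g_def field_simps")
 also have "\<dots> = ph (\<lambda>n. of_nat a) \<oplus> ph (\<lambda>n. of_nat p * g n)" by (intro ph_add c_mult c_const g)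
 also have "ph (\<lambda>n. of_nat p * g n) = ph (\<lambda>_. of_nat p) \<otimes> ph g" by (intro ph_mult c_const g)
 finally have "x = natc a \<oplus> natc p \<otimes> ph g" using x by (simp add: ph_nat)
 thus ?thesis using a(1) ZsetI[OF g g1] by blast
qed

lemma Zset_complete:
 "\<exists>c\<in>Zset. \<forall>M. \<exists>y\<in>Zset. c = natc (\<Sum>n<M. b n * p ^ n) \<oplus> natc p [^] M \<otimes> y"
proof -
 define s where "s = (\<lambda>m. of_nat (\<Sum>n<m. b n * p ^ n) :: rat)"
 \<comment> \<open>\<open>t M m\<close> is the part of the partial sum between \<open>M\<close> and
   \<open>m\<close>, divided by \<open>p ^ M\<close>. It is a natural number, hence
   integral.\<close>
 define t where "t = (\<lambda>M m. of_nat (\<Sum>n\<in>{M..<m}. b n * p ^ (n - M)) :: rat)"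
 have st: "s m = s M + of_nat (p ^ M) * t M m" if "m \<ge> M" for m M
 proof -
  have "(\<Sum>n<m. b n * p ^ n) = (\<Sum>n<M. b n * p ^ n) + (\<Sum>n\<in>{M..<m}. b n * p ^ n)"
  proof -
   have "{..<m} = {..<M} \<union> {M..<m}" using that by auto
   thus ?thesis by (simp add: sum.union_disjoint ivl_disj_int)
  qed
  also have "(\<Sum>n\<in>{M..<m}. b n * p ^ n) = p ^ M * (\<Sum>n\<in>{M..<m}. b n * p ^ (n - M))"
   unfolding sum_distrib_left
  proof (rule sum.cong[OF refl])
   fix n assume "n \<in> {M..<m}"
   hence "p ^ n = p ^ M * p ^ (n - M)" by (simp add: power_add[symmetric])
   thus "b n * p ^ n = p ^ M * (b n * p ^ (n - M))" by simp
  qed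
  finally show ?thesis unfolding s_def t_def by (simp only: of_nat_add of_nat_mult)
 qed
 have p0: "real p > 1" by (rule p_gt_1[OF p_prime])
 have s: "padic_cauchy p s"
 proof (rule padic_cauchyI[OF p_prime])
  fix e :: real assume "e > 0"
  then obtain M where M: "inverse (real p) ^ M < e"
   using real_arch_pow_inv[of e "inverse (real p)"] p0 by (auto simp: inverse_less_1_iff)
  have "padic_abs p (s m - s M) < e" if "m \<ge> M" for m
  proof -
   have "padic_abs p (s m - s M) = inverse (real p) ^ M * padic_abs p (t M m)"
    using st[OF that] by (simp add: pabs_mult padic_abs_power[OF p_prime] padic_abs_p[OF p_prime])
   also have "\<dots> \<le> inverse (real p) ^ M * 1"
    unfolding t_def by (intro mult_left_mono padic_abs_of_nat_le[OF p_prime]) simp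
   finally show ?thesis using M by simp
  qed
  thus "\<exists>N. \<forall>m\<ge>N. padic_abs p (s m - s N) < e" by blast
 qed
 have "\<exists>y\<in>Zset. ph s = natc (\<Sum>n<M. b n * p ^ n) \<oplus> natc p [^] M \<otimes> y" for M
 proof -
  define g where "g = (\<lambda>m. if m \<ge> M then (s m + - s M) * inverse (of_nat (p ^ M)) else 0)"
  have g: "padic_cauchy p g"
   by (rule padic_cauchy_cong[OF p_prime, of "\<lambda>n. (s n + - s M) * inverse (of_nat (p ^ M))" M])
     (auto simp: g_def intro!: c_mult c_add c_diff c_const s)
  have gt: "g m = t M m" if "m \<ge> M" for m using st[OF that] that p0 by (simp add: g_def)
  have g1: "padic_abs p (g m) \<le> 1" for m
   using gt[of m] padic_abs_of_nat_le[OF p_prime] by (cases "m \<ge> M") (auto simp: t_def g_def simp del: of_nat_sum)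
  have "ph s = ph (\<lambda>m. s M + of_nat (p ^ M) * g m)"
   by (rule ph_cong[of _ M]) (use st gt in "auto intro!: c_add c_mult c_const g")
  also have "\<dots> = ph (\<lambda>m. s M) \<oplus> ph (\<lambda>m. of_nat (p ^ M) * g m)" by (intro ph_add c_mult c_const g)
  also have "ph (\<lambda>m. of_nat (p ^ M) * g m) = ph (\<lambda>_. of_nat (p ^ M)) \<otimes> ph g" by (intro ph_mult c_const g)
  finally have "ph s = natc (\<Sum>n<M. b n * p ^ n) \<oplus> natc p [^] M \<otimes> ph g"
   unfolding s_def by (simp only: ph_nat natc_power)
  thus ?thesis using ZsetI[OF g g1] by blast
 qed
 moreover have "ph s \<in> Zset" by (intro ZsetI s) (simp add: s_def padic_abs_of_nat_le[OF p_prime] del: of_nat_sum)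
 ultimately show ?thesis by blast
qed

lemma Qset_val:
 assumes "x \<in> Qset" "x \<noteq> \<zero>"
 shows "\<exists>u\<in>Zset. \<exists>u'\<in>Zset. \<exists>k::nat. u \<otimes> u' = \<one> \<and>
     (x = u \<otimes> natc p [^] k \<or> x \<otimes> natc p [^] k = u)"
proof -
 obtain f where x: "x = ph f" and f: "padic_cauchy p f" using assms unfolding Qset_def by auto
 have nn: "\<not> padic_null p f" using assms x ph_null by auto
 obtain N where N: "f N \<noteq> 0" "\<And>n. n \<ge> N ==> padic_abs p (f n) = padic_abs p (f N)"
  using padic_cauchy_not_null[OF p_prime f nn] by blast
 obtain k where k: "padic_abs p (f N) = real p powi k" using padic_abs_nonzero[OF p_prime N(1)] by blast
 have p0: "real p > 1" by (rule p_gt_1[OF p_prime])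
 \<comment> \<open>The factor \<open>p powi k\<close> has absolute value \<open>p powi (- k)\<close>
   and so turns the eventual absolute value of \<open>f\<close> into \<open>1\<close>; the default
   \<open>1\<close> does the same for the initial terms.\<close>
 define g where "g = (\<lambda>n. if n \<ge> N then f n * of_nat p powi k else 1)"
 have g: "padic_cauchy p g"
  by (rule padic_cauchy_cong[OF p_prime, of "\<lambda>n. f n * of_nat p powi k" N])
    (auto simp: g_def intro!: c_mult c_const f)
 have g1: "padic_abs p (g n) = 1" for n
 proof (cases "n \<ge> N")
  case True
  hence "padic_abs p (g n) = real p powi k * real p powi (- k)"
   using N(2)[of n] k by (simp add: g_def pabs_mult padic_abs_powi[OF p_prime])
  thus ?thesis using p0 by (simp add: power_int_minus)
 qed (auto simp: g_def padic_abs_1[OF p_prime])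
 have g0: "g n \<noteq> 0" for n using g1[of n] by auto
 define h where "h = (\<lambda>n. if n \<ge> 0 then inverse (g n) else 1)"
 have h: "padic_cauchy p h" unfolding h_def
  by (rule padic_cauchy_inverse[OF p_prime g]) (use g1 g0 in auto)
 have h1: "padic_abs p (h n) \<le> 1" for n by (simp add: h_def pabs_inverse g1)
 have "ph (\<lambda>n. g n * h n) = ph g \<otimes> ph h" by (rule ph_mult[OF g h])
 hence gh: "ph g \<otimes> ph h = \<one>" using g0 by (simp add: h_def ph_one)
 have "x = ph g \<otimes> natc p [^] nat (- k) \<or> x \<otimes> natc p [^] nat k = ph g"
 proof (cases "k \<le> 0")
  case True
  have "ph f = ph (\<lambda>n. g n * of_nat (p ^ nat (- k)))"
  proof (rule ph_cong[of _ N])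
   fix n assume n: "n \<ge> N"
   have "(of_nat (p ^ nat (- k)) :: rat) = of_nat p powi (- k)" using True by (simp add: power_int_def)
   hence "g n * of_nat (p ^ nat (- k)) = f n * (of_nat p powi k * of_nat p powi (- k))" using n by (simp add: g_def)
   also have "\<dots> = f n" using p0 by (simp add: power_int_minus)
   finally show "f n = g n * of_nat (p ^ nat (- k))" by simp
  qed (intro c_mult g c_const)
  also have "\<dots> = ph g \<otimes> ph (\<lambda>_. of_nat (p ^ nat (- k)))" by (intro ph_mult g c_const)
  finally show ?thesis using x by (simp only: ph_nat natc_power) simp
 next
  case False
  have "ph g = ph (\<lambda>n. f n * of_nat (p ^ nat k))"
   by (rule ph_cong[of _ N]) (use False in "auto simp: g_def power_int_def intro!: c_mult f c_const")
  also have "\<dots> = ph f \<otimes> ph (\<lambda>_. of_nat (p ^ nat k))" by (intro ph_mult f c_const)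
  finally show ?thesis using x by (simp only: ph_nat natc_power) simp
 qed
 thus ?thesis using gh ZsetI[OF g] ZsetI[OF h h1] g1 by (metis order_refl)
qed

lemma Qset_subfield: "subfield Qset F"
proof (rule subfieldI')
 show "subring Qset F"
 proof (rule subringI)
  show "Qset \<subseteq> carrier F" unfolding Qset_def using ph_closed by auto
  show "\<one> \<in> Qset" unfolding Qset_def using ph_one c_const[of 1] by (metis image_eqI mem_Collect_eq)
 next
  fix h assume "h \<in> Qset"
  then obtain f where f: "h = ph f" "padic_cauchy p f" unfolding Qset_def by auto
  show "\<ominus> h \<in> Qset" unfolding Qset_def f(1) ph_minus[OF f(2), symmetric] using c_minus[OF f(2)] by blast
 next
  fix h1 h2 assume "h1 \<in> Qset" "h2 \<in> Qset"
  thus "h1 \<otimes> h2 \<in> Qset" "h1 \<oplus> h2 \<in> Qset" unfolding Qset_def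
   using ph_mult[symmetric] c_mult ph_add[symmetric] c_add by (auto intro!: image_eqI[of _ ph])
 qed
next
 fix k assume k: "k \<in> Qset - {\<zero>}"
 then obtain f where f: "k = ph f" "padic_cauchy p f" unfolding Qset_def by auto
 hence "\<not> padic_null p f" using k ph_null by auto
 then obtain g where g: "padic_cauchy p g" "ph f \<otimes> ph g = \<one>" using not_null_inverse f by blast
 hence "inv k = ph g" using f ph_closed by (metis comm_inv_char)
 thus "inv k \<in> Qset" using g unfolding Qset_def by auto
qed

lemma Zset_subring: "subring Zset F"
proof (rule subringI)
 show "Zset \<subseteq> carrier F" unfolding Zset_def using ph_closed by auto
 show "\<one> \<in> Zset" using ZsetI[OF c_const[of 1]] ph_one padic_abs_1[OF p_prime] by simp
next
 fix h assume "h \<in> Zset"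
 then obtain f where f: "h = ph f" "padic_cauchy p f" "\<And>n. padic_abs p (f n) \<le> 1" unfolding Zset_def by auto
 show "\<ominus> h \<in> Zset" unfolding f(1) ph_minus[OF f(2), symmetric]
  by (rule ZsetI[OF c_minus[OF f(2)]]) (simp add: padic_abs_minus[OF p_prime] f(3))
next
 fix h1 h2 assume "h1 \<in> Zset" "h2 \<in> Zset"
 then obtain f g where f: "h1 = ph f" "padic_cauchy p f" "\<And>n. padic_abs p (f n) \<le> 1"
  and g: "h2 = ph g" "padic_cauchy p g" "\<And>n. padic_abs p (g n) \<le> 1" unfolding Zset_def by auto
 have "padic_abs p (f n * g n) \<le> 1" for n
  using f(3)[of n] g(3)[of n] padic_abs_nonneg[OF p_prime] by (simp add: pabs_mult mult_le_one)
 thus "h1 \<otimes> h2 \<in> Zset" using ZsetI[OF c_mult[OF f(2) g(2)]] ph_mult[OF f(2) g(2)] f g by simp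
 have "padic_abs p (f n + g n) \<le> 1" for n
  using padic_abs_add_le[OF p_prime, of "f n" "g n"] f(3)[of n] g(3)[of n] by linarith
 thus "h1 \<oplus> h2 \<in> Zset" using ZsetI[OF c_add[OF f(2) g(2)]] ph_add[OF f(2) g(2)] f g by simp
qed

theorem padic_base: "padic_base F p Zset Qset"
proof (intro padic_base.intro padic_base_axioms.intro field_axioms)
 show "nat_prime p" by (rule p_prime)
 show "subring Zset F" by (rule Zset_subring)
 show "subfield Qset F" by (rule Qset_subfield)
 show "Zset \<subseteq> Qset" unfolding Zset_def Qset_def by auto
 fix n assume "natc n = \<zero>"
 hence "padic_null p (\<lambda>_. of_nat n)" using ph_eq_0[OF c_const] ph_nat by metis
 hence *: "padic_abs p (of_nat n) < e" if "e > 0" for e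
  using padic_nullD[OF p_prime, of "\<lambda>_. of_nat n" e] that by auto
 have "padic_abs p (of_nat n) = 0" using *[of "padic_abs p (of_nat n)"] padic_abs_nonneg[OF p_prime, of "of_nat n"] by force
 thus "n = 0" using padic_abs_eq_0[OF p_prime] by simp
next
 fix y assume "y \<in> Zset"
 then obtain f where f: "y = ph f" "padic_cauchy p f" "\<And>n. padic_abs p (f n) \<le> 1" unfolding Zset_def by auto
 \<comment> \<open>An inverse of \<open>p\<close> would make \<open>p * f n - 1\<close> a null
   sequence while every \<open>p * f n\<close> has absolute value below \<open>1\<close>, so
   \<open>1\<close> would have absolute value below \<open>1\<close>.\<close>
 show "natc p \<otimes> y \<noteq> \<one>"
 proof
  assume "natc p \<otimes> y = \<one>"
  hence "ph (\<lambda>n. of_nat p * f n) = \<one>" using ph_mult[OF c_const f(2)] ph_nat f(1) by metis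
  moreover have "ph (\<lambda>n. of_nat p * f n + - 1) = ph (\<lambda>n. of_nat p * f n) \<oplus> ph (\<lambda>_. - 1)"
   by (intro ph_add c_mult c_const f(2))
  moreover have "ph (\<lambda>_. - 1) = \<ominus> \<one>" using ph_minus[OF c_const[of 1]] ph_one by simp
  ultimately have "ph (\<lambda>n. of_nat p * f n + - 1) = \<zero>" by (simp add: r_neg)
  hence "padic_null p (\<lambda>n. of_nat p * f n + - 1)"
   using ph_eq_0 c_add[OF c_mult[OF c_const f(2)] c_const] by blast
  then obtain n where n: "padic_abs p (of_nat p * f n + - 1) < 1"
   using padic_nullD[OF p_prime, of "\<lambda>n. of_nat p * f n + - 1" 1] by auto
  have "padic_abs p (of_nat p * f n) \<le> inverse (real p) * 1"
   unfolding pabs_mult padic_abs_p[OF p_prime] using f(3) by (intro mult_left_mono) auto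
  also have "\<dots> < 1" using p_gt_1[OF p_prime] by (simp add: inverse_less_1_iff)
  finally have "padic_abs p (of_nat p * f n - (of_nat p * f n + - 1)) < 1"
   using n by (intro padic_abs_diff_less[OF p_prime])
  thus False using padic_abs_1[OF p_prime] by simp
 qed
qed (use Qset_val Zset_digit Zset_complete in auto)

end

section \<open>Homomorphisms from \<open>Qp\<close>\<close>

lemma padic_emb_of_Qp_hom:
 assumes p: "nat_prime p" and F: "field F" and e: "e \<in> ring_hom (Qp p) F"
 obtains Z Q where "padic_base F p Z Q" "Z = e ` Zp p" "Q = e ` carrier (Qp p)"
proof -
 let ?C = "padic_cauchy_ring p" and ?I = "Collect (padic_null p)"
 define cl where "cl = (\<lambda>f. ?I +>\<^bsub>?C\<^esub> f)"
 define ph where "ph = e \<circ> cl"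
 interpret C: cring ?C by (rule padic_cauchy_ring_cring[OF p])
 interpret I: ideal ?I ?C by (rule padic_null_ideal[OF p])
 interpret F: field F by (rule F)
 have cl_hom: "cl \<in> ring_hom ?C (Qp p)" unfolding cl_def Qp_def by (rule I.rcos_ring_hom)
 have hom: "ph \<in> ring_hom ?C F" unfolding ph_def by (rule ring_hom_trans[OF cl_hom e])
 have car: "carrier ?C = Collect (padic_cauchy p)" by (simp add: padic_cauchy_ring_def)
 have Qring: "ring (Qp p)" unfolding Qp_def by (rule I.quotient_is_ring)
 have e0: "e \<zero>\<^bsub>Qp p\<^esub> = \<zero>\<^bsub>F\<^esub>" using ring_hom_zero[OF e Qring F.ring_axioms] .
 interpret E: padic_emb F p ph
 proof
  show "nat_prime p" by (rule p)
  show "ph f \<in> carrier F" if "padic_cauchy p f" for f using ring_hom_closed[OF hom] that car by auto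
  show "ph (\<lambda>n. f n + g n) = ph f \<oplus>\<^bsub>F\<^esub> ph g" if "padic_cauchy p f" "padic_cauchy p g" for f g
   using ring_hom_add[OF hom, of f g] that by (simp add: padic_cauchy_ring_def)
  show "ph (\<lambda>n. f n * g n) = ph f \<otimes>\<^bsub>F\<^esub> ph g" if "padic_cauchy p f" "padic_cauchy p g" for f g
   using ring_hom_mult[OF hom, of f g] that by (simp add: padic_cauchy_ring_def)
  show "ph (\<lambda>_. 1) = \<one>\<^bsub>F\<^esub>" using ring_hom_one[OF hom] by (simp add: padic_cauchy_ring_def)
  show "ph f = \<zero>\<^bsub>F\<^esub>" if "padic_null p f" for f
  proof -
   have "cl f = ?I" unfolding cl_def using that by (intro I.a_rcos_const) auto
   thus ?thesis using e0 unfolding ph_def by (simp add: Qp_def FactRing_def)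
  qed
 qed
 have cQ: "carrier (Qp p) = cl ` Collect (padic_cauchy p)"
  unfolding Qp_def FactRing_def cl_def by (auto simp: A_RCOSETS_def' car)
 have Q: "e ` carrier (Qp p) = E.Qset" unfolding E.Qset_def cQ by (simp add: ph_def image_image)
 have cl_self: "f \<in> cl f" if "padic_cauchy p f" for f
  unfolding cl_def using that car by (intro I.a_rcos_self) auto
 have Zp: "Zp p = cl ` {f. padic_cauchy p f \<and> (\<forall>n. padic_abs p (f n) \<le> 1)}"
 proof (intro subset_antisym subsetI)
  fix x assume "x \<in> Zp p"
  then obtain f g where f: "f \<in> x" "\<forall>n. padic_abs p (f n) \<le> 1" and g: "x = cl g" "padic_cauchy p g"
   unfolding Zp_def cQ by auto
  have "cl g \<subseteq> carrier ?C" unfolding cl_def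
   by (rule C.a_r_coset_subset_G) (use g car I.a_subset in auto)
  hence f': "f \<in> carrier ?C" using f g by auto
  have "cl g = cl f" using f(1) g car unfolding cl_def
   by (metis I.a_repr_independence' mem_Collect_eq)
  thus "x \<in> cl ` {f. padic_cauchy p f \<and> (\<forall>n. padic_abs p (f n) \<le> 1)}" using g f f' car by auto
 next
  fix x assume "x \<in> cl ` {f. padic_cauchy p f \<and> (\<forall>n. padic_abs p (f n) \<le> 1)}"
  thus "x \<in> Zp p" unfolding Zp_def cQ using cl_self by auto
 qed
 have Z: "e ` Zp p = E.Zset" unfolding E.Zset_def Zp by (simp add: ph_def image_image)
 show ?thesis using that[OF E.padic_base] Z Q by simp
qed

section \<open>Values of polynomials of bounded degree\<close>

text \<open>These are the values at \<open>x\<close> of polynomials of degree below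
  \<open>n\<close>. Leading zeros are allowed, so over a subring the sets are closed under addition
  and increase with \<open>n\<close>, and inductions on the degree can be carried out on values
  alone.\<close>

definition (in ring) pvals :: "'a set \<Rightarrow> nat \<Rightarrow> 'a \<Rightarrow> 'a set" where
 "pvals A n x = {eval P x |P. set P \<subseteq> A \<and> length P = n}"

context cring
begin

lemma pvals_0 [simp]: "pvals A 0 x = {\<zero>}"
 unfolding pvals_def by auto

lemma pvals_closed: "A \<subseteq> carrier R ==> x \<in> carrier R ==> e \<in> pvals A n x ==> e \<in> carrier R"
 unfolding pvals_def using eval_in_carrier by auto

lemma pvals_Suc:
 assumes "A \<subseteq> carrier R" "x \<in> carrier R"
 shows "e \<in> pvals A (Suc n) x \<longleftrightarrow> (\<exists>e'\<in>pvals A n x. \<exists>a\<in>A. e = e' \<otimes> x \<oplus> a)"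
proof
 assume "e \<in> pvals A (Suc n) x"
 then obtain P where P: "e = eval P x" "set P \<subseteq> A" "length P = Suc n" unfolding pvals_def by auto
 obtain P' a where P': "P = P' @ [a]" using P(3) by (metis length_0_conv nat.distinct(1) rev_exhaust)
 have "e = eval P' x \<otimes> x \<oplus> a" using eval_append_aux[of P' a x] P P' assms by auto
 thus "\<exists>e'\<in>pvals A n x. \<exists>a\<in>A. e = e' \<otimes> x \<oplus> a" using P P' unfolding pvals_def by auto
next
 assume "\<exists>e'\<in>pvals A n x. \<exists>a\<in>A. e = e' \<otimes> x \<oplus> a"
 then obtain P a where P: "set P \<subseteq> A" "length P = n" "a \<in> A" "e = eval P x \<otimes> x \<oplus> a"
  unfolding pvals_def by auto
 have "eval (P @ [a]) x = e" using eval_append_aux[of P a x] P assms by auto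
 thus "e \<in> pvals A (Suc n) x" unfolding pvals_def using P by (intro CollectI exI[of _ "P @ [a]"]) auto
qed

lemma pvals_Suc':
 assumes "A \<subseteq> carrier R" "x \<in> carrier R"
 shows "e \<in> pvals A (Suc n) x \<longleftrightarrow> (\<exists>e'\<in>pvals A n x. \<exists>a\<in>A. e = a \<otimes> x [^] n \<oplus> e')"
proof
 assume "e \<in> pvals A (Suc n) x"
 then obtain P where P: "e = eval P x" "set P \<subseteq> A" "length P = Suc n" unfolding pvals_def by auto
 obtain a P' where P': "P = a # P'" using P(3) by (cases P) auto
 show "\<exists>e'\<in>pvals A n x. \<exists>a\<in>A. e = a \<otimes> x [^] n \<oplus> e'" using P P' unfolding pvals_def by auto
next
 assume "\<exists>e'\<in>pvals A n x. \<exists>a\<in>A. e = a \<otimes> x [^] n \<oplus> e'"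
 then obtain P a where P: "set P \<subseteq> A" "length P = n" "a \<in> A" "e = a \<otimes> x [^] n \<oplus> eval P x"
  unfolding pvals_def by auto
 have "eval (a # P) x = e" using P by simp
 thus "e \<in> pvals A (Suc n) x" unfolding pvals_def using P by (intro CollectI exI[of _ "a # P"]) auto
qed

context
 fixes A assumes A: "subring A R"
begin

lemma subring_nat_pow: "a \<in> A ==> a [^] (k::nat) \<in> A"
 using subringE(3,6)[OF A] by (induction k) auto

lemma pvals_zero: "x \<in> carrier R ==> \<zero> \<in> pvals A n x"
 using subringE(1,2)[OF A] by (induction n) (force simp: pvals_Suc)+

lemma pvals_add:
 assumes x: "x \<in> carrier R" shows "e \<in> pvals A n x ==> f \<in> pvals A n x ==> e \<oplus> f \<in> pvals A n x"
proof (induction n arbitrary: e f)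
 case (Suc n)
 note AR = subringE(1)[OF A]
 obtain e' a f' b where e: "e' \<in> pvals A n x" "a \<in> A" "e = e' \<otimes> x \<oplus> a"
  and f: "f' \<in> pvals A n x" "b \<in> A" "f = f' \<otimes> x \<oplus> b"
  using Suc.prems unfolding pvals_Suc[OF AR x] by auto
 have c: "e' \<in> carrier R" "f' \<in> carrier R" "a \<in> carrier R" "b \<in> carrier R"
  using e f AR pvals_closed[OF AR x] by auto
 have "e \<oplus> f = (e' \<oplus> f') \<otimes> x \<oplus> (a \<oplus> b)" unfolding e f using c x by algebra
 thus ?case unfolding pvals_Suc[OF AR x] using Suc.IH[OF e(1) f(1)] subringE(7)[OF A e(2) f(2)] by blast
qed auto

lemma pvals_smult:
 assumes x: "x \<in> carrier R" and k: "k \<in> A" shows "e \<in> pvals A n x ==> k \<otimes> e \<in> pvals A n x"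
proof (induction n arbitrary: e)
 case (Suc n)
 note AR = subringE(1)[OF A]
 obtain e' a where e: "e' \<in> pvals A n x" "a \<in> A" "e = e' \<otimes> x \<oplus> a"
  using Suc.prems unfolding pvals_Suc[OF AR x] by auto
 have c: "e' \<in> carrier R" "a \<in> carrier R" "k \<in> carrier R"
  using e k AR pvals_closed[OF AR x] by auto
 have "k \<otimes> e = (k \<otimes> e') \<otimes> x \<oplus> (k \<otimes> a)" unfolding e using c x by algebra
 thus ?case unfolding pvals_Suc[OF AR x] using Suc.IH[OF e(1)] subringE(6)[OF A k e(2)] by blast
qed (use k subringE(1)[OF A] in auto)

lemma pvals_mult_x:
 assumes x: "x \<in> carrier R" and e: "e \<in> pvals A n x" shows "e \<otimes> x \<in> pvals A (Suc n) x"
 unfolding pvals_Suc[OF subringE(1)[OF A] x]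
 using e subringE(2)[OF A] pvals_closed[OF subringE(1)[OF A] x e] x
 by (intro bexI[of _ e] bexI[of _ \<zero>]) auto

lemma pvals_mult_pow:
 assumes x: "x \<in> carrier R" and e: "e \<in> pvals A n x" shows "e \<otimes> x [^] k \<in> pvals A (n + k) x"
proof (induction k)
 case (Suc k)
 have "e \<in> carrier R" using pvals_closed[OF subringE(1)[OF A] x e] .
 thus ?case using pvals_mult_x[OF x Suc] x by (simp add: m_assoc)
qed (use pvals_closed[OF subringE(1)[OF A] x e] e in auto)

lemma pvals_mono:
 assumes x: "x \<in> carrier R" and e: "e \<in> pvals A n x" shows "n \<le> m ==> e \<in> pvals A m x"
proof (induction m)
 case (Suc m)
 show ?case
 proof (cases "n = Suc m")
  case False
  hence "e \<in> pvals A m x" using Suc by auto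
  thus ?thesis unfolding pvals_Suc'[OF subringE(1)[OF A] x]
   using subringE(2)[OF A] pvals_closed[OF subringE(1)[OF A] x e] x
   by (intro bexI[of _ e] bexI[of _ \<zero>]) auto
 qed (use e in auto)
qed (use e in auto)

lemma pvals_pow:
 assumes x: "x \<in> carrier R" shows "x [^] n \<in> pvals A (Suc n) x"
 unfolding pvals_Suc'[OF subringE(1)[OF A] x]
 using pvals_zero[OF x] subringE(3)[OF A] x by (intro bexI[of _ \<zero>] bexI[of _ \<one>]) auto

lemma pvals_in_subring:
 assumes x: "x \<in> A" shows "e \<in> pvals A n x ==> e \<in> A"
proof (induction n arbitrary: e)
 case 0
 thus ?case using subringE(2)[OF A] by simp
next
 case (Suc n)
 have x': "x \<in> carrier R" using x subringE(1)[OF A] by auto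
 obtain e' a where e: "e' \<in> pvals A n x" "a \<in> A" "e = e' \<otimes> x \<oplus> a"
  using Suc.prems unfolding pvals_Suc[OF subringE(1)[OF A] x'] by auto
 show ?case unfolding e using Suc.IH[OF e(1)] e(2) x subringE(6,7)[OF A] by simp
qed

lemma simple_extension_pvals:
 assumes x: "x \<in> carrier R" and e: "e \<in> simple_extension A x" shows "\<exists>n. e \<in> pvals A n x"
 using e
proof (induction rule: simple_extension.induct)
 case (lin k1 k2)
 then obtain n where "k1 \<in> pvals A n x" by blast
 hence "k1 \<otimes> x \<oplus> k2 \<in> pvals A (Suc n) x" unfolding pvals_Suc[OF subringE(1)[OF A] x] using lin by blast
 thus ?case by blast
qed (use pvals_0 in blast)

lemma pvals_simple_extension:
 assumes x: "x \<in> carrier R" shows "e \<in> pvals A n x ==> e \<in> simple_extension A x"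
 by (induction n arbitrary: e) (auto simp: pvals_Suc[OF subringE(1)[OF A] x] intro: simple_extension.intros)

end

end

context field
begin

lemma pow_nonzero: "x \<in> carrier R ==> x \<noteq> \<zero> ==> x [^] (n::nat) \<noteq> \<zero>"
 by (induction n) (auto simp: integral_iff)

context
 fixes A assumes A: "subring A R"
begin

text \<open>Multiplication by \<open>x ^ n\<close> reverses the coefficient list: a polynomial of
  degree at most \<open>n\<close> in \<open>1 / x\<close> becomes one in \<open>x\<close>.\<close>

lemma pvals_inverse:
 assumes x: "x \<in> carrier R" "x \<noteq> \<zero>"
 shows "e \<in> pvals A (Suc n) (inv x) ==> x [^] n \<otimes> e \<in> pvals A (Suc n) x"
proof (induction n arbitrary: e)
 case 0
 have ix: "inv x \<in> carrier R" using x field_Units by auto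
 thus ?case using 0 x unfolding pvals_Suc[OF subringE(1)[OF A] ix] pvals_Suc[OF subringE(1)[OF A] x(1)]
  using subringE(1)[OF A] by (force simp: subset_iff)
next
 case (Suc n)
 note AR = subringE(1)[OF A]
 have ix: "inv x \<in> carrier R" "x \<otimes> inv x = \<one>" using x field_Units by auto
 obtain e' a where e: "e' \<in> pvals A (Suc n) (inv x)" "a \<in> A" "e = a \<otimes> inv x [^] Suc n \<oplus> e'"
  using Suc.prems unfolding pvals_Suc'[OF AR ix(1), of _ "Suc n"] by auto
 have c: "e' \<in> carrier R" "a \<in> carrier R" using e AR pvals_closed[OF AR ix(1)] by auto
 have "x [^] Suc n \<otimes> inv x [^] Suc n = (x \<otimes> inv x) [^] Suc n"
  using x(1) ix(1) by (simp only: nat_pow_distrib)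
 hence 1: "x [^] Suc n \<otimes> inv x [^] Suc n = \<one>" using ix by simp
 have cc: "x [^] Suc n \<in> carrier R" "inv x [^] Suc n \<in> carrier R" using x ix by auto
 have "x [^] Suc n \<otimes> e = a \<otimes> (x [^] Suc n \<otimes> inv x [^] Suc n) \<oplus> x [^] Suc n \<otimes> e'"
  unfolding e(3) using c cc by algebra
 also have "\<dots> = (x [^] n \<otimes> e') \<otimes> x \<oplus> a" unfolding 1 using c x by (simp add: m_ac a_comm)
 finally show ?case unfolding pvals_Suc[OF AR x(1), of _ "Suc n"] using Suc.IH[OF e(1)] e(2) by blast
qed

lemma pvals_inverse_pow_mult:
 assumes x: "x \<in> carrier R" "x \<noteq> \<zero>" and ixA: "inv x \<in> A"
 shows "e \<in> pvals A (Suc n) x ==> inv x [^] n \<otimes> e \<in> A"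
proof -
 assume e: "e \<in> pvals A (Suc n) x"
 have ix: "inv x \<in> carrier R" "inv x \<noteq> \<zero>" "inv (inv x) = x" using x field_Units
  by (auto simp: nonzero_imp_inverse_nonzero)
 have "inv x [^] n \<otimes> e \<in> pvals A (Suc n) (inv x)" using pvals_inverse[OF ix(1,2), of e n] e ix(3) by simp
 thus ?thesis by (rule pvals_in_subring[OF A ixA])
qed

end

end

section \<open>The valuation ring\<close>

locale padic_alg = padic_base +
 assumes algebraic_Q: "x \<in> carrier F ==> \<exists>P. P \<noteq> [] \<and> hd P \<noteq> \<zero> \<and> set P \<subseteq> Q \<and> eval P x = \<zero>"
begin

abbreviation \<F> where "\<F> \<equiv> carrier F"

abbreviation \<pi> where "\<pi> \<equiv> natc p"

lemma Z_carrier: "Z \<subseteq> \<F>" by (rule subringE(1)[OF Z_subring])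

lemma pi_nonzero: "\<pi> \<noteq> \<zero>"
 using char0[of p] p_prime not_prime_0 by blast

lemma natc_Z: "natc n \<in> Z"
 by (induction n) (use subringE[OF Z_subring] in "auto simp: natc_Suc")

text \<open>A negative exponent in \<open>Q_val\<close> would make \<open>p\<close> invertible in
  \<open>Z\<close>. What remains is a unit times \<open>p ^ k\<close> with \<open>k = 0\<close> or
  \<open>k > 0\<close>.\<close>

lemma Z_unit_or_div: "x \<in> Z ==> (\<exists>u\<in>Z. x \<otimes> u = \<one>) \<or> (\<exists>y\<in>Z. x = \<pi> \<otimes> y)"
proof (cases "x = \<zero>")
 case True
 thus ?thesis using subringE(2)[OF Z_subring] by (intro disjI2 bexI[of _ \<zero>]) auto
next
 case False
 assume xZ: "x \<in> Z"
 have xc: "x \<in> \<F>" using xZ Z_carrier by auto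
 obtain u u' k where u: "u \<in> Z" "u' \<in> Z" "u \<otimes> u' = \<one>"
   "x = u \<otimes> \<pi> [^] (k::nat) \<or> x \<otimes> \<pi> [^] k = u"
  using Q_val[of x] xZ Z_sub_Q False by blast
 have c: "u \<in> \<F>" "u' \<in> \<F>" using u Z_carrier by auto
 show ?thesis
 proof (cases k)
  case 0
  hence "x = u" using u(4) c xc by auto
  thus ?thesis using u by blast
 next
  case (Suc j)
  show ?thesis
  proof (cases "x = u \<otimes> \<pi> [^] k")
   case True
   hence "x = \<pi> \<otimes> (u \<otimes> \<pi> [^] j)" using Suc c by (simp add: m_ac)
   moreover have "u \<otimes> \<pi> [^] j \<in> Z"
    using u(1) natc_Z subringE(6)[OF Z_subring] subring_nat_pow[OF Z_subring] by blast
   ultimately show ?thesis by blast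
  next
   case False
   hence "x \<otimes> \<pi> [^] k = u" using u by auto
   hence "\<pi> \<otimes> ((x \<otimes> \<pi> [^] j) \<otimes> u') = \<one>" using u(3) Suc xc c by (simp add: m_ac)
   moreover have "(x \<otimes> \<pi> [^] j) \<otimes> u' \<in> Z"
    using u(2) xZ natc_Z subringE(6)[OF Z_subring] subring_nat_pow[OF Z_subring] by blast
   ultimately show ?thesis using p_nonunit_Z by blast
  qed
 qed
qed

text \<open>The claim covers all large exponents, not just one, so that finitely many coefficients
  have a common denominator.\<close>

lemma Q_scale: "x \<in> Q ==> \<exists>k. \<forall>j\<ge>k. \<pi> [^] (j::nat) \<otimes> x \<in> Z"
proof (cases "x = \<zero>")
 case True
 thus ?thesis using subringE(2)[OF Z_subring] by auto
next
 case False
 assume xQ: "x \<in> Q"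
 have xc: "x \<in> \<F>" using xQ subfieldE(3)[OF Q_subfield] by auto
 obtain u u' k where u: "u \<in> Z" "u' \<in> Z" "x = u \<otimes> \<pi> [^] (k::nat) \<or> x \<otimes> \<pi> [^] k = u"
  using Q_val[OF xQ False] by blast
 have c: "u \<in> \<F>" using u Z_carrier by auto
 have pZ: "\<pi> [^] (j::nat) \<in> Z" for j using natc_Z subring_nat_pow[OF Z_subring] by blast
 show ?thesis
 proof (cases "x = u \<otimes> \<pi> [^] k")
  case True
  thus ?thesis using u(1) pZ subringE(6)[OF Z_subring] by (intro exI[of _ 0]) blast
 next
  case False
  hence xk: "x \<otimes> \<pi> [^] k = u" using u by auto
  have "\<pi> [^] j \<otimes> x \<in> Z" if "j \<ge> k" for j
  proof -
   have "\<pi> [^] j = \<pi> [^] (j - k) \<otimes> \<pi> [^] k" using that by (simp add: nat_pow_mult)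
   hence "\<pi> [^] j \<otimes> x = \<pi> [^] (j - k) \<otimes> u" unfolding xk[symmetric] using xc by (simp add: m_ac)
   thus ?thesis using u(1) pZ subringE(6)[OF Z_subring] by simp
  qed
  thus ?thesis by blast
 qed
qed

lemma eval_map_mult:
 "c \<in> \<F> ==> x \<in> \<F> ==> set P \<subseteq> \<F> ==> eval (map ((\<otimes>) c) P) x = c \<otimes> eval P x"
 by (induction P) (auto simp: r_distr m_assoc eval_in_carrier)

lemma annihilator_scale:
 assumes x: "x \<in> \<F>" and P: "P \<noteq> []" "hd P \<noteq> \<zero>" "set P \<subseteq> Q" "eval P x = \<zero>"
 obtains P' where "P' \<noteq> []" "length P' = length P" "hd P' \<noteq> \<zero>" "set P' \<subseteq> Z" "eval P' x = \<zero>"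
proof -
 have PF: "set P \<subseteq> \<F>" using P subfieldE(3)[OF Q_subfield] by auto
 have "\<exists>k. \<forall>j\<ge>k. \<forall>c\<in>set P. \<pi> [^] (j::nat) \<otimes> c \<in> Z"
  using P(3)
 proof (induction P)
  case (Cons a P)
  then obtain k where "\<forall>j\<ge>k. \<forall>c\<in>set P. \<pi> [^] (j::nat) \<otimes> c \<in> Z" by auto
  moreover obtain k' where "\<forall>j\<ge>k'. \<pi> [^] (j::nat) \<otimes> a \<in> Z" using Q_scale Cons by (metis list.set_intros(1) subset_iff)
  ultimately show ?case by (intro exI[of _ "max k k'"]) auto
 qed auto
 then obtain k where k: "\<And>c. c \<in> set P ==> \<pi> [^] (k::nat) \<otimes> c \<in> Z" by blast
 let ?P = "map ((\<otimes>) (\<pi> [^] k)) P"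
 have "\<pi> [^] k \<noteq> \<zero>" using pi_nonzero pow_nonzero by simp
 hence "hd ?P \<noteq> \<zero>" using P PF by (cases P) (auto simp: integral_iff)
 moreover have "eval ?P x = \<zero>" using eval_map_mult[of "\<pi> [^] k" x P] P x PF by simp
 ultimately show ?thesis using that[of ?P] P k by auto
qed

lemma annihilator_Z:
 assumes x: "x \<in> \<F>"
 obtains P where "P \<noteq> []" "hd P \<noteq> \<zero>" "set P \<subseteq> Z" "eval P x = \<zero>"
proof -
 obtain P where "P \<noteq> []" "hd P \<noteq> \<zero>" "set P \<subseteq> Q" "eval P x = \<zero>" using algebraic_Q[OF x] by blast
 thus ?thesis using annihilator_scale[OF x] that by metis
qed

text \<open>A factor \<open>p\<close> common to all coefficients can be cancelled. The exponent of
  \<open>p\<close> in the leading coefficient drops each time, so a unit coefficient appears at the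
  latest when the leading one has become a unit.\<close>

lemma annihilator_primitive:
 assumes x: "x \<in> \<F>" and P: "P \<noteq> []" "hd P \<noteq> \<zero>" "set P \<subseteq> Z" "eval P x = \<zero>"
 obtains P' where "length P' = length P" "set P' \<subseteq> Z" "\<exists>c\<in>set P'. \<exists>u\<in>Z. c \<otimes> u = \<one>" "eval P' x = \<zero>"
proof -
 have main: "\<exists>P'. length P' = length P \<and> set P' \<subseteq> Z \<and> (\<exists>c\<in>set P'. \<exists>u\<in>Z. c \<otimes> u = \<one>) \<and> eval P' x = \<zero>"
  if "P \<noteq> []" "u \<in> Z" "u' \<in> Z" "u \<otimes> u' = \<one>" "hd P = u \<otimes> \<pi> [^] k" "set P \<subseteq> Z" "eval P x = \<zero>"
  for u u' and k :: nat and P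
  using that
 proof (induction k arbitrary: P)
  case 0
  have "hd P = u" using 0 Z_carrier by auto
  thus ?case using 0 by (intro exI[of _ P]) force
 next
  case (Suc k)
  show ?case
  proof (cases "\<exists>c\<in>set P. \<exists>u\<in>Z. c \<otimes> u = \<one>")
   case True
   thus ?thesis using Suc by blast
  next
   case False
   hence "\<forall>c\<in>set P. \<exists>y. y \<in> Z \<and> c = \<pi> \<otimes> y" using Z_unit_or_div Suc.prems(6) by blast
   then obtain d where d: "\<And>c. c \<in> set P ==> d c \<in> Z \<and> c = \<pi> \<otimes> d c" by metis
   let ?P = "map d P"
   have PZ: "set ?P \<subseteq> Z" using d by auto
   have P: "P = map ((\<otimes>) \<pi>) ?P" using d by (simp add: map_idI)
   have "eval P x = \<pi> \<otimes> eval ?P x"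
    by (subst P) (rule eval_map_mult, use x PZ Z_carrier in auto)
   hence ev: "eval ?P x = \<zero>"
    using Suc.prems(7) pi_nonzero eval_in_carrier[of ?P x] PZ Z_carrier x integral[of \<pi> "eval ?P x"] by auto
   have "hd P \<in> set P" using Suc.prems(1) by simp
   hence "\<pi> \<otimes> d (hd P) = hd P" using d by metis
   also have "\<dots> = \<pi> \<otimes> (u \<otimes> \<pi> [^] k)" using Suc.prems(2,5) Z_carrier by (simp add: m_ac subset_iff)
   finally have "\<pi> \<otimes> d (hd P) = \<pi> \<otimes> (u \<otimes> \<pi> [^] k)" .
   moreover have "d (hd P) \<in> \<F>" using d[OF \<open>hd P \<in> set P\<close>] Z_carrier by blast
   moreover have "u \<otimes> \<pi> [^] k \<in> \<F>" using Suc.prems(2) Z_carrier by auto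
   ultimately have "d (hd P) = u \<otimes> \<pi> [^] k" using m_lcancel[OF pi_nonzero natc_closed] by blast
   hence "hd ?P = u \<otimes> \<pi> [^] k" using Suc.prems(1) by (simp add: hd_map)
   from Suc.IH[OF _ Suc.prems(2,3,4) this PZ ev] Suc.prems(1) show ?thesis by simp
  qed
 qed
 obtain u u' k where u: "u \<in> Z" "u' \<in> Z" "u \<otimes> u' = \<one>"
   "hd P = u \<otimes> \<pi> [^] (k::nat) \<or> hd P \<otimes> \<pi> [^] k = u"
  using Q_val[of "hd P"] P Z_sub_Q by (metis hd_in_set subset_iff)
 show ?thesis
 proof (cases "hd P = u \<otimes> \<pi> [^] k")
  case True
  show ?thesis using main[OF P(1) u(1-3) True P(3,4)] that by blast
 next
  case False
  hence hk: "hd P \<otimes> \<pi> [^] k = u" using u by blast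
  have hZ: "hd P \<in> Z" using P by auto
  have "hd P \<otimes> (\<pi> [^] k \<otimes> u') = \<one>" using hk u(1-3) hZ Z_carrier by (simp add: m_assoc[symmetric] subset_iff)
  moreover have "\<pi> [^] k \<otimes> u' \<in> Z" using u natc_Z subringE(6)[OF Z_subring] subring_nat_pow[OF Z_subring] by blast
  ultimately show ?thesis using that[of P] P by (metis hd_in_set)
 qed
qed

end

text \<open>This is Chevalley's construction of valuation rings. Maximality refers only to
  \<open>p\<close> remaining a nonunit; that \<open>V\<close> is the integral closure of
  \<open>Z\<close>, hence unique, comes later from completeness.\<close>

locale max_subring = padic_alg +
 fixes V assumes V_subring: "subring V F" and Z_V: "Z \<subseteq> V" and V_pnonunit: "y \<in> V ==> \<pi> \<otimes> y \<noteq> \<one>"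
  and V_max: "subring W F ==> V \<subseteq> W ==> (\<And>y. y \<in> W ==> \<pi> \<otimes> y \<noteq> \<one>) ==> W = V"
begin

lemma V_carrier: "V \<subseteq> \<F>" by (rule subringE(1)[OF V_subring])
lemma pi_V: "\<pi> \<in> V" using natc_Z Z_V by auto

text \<open>Adjoining \<open>x\<close> breaks maximality, so \<open>p\<close> becomes invertible in
  \<open>V[x]\<close>, and the inverse is a polynomial in \<open>x\<close>.\<close>

lemma not_in_V:
 assumes x: "x \<in> \<F>" "x \<notin> V" obtains n e where "e \<in> pvals V n x" "\<pi> \<otimes> e = \<one>"
proof -
 let ?W = "simple_extension V x"
 have "subring ?W F" by (rule simple_extension_is_subring[OF V_subring x(1)])
 moreover have "V \<subseteq> ?W" by (rule simple_extension_incl[OF V_carrier x(1)])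
 moreover have "?W \<noteq> V" using simple_extension_mem[OF V_subring x(1)] x(2) by auto
 ultimately obtain y where y: "y \<in> ?W" "\<pi> \<otimes> y = \<one>" using V_max[of ?W] by blast
 thus ?thesis using that simple_extension_pvals[OF V_subring x(1)] by blast
qed

text \<open>\<open>V\<close> is not yet known to be local, so maximality is used instead. If the
  inverse of \<open>y = 1 - p b\<close> were outside \<open>V\<close>, there would be a polynomial
  \<open>e\<close> in this inverse with \<open>p e = 1\<close>. Multiplying by \<open>y ^ n\<close>
  and writing \<open>y ^ n = 1 - p b'\<close> gives \<open>p (y ^ n e + b') = 1\<close> inside
  \<open>V\<close>.\<close>

lemma one_minus_unit:
 assumes b: "b \<in> V" shows "\<exists>w\<in>V. w \<otimes> (\<one> \<ominus> \<pi> \<otimes> b) = \<one>"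
proof -
 let ?y = "\<one> \<ominus> \<pi> \<otimes> b"
 have bc: "b \<in> \<F>" using b V_carrier by auto
 have yV: "?y \<in> V" unfolding a_minus_def using b pi_V subringE(3,5,6,7)[OF V_subring] by simp
 have yc: "?y \<in> \<F>" using yV V_carrier by auto
 have y0: "?y \<noteq> \<zero>"
 proof
  assume "?y = \<zero>"
  hence "\<pi> \<otimes> b = \<one>" using bc by (simp add: r_right_minus_eq)
  thus False using V_pnonunit b by blast
 qed
 have iy: "inv ?y \<in> \<F>" "inv ?y \<noteq> \<zero>" "inv (inv ?y) = ?y" "inv ?y \<otimes> ?y = \<one>"
  using yc y0 field_Units by (auto simp: nonzero_imp_inverse_nonzero)
 have pow: "\<exists>b'\<in>V. ?y [^] (k::nat) = \<one> \<ominus> \<pi> \<otimes> b'" for k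
 proof (induction k)
  case 0
  show ?case using subringE(2)[OF V_subring] by (intro bexI[of _ \<zero>]) (auto simp: a_minus_def)
 next
  case (Suc k)
  then obtain b' where b': "b' \<in> V" "?y [^] k = \<one> \<ominus> \<pi> \<otimes> b'" by blast
  have c: "b' \<in> \<F>" using b' V_carrier by auto
  let ?c = "b \<oplus> b' \<ominus> \<pi> \<otimes> b' \<otimes> b"
  have "?y [^] Suc k = (\<one> \<ominus> \<pi> \<otimes> b') \<otimes> ?y" using b' by simp
  also have "\<dots> = \<one> \<ominus> \<pi> \<otimes> ?c" using bc c natc_closed[of p] by algebra
  finally have "?y [^] Suc k = \<one> \<ominus> \<pi> \<otimes> ?c" .
  moreover have "?c \<in> V" unfolding a_minus_def using b b' pi_V subringE(5,6,7)[OF V_subring] by simp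
  ultimately show ?case by blast
 qed
 have "inv ?y \<in> V"
 proof (rule ccontr)
  assume "inv ?y \<notin> V"
  then obtain n e where e: "e \<in> pvals V n (inv ?y)" "\<pi> \<otimes> e = \<one>" using not_in_V[OF iy(1)] by blast
  have e': "e \<in> pvals V (Suc n) (inv ?y)" using pvals_mono[OF V_subring iy(1) e(1)] by simp
  have ec: "e \<in> \<F>" using pvals_closed[OF V_carrier iy(1) e(1)] .
  have ye: "?y [^] n \<otimes> e \<in> V"
   using pvals_inverse_pow_mult[OF V_subring iy(1,2) _ e'] iy(3) yV by simp
  obtain b' where b': "b' \<in> V" "?y [^] n = \<one> \<ominus> \<pi> \<otimes> b'" using pow by blast
  have c: "b' \<in> \<F>" using b' V_carrier by auto
  have "\<pi> \<otimes> (?y [^] n \<otimes> e \<oplus> b') = ?y [^] n \<otimes> (\<pi> \<otimes> e) \<oplus> \<pi> \<otimes> b'"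
   using nat_pow_closed[OF yc, of n] ec c natc_closed[of p] by algebra
  also have "\<dots> = (\<one> \<ominus> \<pi> \<otimes> b') \<otimes> \<one> \<oplus> \<pi> \<otimes> b'" using e(2) b'(2) by simp
  also have "\<dots> = \<one>" using c natc_closed[of p] by algebra
  finally show False using V_pnonunit[OF subringE(7)[OF V_subring ye b'(1)]] by blast
 qed
 thus ?thesis using iy(4) by blast
qed

text \<open>The relation \<open>p f = 1\<close> has constant term \<open>p b\<close>, and
  \<open>1 - p b\<close> is a unit. Multiplied by a power of \<open>x\<close>, it expresses
  \<open>x ^ m'\<close> as \<open>p\<close> times a polynomial of smaller degree. Substituting this
  for the top power in \<open>e\<close> shortens \<open>e\<close> and keeps
  \<open>p e = 1\<close>.\<close>

lemma descent:
 assumes x: "x \<in> \<F>" "x \<noteq> \<zero>" and e: "e \<in> pvals V n x" "\<pi> \<otimes> e = \<one>"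
  and f: "f \<in> pvals V m (inv x)" "\<pi> \<otimes> f = \<one>" and mn: "m \<le> n"
 shows "\<exists>e'\<in>pvals V (n - 1) x. \<pi> \<otimes> e' = \<one> \<and> n > 0"
proof -
 have ix: "inv x \<in> \<F>" "inv x \<otimes> x = \<one>" "x \<otimes> inv x = \<one>" using x field_Units by auto
 have "m \<noteq> 0"
 proof
  assume "m = 0"
  hence "f = \<zero>" using f(1) by simp
  thus False using f(2) by simp
 qed
 then obtain m' where m': "m = Suc m'" by (cases m) auto
 obtain n' where n': "n = Suc n'" using mn m' by (cases n) auto
 obtain f' b where f': "f' \<in> pvals V m' (inv x)" "b \<in> V" "f = f' \<otimes> inv x \<oplus> b"
  using f(1) unfolding m' pvals_Suc[OF V_carrier ix(1)] by blast
 obtain e' a where e': "e' \<in> pvals V n' x" "a \<in> V" "e = a \<otimes> x [^] n' \<oplus> e'"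
  using e(1) unfolding n' pvals_Suc'[OF V_carrier x(1)] by blast
 obtain w where w: "w \<in> V" "w \<otimes> (\<one> \<ominus> \<pi> \<otimes> b) = \<one>" using one_minus_unit[OF f'(2)] by blast
 have c: "f' \<in> \<F>" "b \<in> \<F>" "e' \<in> \<F>" "a \<in> \<F>" "w \<in> \<F>"
  using f' e' w V_carrier pvals_closed[OF V_carrier x(1) e'(1)] pvals_closed[OF V_carrier ix(1) f'(1)] by auto
 have "\<one> \<ominus> \<pi> \<otimes> b = \<pi> \<otimes> f \<ominus> \<pi> \<otimes> b" using f by simp
 also have "\<dots> = \<pi> \<otimes> f' \<otimes> inv x" unfolding f'(3) using c ix natc_closed[of p] by algebra
 finally have h: "w \<otimes> (\<pi> \<otimes> f' \<otimes> inv x) = \<one>" using w by simp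
 have "x [^] m' \<in> \<F>" using x by simp
 note c = c this
 have "x [^] m' = x [^] m' \<otimes> (w \<otimes> (\<pi> \<otimes> f' \<otimes> inv x))" using h x by simp
 also have "\<dots> = \<pi> \<otimes> (w \<otimes> (x [^] m' \<otimes> f' \<otimes> inv x))" using c ix natc_closed[of p] by algebra
 finally have xm: "x [^] m' = \<pi> \<otimes> (w \<otimes> (x [^] m' \<otimes> f' \<otimes> inv x))" .
 have g: "x [^] m' \<otimes> f' \<otimes> inv x \<in> pvals V m' x"
 proof (cases m')
  case 0
  thus ?thesis using f'(1) ix by simp
 next
  case (Suc k)
  have "x [^] m' \<otimes> f' \<otimes> inv x = x [^] k \<otimes> f'"
   using Suc c x ix by (simp add: m_assoc) (simp add: m_lcomm[of x] ix)
  thus ?thesis using pvals_inverse[OF V_subring x, of f' k] f'(1) Suc by simp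
 qed
 let ?g = "x [^] m' \<otimes> f' \<otimes> inv x"
 have gc: "?g \<in> \<F>" using pvals_closed[OF V_carrier x(1) g] .
 let ?d = "n' - m'"
 have nm: "n' = m' + ?d" using mn m' n' by simp
 have "x [^] n' = x [^] m' \<otimes> x [^] ?d" using nm x by (metis nat_pow_mult)
 also have "\<dots> = \<pi> \<otimes> (w \<otimes> (?g \<otimes> x [^] ?d))"
  by (subst xm) (use gc c x in "simp add: m_assoc")
 finally have xn: "x [^] n' = \<pi> \<otimes> (w \<otimes> (?g \<otimes> x [^] ?d))" .
 define g' where "g' = w \<otimes> (?g \<otimes> x [^] ?d)"
 have g': "g' \<in> pvals V n' x" unfolding g'_def using nm
  by (metis pvals_smult[OF V_subring x(1) w(1)] pvals_mult_pow[OF V_subring x(1) g])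
 have g'c: "g' \<in> \<F>" using pvals_closed[OF V_carrier x(1) g'] .
 have "e = \<pi> \<otimes> (a \<otimes> g') \<oplus> e'" unfolding e'(3) xn g'_def[symmetric] using c g'c by (simp add: m_lcomm)
 moreover have "\<pi> \<otimes> (a \<otimes> g') \<oplus> e' \<in> pvals V n' x"
  by (intro pvals_add[OF V_subring x(1)] pvals_smult[OF V_subring x(1)] pi_V e' g')
 ultimately show ?thesis using e(2) n' by auto
qed

lemma V_valuation:
 assumes x: "x \<in> \<F>" "x \<noteq> \<zero>" shows "x \<in> V \<or> inv x \<in> V"
proof (rule ccontr)
 assume "\<not> ?thesis"
 hence nx: "x \<notin> V" "inv x \<notin> V" by auto
 have ix: "inv x \<in> \<F>" "inv x \<noteq> \<zero>" "inv (inv x) = x"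
  using x field_Units by (auto simp: nonzero_imp_inverse_nonzero)
 obtain n e where e: "e \<in> pvals V n x" "\<pi> \<otimes> e = \<one>" using not_in_V[OF x(1) nx(1)] by blast
 obtain m f where f: "f \<in> pvals V m (inv x)" "\<pi> \<otimes> f = \<one>" using not_in_V[OF ix(1) nx(2)] by blast
 \<comment> \<open>Each descent shortens the longer of the two representations, so
   \<open>n + m\<close> decreases.\<close>
 have "False" if "e \<in> pvals V n x" "\<pi> \<otimes> e = \<one>" "f \<in> pvals V m (inv x)" "\<pi> \<otimes> f = \<one>" for e f n m
  using that
 proof (induction "n + m" arbitrary: n m e f rule: less_induct)
  case less
  show False
  proof (cases "m \<le> n")
   case True
   obtain e' where "e' \<in> pvals V (n - 1) x" "\<pi> \<otimes> e' = \<one>" "n > 0"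
    using descent[OF x less.prems True] by blast
   thus False using less.hyps[of "n - 1" m e' f] less.prems by auto
  next
   case False
   obtain f' where "f' \<in> pvals V (m - 1) (inv x)" "\<pi> \<otimes> f' = \<one>" "m > 0"
    using descent[OF ix(1,2) less.prems(3,4), of e n] less.prems(1,2) ix(3) False by auto
   thus False using less.hyps[of n "m - 1" e f'] less.prems by auto
  qed
 qed
 thus False using e f by blast
qed

end

context cring
begin

lemma pvals_subset: "A \<subseteq> B ==> pvals A n x \<subseteq> pvals B n x"
 unfolding pvals_def by blast

lemma eval_in_pvals: "set P \<subseteq> A ==> eval P x \<in> pvals A (length P) x"
 unfolding pvals_def by blast

lemma eval_map_add:
 "f ` set xs \<subseteq> carrier R ==> g ` set xs \<subseteq> carrier R ==> x \<in> carrier R ==>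
  eval (map (\<lambda>i. f i \<oplus> g i) xs) x = eval (map f xs) x \<oplus> eval (map g xs) x"
proof (induction xs)
 case (Cons a xs)
 have c: "eval (map f xs) x \<in> carrier R" "eval (map g xs) x \<in> carrier R" "f a \<in> carrier R" "g a \<in> carrier R"
   "x [^] length xs \<in> carrier R"
  using Cons.prems by (auto intro!: eval_in_carrier)
 have "(f a \<oplus> g a) \<otimes> x [^] length xs \<oplus> (eval (map f xs) x \<oplus> eval (map g xs) x)
   = (f a \<otimes> x [^] length xs \<oplus> eval (map f xs) x) \<oplus> (g a \<otimes> x [^] length xs \<oplus> eval (map g xs) x)"
  using c by algebra
 thus ?case using Cons by simp
qed auto

lemma eval_map_smult:
 "c \<in> carrier R ==> f ` set xs \<subseteq> carrier R ==> x \<in> carrier R ==>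
  eval (map (\<lambda>i. c \<otimes> f i) xs) x = c \<otimes> eval (map f xs) x"
proof (induction xs)
 case (Cons a xs)
 have c: "eval (map f xs) x \<in> carrier R" "f a \<in> carrier R" "x [^] length xs \<in> carrier R"
  using Cons.prems by (auto intro!: eval_in_carrier)
 have "c \<otimes> f a \<otimes> x [^] length xs \<oplus> c \<otimes> eval (map f xs) x = c \<otimes> (f a \<otimes> x [^] length xs \<oplus> eval (map f xs) x)"
  using c Cons.prems by algebra
 thus ?case using Cons by simp
qed auto

lemma eval_map_zero: "x \<in> carrier R ==> eval (map (\<lambda>_. \<zero>) xs) x = \<zero>"
 by (induction xs) auto

lemma eval_map_minus:
 assumes "set P \<subseteq> carrier R" "x \<in> carrier R"
 shows "eval (map (a_inv R) P) x = \<ominus> eval P x"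
proof -
 have eq: "map (a_inv R) P = map (\<lambda>a. (\<ominus> \<one>) \<otimes> a) P" using assms by (auto simp: l_minus)
 have "eval (map (a_inv R) P) x = (\<ominus> \<one>) \<otimes> eval (map (\<lambda>a. a) P) x"
  unfolding eq by (rule eval_map_smult) (use assms in auto)
 thus ?thesis using assms eval_in_carrier by (simp add: l_minus)
qed

end

definition (in padic_base) "Oint = {x \<in> carrier F. \<exists>P. P \<noteq> [] \<and> hd P = \<one> \<and> set P \<subseteq> Z \<and> eval P x = \<zero>}"

section \<open>Digit expansions in rings generated by one element\<close>

context padic_alg
begin

text \<open>The first unit coefficient of a primitive annihilator becomes its leading coefficient
  modulo \<open>p\<close>, so modulo \<open>p\<close> the ring \<open>Z[x]\<close> is spanned by the
  powers of \<open>x\<close> below some \<open>k\<close>. The bound on \<open>k\<close> later bounds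
  the residue field, and iterating the expansion on \<open>g\<close> yields integrality.\<close>

lemma digit_expansion:
 assumes xc: "x \<in> \<F>" and P0: "P0 \<noteq> []" "hd P0 \<noteq> \<zero>" "set P0 \<subseteq> Z" "eval P0 x = \<zero>"
 shows "\<exists>k<length P0. \<forall>y\<in>simple_extension Z x. \<exists>as g. length as = k \<and> set as \<subseteq> {..<p} \<and>
   g \<in> simple_extension Z x \<and> y = eval (map natc as) x \<oplus> \<pi> \<otimes> g"
proof -
 define M where "M = simple_extension Z x"
 have M: "subring M F" unfolding M_def by (rule simple_extension_is_subring[OF Z_subring xc])
 have MF: "M \<subseteq> \<F>" using subringE(1)[OF M] .
 have pvM: "e \<in> M" if "e \<in> pvals Z n x" for e n unfolding M_def by (rule pvals_simple_extension[OF Z_subring xc that])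
 have xM: "x \<in> M" unfolding M_def by (rule simple_extension_mem[OF Z_subring xc])
 have ZM: "Z \<subseteq> M" unfolding M_def by (rule simple_extension_incl[OF Z_carrier xc])
 have piM: "\<pi> \<in> M" using natc_Z ZM by blast
 note Mc = subringE(2-7)[OF M]
 obtain P where P: "length P = length P0" "set P \<subseteq> Z" "\<exists>c\<in>set P. \<exists>u\<in>Z. c \<otimes> u = \<one>" "eval P x = \<zero>"
  using annihilator_primitive[OF xc P0] by metis
 \<comment> \<open>All coefficients before the first unit \<open>c\<close> are divisible by
   \<open>p\<close>, so modulo \<open>p\<close> the relation has leading term \<open>c x ^ k\<close>
   with \<open>k = length B\<close>.\<close>
 obtain A c B where sp: "P = A @ c # B" "\<exists>u\<in>Z. c \<otimes> u = \<one>" "\<forall>a\<in>set A. \<not> (\<exists>u\<in>Z. a \<otimes> u = \<one>)"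
  using split_list_first_prop[OF P(3)] by blast
 obtain u where u: "u \<in> Z" "c \<otimes> u = \<one>" using sp by blast
 define k where "k = length B"
 have cl: "set A \<subseteq> Z" "c \<in> Z" "set B \<subseteq> Z" using P sp by auto
 have "\<forall>a\<in>set A. \<exists>y\<in>Z. a = \<pi> \<otimes> y" using sp(3) cl(1) Z_unit_or_div by blast
 then obtain d where d: "\<And>a. a \<in> set A ==> d a \<in> Z \<and> a = \<pi> \<otimes> d a" by metis
 have Ad: "map ((\<otimes>) \<pi>) (map d A) = A" unfolding map_map by (rule map_idI) (use d in auto)
 have "set (map d A) \<subseteq> \<F>" using d Z_carrier by auto
 from eval_map_mult[OF natc_closed[of p] xc this] have eA: "eval A x = \<pi> \<otimes> eval (map d A) x" unfolding Ad .
 define a where "a = eval (map d A) x"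
 define b where "b = eval B x"
 have aM: "a \<in> M" unfolding a_def using d by (intro pvM[OF eval_in_pvals]) auto
 have bpv: "b \<in> pvals Z k x" unfolding b_def k_def using cl by (intro eval_in_pvals)
 have cc: "a \<in> \<F>" "b \<in> \<F>" "c \<in> \<F>" "u \<in> \<F>"
  using aM MF pvM[OF bpv] cl u Z_carrier by auto
 have "eval P x = eval A x \<otimes> x [^] length (c # B) \<oplus> eval (c # B) x"
  unfolding sp(1) by (rule eval_append) (use cl Z_carrier xc in auto)
 also have "\<dots> = \<pi> \<otimes> (a \<otimes> x [^] Suc k) \<oplus> (c \<otimes> x [^] k \<oplus> b)"
  using cc xc by (simp add: eA a_def k_def b_def m_assoc)
 finally have rel: "\<pi> \<otimes> (a \<otimes> x [^] Suc k) \<oplus> (c \<otimes> x [^] k \<oplus> b) = \<zero>" using P by simp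
 \<comment> \<open>With \<open>u\<close> the inverse of \<open>c\<close>, solving the relation for
   \<open>x ^ k\<close> leaves the lower part \<open>e0\<close> and \<open>p\<close> times the error
   \<open>g0\<close>.\<close>
 define g0 where "g0 = \<ominus> (u \<otimes> (a \<otimes> x [^] Suc k))"
 define e0 where "e0 = (\<ominus> u) \<otimes> b"
 have g0M: "g0 \<in> M" unfolding g0_def
  by (intro Mc(4,5) aM subring_nat_pow[OF M xM]) (use u ZM in auto)
 have e0pv: "e0 \<in> pvals Z k x" unfolding e0_def
  by (rule pvals_smult[OF Z_subring xc _ bpv]) (use u subringE(5)[OF Z_subring] in blast)
 have xk: "x [^] k = e0 \<oplus> \<pi> \<otimes> g0"
 proof -
  have xp: "x [^] k \<in> \<F>" "x [^] Suc k \<in> \<F>" using xc by auto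
  have "u \<otimes> (\<pi> \<otimes> (a \<otimes> x [^] Suc k) \<oplus> (c \<otimes> x [^] k \<oplus> b)) = \<zero>" using rel cc by simp
  moreover have "u \<otimes> (\<pi> \<otimes> (a \<otimes> x [^] Suc k) \<oplus> (c \<otimes> x [^] k \<oplus> b))
    = (c \<otimes> u) \<otimes> x [^] k \<ominus> (e0 \<oplus> \<pi> \<otimes> g0)"
   unfolding e0_def g0_def using cc xp natc_closed[of p] by algebra
  ultimately have "x [^] k \<ominus> (e0 \<oplus> \<pi> \<otimes> g0) = \<zero>" using u xp by simp
  moreover have "e0 \<oplus> \<pi> \<otimes> g0 \<in> \<F>" using g0M MF pvM[OF e0pv] by blast
  ultimately show ?thesis using xp by (simp add: r_right_minus_eq)
 qed
 have red: "\<exists>e\<in>pvals Z k x. \<exists>g\<in>M. y = e \<oplus> \<pi> \<otimes> g" if "y \<in> M" for y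
  using that unfolding M_def
 proof (induction rule: simple_extension.induct)
  case zero
  show ?case using pvals_zero[OF Z_subring xc, of k] Mc(1) unfolding M_def
   by (intro bexI[of _ \<zero> "pvals Z k x"] bexI[of _ \<zero> "simple_extension Z x"]) auto
 next
  case (lin k1 k2)
  then obtain e g where eg: "e \<in> pvals Z k x" "g \<in> M" "k1 = e \<oplus> \<pi> \<otimes> g" unfolding M_def by blast
  have "e \<otimes> x \<oplus> k2 \<in> pvals Z (Suc k) x" unfolding pvals_Suc[OF Z_carrier xc] using eg lin by blast
  then obtain e' t where et: "e' \<in> pvals Z k x" "t \<in> Z" "e \<otimes> x \<oplus> k2 = t \<otimes> x [^] k \<oplus> e'"
   unfolding pvals_Suc'[OF Z_carrier xc] by blast
  have c': "e \<in> \<F>" "g \<in> \<F>" "e' \<in> \<F>" "t \<in> \<F>" "k2 \<in> \<F>"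
    "e0 \<in> \<F>" "g0 \<in> \<F>"
   using eg et lin Z_carrier MF pvM[OF eg(1)] pvM[OF et(1)] g0M pvM[OF e0pv] by auto
  have "k1 \<otimes> x \<oplus> k2 = (e \<otimes> x \<oplus> k2) \<oplus> \<pi> \<otimes> (g \<otimes> x)"
   unfolding eg using c' xc natc_closed[of p] by algebra
  also have "\<dots> = (t \<otimes> e0 \<oplus> e') \<oplus> \<pi> \<otimes> (t \<otimes> g0 \<oplus> g \<otimes> x)"
   unfolding et(3) xk using c' xc natc_closed[of p] by algebra
  finally have eq: "k1 \<otimes> x \<oplus> k2 = (t \<otimes> e0 \<oplus> e') \<oplus> \<pi> \<otimes> (t \<otimes> g0 \<oplus> g \<otimes> x)" .
  have "t \<otimes> e0 \<oplus> e' \<in> pvals Z k x"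
   by (intro pvals_add[OF Z_subring xc] pvals_smult[OF Z_subring xc] et e0pv)
  moreover have "t \<otimes> g0 \<oplus> g \<otimes> x \<in> M"
   by (intro Mc(5,6) g0M eg(2) xM) (use et(2) ZM in auto)
  ultimately show ?case using eq unfolding M_def by blast
 qed
 have dig: "\<exists>as. length as = length P \<and> set as \<subseteq> {..<p} \<and> (\<exists>g\<in>M. eval P x = eval (map natc as) x \<oplus> \<pi> \<otimes> g)"
  if "set P \<subseteq> Z" for P using that
 proof (induction P)
  case Nil
  show ?case using Mc(1) by (intro exI[of _ "[]"] conjI bexI[of _ \<zero>]) auto
 next
  case (Cons a P)
  then obtain as g where as: "length as = length P" "set as \<subseteq> {..<p}" "g \<in> M" "eval P x = eval (map natc as) x \<oplus> \<pi> \<otimes> g" by auto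
  obtain j y where y: "y \<in> Z" "a = natc j \<oplus> \<pi> \<otimes> y" "j < p" using Z_digit[of a] Cons.prems by auto
  let ?x = "x [^] length P"
  have c: "g \<in> \<F>" "y \<in> \<F>" "eval (map natc as) x \<in> \<F>" "?x \<in> \<F>"
   using as y MF Z_carrier xc by (auto intro!: eval_in_carrier)
  have "eval (a # P) x = a \<otimes> ?x \<oplus> eval P x" by simp
  also have "\<dots> = (natc j \<otimes> ?x \<oplus> eval (map natc as) x) \<oplus> \<pi> \<otimes> (y \<otimes> ?x \<oplus> g)"
   unfolding as(4) y(2) using c natc_closed[of p] natc_closed[of j] by algebra
  finally have "eval (a # P) x = eval (map natc (j # as)) x \<oplus> \<pi> \<otimes> (y \<otimes> ?x \<oplus> g)" using as(1) by simp
  moreover have "y \<otimes> ?x \<oplus> g \<in> M"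
   by (intro Mc(5,6) as(3) subring_nat_pow[OF M xM]) (use y(1) ZM in auto)
  ultimately show ?case using as(1,2) y(3) by (intro exI[of _ "j # as"]) auto
 qed
 have red2: "\<forall>y\<in>M. \<exists>as g. length as = k \<and> set as \<subseteq> {..<p} \<and> g \<in> M \<and> y = eval (map natc as) x \<oplus> \<pi> \<otimes> g"
 proof
  fix y assume "y \<in> M"
  then obtain e g where eg: "e \<in> pvals Z k x" "g \<in> M" "y = e \<oplus> \<pi> \<otimes> g" using red by blast
  then obtain P where P: "set P \<subseteq> Z" "length P = k" "e = eval P x" unfolding pvals_def by auto
  obtain as g' where as: "length as = k" "set as \<subseteq> {..<p}" "g' \<in> M" "e = eval (map natc as) x \<oplus> \<pi> \<otimes> g'"
   using dig[OF P(1)] P by auto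
  have c: "g \<in> \<F>" "g' \<in> \<F>" "eval (map natc as) x \<in> \<F>"
   using eg as MF xc by (auto intro!: eval_in_carrier)
  have "y = eval (map natc as) x \<oplus> \<pi> \<otimes> (g' \<oplus> g)" unfolding eg(3) as(4) using c natc_closed[of p] by algebra
  thus "\<exists>as g. length as = k \<and> set as \<subseteq> {..<p} \<and> g \<in> M \<and> y = eval (map natc as) x \<oplus> \<pi> \<otimes> g"
   using as eg Mc(6) by blast
 qed
 moreover have "k < length P0" using P(1) unfolding sp(1) k_def by simp
 ultimately show ?thesis unfolding M_def by blast
qed

end

context max_subring
begin

text \<open>Valuation rings are integrally closed: if \<open>x\<close> is outside \<open>V\<close>,
  its inverse is inside, and dividing the monic equation by a power of \<open>x\<close> exhibits
  \<open>x\<close> as an element of \<open>V\<close>.\<close>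

lemma int_imp_V: assumes x: "x \<in> Oint" shows "x \<in> V"
proof (rule ccontr)
 assume nx: "x \<notin> V"
 obtain B where xc: "x \<in> \<F>" and B: "set B \<subseteq> Z" "eval (\<one> # B) x = \<zero>"
  using x unfolding Oint_def by (smt (verit) list.exhaust_sel list.set_intros(2) mem_Collect_eq subset_iff)
 have x0: "x \<noteq> \<zero>" using nx subringE(2)[OF V_subring] by auto
 have iV: "inv x \<in> V" using V_valuation[OF xc x0] nx by auto
 have ix: "inv x \<in> \<F>" "inv x \<otimes> x = \<one>" using xc x0 field_Units by auto
 have e: "eval B x \<in> pvals V (length B) x"
  using eval_in_pvals[OF B(1)] pvals_subset[OF Z_V] by blast
 have ec: "eval B x \<in> \<F>" using pvals_closed[OF V_carrier xc e] .
 have eq: "x [^] length B \<oplus> eval B x = \<zero>" using B(2) xc by simp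
 show False
 proof (cases "length B")
  case 0
  thus False using eq by simp
 next
  case (Suc n)
  have 1: "inv x [^] n \<otimes> eval B x \<in> V" using pvals_inverse_pow_mult[OF V_subring xc x0 iV] e Suc by simp
  have "inv x [^] n \<otimes> x [^] n = \<one>" using ix xc by (metis nat_pow_distrib nat_pow_one)
  moreover have "inv x [^] n \<otimes> x [^] Suc n = (inv x [^] n \<otimes> x [^] n) \<otimes> x" using ix xc by (simp add: m_assoc)
  ultimately have 2: "inv x [^] n \<otimes> x [^] Suc n = x" using xc by simp
  have "inv x [^] n \<otimes> (x [^] Suc n \<oplus> eval B x) = \<zero>" using eq Suc ix by simp
  hence "x \<oplus> inv x [^] n \<otimes> eval B x = \<zero>" using 2 ix xc ec by (simp add: r_distr)
  hence "x = \<ominus> (inv x [^] n \<otimes> eval B x)" using ix xc ec by (simp add: minus_equality)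
  thus False using nx 1 subringE(5)[OF V_subring] by metis
 qed
qed

text \<open>A nonzero constant coefficient \<open>c\<close> of an annihilator of \<open>z\<close> is
  a multiple of \<open>z\<close>, and \<open>c\<close> divides a power of \<open>p\<close>. If
  \<open>c\<close> vanishes, the polynomial is divided by its variable, hence the induction from the
  end of the list.\<close>

lemma pi_pow_in:
 assumes z: "z \<in> V" "z \<noteq> \<zero>" shows "\<exists>j::nat. \<exists>v\<in>V. \<pi> [^] j = z \<otimes> v"
proof -
 have zc: "z \<in> \<F>" using z V_carrier by auto
 have "\<exists>j::nat. \<exists>v\<in>V. \<pi> [^] j = z \<otimes> v" if "P \<noteq> []" "hd P \<noteq> \<zero>" "set P \<subseteq> Z" "eval P z = \<zero>" for P
  using that
 proof (induction P rule: rev_induct)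
  case (snoc c P)
  have PF: "set P \<subseteq> \<F>" and cZ: "c \<in> Z" and cc: "c \<in> \<F>" and PZ: "set P \<subseteq> Z" using snoc.prems(3) Z_carrier by auto
  have ec: "eval P z \<in> \<F>" using eval_in_carrier[OF PF zc] .
  have ev: "eval P z \<otimes> z \<oplus> c = \<zero>" using eval_append_aux[OF PF cc zc] snoc.prems(4) by simp
  show ?case
  proof (cases "c = \<zero>")
   case True
   hence "eval P z \<otimes> z = \<zero>" using ev ec zc by simp
   hence "eval P z = \<zero>" using integral ec zc z by blast
   moreover have "P \<noteq> []" using snoc.prems(2) True by auto
   ultimately show ?thesis using snoc.IH snoc.prems PZ by simp
  next
   case False
   obtain u u' k where u: "u \<in> Z" "u' \<in> Z" "u \<otimes> u' = \<one>" "c = u \<otimes> \<pi> [^] (k::nat) \<or> c \<otimes> \<pi> [^] k = u"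
    using Q_val[of c] cZ Z_sub_Q False by blast
   have uc: "u \<in> \<F>" "u' \<in> \<F>" using u Z_carrier by auto
   have pZ: "\<pi> [^] k \<in> Z" using natc_Z subring_nat_pow[OF Z_subring] by blast
   have "\<exists>j::nat. \<exists>t\<in>Z. \<pi> [^] j = c \<otimes> t"
   proof (cases "c = u \<otimes> \<pi> [^] k")
    case True
    have "c \<otimes> u' = \<pi> [^] k \<otimes> (u \<otimes> u')" using True uc by (simp add: m_ac)
    hence "\<pi> [^] k = c \<otimes> u'" using u(3) by simp
    thus ?thesis using u(2) by blast
   next
    case False
    hence "c \<otimes> (\<pi> [^] k \<otimes> u') = \<one>" using u uc cc by (simp add: m_assoc[symmetric])
    hence "\<pi> [^] (0::nat) = c \<otimes> (\<pi> [^] k \<otimes> u')" by simp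
    thus ?thesis using u(2) pZ subringE(6)[OF Z_subring] by blast
   qed
   then obtain j t where t: "t \<in> Z" "\<pi> [^] (j::nat) = c \<otimes> t" by blast
   have tc: "t \<in> \<F>" using t Z_carrier by auto
   have "c = \<ominus> (eval P z \<otimes> z)" using ev ec zc cc by (metis a_comm m_closed minus_equality)
   hence "\<pi> [^] j = z \<otimes> (\<ominus> (eval P z) \<otimes> t)" unfolding t(2) using ec zc tc by algebra
   moreover have "\<ominus> (eval P z) \<otimes> t \<in> V"
   proof -
    have "eval P z \<in> V" using pvals_in_subring[OF V_subring z(1)] eval_in_pvals[of P V z] PZ Z_V by blast
    thus ?thesis using t(1) Z_V subringE(5,6)[OF V_subring] by blast
   qed
   ultimately show ?thesis by blast
  qed
 qed simp
 thus ?thesis using annihilator_Z[OF zc] by metis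
qed

text \<open>If \<open>z\<close> were nonzero, some \<open>p ^ j\<close> would be a multiple of
  \<open>z\<close>, hence of \<open>p ^ (j + 1)\<close>, and \<open>p\<close> would be a
  unit.\<close>

lemma V_separated:
 assumes z: "z \<in> V" and div: "\<And>M::nat. \<exists>v\<in>V. z = \<pi> [^] M \<otimes> v" shows "z = \<zero>"
proof (rule ccontr)
 assume "z \<noteq> \<zero>"
 then obtain j v where v: "v \<in> V" "\<pi> [^] (j::nat) = z \<otimes> v" using pi_pow_in[OF z] by blast
 obtain w where w: "w \<in> V" "z = \<pi> [^] Suc j \<otimes> w" using div by blast
 have c: "v \<in> \<F>" "w \<in> \<F>" using v w V_carrier by auto
 have "\<pi> [^] j \<otimes> \<one> = \<pi> [^] j \<otimes> (\<pi> \<otimes> (w \<otimes> v))" using v(2) w(2) c by (simp add: m_assoc)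
 moreover have "\<pi> [^] j \<noteq> \<zero>" using pow_nonzero pi_nonzero by simp
 ultimately have "\<one> = \<pi> \<otimes> (w \<otimes> v)" using m_lcancel[of "\<pi> [^] j" \<one> "\<pi> \<otimes> (w \<otimes> v)"] c by simp
 thus False using V_pnonunit subringE(6)[OF V_subring w(1) v(1)] by metis
qed

text \<open>Completeness enters here. Iterating the digit expansion of \<open>x ^ k\<close> writes
  it, up to arbitrarily high powers of \<open>p\<close>, as a combination of lower powers of
  \<open>x\<close> whose coefficients are partial sums of series in \<open>p\<close>. The sums
  \<open>C i\<close> of these series lie in \<open>Z\<close>, and the difference \<open>z\<close>
  vanishes because \<open>V\<close> is separated; the result is a monic equation for
  \<open>x\<close>.\<close>

lemma V_imp_int: assumes x: "x \<in> V" shows "x \<in> Oint"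
proof -
 have xc: "x \<in> \<F>" using x V_carrier by auto
 define M where "M = simple_extension Z x"
 have M: "subring M F" unfolding M_def by (rule simple_extension_is_subring[OF Z_subring xc])
 have MV: "M \<subseteq> V" unfolding M_def by (rule simple_extension_subring_incl[OF V_subring Z_V x])
 have MF: "M \<subseteq> \<F>" using subringE(1)[OF M] .
 have xM: "x \<in> M" unfolding M_def by (rule simple_extension_mem[OF Z_subring xc])
 obtain P0 where "P0 \<noteq> []" "hd P0 \<noteq> \<zero>" "set P0 \<subseteq> Z" "eval P0 x = \<zero>" by (rule annihilator_Z[OF xc])
 from digit_expansion[OF xc this] obtain k where red2: "\<forall>y\<in>M. \<exists>as g. length as = k \<and> set as \<subseteq> {..<p} \<and>
   g \<in> M \<and> y = eval (map natc as) x \<oplus> \<pi> \<otimes> g"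
  unfolding M_def by blast
 obtain AS where "\<forall>y\<in>M. \<exists>g. length (AS y) = k \<and> set (AS y) \<subseteq> {..<p} \<and> g \<in> M \<and> y = eval (map natc (AS y)) x \<oplus> \<pi> \<otimes> g"
  using bchoice[OF red2] by blast
 then obtain G where G: "\<And>y. y \<in> M ==> length (AS y) = k \<and> set (AS y) \<subseteq> {..<p} \<and> G y \<in> M \<and> y = eval (map natc (AS y)) x \<oplus> \<pi> \<otimes> G y"
  using bchoice[of M "\<lambda>y g. length (AS y) = k \<and> set (AS y) \<subseteq> {..<p} \<and> g \<in> M \<and> y = eval (map natc (AS y)) x \<oplus> \<pi> \<otimes> g"] by blast
 \<comment> \<open>\<open>y n\<close> is the remainder after \<open>n\<close> expansions and
   \<open>D n\<close> below the list of digits split off from it; \<open>S N i\<close> adds up the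
   first \<open>N\<close> digits in position \<open>i\<close>.\<close>
 define y where "y = (\<lambda>n. (G ^^ n) (x [^] k))"
 have yM: "y n \<in> M" for n
  by (induction n) (use G subring_nat_pow[OF M xM] in "auto simp: y_def")
 define D where "D = (\<lambda>n. AS (y n))"
 have Dlen: "length (D n) = k" for n using G[OF yM] unfolding D_def by blast
 have ystep: "y n = eval (map natc (D n)) x \<oplus> \<pi> \<otimes> y (Suc n)" for n
  using G[OF yM[of n]] unfolding D_def by (simp add: y_def)
 define S where "S = (\<lambda>N i. \<Sum>n<N. D n ! i * p ^ n)"
 have sumN: "x [^] k = eval (map (\<lambda>i. natc (S N i)) [0..<k]) x \<oplus> \<pi> [^] N \<otimes> y N" for N
 proof (induction N)
  case 0
  have "eval (map (\<lambda>i. natc (S 0 i)) [0..<k]) x = \<zero>"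
   using eval_map_zero[OF xc, of "[0..<k]"] by (simp add: S_def)
  thus ?case using yM[of 0] MF xc by (simp add: y_def)
 next
  case (Suc N)
  have c: "y (Suc N) \<in> \<F>" "\<pi> [^] N \<in> \<F>" using yM MF by auto
  have Dm: "map natc (D N) = map (\<lambda>i. natc (D N ! i)) [0..<k]"
   using map_nth[of "D N"] Dlen[of N] by (metis (no_types, lifting) list.map_comp comp_def map_eq_conv)
  have Ec: "eval (map (\<lambda>i. natc (f i)) [0..<k]) x \<in> \<F>" for f using xc by (auto intro!: eval_in_carrier)
  have "S (Suc N) i = S N i + p ^ N * D N ! i" for i by (simp add: S_def)
  hence mS: "map (\<lambda>i. natc (S (Suc N) i)) [0..<k] = map (\<lambda>i. natc (S N i) \<oplus> \<pi> [^] N \<otimes> natc (D N ! i)) [0..<k]"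
   by (simp add: natc_add natc_mult natc_power)
  have "eval (map (\<lambda>i. natc (S (Suc N) i)) [0..<k]) x
   = eval (map (\<lambda>i. natc (S N i)) [0..<k]) x \<oplus> eval (map (\<lambda>i. \<pi> [^] N \<otimes> natc (D N ! i)) [0..<k]) x"
   unfolding mS by (rule eval_map_add) (use xc in auto)
  also have "eval (map (\<lambda>i. \<pi> [^] N \<otimes> natc (D N ! i)) [0..<k]) x = \<pi> [^] N \<otimes> eval (map natc (D N)) x"
   unfolding Dm by (rule eval_map_smult) (use xc in auto)
  finally have 1: "eval (map (\<lambda>i. natc (S (Suc N) i)) [0..<k]) x =
   eval (map (\<lambda>i. natc (S N i)) [0..<k]) x \<oplus> \<pi> [^] N \<otimes> eval (map natc (D N)) x" .
  have c2: "eval (map natc (D N)) x \<in> \<F>" unfolding Dm by (rule Ec)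
  have c3: "eval (map (\<lambda>i. natc (S N i)) [0..<k]) x \<in> \<F>" by (rule Ec)
  have "x [^] k = eval (map (\<lambda>i. natc (S N i)) [0..<k]) x
    \<oplus> \<pi> [^] N \<otimes> (eval (map natc (D N)) x \<oplus> \<pi> \<otimes> y (Suc N))" using Suc ystep by metis
  also have "\<dots> = eval (map (\<lambda>i. natc (S (Suc N) i)) [0..<k]) x \<oplus> (\<pi> [^] N \<otimes> \<pi>) \<otimes> y (Suc N)"
   unfolding 1 using c c2 c3 by (simp only: r_distr m_assoc a_assoc natc_closed m_closed a_closed)
  finally show ?case by simp
 qed
 have "\<forall>i. \<exists>c. c \<in> Z \<and> (\<forall>N. \<exists>w\<in>Z. c = natc (S N i) \<oplus> \<pi> [^] N \<otimes> w)"
 proof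
  fix i
  show "\<exists>c. c \<in> Z \<and> (\<forall>N. \<exists>w\<in>Z. c = natc (S N i) \<oplus> \<pi> [^] N \<otimes> w)"
   unfolding S_def using Z_complete[of "\<lambda>n. D n ! i"] by blast
 qed
 from choice[OF this] obtain C where C0: "\<forall>i. C i \<in> Z \<and> (\<forall>N. \<exists>w\<in>Z. C i = natc (S N i) \<oplus> \<pi> [^] N \<otimes> w)"
  by blast
 have C: "\<And>i. C i \<in> Z" "\<And>i N. \<exists>w\<in>Z. C i = natc (S N i) \<oplus> \<pi> [^] N \<otimes> w" using C0 by auto
 define Ce where "Ce = eval (map C [0..<k]) x"
 have CeV: "Ce \<in> V" unfolding Ce_def
  by (rule pvals_in_subring[OF V_subring x eval_in_pvals]) (use C Z_V in auto)
 define z where "z = x [^] k \<ominus> Ce"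
 have zV: "z \<in> V" unfolding z_def a_minus_def
  using subringE(5,7)[OF V_subring] CeV subring_nat_pow[OF V_subring x] by blast
 have "z = \<zero>"
 proof (rule V_separated[OF zV])
  fix N
  have "\<forall>i. \<exists>w. w \<in> Z \<and> C i = natc (S N i) \<oplus> \<pi> [^] N \<otimes> w" using C(2) by blast
  from choice[OF this] obtain w where w0: "\<forall>i. w i \<in> Z \<and> C i = natc (S N i) \<oplus> \<pi> [^] N \<otimes> w i" by blast
  have w: "\<And>i. w i \<in> Z" "\<And>i. C i = natc (S N i) \<oplus> \<pi> [^] N \<otimes> w i" using w0 by auto
  have wc: "w i \<in> \<F>" for i using w Z_carrier by auto
  have "Ce = eval (map (\<lambda>i. natc (S N i)) [0..<k]) x \<oplus> eval (map (\<lambda>i. \<pi> [^] N \<otimes> w i) [0..<k]) x"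
   unfolding Ce_def w(2) by (rule eval_map_add) (use wc xc in auto)
  also have "eval (map (\<lambda>i. \<pi> [^] N \<otimes> w i) [0..<k]) x = \<pi> [^] N \<otimes> eval (map w [0..<k]) x"
   by (rule eval_map_smult) (use wc xc in auto)
  finally have Ce: "Ce = eval (map (\<lambda>i. natc (S N i)) [0..<k]) x \<oplus> \<pi> [^] N \<otimes> eval (map w [0..<k]) x" .
  define E1 where "E1 = eval (map (\<lambda>i. natc (S N i)) [0..<k]) x"
  define E2 where "E2 = eval (map w [0..<k]) x"
  have c: "E1 \<in> \<F>" "E2 \<in> \<F>" "y N \<in> \<F>" "\<pi> [^] N \<in> \<F>"
   using wc xc yM MF by (auto simp: E1_def E2_def intro!: eval_in_carrier)
  have "z = (E1 \<oplus> \<pi> [^] N \<otimes> y N) \<ominus> (E1 \<oplus> \<pi> [^] N \<otimes> E2)"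
   unfolding z_def Ce E1_def E2_def using sumN[of N] by simp
  also have "\<dots> = \<pi> [^] N \<otimes> (y N \<ominus> E2)" using c by algebra
  finally have "z = \<pi> [^] N \<otimes> (y N \<ominus> eval (map w [0..<k]) x)" unfolding E2_def .
  moreover have "eval (map w [0..<k]) x \<in> V"
   by (rule pvals_in_subring[OF V_subring x eval_in_pvals]) (use w Z_V in auto)
  hence "y N \<ominus> eval (map w [0..<k]) x \<in> V" unfolding a_minus_def
   using yM MV subringE(5,7)[OF V_subring] by blast
  ultimately show "\<exists>v\<in>V. z = \<pi> [^] N \<otimes> v" by blast
 qed
 moreover have CeF: "Ce \<in> \<F>" using CeV V_carrier by auto
 ultimately have xC: "x [^] k = Ce" unfolding z_def using xc by (simp add: r_right_minus_eq)
 let ?P = "\<one> # map (a_inv F) (map C [0..<k])"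
 have "eval (map (a_inv F) (map C [0..<k])) x = \<ominus> Ce"
  unfolding Ce_def by (rule eval_map_minus) (use C Z_carrier xc in auto)
 hence ev: "eval ?P x = \<zero>" using xC CeF xc by (simp add: r_neg del: map_map)
 have st: "set ?P \<subseteq> Z" using C subringE(3,5)[OF Z_subring] by auto
 show ?thesis unfolding Oint_def mem_Collect_eq by (intro conjI xc exI[of _ ?P] ev st) simp_all
qed

lemma V_eq: "V = Oint" using V_imp_int int_imp_V by blast

end

context padic_alg
begin

lemma ex_max_subring: "\<exists>V. max_subring F p Z Q V"
proof -
 define A where "A = {V. subring V F \<and> Z \<subseteq> V \<and> (\<forall>y\<in>V. \<pi> \<otimes> y \<noteq> \<one>)}"
 have ZA: "Z \<in> A" unfolding A_def using Z_subring p_nonunit_Z by auto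
 have "\<exists>V\<in>A. \<forall>W\<in>A. V \<subseteq> W --> W = V"
 proof (rule subset_Zorn_nonempty)
  show "A \<noteq> {}" using ZA by blast
  fix C assume C: "C \<noteq> {}" "subset.chain A C"
  have CA: "C \<subseteq> A" and lin: "\<And>W Y. W \<in> C ==> Y \<in> C ==> W \<subseteq> Y \<or> Y \<subseteq> W"
   using C(2) unfolding subset_chain_def by auto
  have CA': "subring W F" if "W \<in> C" for W using CA that unfolding A_def by auto
  have "subring (\<Union>C) F"
  proof (rule subringI)
   show "\<Union>C \<subseteq> \<F>" using subringE(1)[OF CA'] by auto
   show "\<one> \<in> \<Union>C" using C(1) subringE(3)[OF CA'] by auto
   show "\<ominus> h \<in> \<Union>C" if "h \<in> \<Union>C" for h using that subringE(5)[OF CA'] by auto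
  next
   fix a b assume "a \<in> \<Union>C" "b \<in> \<Union>C"
   then obtain W where W: "W \<in> C" "a \<in> W" "b \<in> W" using lin by (elim UnionE) (metis subset_iff)
   show "a \<otimes> b \<in> \<Union>C" by (rule UnionI[OF W(1) subringE(6)[OF CA'[OF W(1)] W(2,3)]])
   show "a \<oplus> b \<in> \<Union>C" by (rule UnionI[OF W(1) subringE(7)[OF CA'[OF W(1)] W(2,3)]])
  qed
  thus "\<Union>C \<in> A" using C(1) CA unfolding A_def by auto
 qed
 then obtain V where V: "subring V F" "Z \<subseteq> V" "\<And>y. y \<in> V ==> \<pi> \<otimes> y \<noteq> \<one>"
  and mx: "\<And>W. W \<in> A ==> V \<subseteq> W ==> W = V" unfolding A_def by auto
 have "max_subring F p Z Q V"
  by (intro max_subring.intro padic_alg_axioms max_subring_axioms.intro V mx) (use V in "auto simp: A_def")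
 thus ?thesis by blast
qed

text \<open>Whatever maximal ring is chosen, it equals \<open>Oint\<close>, so everything proved for
  it holds for the integral closure.\<close>

lemma O_subring: "subring Oint F"
 and Z_O: "Z \<subseteq> Oint"
 and pi_nonunit_O: "y \<in> Oint ==> \<pi> \<otimes> y \<noteq> \<one>"
 and O_valuation: "x \<in> \<F> ==> x \<noteq> \<zero> ==> x \<in> Oint \<or> inv x \<in> Oint"
 and pi_pow_in_O: "z \<in> Oint ==> z \<noteq> \<zero> ==> \<exists>j::nat. \<exists>v\<in>Oint. \<pi> [^] j = z \<otimes> v"
proof -
 obtain V where "max_subring F p Z Q V" using ex_max_subring by blast
 then interpret max_subring F p Z Q V .
 show "subring Oint F" "Z \<subseteq> Oint" "y \<in> Oint ==> \<pi> \<otimes> y \<noteq> \<one>"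
  "x \<in> \<F> ==> x \<noteq> \<zero> ==> x \<in> Oint \<or> inv x \<in> Oint"
  "z \<in> Oint ==> z \<noteq> \<zero> ==> \<exists>j::nat. \<exists>v\<in>Oint. \<pi> [^] j = z \<otimes> v"
  using V_subring Z_V V_pnonunit V_valuation pi_pow_in unfolding V_eq by auto
qed

end

section \<open>Roots of polynomials\<close>

context field
begin

lemma minus_self [simp]: "x \<in> carrier R ==> x \<ominus> x = \<zero>" by simp

primrec root_prod :: "'a list \<Rightarrow> 'a \<Rightarrow> 'a" where
 "root_prod [] x = \<one>"
| "root_prod (r # rs) x = (x \<ominus> r) \<otimes> root_prod rs x"

lemma root_prod_closed [simp]: "set rs \<subseteq> carrier R ==> x \<in> carrier R ==> root_prod rs x \<in> carrier R"
 by (induction rs) auto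

lemma root_prod_eq_0: "set rs \<subseteq> carrier R ==> x \<in> carrier R ==> root_prod rs x = \<zero> \<longleftrightarrow> x \<in> set rs"
 by (induction rs) (auto simp: integral_iff r_right_minus_eq)

lemma synthetic_division:
 assumes "set P \<subseteq> carrier R" "P \<noteq> []" "a \<in> carrier R"
 shows "\<exists>P'. length P = Suc (length P') \<and> set P' \<subseteq> carrier R \<and> (P' \<noteq> [] --> hd P' = hd P) \<and>
  (\<forall>x\<in>carrier R. eval P x = (x \<ominus> a) \<otimes> eval P' x \<oplus> eval P a)"
 using assms
proof (induction P rule: rev_induct)
 case (snoc c P)
 have PF: "set P \<subseteq> carrier R" and c: "c \<in> carrier R" using snoc.prems by auto
 show ?case
 proof (cases "P = []")
  case True
  thus ?thesis using c snoc.prems(3) by (intro exI[of _ "[]"]) auto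
 next
  case False
  then obtain Q where Q: "length P = Suc (length Q)" "set Q \<subseteq> carrier R" "Q \<noteq> [] --> hd Q = hd P"
   "\<And>x. x \<in> carrier R ==> eval P x = (x \<ominus> a) \<otimes> eval Q x \<oplus> eval P a"
   using snoc.IH[OF PF False snoc.prems(3)] by blast
  let ?b = "eval P a"
  have bc: "?b \<in> carrier R" using eval_in_carrier[OF PF snoc.prems(3)] .
  have a: "a \<in> carrier R" by fact
  have "eval (P @ [c]) x = (x \<ominus> a) \<otimes> eval (Q @ [?b]) x \<oplus> eval (P @ [c]) a" if x: "x \<in> carrier R" for x
  proof -
   have Qx: "eval Q x \<in> carrier R" using eval_in_carrier[OF Q(2) x] .
   have "eval (P @ [c]) x = ((x \<ominus> a) \<otimes> eval Q x \<oplus> ?b) \<otimes> x \<oplus> c"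
    using eval_append_aux[OF PF c x] Q(4)[OF x] by simp
   also have "\<dots> = (x \<ominus> a) \<otimes> (eval Q x \<otimes> x \<oplus> ?b) \<oplus> (?b \<otimes> a \<oplus> c)"
    using Qx bc a c x by algebra
   finally show ?thesis
    using eval_append_aux[OF PF c a] eval_append_aux[OF Q(2) bc x] by simp
  qed
  moreover have "hd (Q @ [?b]) = hd (P @ [c])"
  proof (cases Q)
   case Nil
   then obtain d where "P = [d]" using Q(1) by (metis length_0_conv length_Suc_conv list.size(3))
   thus ?thesis using Nil PF by auto
  qed (use Q False in auto)
  ultimately show ?thesis using Q bc by (intro exI[of _ "Q @ [?b]"]) auto
 qed
qed simp

end

section \<open>Algebraically closed fields and primitive roots of unity\<close>

locale alg_closed_field = field F for F (structure) +
 assumes has_root: "set P \<subseteq> carrier F ==> hd P = \<one> ==> length P > 1 ==> \<exists>x\<in>carrier F. eval P x = \<zero>"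
begin

lemma monic_splits:
 assumes "set P \<subseteq> carrier F" "length P = Suc n" "hd P = \<one>"
 shows "\<exists>rs. length rs = n \<and> set rs \<subseteq> carrier F \<and> (\<forall>x\<in>carrier F. eval P x = root_prod rs x)"
 using assms
proof (induction n arbitrary: P)
 case 0
 hence "P = [\<one>]" by (cases P) auto
 thus ?case by (intro exI[of _ "[]"]) auto
next
 case (Suc n)
 obtain a where a: "a \<in> carrier F" "eval P a = \<zero>" using has_root[of P] Suc.prems by auto
 have "P \<noteq> []" using Suc.prems(2) by auto
 from synthetic_division[OF Suc.prems(1) this a(1)]
 obtain Q where Q: "length P = Suc (length Q)" "set Q \<subseteq> carrier F" "Q \<noteq> [] --> hd Q = hd P"
   "\<And>x. x \<in> carrier F ==> eval P x = (x \<ominus> a) \<otimes> eval Q x \<oplus> eval P a"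
  by blast
 have lQ: "length Q = Suc n" using Q(1) Suc.prems(2) by simp
 hence "hd Q = \<one>" using Q(3) Suc.prems(3) by auto
 then obtain rs where rs: "length rs = n" "set rs \<subseteq> carrier F" "\<And>x. x \<in> carrier F ==> eval Q x = root_prod rs x"
  using Suc.IH[OF Q(2) lQ] by blast
 have "eval P x = root_prod (a # rs) x" if x: "x \<in> carrier F" for x
  unfolding Q(4)[OF x] a(2) rs(3)[OF x] using x a(1) rs(2) by simp
 thus ?case using rs(1,2) a(1) by (intro exI[of _ "a # rs"]) auto
qed

lemma pow_splits:
 assumes "n > 0" "c \<in> carrier F"
 obtains rs where "length rs = n" "set rs \<subseteq> carrier F" "\<And>x. x \<in> carrier F ==> x [^] n \<ominus> c = root_prod rs x"
proof -
 let ?P = "\<one> # replicate (n - 1) \<zero> @ [\<ominus> c]"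
 have ev: "eval ?P x = x [^] n \<ominus> c" if "x \<in> carrier F" for x
 proof -
  have "eval (replicate k \<zero> @ [\<ominus> c]) x = \<ominus> c" for k
   by (induction k) (use that assms in auto)
  thus ?thesis using that assms by (simp add: a_minus_def)
 qed
 have "set ?P \<subseteq> carrier F" using assms by auto
 from monic_splits[OF this, of n] show ?thesis using assms ev that by auto
qed

lemma finite_roots_pow: "n > 0 ==> c \<in> carrier F ==> finite {x \<in> carrier F. x [^] n = c} \<and> card {x \<in> carrier F. x [^] n = c} \<le> n"
proof -
 assume n: "n > 0" and c: "c \<in> carrier F"
 obtain rs where rs: "length rs = n" "set rs \<subseteq> carrier F" "\<And>x. x \<in> carrier F ==> x [^] n \<ominus> c = root_prod rs x"
  by (rule pow_splits[OF n c]) blast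
 have "{x \<in> carrier F. x [^] n = c} \<subseteq> set rs"
 proof safe
  fix x assume x: "x \<in> carrier F" and xc: "c = x [^] n"
  hence "root_prod rs x = \<zero>" using rs(3)[OF x] c by (simp add: r_right_minus_eq)
  thus "x \<in> set rs" using root_prod_eq_0[OF rs(2) x] by simp
 qed
 thus ?thesis using rs(1) card_length[of rs] card_mono[of "set rs" "{x \<in> carrier F. x [^] n = c}"]
  by (auto intro: finite_subset)
qed

lemma ex_root_pow: "(n::nat) > 0 ==> c \<in> carrier F ==> \<exists>x\<in>carrier F. x [^] n = c"
proof -
 assume n: "n > 0" and c: "c \<in> carrier F"
 obtain rs where rs: "length rs = n" "set rs \<subseteq> carrier F" "\<And>x. x \<in> carrier F ==> x [^] n \<ominus> c = root_prod rs x"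
  by (rule pow_splits[OF n c]) blast
 then obtain x where x: "x \<in> set rs" using n by (cases rs) auto
 hence xc: "x \<in> carrier F" using rs by auto
 hence "x [^] n \<ominus> c = \<zero>" using rs x root_prod_eq_0 by simp
 thus ?thesis using xc c by (auto simp: r_right_minus_eq)
qed

definition prim :: "'a \<Rightarrow> nat \<Rightarrow> bool" where
 "prim \<zeta> n \<longleftrightarrow> n > 0 \<and> \<zeta> \<in> carrier F \<and> (\<forall>a::nat. \<zeta> [^] a = \<one> \<longleftrightarrow> n dvd a)"

lemma primD: "prim \<zeta> n ==> n > 0" "prim \<zeta> n ==> \<zeta> \<in> carrier F" "prim \<zeta> n ==> \<zeta> [^] n = \<one>"
  "prim \<zeta> n ==> \<zeta> [^] (a::nat) = \<one> \<longleftrightarrow> n dvd a"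
 unfolding prim_def by auto

lemma prim_nonzero: "prim \<zeta> n ==> \<zeta> \<noteq> \<zero>"
proof
 assume "prim \<zeta> n" "\<zeta> = \<zero>"
 hence "\<zero> [^] n = \<one>" "n > 0" using primD by auto
 thus False by (cases n) auto
qed

lemma prim_pow_eq:
 assumes z: "prim \<zeta> n" shows "\<zeta> [^] (a::nat) = \<zeta> [^] b \<longleftrightarrow> [a = b] (mod n)"
proof -
 have *: "\<zeta> [^] a = \<zeta> [^] b \<longleftrightarrow> [a = b] (mod n)" if "a \<le> b" for a b :: nat
 proof -
  have zc: "\<zeta> \<in> carrier F" "\<zeta> [^] a \<noteq> \<zero>" using primD[OF z] prim_nonzero[OF z] pow_nonzero by auto
  have "\<zeta> [^] b = \<zeta> [^] a \<otimes> \<zeta> [^] (b - a)" using that zc by (simp add: nat_pow_mult)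
  hence "\<zeta> [^] a = \<zeta> [^] b \<longleftrightarrow> \<zeta> [^] a \<otimes> \<one> = \<zeta> [^] a \<otimes> \<zeta> [^] (b - a)" using zc by simp
  also have "\<dots> \<longleftrightarrow> \<one> = \<zeta> [^] (b - a)" using zc by (intro m_lcancel) auto
  also have "\<dots> \<longleftrightarrow> n dvd b - a" using primD(4)[OF z, of "b - a"] by auto
  also have "\<dots> \<longleftrightarrow> [a = b] (mod n)" using that by (metis cong_altdef_nat cong_sym_eq)
  finally show ?thesis .
 qed
 show ?thesis using *[of a b] *[of b a] by (cases "a \<le> b") (auto simp: cong_sym_eq)
qed

text \<open>The \<open>n\<close> powers of a primitive root are distinct and
  \<open>x ^ n = 1\<close> has at most \<open>n\<close> solutions.\<close>

lemma prim_roots: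
 assumes z: "prim \<zeta> n" and x: "x \<in> carrier F" "x [^] n = \<one>"
 shows "\<exists>i<n. x = \<zeta> [^] i"
proof -
 let ?S = "{x \<in> carrier F. x [^] n = \<one>}"
 have fin: "finite ?S" "card ?S \<le> n" using finite_roots_pow[of n \<one>] primD(1)[OF z] by auto
 have sub: "(\<lambda>i. \<zeta> [^] i) ` {..<n} \<subseteq> ?S"
 proof safe
  fix i :: nat show "\<zeta> [^] i \<in> carrier F" using primD[OF z] by auto
  have "(\<zeta> [^] i) [^] n = (\<zeta> [^] n) [^] i" using primD[OF z] by (simp add: nat_pow_pow mult.commute)
  thus "(\<zeta> [^] i) [^] n = \<one>" using primD[OF z] by simp
 qed
 have "inj_on (\<lambda>i. \<zeta> [^] i) {..<n}"
  by (rule inj_onI) (simp add: prim_pow_eq[OF z] cong_less_modulus_unique_nat)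
 hence "card ((\<lambda>i. \<zeta> [^] i) ` {..<n}) = n" by (simp add: card_image)
 hence "(\<lambda>i. \<zeta> [^] i) ` {..<n} = ?S" using sub fin by (metis card_subset_eq card_mono le_antisym)
 thus ?thesis using x by (auto simp: image_iff set_eq_iff)
qed

lemma prim_mult:
 assumes "prim \<zeta> m" "prim \<xi> n" "coprime m n" shows "prim (\<zeta> \<otimes> \<xi>) (m * n)"
proof -
 note z = primD[OF assms(1)] and x = primD[OF assms(2)]
 have "(\<zeta> \<otimes> \<xi>) [^] a = \<one> \<longleftrightarrow> m * n dvd a" for a :: nat
 proof
  assume "m * n dvd a"
  hence "m dvd a" "n dvd a" by (auto intro: dvd_trans)
  hence "\<zeta> [^] a = \<one>" "\<xi> [^] a = \<one>" using z(4) x(4) by auto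
  thus "(\<zeta> \<otimes> \<xi>) [^] a = \<one>" using z(2) x(2) by (simp add: nat_pow_distrib)
 next
  assume a: "(\<zeta> \<otimes> \<xi>) [^] a = \<one>"
  have "\<zeta> [^] (a * n) \<otimes> \<xi> [^] (a * n) = ((\<zeta> \<otimes> \<xi>) [^] a) [^] n"
   using z(2) x(2) by (simp add: nat_pow_distrib nat_pow_pow)
  also have "\<xi> [^] (a * n) = \<one>" using x(4)[of "a * n"] by simp
  finally have "\<zeta> [^] (a * n) = \<one>" using a z(2) by simp
  hence 1: "m dvd a" using z(4) assms(3) by (simp add: coprime_dvd_mult_left_iff)
  have "\<zeta> [^] (a * m) \<otimes> \<xi> [^] (a * m) = ((\<zeta> \<otimes> \<xi>) [^] a) [^] m"
   using z(2) x(2) by (simp add: nat_pow_distrib nat_pow_pow)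
  also have "\<zeta> [^] (a * m) = \<one>" using z(4)[of "a * m"] by simp
  finally have "\<xi> [^] (a * m) = \<one>" using a x(2) by simp
  hence 2: "n dvd a" using x(4) assms(3) by (simp add: coprime_dvd_mult_left_iff coprime_commute)
  show "m * n dvd a" by (rule semiring_gcd_class.divides_mult[OF 1 2 assms(3)])
 qed
 thus ?thesis unfolding prim_def using z x by auto
qed

text \<open>The list \<open>replicate n \<one>\<close> encodes the geometric sum
  \<open>1 + x + ... + x ^ (n - 1)\<close>.\<close>

lemma eval_replicate_one:
 assumes x: "x \<in> carrier F" shows "eval (replicate n \<one>) x \<otimes> (x \<ominus> \<one>) = x [^] n \<ominus> \<one>"
proof (induction n)
 case (Suc n)
 let ?e = "eval (replicate n \<one>) x"
 have e: "?e \<in> carrier F" using x by (intro eval_in_carrier) auto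
 have "eval (replicate (Suc n) \<one>) x \<otimes> (x \<ominus> \<one>) = (x [^] n \<oplus> ?e) \<otimes> (x \<ominus> \<one>)" using x by simp
 also have "\<dots> = x [^] n \<otimes> (x \<ominus> \<one>) \<oplus> ?e \<otimes> (x \<ominus> \<one>)" using x e by (intro l_distr) auto
 also have "\<dots> = x [^] n \<otimes> (x \<ominus> \<one>) \<oplus> (x [^] n \<ominus> \<one>)" using Suc by simp
 also have "\<dots> = x [^] Suc n \<ominus> \<one>" using x nat_pow_closed[OF x, of n] nat_pow_Suc[of x n] by algebra
 finally show ?case .
qed (use x in simp)

end

locale padic_closed = padic_alg + alg_closed_field
begin

text \<open>A root of \<open>1 + x + ... + x ^ (l - 1)\<close> is an \<open>l\<close>-th root of
  unity other than \<open>1\<close>, because the value of the sum at \<open>1\<close> is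
  \<open>l\<close>, which is nonzero in characteristic zero. Higher powers of \<open>l\<close> are
  reached by taking \<open>l\<close>-th roots.\<close>

lemma ex_prim_prime_power:
 assumes l: "nat_prime l" shows "\<exists>\<zeta>. prim \<zeta> (l ^ Suc k)"
proof (induction k)
 case 0
 have l1: "l > 1" using prime_gt_1_nat[OF l] .
 let ?P = "replicate l \<one>"
 have "hd ?P = \<one>" using l1 by (cases l) auto
 then obtain z where z: "z \<in> \<F>" "eval ?P z = \<zero>" using has_root[of ?P] l1 by auto
 have "z [^] l \<ominus> \<one> = eval ?P z \<otimes> (z \<ominus> \<one>)" using eval_replicate_one[OF z(1), of l] by simp
 hence zl: "z [^] l = \<one>" using z by (simp add: r_right_minus_eq)
 have "eval (replicate n \<one>) \<one> = natc n" for n by (induction n) (auto simp: natc_Suc)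
 hence z1: "z \<noteq> \<one>" using z char0[of l] l1 by auto
 have "z [^] a = \<one> \<longleftrightarrow> l dvd a" for a :: nat
 proof
  assume "l dvd a"
  thus "z [^] a = \<one>" using zl z(1) by (auto simp: nat_pow_pow[symmetric])
 next
  assume a: "z [^] a = \<one>"
  show "l dvd a"
  proof (rule ccontr)
   assume "\<not> l dvd a"
   hence "coprime a l" using l by (metis coprime_commute prime_imp_coprime)
   then obtain u v where uv: "a * u = l * v + 1" using bezout_nat[of a l] l1
    by (metis One_nat_def \<open>\<not> l dvd a\<close> coprime_imp_gcd_eq_1 dvd_0_right)
   have "\<one> = (z [^] a) [^] u" using a by simp
   also have "\<dots> = z [^] (l * v + 1)" using uv z(1) by (simp add: nat_pow_pow)
   also have "\<dots> = (z [^] l) [^] v \<otimes> z" using z(1) by (simp add: nat_pow_pow nat_pow_mult)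
   finally show False using zl z1 z(1) by simp
  qed
 qed
 thus ?case using z l1 unfolding prim_def by auto
next
 case (Suc k)
 then obtain z where z: "prim z (l ^ Suc k)" by blast
 have l1: "l > 1" using prime_gt_1_nat[OF l] .
 obtain y where y: "y \<in> \<F>" "y [^] l = z" using ex_root_pow[of l z] primD(2)[OF z] l1 by auto
 have "y [^] a = \<one> \<longleftrightarrow> l ^ Suc (Suc k) dvd a" for a :: nat
 proof
  assume "l ^ Suc (Suc k) dvd a"
  then obtain c where "a = l ^ Suc (Suc k) * c" by (rule dvdE)
  hence "a = l * (l ^ Suc k * c)" by (simp add: mult.assoc)
  hence "y [^] a = z [^] (l ^ Suc k * c)" using y by (simp add: nat_pow_pow[symmetric])
  thus "y [^] a = \<one>" using primD(4)[OF z, of "l ^ Suc k * c"] by simp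
 next
  assume a: "y [^] a = \<one>"
  have "z [^] a = (y [^] a) [^] l" using y by (metis nat_pow_pow mult.commute)
  hence "l ^ Suc k dvd a" using a primD(4)[OF z] by simp
  hence "l dvd a" by (metis dvd_trans dvd_triv_left power_Suc)
  then obtain b where b: "a = l * b" by blast
  hence "z [^] b = \<one>" using a y by (simp add: nat_pow_pow[symmetric])
  hence "l ^ Suc k dvd b" using primD(4)[OF z] by simp
  thus "l ^ Suc (Suc k) dvd a" using b by simp
 qed
 thus ?case using y l1 unfolding prim_def by auto
qed

lemma ex_prim: "n > 0 ==> \<exists>\<zeta>. prim \<zeta> n"
proof (induction n rule: less_induct)
 case (less n)
 show ?case
 proof (cases "n = 1")
  case True
  thus ?thesis unfolding prim_def by (intro exI[of _ \<one>]) auto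
 next
  case False
  then obtain l where l: "nat_prime l" "l dvd n" using less.prems by (metis prime_factor_nat)
  have l1: "l > 1" using prime_gt_1_nat[OF l(1)] .
  obtain m where m: "n = l ^ multiplicity l n * m" "\<not> l dvd m"
   using multiplicity_decompose'[of n l] less.prems l1 by auto
  have "multiplicity l n > 0" using l less.prems by (simp add: prime_multiplicity_gt_zero_iff)
  then obtain k where k: "multiplicity l n = Suc k" by (metis gr0_conv_Suc)
  have m0: "m > 0" using m less.prems by (metis gr0I mult_0_right)
  have "l ^ Suc k > 1" using l1 by (metis one_less_power zero_less_Suc)
  hence "m < n" using m(1) k m0 by simp
  then obtain y where y: "prim y m" using less.IH m0 by blast
  obtain z where z: "prim z (l ^ Suc k)" using ex_prim_prime_power[OF l(1)] by blast
  have "coprime (l ^ Suc k) m" using m(2) l(1) by (simp add: prime_imp_coprime)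
  from prim_mult[OF z y this] show ?thesis using m(1) k by auto
 qed
qed

section \<open>Congruences modulo the maximal ideal\<close>

definition "mx = {x \<in> Oint. \<not> (\<exists>u\<in>Oint. x \<otimes> u = \<one>)}"

definition rcong (infix "\<doteq>" 50) where "x \<doteq> y \<longleftrightarrow> x \<ominus> y \<in> mx"

lemma O_carrier: "x \<in> Oint ==> x \<in> \<F>" using subringE(1)[OF O_subring] by auto
lemma O_zero [simp]: "\<zero> \<in> Oint" by (rule subringE(2)[OF O_subring])
lemma O_one [simp]: "\<one> \<in> Oint" by (rule subringE(3)[OF O_subring])
lemma O_minus: "x \<in> Oint ==> \<ominus> x \<in> Oint" by (rule subringE(5)[OF O_subring])
lemma O_mult: "x \<in> Oint ==> y \<in> Oint ==> x \<otimes> y \<in> Oint" by (rule subringE(6)[OF O_subring])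
lemma O_add: "x \<in> Oint ==> y \<in> Oint ==> x \<oplus> y \<in> Oint" by (rule subringE(7)[OF O_subring])
lemma O_diff: "x \<in> Oint ==> y \<in> Oint ==> x \<ominus> y \<in> Oint" unfolding a_minus_def by (intro O_add O_minus)
lemma O_pow: "x \<in> Oint ==> x [^] (n::nat) \<in> Oint" by (rule subring_nat_pow[OF O_subring])
lemma O_natc: "natc n \<in> Oint" using natc_Z Z_O by auto
lemmas O_intros = O_zero O_one O_minus O_mult O_add O_diff O_pow O_natc

lemma mx_O: "x \<in> mx ==> x \<in> Oint" unfolding mx_def by auto
lemma mx_carrier: "x \<in> mx ==> x \<in> \<F>" using mx_O O_carrier by auto
lemma mx_zero [simp]: "\<zero> \<in> mx" unfolding mx_def using O_carrier by auto
lemma one_not_mx: "\<one> \<notin> mx" unfolding mx_def by (auto intro!: bexI[of _ \<one>])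
lemma pi_mx: "\<pi> \<in> mx" unfolding mx_def using O_natc pi_nonunit_O by auto

lemma unit_iff: "x \<in> Oint ==> x \<notin> mx \<longleftrightarrow> (\<exists>u\<in>Oint. x \<otimes> u = \<one>)" unfolding mx_def by auto

lemma mx_mult: "a \<in> Oint ==> x \<in> mx ==> a \<otimes> x \<in> mx"
proof -
 assume a: "a \<in> Oint" and x: "x \<in> mx"
 have "\<not> (\<exists>u\<in>Oint. (a \<otimes> x) \<otimes> u = \<one>)"
 proof
  assume "\<exists>u\<in>Oint. (a \<otimes> x) \<otimes> u = \<one>"
  then obtain u where u: "u \<in> Oint" "(a \<otimes> x) \<otimes> u = \<one>" by blast
  hence "x \<otimes> (a \<otimes> u) = \<one>" using a u mx_carrier[OF x] O_carrier by (simp add: m_ac)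
  thus False using x O_mult[OF a u(1)] unfolding mx_def by blast
 qed
 thus ?thesis unfolding mx_def using O_mult[OF a mx_O[OF x]] by auto
qed

lemma mx_prime: "a \<in> Oint ==> b \<in> Oint ==> a \<otimes> b \<in> mx ==> a \<in> mx \<or> b \<in> mx"
proof (rule ccontr)
 assume a: "a \<in> Oint" and b: "b \<in> Oint" and ab: "a \<otimes> b \<in> mx" and n: "\<not> (a \<in> mx \<or> b \<in> mx)"
 obtain u v where u: "u \<in> Oint" "a \<otimes> u = \<one>" "v \<in> Oint" "b \<otimes> v = \<one>" using n a b unit_iff by auto
 have c: "a \<in> \<F>" "b \<in> \<F>" "u \<in> \<F>" "v \<in> \<F>" using a b u O_carrier by auto
 have "(a \<otimes> b) \<otimes> (u \<otimes> v) = (a \<otimes> u) \<otimes> (b \<otimes> v)" using c by algebra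
 hence "(a \<otimes> b) \<otimes> (u \<otimes> v) = \<one>" using u by simp
 thus False using ab O_mult[OF u(1,3)] unfolding mx_def by blast
qed

lemma mx_minus: "x \<in> mx ==> \<ominus> x \<in> mx"
 using mx_mult[of "\<ominus> \<one>" x] mx_carrier[of x] O_minus[of \<one>] by (simp add: l_minus)

text \<open>The valuation property in multiplicative form. In the second case the quotient is a
  nonunit because otherwise the first case would apply. This replaces comparisons in a value
  group.\<close>

lemma O_divides:
 assumes x: "x \<in> \<F>" and y: "y \<in> \<F>" "y \<noteq> \<zero>"
 shows "(\<exists>t\<in>Oint. x = y \<otimes> t) \<or> (\<exists>t\<in>mx. x \<noteq> \<zero> \<and> y = x \<otimes> t)"
proof -
 have iy: "inv y \<in> \<F>" "y \<otimes> inv y = \<one>" using y field_Units by auto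
 let ?t = "inv y \<otimes> x"
 have xt: "x = y \<otimes> ?t" using x y iy by (simp add: m_assoc[symmetric])
 have tc: "?t \<in> \<F>" using x iy by simp
 show ?thesis
 proof (cases "?t \<in> Oint")
  case True
  thus ?thesis using xt by blast
 next
  case False
  hence t0: "?t \<noteq> \<zero>" using O_zero by metis
  hence it: "inv ?t \<in> Oint" using O_valuation[OF tc] False by auto
  have ti: "?t \<otimes> inv ?t = \<one>" "inv ?t \<in> \<F>" using tc t0 field_Units by auto
  have "y = x \<otimes> inv ?t"
  proof -
   have "x \<otimes> inv ?t = y \<otimes> (?t \<otimes> inv ?t)" using xt y(1) tc ti by (metis m_assoc)
   thus ?thesis using ti y by simp
  qed
  moreover have "inv ?t \<in> mx"
  proof (rule ccontr)
   assume "inv ?t \<notin> mx"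
   then obtain u where u: "u \<in> Oint" "inv ?t \<otimes> u = \<one>" using unit_iff it by blast
   have "?t = u" using m_assoc[OF tc ti(2) O_carrier[OF u(1)]] ti(1) u(2) tc O_carrier[OF u(1)] by simp
   thus False using u False by simp
  qed
  moreover have "x \<noteq> \<zero>" using t0 iy by auto
  ultimately show ?thesis by blast
 qed
qed

lemma mx_add: "x \<in> mx ==> y \<in> mx ==> x \<oplus> y \<in> mx"
proof -
 assume x: "x \<in> mx" and y: "y \<in> mx"
 have c: "x \<in> \<F>" "y \<in> \<F>" using x y mx_carrier by auto
 show ?thesis
 proof (cases "y = \<zero>")
  case True
  thus ?thesis using x c by simp
 next
  case False
  from O_divides[OF c False] show ?thesis
  proof
   assume "\<exists>t\<in>Oint. x = y \<otimes> t"
   then obtain t where t: "t \<in> Oint" "x = y \<otimes> t" by blast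
   have "x \<oplus> y = (t \<oplus> \<one>) \<otimes> y" unfolding t(2) using O_carrier[OF t(1)] c by algebra
   thus ?thesis using mx_mult[OF O_add[OF t(1) O_one] y] by simp
  next
   assume "\<exists>t\<in>mx. x \<noteq> \<zero> \<and> y = x \<otimes> t"
   then obtain t where t: "t \<in> mx" "y = x \<otimes> t" by blast
   have "x \<oplus> y = (\<one> \<oplus> t) \<otimes> x" unfolding t(2) using mx_carrier[OF t(1)] c by algebra
   thus ?thesis using mx_mult[OF O_add[OF O_one mx_O[OF t(1)]] x] by simp
  qed
 qed
qed

lemma mx_diff: "x \<in> mx ==> y \<in> mx ==> x \<ominus> y \<in> mx"
 unfolding a_minus_def by (intro mx_add mx_minus)

lemma rcong_refl [simp]: "x \<in> \<F> ==> x \<doteq> x" unfolding rcong_def by (simp add: r_right_minus_eq)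

lemma rcong_sym: "x \<in> \<F> ==> y \<in> \<F> ==> x \<doteq> y ==> y \<doteq> x"
 unfolding rcong_def using mx_minus[of "x \<ominus> y"] by (simp add: minus_add a_minus_def a_comm)

lemma rcong_trans:
 assumes c: "x \<in> \<F>" "y \<in> \<F>" "z \<in> \<F>" and "x \<doteq> y" "y \<doteq> z" shows "x \<doteq> z"
proof -
 have "x \<ominus> z = (x \<ominus> y) \<oplus> (y \<ominus> z)" using c by algebra
 thus ?thesis using mx_add assms(4,5) unfolding rcong_def by metis
qed

lemma rcong_add:
 assumes c: "x \<in> \<F>" "y \<in> \<F>" "x' \<in> \<F>" "y' \<in> \<F>" and "x \<doteq> x'" "y \<doteq> y'"
 shows "x \<oplus> y \<doteq> x' \<oplus> y'"
proof -
 have "(x \<oplus> y) \<ominus> (x' \<oplus> y') = (x \<ominus> x') \<oplus> (y \<ominus> y')" using c by algebra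
 thus ?thesis using mx_add assms(5,6) unfolding rcong_def by metis
qed

lemma rcong_mult:
 assumes c: "x \<in> Oint" "y \<in> Oint" "x' \<in> Oint" "y' \<in> Oint" and "x \<doteq> x'" "y \<doteq> y'"
 shows "x \<otimes> y \<doteq> x' \<otimes> y'"
proof -
 have c': "x \<in> \<F>" "y \<in> \<F>" "x' \<in> \<F>" "y' \<in> \<F>" using c O_carrier by auto
 have "(x \<otimes> y) \<ominus> (x' \<otimes> y') = y \<otimes> (x \<ominus> x') \<oplus> x' \<otimes> (y \<ominus> y')" using c' by algebra
 thus ?thesis using mx_add[OF mx_mult mx_mult] assms unfolding rcong_def by metis
qed

lemma rcong_pow: "x \<in> Oint ==> y \<in> Oint ==> x \<doteq> y ==> x [^] (n::nat) \<doteq> y [^] n"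
 by (induction n) (auto intro!: rcong_mult O_pow)

lemma rcong_mx: "x \<in> \<F> ==> x \<doteq> \<zero> \<longleftrightarrow> x \<in> mx"
 unfolding rcong_def by (simp add: a_minus_def)

lemma rcong_mx_iff: "x \<in> \<F> ==> y \<in> \<F> ==> x \<doteq> y ==> x \<in> mx \<longleftrightarrow> y \<in> mx"
 using rcong_mx rcong_trans rcong_sym zero_closed by metis

lemma natc_mx: "natc n \<in> mx \<longleftrightarrow> p dvd n"
proof
 assume "p dvd n"
 then obtain k where "n = k * p" by (metis dvd_def mult.commute)
 thus "natc n \<in> mx" using mx_mult[OF O_natc pi_mx, of k] by (simp add: natc_mult)
next
 assume n: "natc n \<in> mx"
 show "p dvd n"
 proof (rule ccontr)
  assume nd: "\<not> p dvd n"
  hence "coprime n p" using p_prime by (metis coprime_commute prime_imp_coprime)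
  then obtain u v where uv: "n * u = p * v + 1"
   using bezout_nat[of n p] nd by (metis coprime_imp_gcd_eq_1 dvd_0_right One_nat_def)
  have "natc n \<otimes> natc u = \<pi> \<otimes> natc v \<oplus> \<one>" using arg_cong[OF uv, of natc] by (simp add: natc_mult natc_add natc_Suc a_comm)
  hence "\<one> = natc u \<otimes> natc n \<ominus> natc v \<otimes> \<pi>"
   using natc_closed[of n] natc_closed[of u] natc_closed[of v] natc_closed[of p]
   by (metis m_comm add.m_comm minus_closed m_closed one_closed minus_eq r_neg2 add.inv_closed add.m_assoc a_assoc r_neg1)
  moreover have "natc u \<otimes> natc n \<ominus> natc v \<otimes> \<pi> \<in> mx" by (intro mx_diff mx_mult O_natc n pi_mx)
  ultimately show False using one_not_mx by simp
 qed
qed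

lemma root_of_unity_O:
 assumes x: "x \<in> \<F>" "x [^] (n::nat) = \<one>" "n > 0" shows "x \<in> Oint" "x \<notin> mx"
proof -
 have x0: "x \<noteq> \<zero>" using x by (metis gr0_conv_Suc nat_pow_zero neq0_conv one_not_zero)
 obtain k where k: "n = Suc k" using x(3) by (metis gr0_conv_Suc)
 have xk: "x [^] k \<otimes> x = \<one>" using x k by simp
 have inv: "inv x = x [^] k" using xk x(1) by (metis comm_inv_char m_comm nat_pow_closed)
 show O: "x \<in> Oint"
 proof (rule ccontr)
  assume "x \<notin> Oint"
  hence iO: "inv x \<in> Oint" using O_valuation[OF x(1) x0] by auto
  have ix: "inv x \<in> \<F>" "inv x \<otimes> x = \<one>" using x x0 field_Units by auto
  have "inv x [^] n = \<one>" using ix x by (metis nat_pow_distrib nat_pow_one r_one nat_pow_closed)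
  hence "inv x [^] k \<otimes> inv x = \<one>" using k by simp
  hence "x = inv x [^] k" using ix x(1)
   by (metis m_assoc m_comm nat_pow_closed r_one)
  thus False using O_pow[OF iO] \<open>x \<notin> Oint\<close> by metis
 qed
 show "x \<notin> mx" using unit_iff[OF O] xk O_pow[OF O, of k] x(1) by (metis m_comm nat_pow_closed)
qed

text \<open>The quotient \<open>z\<close> of \<open>x\<close> and \<open>y\<close> is congruent to
  \<open>1\<close>. If it were different from \<open>1\<close>, then
  \<open>1 + z + ... + z ^ (n - 1) = 0\<close>; but this sum is congruent to \<open>n\<close>, a
  unit when \<open>p\<close> does not divide \<open>n\<close>.\<close>

lemma root_of_unity_inj:
 assumes x: "x \<in> \<F>" "x [^] n = \<one>" and y: "y \<in> \<F>" "y [^] n = \<one>"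
  and n: "\<not> p dvd n" and xy: "x \<doteq> y"
 shows "x = y"
proof -
 have n0: "n > 0" using n by (cases n) auto
 then obtain k where k: "n = Suc k" by (metis gr0_conv_Suc)
 have O: "x \<in> Oint" "y \<in> Oint" using root_of_unity_O x y n0 by auto
 define z where "z = x \<otimes> y [^] k"
 have zO: "z \<in> Oint" unfolding z_def using O by (intro O_intros)
 have zc: "z \<in> \<F>" using zO O_carrier by auto
 have "z [^] n = x [^] n \<otimes> (y [^] n) [^] k" unfolding z_def using x(1) y(1)
  by (simp add: nat_pow_distrib nat_pow_pow mult.commute)
 hence zn: "z [^] n = \<one>" using x y by simp
 have "x \<otimes> y [^] k \<doteq> y \<otimes> y [^] k" by (intro rcong_mult O_intros O xy) (use O O_carrier in auto)
 hence z1: "z \<doteq> \<one>" unfolding z_def using y k by (simp add: m_comm)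
 have zeq: "z = \<one>"
 proof (rule ccontr)
  assume nz: "z \<noteq> \<one>"
  have ec: "eval (replicate n \<one>) z \<in> \<F>" using zc by (intro eval_in_carrier) auto
  have "eval (replicate n \<one>) z \<otimes> (z \<ominus> \<one>) = \<zero>" using eval_replicate_one[OF zc, of n] zn
   by (simp add: r_right_minus_eq)
  hence e0: "eval (replicate n \<one>) z = \<zero>" using integral[of "eval (replicate n \<one>) z" "z \<ominus> \<one>"] ec zc nz
   by (simp add: r_right_minus_eq)
  have "eval (replicate m \<one>) z \<doteq> natc m \<and> eval (replicate m \<one>) z \<in> \<F>" for m
  proof (induction m)
   case (Suc m)
   have "z [^] m \<oplus> eval (replicate m \<one>) z \<doteq> \<one> \<oplus> natc m"
    using Suc rcong_pow[OF zO O_one z1, of m] zc by (intro rcong_add) auto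
   thus ?case using Suc zc by (simp add: natc_Suc)
  qed simp
  hence "\<zero> \<doteq> natc n" using e0 by metis
  hence "natc n \<in> mx" using rcong_mx_iff[of \<zero> "natc n"] by simp
  thus False using n natc_mx by simp
 qed
 have "x = x \<otimes> (y [^] k \<otimes> y)" using y x k by simp
 also have "\<dots> = z \<otimes> y" unfolding z_def using x y by (simp add: m_assoc)
 finally show ?thesis using zeq y by simp
qed

lemma root_prod_mx:
 "set rs \<subseteq> Oint ==> x \<in> Oint ==> root_prod rs x \<in> mx ==> \<exists>r\<in>set rs. x \<doteq> r"
proof (induction rs)
 case (Cons r rs)
 have O: "root_prod rs x \<in> Oint" using Cons.prems(1,2)
 proof (induction rs)
  case (Cons a rs)
  thus ?case by (auto intro!: O_intros)
 qed auto
 from mx_prime[OF O_diff O, of x r] Cons.prems have "x \<ominus> r \<in> mx \<or> root_prod rs x \<in> mx" by auto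
 thus ?case using Cons unfolding rcong_def by auto
qed (use one_not_mx in auto)

end

section \<open>The Frobenius congruence and Teichmueller representatives\<close>

lemma (in cring) binomial_pow:
 assumes c: "x \<in> carrier R" "y \<in> carrier R"
 shows "(x \<oplus> y) [^] n = (\<Oplus>i\<in>{..n}. natc (n choose i) \<otimes> (x [^] i \<otimes> y [^] (n - i)))"
proof (induction n)
 case 0
 show ?case using c by simp
next
 case (Suc n)
 let ?t = "\<lambda>i. natc (n choose i) \<otimes> (x [^] i \<otimes> y [^] (n - i))"
 let ?S = "\<Oplus>i\<in>{..n}. ?t i"
 let ?u = "\<lambda>i. natc (n choose i) \<otimes> (x [^] Suc i \<otimes> y [^] (n - i))"
 let ?v = "\<lambda>i. natc (n choose Suc i) \<otimes> (x [^] Suc i \<otimes> y [^] (n - i))"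
 have cl: "?t i \<in> carrier R" "?u i \<in> carrier R" "?v i \<in> carrier R" for i using c by auto
 have S: "?S \<in> carrier R" using cl by (intro finsum_closed) auto
 have "x \<otimes> ?S = (\<Oplus>i\<in>{..n}. x \<otimes> ?t i)" using c cl by (intro finsum_rdistr) auto
 also have "\<dots> = (\<Oplus>i\<in>{..n}. ?u i)"
  by (rule finsum_cong') (use c in "auto simp: m_ac")
 finally have 1: "x \<otimes> ?S = (\<Oplus>i\<in>{..n}. ?u i)" .
 let ?w = "\<lambda>i. natc (n choose i) \<otimes> (x [^] i \<otimes> y [^] (Suc n - i))"
 have "y \<otimes> ?S = (\<Oplus>i\<in>{..n}. y \<otimes> ?t i)" using c cl by (intro finsum_rdistr) auto
 also have "\<dots> = (\<Oplus>i\<in>{..n}. ?w i)"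
  by (rule finsum_cong') (use c in "auto simp: m_ac Suc_diff_le")
 also have "\<dots> = (\<Oplus>i\<in>{..Suc n}. ?w i)"
  using c by (subst finsum_Suc) (auto simp: binomial_eq_0)
 also have "\<dots> = (\<Oplus>i\<in>{..n}. ?w (Suc i)) \<oplus> ?w 0"
  by (rule finsum_Suc2) (use c in auto)
 finally have 2: "y \<otimes> ?S = (\<Oplus>i\<in>{..n}. ?v i) \<oplus> y [^] Suc n" using c by simp
 have "(\<Oplus>i\<in>{..Suc n}. natc (Suc n choose i) \<otimes> (x [^] i \<otimes> y [^] (Suc n - i)))
   = (\<Oplus>i\<in>{..n}. natc (Suc n choose Suc i) \<otimes> (x [^] Suc i \<otimes> y [^] (Suc n - Suc i))) \<oplus>
    natc (Suc n choose 0) \<otimes> (x [^] (0::nat) \<otimes> y [^] (Suc n - 0))"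
  by (rule finsum_Suc2) (use c in auto)
 also have "(\<Oplus>i\<in>{..n}. natc (Suc n choose Suc i) \<otimes> (x [^] Suc i \<otimes> y [^] (Suc n - Suc i)))
   = (\<Oplus>i\<in>{..n}. ?u i \<oplus> ?v i)"
  by (rule finsum_cong') (use c in "auto simp: natc_add l_distr")
 also have "\<dots> = (\<Oplus>i\<in>{..n}. ?u i) \<oplus> (\<Oplus>i\<in>{..n}. ?v i)" using cl by (intro finsum_addf) auto
 finally have 3: "(\<Oplus>i\<in>{..Suc n}. natc (Suc n choose i) \<otimes> (x [^] i \<otimes> y [^] (Suc n - i)))
   = (\<Oplus>i\<in>{..n}. ?u i) \<oplus> (\<Oplus>i\<in>{..n}. ?v i) \<oplus> y [^] Suc n" using c by simp
 have "(x \<oplus> y) [^] Suc n = ?S \<otimes> (x \<oplus> y)" using Suc by simp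
 also have "\<dots> = x \<otimes> ?S \<oplus> y \<otimes> ?S"
  by (simp only: r_distr[OF c S] m_comm[OF S c(1)] m_comm[OF S c(2)])
 also have "\<dots> = (\<Oplus>i\<in>{..n}. ?u i) \<oplus> ((\<Oplus>i\<in>{..n}. ?v i) \<oplus> y [^] Suc n)" unfolding 1 2 ..
 also have "\<dots> = (\<Oplus>i\<in>{..n}. ?u i) \<oplus> (\<Oplus>i\<in>{..n}. ?v i) \<oplus> y [^] Suc n"
  using c cl by (intro a_assoc[symmetric] finsum_closed) auto
 finally show ?case unfolding 3 .
qed

context padic_closed
begin

lemma finsum_mx: "finite A ==> (\<And>i. i \<in> A ==> f i \<in> mx) ==> (\<Oplus>i\<in>A. f i) \<in> mx"
proof (induction A rule: finite_induct)
 case (insert a A)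
 have "(\<Oplus>i\<in>insert a A. f i) = f a \<oplus> (\<Oplus>i\<in>A. f i)"
  using insert mx_carrier by (intro finsum_insert) auto
 thus ?case using insert mx_add by auto
qed simp

lemma frobenius_add_p:
 assumes x: "x \<in> Oint" and y: "y \<in> Oint" shows "(x \<oplus> y) [^] p \<doteq> x [^] p \<oplus> y [^] p"
proof -
 have c: "x \<in> \<F>" "y \<in> \<F>" using x y O_carrier by auto
 let ?t = "\<lambda>i. natc (p choose i) \<otimes> (x [^] i \<otimes> y [^] (p - i))"
 have p1: "p > 1" using prime_gt_1_nat[OF p_prime] .
 have cl: "?t i \<in> \<F>" for i using c by auto
 have "{..p} = insert 0 (insert p {0<..<p})" using p1 by auto
 hence "(x \<oplus> y) [^] p = (\<Oplus>i\<in>insert 0 (insert p {0<..<p}). ?t i)" using binomial_pow[OF c, of p] by simp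
 also have "\<dots> = ?t 0 \<oplus> (?t p \<oplus> (\<Oplus>i\<in>{0<..<p}. ?t i))"
  using p1 cl c by (subst finsum_insert; (subst finsum_insert)?) auto
 finally have 1: "(x \<oplus> y) [^] p = y [^] p \<oplus> (x [^] p \<oplus> (\<Oplus>i\<in>{0<..<p}. ?t i))" using c by simp
 define M where "M = (\<Oplus>i\<in>{0<..<p}. ?t i)"
 have "M \<in> mx" unfolding M_def
 proof (rule finsum_mx)
  fix i assume i: "i \<in> {0<..<p}"
  hence "p dvd (p choose i)" using p_prime by (intro dvd_choose_prime) auto
  hence "natc (p choose i) \<in> mx" using natc_mx by blast
  moreover have "x [^] i \<otimes> y [^] (p - i) \<in> Oint" using x y by (intro O_intros)
  ultimately show "?t i \<in> mx" using mx_mult[of "x [^] i \<otimes> y [^] (p - i)" "natc (p choose i)"] c by (simp add: m_comm)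
 qed auto
 moreover have "(x \<oplus> y) [^] p \<ominus> (x [^] p \<oplus> y [^] p) = M"
  unfolding 1 M_def[symmetric] using mx_carrier[OF \<open>M \<in> mx\<close>] nat_pow_closed[OF c(1), of p] nat_pow_closed[OF c(2), of p]
  by algebra
 ultimately show ?thesis unfolding rcong_def by simp
qed

lemma frobenius_add:
 assumes x: "x \<in> Oint" and y: "y \<in> Oint" shows "(x \<oplus> y) [^] (p ^ a) \<doteq> x [^] (p ^ a) \<oplus> y [^] (p ^ a)"
proof (induction a)
 case 0
 thus ?case using x y O_carrier by simp
next
 case (Suc a)
 have c: "x \<in> \<F>" "y \<in> \<F>" using x y O_carrier by auto
 have pw: "z [^] (p ^ Suc a) = (z [^] (p ^ a)) [^] p" if "z \<in> \<F>" for z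
  using that by (simp add: nat_pow_pow mult.commute)
 have O: "(x \<oplus> y) [^] (p ^ a) \<in> Oint" "x [^] (p ^ a) \<oplus> y [^] (p ^ a) \<in> Oint" "x [^] (p ^ a) \<in> Oint" "y [^] (p ^ a) \<in> Oint"
  using x y by (auto intro!: O_intros)
 note Oc = O[THEN O_carrier]
 have "((x \<oplus> y) [^] (p ^ a)) [^] p \<doteq> (x [^] (p ^ a)) [^] p \<oplus> (y [^] (p ^ a)) [^] p"
  by (rule rcong_trans[OF nat_pow_closed[OF Oc(1)] nat_pow_closed[OF Oc(2)]
     a_closed[OF nat_pow_closed[OF Oc(3)] nat_pow_closed[OF Oc(4)]]
     rcong_pow[OF O(1,2) Suc] frobenius_add_p[OF O(3,4)]])
 thus ?case using c by (simp only: pw a_closed)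
qed

lemma frobenius_diff:
 assumes x: "x \<in> Oint" and y: "y \<in> Oint" shows "(x \<ominus> y) [^] (p ^ a) \<doteq> x [^] (p ^ a) \<ominus> y [^] (p ^ a)"
proof -
 have c: "x \<in> \<F>" "y \<in> \<F>" using x y O_carrier by auto
 have "(x \<ominus> y) \<oplus> y = x" using c by algebra
 hence h: "x [^] (p ^ a) \<doteq> (x \<ominus> y) [^] (p ^ a) \<oplus> y [^] (p ^ a)"
  using frobenius_add[OF O_diff[OF x y] y, of a] by simp
 define A B C where "A = x [^] (p ^ a)" and "B = (x \<ominus> y) [^] (p ^ a)" and "C = y [^] (p ^ a)"
 have ABC: "A \<in> \<F>" "B \<in> \<F>" "C \<in> \<F>" unfolding A_def B_def C_def using c by auto
 have "A \<ominus> (B \<oplus> C) \<in> mx" using h unfolding A_def B_def C_def rcong_def .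
 moreover have "B \<ominus> (A \<ominus> C) = \<ominus> (A \<ominus> (B \<oplus> C))" using ABC by algebra
 ultimately show ?thesis using mx_minus unfolding A_def B_def C_def rcong_def by metis
qed

lemma mx_pow: "x \<in> Oint ==> x [^] (n::nat) \<in> mx ==> x \<in> mx"
proof (induction n)
 case (Suc n)
 thus ?case using mx_prime[OF O_pow[of x n], of x] by auto
qed (use one_not_mx in auto)

text \<open>The residue field has characteristic \<open>p\<close>, so \<open>x ^ (p ^ a) - 1\<close>
  is congruent to \<open>(x - 1) ^ (p ^ a)\<close>.\<close>

lemma rcong_one_p_power:
 assumes x: "x \<in> Oint" and "x [^] (p ^ a) \<doteq> \<one>" shows "x \<doteq> \<one>"
proof -
 have c: "x \<in> \<F>" using x O_carrier by auto
 have "x [^] (p ^ a) \<ominus> \<one> \<in> mx" using assms(2) unfolding rcong_def .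
 moreover have "(x \<ominus> \<one>) [^] (p ^ a) \<doteq> x [^] (p ^ a) \<ominus> \<one>" using frobenius_diff[OF x O_one, of a] by simp
 ultimately have "(x \<ominus> \<one>) [^] (p ^ a) \<in> mx" using c rcong_mx_iff by (metis minus_closed nat_pow_closed one_closed)
 thus ?thesis unfolding rcong_def by (rule mx_pow[OF O_diff[OF x O_one]])
qed

text \<open>Pigeonhole: modulo the maximal ideal each power of \<open>x\<close> is given by a list
  of \<open>k\<close> digits, so two of the first \<open>p ^ k + 1\<close> powers agree. The bound
  depends only on the degree of the relation, which later makes the residue field of the base field
  finite.\<close>

lemma residue_order:
 assumes x: "x \<in> Oint" "x \<notin> mx" and P: "P \<noteq> []" "hd P \<noteq> \<zero>" "set P \<subseteq> Q" "eval P x = \<zero>"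
 shows "\<exists>N::nat. 0 < N \<and> N \<le> p ^ (length P - 1) \<and> x [^] N \<doteq> \<one>"
proof -
 have c: "x \<in> \<F>" using x O_carrier by auto
 have p1: "p > 1" using prime_gt_1_nat[OF p_prime] .
 obtain P0 where P0: "P0 \<noteq> []" "length P0 = length P" "hd P0 \<noteq> \<zero>" "set P0 \<subseteq> Z" "eval P0 x = \<zero>"
  by (rule annihilator_scale[OF c P]) blast
 let ?M = "simple_extension Z x"
 obtain k where k: "k < length P0" and exp: "\<And>y. y \<in> ?M ==> \<exists>as g. length as = k \<and> set as \<subseteq> {..<p} \<and>
   g \<in> ?M \<and> y = eval (map natc as) x \<oplus> \<pi> \<otimes> g"
  using digit_expansion[OF c P0(1,3,4,5)] by blast
 have MO: "?M \<subseteq> Oint" by (rule simple_extension_subring_incl[OF O_subring Z_O x(1)])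
 have M: "subring ?M F" by (rule simple_extension_is_subring[OF Z_subring c])
 have xM: "x [^] n \<in> ?M" for n :: nat by (rule subring_nat_pow[OF M simple_extension_mem[OF Z_subring c]])
 have "\<forall>n. \<exists>as. length as = k \<and> set as \<subseteq> {..<p} \<and> x [^] (n::nat) \<doteq> eval (map natc as) x"
 proof
  fix n :: nat
  obtain as g where as: "length as = k" "set as \<subseteq> {..<p}" "g \<in> ?M" "x [^] n = eval (map natc as) x \<oplus> \<pi> \<otimes> g"
   using exp[OF xM[of n]] by blast
  have ec: "eval (map natc as) x \<in> \<F>" using c by (intro eval_in_carrier) auto
  define E where "E = eval (map natc as) x"
  have gO: "g \<in> Oint" using as MO by auto
  have "x [^] n \<ominus> E = g \<otimes> \<pi>"
   unfolding as(4) E_def[symmetric] using ec[folded E_def] O_carrier[OF gO] natc_closed[of p] by algebra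
  hence "x [^] n \<doteq> eval (map natc as) x" unfolding rcong_def E_def using mx_mult[OF gO pi_mx] by simp
  thus "\<exists>as. length as = k \<and> set as \<subseteq> {..<p} \<and> x [^] n \<doteq> eval (map natc as) x" using as by blast
 qed
 from choice[OF this] obtain D where D: "\<And>n. length (D n) = k \<and> set (D n) \<subseteq> {..<p} \<and> x [^] (n::nat) \<doteq> eval (map natc (D n)) x"
  by blast
 let ?L = "{as. set as \<subseteq> {..<p} \<and> length as = k}"
 have "\<not> inj_on D {..p ^ k}"
 proof
  assume "inj_on D {..p ^ k}"
  moreover have "D ` {..p ^ k} \<subseteq> ?L" using D by auto
  ultimately have "card {..p ^ k} \<le> card ?L" by (rule card_inj_on_le) (simp add: finite_lists_length_eq)
  thus False by (simp add: card_lists_length_eq)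
 qed
 then obtain i j where "i \<in> {..p ^ k}" "j \<in> {..p ^ k}" "i \<noteq> j" "D i = D j" unfolding inj_on_def by blast
 then obtain i j where ij: "i < j" "j \<le> p ^ k" "D i = D j" by (metis atMost_iff linorder_neqE_nat)
 have ec: "eval (map natc as) x \<in> \<F>" for as using c by (intro eval_in_carrier) auto
 have "x [^] j \<doteq> x [^] i"
  using D[of i] D[of j] ij(3) rcong_trans[of "x [^] j" "eval (map natc (D i)) x" "x [^] i"] rcong_sym[of "x [^] i"] ec c
  by auto
 moreover have "x [^] j = x [^] i \<otimes> x [^] (j - i)" using ij c by (simp add: nat_pow_mult)
 moreover have "x [^] i \<otimes> x [^] (j - i) \<ominus> x [^] i = x [^] i \<otimes> (x [^] (j - i) \<ominus> \<one>)"
  using nat_pow_closed[OF c, of i] nat_pow_closed[OF c, of "j - i"] by algebra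
 ultimately have "x [^] i \<otimes> (x [^] (j - i) \<ominus> \<one>) \<in> mx" unfolding rcong_def by simp
 hence "x [^] (j - i) \<doteq> \<one>" unfolding rcong_def
  using mx_prime[of "x [^] i" "x [^] (j - i) \<ominus> \<one>"] mx_pow[OF x(1)] x(1,2) by (meson O_diff O_one O_pow)
 moreover have "j - i \<le> p ^ (length P - 1)"
 proof -
  have "p ^ k \<le> p ^ (length P - 1)" using k P0(2) p1 by (intro power_increasing) auto
  thus ?thesis using ij by linarith
 qed
 ultimately show ?thesis using ij(1) by (intro exI[of _ "j - i"]) auto
qed

text \<open>Over an algebraically closed field \<open>x ^ N - 1\<close> is the product of the
  \<open>x - r\<close> over the roots of unity \<open>r\<close>, and one factor lies in the maximal
  ideal because this is prime; the factorization takes the place of Hensel's lemma.\<close>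

lemma teichmueller_of_pow:
 assumes x: "x \<in> Oint" and N: "N > 0" "x [^] (N::nat) \<doteq> \<one>"
 shows "\<exists>\<omega>\<in>\<F>. \<omega> [^] N = \<one> \<and> x \<doteq> \<omega>"
proof -
 have c: "x \<in> \<F>" using x O_carrier by auto
 obtain rs where rs: "length rs = N" "set rs \<subseteq> \<F>" "\<And>x. x \<in> \<F> ==> x [^] N \<ominus> \<one> = root_prod rs x"
  by (rule pow_splits[OF N(1) one_closed]) blast
 have r1: "r [^] N = \<one>" if "r \<in> set rs" for r
 proof -
  have rc: "r \<in> \<F>" using rs that by auto
  have "r [^] N \<ominus> \<one> = \<zero>" using rs(3)[OF rc] root_prod_eq_0[OF rs(2) rc] that by simp
  thus ?thesis using rc by (simp add: r_right_minus_eq)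
 qed
 have "set rs \<subseteq> Oint" using root_of_unity_O(1)[OF _ r1 N(1)] rs(2) by auto
 moreover have "root_prod rs x \<in> mx" using N(2) rs(3)[OF c] unfolding rcong_def by simp
 ultimately obtain r where "r \<in> set rs" "x \<doteq> r" using root_prod_mx x by blast
 thus ?thesis using r1 rs(2) by blast
qed

lemma teichmueller:
 assumes x: "x \<in> Oint" "x \<notin> mx" and P: "P \<noteq> []" "hd P \<noteq> \<zero>" "set P \<subseteq> Q" "eval P x = \<zero>"
 shows "\<exists>N::nat. \<exists>\<omega>\<in>\<F>. N \<le> p ^ (length P - 1) \<and> \<not> p dvd N \<and> \<omega> [^] N = \<one> \<and> x \<doteq> \<omega>"
proof -
 have c: "x \<in> \<F>" using x O_carrier by auto
 obtain N where N: "0 < N" "N \<le> p ^ (length P - 1)" "x [^] N \<doteq> \<one>" using residue_order[OF assms] by blast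
 have p1: "p > 1" using prime_gt_1_nat[OF p_prime] .
 \<comment> \<open>The \<open>p\<close>-part of the order is split off: an element whose
   \<open>p ^ a\<close>-th power is residually \<open>1\<close> is itself residually
   \<open>1\<close>.\<close>
 obtain M where M: "N = p ^ multiplicity p N * M" "\<not> p dvd M"
  using multiplicity_decompose'[of N p] N(1) p1 by auto
 have M0: "M > 0" using M N(1) by (metis gr0I mult_0_right)
 have "M \<le> N" using M(1) p1 by (metis One_nat_def Suc_leI le_add2 mult_le_mono1 nat_mult_1 zero_less_power less_trans zero_less_one)
 have "x [^] N = (x [^] M) [^] (p ^ multiplicity p N)" using M(1) c by (metis nat_pow_pow mult.commute)
 hence "(x [^] M) [^] (p ^ multiplicity p N) \<doteq> \<one>" using N(3) by metis
 hence "x [^] M \<doteq> \<one>" by (rule rcong_one_p_power[OF O_pow[OF x(1)]])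
 then obtain \<omega> where "\<omega> \<in> \<F>" "\<omega> [^] M = \<one>" "x \<doteq> \<omega>" using teichmueller_of_pow[OF x(1) M0] by blast
 thus ?thesis using M(2) \<open>M \<le> N\<close> N(2) le_trans by blast
qed

end

section \<open>Extending partial isomorphisms\<close>

context cring
begin

lemma pvals_mult:
 assumes A: "subring A R" and x: "x \<in> carrier R"
 shows "e \<in> pvals A n x ==> f \<in> pvals A m x ==> e \<otimes> f \<in> pvals A (n + m) x"
proof (induction n arbitrary: e)
 case 0
 hence "e = \<zero>" by simp
 thus ?case using pvals_zero[OF A x] pvals_closed[OF subringE(1)[OF A] x 0(2)] by simp
next
 case (Suc n)
 note AR = subringE(1)[OF A]
 obtain e' a where e: "e' \<in> pvals A n x" "a \<in> A" "e = e' \<otimes> x \<oplus> a"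
  using Suc.prems(1) unfolding pvals_Suc[OF AR x] by blast
 have c: "e' \<in> carrier R" "a \<in> carrier R" "f \<in> carrier R"
  using e AR pvals_closed[OF AR x] Suc.prems(2) by auto
 have "e \<otimes> f = (e' \<otimes> f) \<otimes> x \<oplus> a \<otimes> f" unfolding e(3) using c x by algebra
 moreover have "(e' \<otimes> f) \<otimes> x \<in> pvals A (Suc (n + m)) x"
  by (rule pvals_mult_x[OF A x Suc.IH[OF e(1) Suc.prems(2)]])
 moreover have "a \<otimes> f \<in> pvals A (Suc (n + m)) x"
  by (rule pvals_mono[OF A x pvals_smult[OF A x e(2) Suc.prems(2)]]) simp
 ultimately show ?case using pvals_add[OF A x] by simp
qed

lemma pvals_subring:
 assumes A: "subring A R" and x: "x \<in> carrier R"
 shows "subring {e. \<exists>n. e \<in> pvals A n x} R"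
proof (rule subringI)
 show "{e. \<exists>n. e \<in> pvals A n x} \<subseteq> carrier R" using pvals_closed[OF subringE(1)[OF A] x] by auto
 show "\<one> \<in> {e. \<exists>n. e \<in> pvals A n x}" using pvals_pow[OF A x, of 0] by auto
next
 fix h assume "h \<in> {e. \<exists>n. e \<in> pvals A n x}"
 then obtain n where n: "h \<in> pvals A n x" by blast
 have "(\<ominus> \<one>) \<otimes> h \<in> pvals A n x" by (rule pvals_smult[OF A x subringE(5)[OF A subringE(3)[OF A]] n])
 thus "\<ominus> h \<in> {e. \<exists>n. e \<in> pvals A n x}" using pvals_closed[OF subringE(1)[OF A] x n] by (auto simp: l_minus)
next
 fix h1 h2 assume "h1 \<in> {e. \<exists>n. e \<in> pvals A n x}" "h2 \<in> {e. \<exists>n. e \<in> pvals A n x}"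
 then obtain n m where n: "h1 \<in> pvals A n x" "h2 \<in> pvals A m x" by blast
 show "h1 \<otimes> h2 \<in> {e. \<exists>n. e \<in> pvals A n x}" using pvals_mult[OF A x n] by blast
 show "h1 \<oplus> h2 \<in> {e. \<exists>n. e \<in> pvals A n x}"
  using pvals_add[OF A x pvals_mono[OF A x n(1)] pvals_mono[OF A x n(2)], of "n + m"] by auto
qed

lemma pvals_1: "subring A R ==> x \<in> carrier R ==> a \<in> A ==> a \<in> pvals A (Suc 0) x"
 by (subst pvals_Suc) (use subringE(1)[of A R] in "auto intro!: bexI[of _ a]")

lemma pvals_1_iff: "subring A R ==> x \<in> carrier R ==> pvals A (Suc 0) x = A"
 using pvals_1[of A x] subringE(1)[of A R] by (auto simp: pvals_Suc subset_iff)

lemma pvals_reduce: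
 assumes A: "subring A R" and x: "x \<in> carrier R" and d: "x [^] d \<in> pvals A d x"
 shows "e \<in> pvals A n x ==> e \<in> pvals A d x"
proof (induction n arbitrary: e)
 case 0
 thus ?case using pvals_zero[OF A x] by simp
next
 case (Suc n)
 note AR = subringE(1)[OF A]
 obtain e' a where e: "e' \<in> pvals A n x" "a \<in> A" "e = e' \<otimes> x \<oplus> a"
  using Suc.prems unfolding pvals_Suc[OF AR x] by blast
 have "e \<in> pvals A (Suc d) x" unfolding pvals_Suc[OF AR x] using e Suc.IH[OF e(1)] by blast
 then obtain e'' t where t: "e'' \<in> pvals A d x" "t \<in> A" "e = t \<otimes> x [^] d \<oplus> e''"
  unfolding pvals_Suc'[OF AR x] by blast
 show ?case unfolding t(3) by (intro pvals_add[OF A x] pvals_smult[OF A x] t d)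
qed

text \<open>The quotient \<open>P'\<close> of \<open>P(x) - P(a)\<close> by \<open>x - a\<close>
  takes at \<open>a\<close> the value of the derivative of \<open>P\<close>. Only its shape is
  recorded, \<open>n a ^ (n - 1)\<close> plus a value of lower degree over \<open>K\<close>, which
  suffices for separability in characteristic zero.\<close>

lemma synthetic_derivative:
 assumes K: "subring K R" and "set P \<subseteq> K" "length P = Suc n" "hd P = \<one>" "a \<in> carrier R"
 shows "\<exists>P'. length P' = n \<and> set P' \<subseteq> carrier R \<and> (n > 0 --> hd P' = \<one>) \<and>
  (\<forall>x\<in>carrier R. eval P x = (x \<ominus> a) \<otimes> eval P' x \<oplus> eval P a) \<and>
  (\<exists>e\<in>pvals K (n - 1) a. eval P' a = natc n \<otimes> a [^] (n - 1) \<oplus> e)"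
 using assms(2-5)
proof (induction n arbitrary: P)
 case 0
 hence "P = [\<one>]" by (cases P) auto
 thus ?case using assms(5) by (intro exI[of _ "[]"]) auto
next
 case (Suc n)
 note KR = subringE(1)[OF K]
 have a: "a \<in> carrier R" by fact
 obtain P0 c where Pc: "P = P0 @ [c]" "length P0 = Suc n" using Suc.prems(2)
  by (metis length_append_singleton length_greater_0_conv nat.inject rev_exhaust zero_less_Suc)
 have h: "hd P0 = \<one>" "set P0 \<subseteq> K" "c \<in> K" using Pc Suc.prems by (auto simp: hd_append split: if_splits)
 have PF: "set P0 \<subseteq> carrier R" and cc: "c \<in> carrier R" using h KR by auto
 obtain Q e where Q: "length Q = n" "set Q \<subseteq> carrier R" "n > 0 --> hd Q = \<one>"
  "\<And>x. x \<in> carrier R ==> eval P0 x = (x \<ominus> a) \<otimes> eval Q x \<oplus> eval P0 a"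
  "e \<in> pvals K (n - 1) a" "eval Q a = natc n \<otimes> a [^] (n - 1) \<oplus> e"
  using Suc.IH[OF h(2) Pc(2) h(1) a] by blast
 let ?b = "eval P0 a"
 have bc: "?b \<in> carrier R" using eval_in_carrier[OF PF a] .
 have "eval P x = (x \<ominus> a) \<otimes> eval (Q @ [?b]) x \<oplus> eval P a" if x: "x \<in> carrier R" for x
 proof -
  have Qx: "eval Q x \<in> carrier R" using eval_in_carrier[OF Q(2) x] .
  have "eval P x = ((x \<ominus> a) \<otimes> eval Q x \<oplus> ?b) \<otimes> x \<oplus> c"
   unfolding Pc(1) eval_append_aux[OF PF cc x] using Q(4)[OF x] by simp
  also have "\<dots> = (x \<ominus> a) \<otimes> (eval Q x \<otimes> x \<oplus> ?b) \<oplus> (?b \<otimes> a \<oplus> c)"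
   using Qx bc a cc x by algebra
  finally show ?thesis unfolding Pc(1) eval_append_aux[OF PF cc a] eval_append_aux[OF Q(2) bc x] .
 qed
 moreover have "hd (Q @ [?b]) = \<one>"
 proof (cases n)
  case 0
  hence "P0 = [\<one>]" using Pc(2) h(1) by (cases P0) auto
  thus ?thesis using Q(1) 0 by simp
 next
  case (Suc m)
  thus ?thesis using Q(1,3) by (cases Q) auto
 qed
 moreover have "\<exists>e'\<in>pvals K n a. eval (Q @ [?b]) a = natc (Suc n) \<otimes> a [^] n \<oplus> e'"
 proof -
  have ec: "e \<in> carrier R" using pvals_closed[OF KR a Q(5)] .
  obtain P1 where P1: "P0 = \<one> # P1" "length P1 = n" using Pc(2) h(1) by (cases P0) auto
  have e2: "eval P1 a \<in> pvals K n a" using eval_in_pvals[of P1 K a] P1 h(2) by auto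
  have e2c: "eval P1 a \<in> carrier R" using pvals_closed[OF KR a e2] .
  have b: "?b = a [^] n \<oplus> eval P1 a" unfolding P1(1) using P1(2) a by simp
  have ev: "eval (Q @ [?b]) a = eval Q a \<otimes> a \<oplus> ?b" by (rule eval_append_aux[OF Q(2) bc a])
  show ?thesis
  proof (cases n)
   case 0
   hence "Q = []" using Q(1) by simp
   hence "eval (Q @ [?b]) a = ?b" unfolding ev using bc a by simp
   moreover have "eval P1 a = \<zero>" using 0 P1(2) by simp
   ultimately have "eval (Q @ [?b]) a = \<one>" using 0 b by simp
   thus ?thesis using 0 by simp
  next
   case (Suc m)
   have "e \<otimes> a \<oplus> eval P1 a \<in> pvals K n a"
    using pvals_mult_x[OF K a Q(5)] Suc by (intro pvals_add[OF K a _ e2]) simp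
   moreover have "eval (Q @ [?b]) a = natc (Suc n) \<otimes> a [^] n \<oplus> (e \<otimes> a \<oplus> eval P1 a)"
   proof -
    have am: "a [^] m \<in> carrier R" "a [^] n = a [^] m \<otimes> a" using a Suc by auto
    define E where "E = eval P1 a"
    have Qa: "eval Q a = natc n \<otimes> a [^] m \<oplus> e" using Q(6) Suc by simp
    have "eval (Q @ [?b]) a = eval Q a \<otimes> a \<oplus> ?b" by (rule ev)
    also have "\<dots> = (natc n \<otimes> a [^] m \<oplus> e) \<otimes> a \<oplus> (a [^] m \<otimes> a \<oplus> E)"
     unfolding b Qa E_def am(2) ..
    also have "\<dots> = (\<one> \<oplus> natc n) \<otimes> (a [^] m \<otimes> a) \<oplus> (e \<otimes> a \<oplus> E)"
     using ec e2c[folded E_def] am(1) a natc_closed[of n] by algebra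
    finally show ?thesis unfolding E_def am(2) natc_Suc[of n] .
   qed
   ultimately show ?thesis by blast
  qed
 qed
 ultimately show ?case using Q(1,2) bc by (intro exI[of _ "Q @ [?b]"]) auto
qed

end

section \<open>Automorphisms of the algebraic closure over the base field\<close>

locale padic_galois = padic_closed +
 fixes K :: "'a set"
 assumes K_subfield: "subfield K F" and Q_K: "Q \<subseteq> K" and K_fin: "finite_dimension Q K"
begin

lemma K_subring: "subring K F" using subfieldE(1)[OF K_subfield] .
lemma K_carrier: "K \<subseteq> \<F>" using subfieldE(3)[OF K_subfield] .

lemma K_inv: "x \<in> K ==> x \<noteq> \<zero> ==> inv x \<in> K"
 using subfield_m_inv(1)[OF K_subfield] by auto

definition "gal = {th \<in> ring_hom F F \<inter> Bij \<F>. \<forall>x\<in>K. th x = x}"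

text \<open>Partial embeddings are represented by their graphs, which are subrings of this product.
  Extending an embedding by \<open>y\<close> and \<open>y'\<close> is then the adjunction of the
  pair \<open>(y, y')\<close> to a subring, and limits and inverses are unions and converses of
  sets.\<close>

abbreviation "FF \<equiv> RDirProd F F"

lemma FF_cring: "cring FF"
proof -
 interpret R: ring FF by (rule RDirProd_ring[OF ring_axioms ring_axioms])
 show ?thesis
  by unfold_locales (auto simp: RDirProd_def DirProd_def monoid.defs m_comm)
qed

lemma FF_simps [simp]:
 "carrier FF = \<F> \<times> \<F>" "(a, b) \<oplus>\<^bsub>FF\<^esub> (c, d) = (a \<oplus> c, b \<oplus> d)"
 "(a, b) \<otimes>\<^bsub>FF\<^esub> (c, d) = (a \<otimes> c, b \<otimes> d)" "\<one>\<^bsub>FF\<^esub> = (\<one>, \<one>)" "\<zero>\<^bsub>FF\<^esub> = (\<zero>, \<zero>)"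
 by (auto simp: RDirProd_def DirProd_def monoid.defs)

lemma FF_minus: "a \<in> \<F> ==> b \<in> \<F> ==> \<ominus>\<^bsub>FF\<^esub> (a, b) = (\<ominus> a, \<ominus> b)"
proof -
 interpret R: cring FF by (rule FF_cring)
 assume "a \<in> \<F>" "b \<in> \<F>"
 thus ?thesis by (intro R.minus_equality) (auto simp: l_neg)
qed

lemma FF_pow: "(a, b) [^]\<^bsub>FF\<^esub> (n::nat) = (a [^] n, b [^] n)"
proof -
 interpret R: cring FF by (rule FF_cring)
 show ?thesis by (induction n) auto
qed

lemma FF_eval: "ring.eval FF P (x, y) = (eval (map fst P) x, eval (map snd P) y)"
proof -
 interpret R: cring FF by (rule FF_cring)
 show ?thesis by (induction P) (auto simp: FF_pow split: prod.splits)
qed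

text \<open>The last condition makes the relation single-valued, since the difference of two values
  over the same point lies over zero.\<close>

definition "pemb Gr \<longleftrightarrow> subring Gr FF \<and> (\<forall>x\<in>K. (x, x) \<in> Gr) \<and> (\<forall>y. (\<zero>, y) \<in> Gr --> y = \<zero>)"

lemma pemb_carrier: "pemb Gr ==> Gr \<subseteq> \<F> \<times> \<F>"
 unfolding pemb_def using subringE(1)[of Gr FF] by auto

lemma pemb_ops:
 assumes "pemb Gr" "(x, x') \<in> Gr" "(y, y') \<in> Gr"
 shows "(x \<oplus> y, x' \<oplus> y') \<in> Gr" "(x \<otimes> y, x' \<otimes> y') \<in> Gr" "(\<ominus> x, \<ominus> x') \<in> Gr"
proof -
 have s: "subring Gr FF" using assms unfolding pemb_def by blast
 show "(x \<oplus> y, x' \<oplus> y') \<in> Gr" "(x \<otimes> y, x' \<otimes> y') \<in> Gr"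
  using subringE(6,7)[OF s assms(2,3)] by auto
 show "(\<ominus> x, \<ominus> x') \<in> Gr" using subringE(5)[OF s assms(2)] FF_minus[of x x'] pemb_carrier[OF assms(1)] assms(2) by auto
qed

lemma pemb_functional: "pemb Gr ==> (x, y) \<in> Gr ==> (x, y') \<in> Gr ==> y = y'"
proof -
 assume g: "pemb Gr" and xy: "(x, y) \<in> Gr" "(x, y') \<in> Gr"
 have c: "x \<in> \<F>" "y \<in> \<F>" "y' \<in> \<F>" using pemb_carrier[OF g] xy by auto
 have "(x \<oplus> \<ominus> x, y \<oplus> \<ominus> y') \<in> Gr" using pemb_ops[OF g xy(1)] pemb_ops[OF g xy(2) xy(2)] by blast
 hence "(\<zero>, y \<ominus> y') \<in> Gr" using c by (simp add: r_neg a_minus_def)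
 hence "y \<ominus> y' = \<zero>" using g unfolding pemb_def by blast
 thus ?thesis using c by (simp add: r_right_minus_eq)
qed

text \<open>An element algebraic over a field has its inverse among its polynomials: after removal
  of zero constant terms, the constant term of a relation is a nonzero multiple of
  \<open>x\<close>.\<close>

lemma subring_inv:
 assumes A: "subring A F" "K \<subseteq> A" and x: "x \<in> A" "x \<noteq> \<zero>" shows "inv x \<in> A"
proof -
 have xc: "x \<in> \<F>" using subringE(1)[OF A(1)] x by auto
 have ix: "inv x \<in> \<F>" "x \<otimes> inv x = \<one>" "inv x \<otimes> x = \<one>" using xc x(2) field_Units by auto
 have "inv x \<in> A" if "P \<noteq> []" "hd P \<noteq> \<zero>" "set P \<subseteq> Q" "eval P x = \<zero>" for P
  using that
 proof (induction P rule: rev_induct)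
  case (snoc c P)
  have PF: "set P \<subseteq> \<F>" and cK: "c \<in> K" and PK: "set P \<subseteq> K" using snoc.prems(3) Q_K K_carrier by auto
  have cc: "c \<in> \<F>" using cK K_carrier by auto
  have ec: "eval P x \<in> \<F>" using eval_in_carrier[OF PF xc] .
  have ev: "eval P x \<otimes> x \<oplus> c = \<zero>" using eval_append_aux[OF PF cc xc] snoc.prems(4) by simp
  show ?case
  proof (cases "c = \<zero>")
   case True
   hence "eval P x \<otimes> x = \<zero>" using ev ec xc by simp
   hence "eval P x = \<zero>" using integral ec xc x by blast
   moreover have "P \<noteq> []" using snoc.prems(2) True by auto
   ultimately show ?thesis using snoc.IH snoc.prems by simp
  next
   case False
   have ic: "inv c \<in> K" "inv c \<in> \<F>" "inv c \<otimes> c = \<one>" using K_inv[OF cK False] cc False field_Units by auto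
   have eA: "eval P x \<in> A" using pvals_in_subring[OF A(1) x(1) eval_in_pvals[of P A x]] PK A(2) by blast
   have "inv c \<otimes> (eval P x \<otimes> x \<oplus> c) \<otimes> inv x = \<zero>" using ev ic ix by simp
   moreover have "inv c \<otimes> (eval P x \<otimes> x \<oplus> c) \<otimes> inv x = inv c \<otimes> eval P x \<otimes> (x \<otimes> inv x) \<oplus> (inv c \<otimes> c) \<otimes> inv x"
    using ic(2) ix(1) ec xc cc by algebra
   ultimately have "inv c \<otimes> eval P x \<oplus> inv x = \<zero>" using ic ix ec by simp
   hence "inv x = \<ominus> (inv c \<otimes> eval P x)" using ic ix ec by (metis a_comm m_closed minus_equality)
   moreover have "\<ominus> (inv c \<otimes> eval P x) \<in> A"
    by (intro subringE(5,6)[OF A(1)] eA) (use ic A(2) in auto)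
   ultimately show ?thesis by simp
  qed
 qed simp
 thus ?thesis using algebraic_Q[OF xc] by blast
qed

lemma pemb_domain:
 assumes g: "pemb Gr" shows "subring (fst ` Gr) F" "K \<subseteq> fst ` Gr"
proof -
 show KG: "K \<subseteq> fst ` Gr" using g unfolding pemb_def by force
 show "subring (fst ` Gr) F"
 proof (rule subringI)
  show "fst ` Gr \<subseteq> \<F>" using pemb_carrier[OF g] by auto
  show "\<one> \<in> fst ` Gr" using KG subringE(3)[OF K_subring] by blast
 next
  fix h assume "h \<in> fst ` Gr"
  then obtain h' where "(h, h') \<in> Gr" by auto
  thus "\<ominus> h \<in> fst ` Gr" using pemb_ops(3)[OF g] by force
 next
  fix h1 h2 assume "h1 \<in> fst ` Gr" "h2 \<in> fst ` Gr"
  then obtain h1' h2' where "(h1, h1') \<in> Gr" "(h2, h2') \<in> Gr" by auto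
  thus "h1 \<otimes> h2 \<in> fst ` Gr" "h1 \<oplus> h2 \<in> fst ` Gr" using pemb_ops(1,2)[OF g] by force+
 qed
qed

lemma pemb_injective: "pemb Gr ==> (x, \<zero>) \<in> Gr ==> x = \<zero>"
proof (rule ccontr)
 assume g: "pemb Gr" and x: "(x, \<zero>) \<in> Gr" "x \<noteq> \<zero>"
 have xc: "x \<in> \<F>" using pemb_carrier[OF g] x by auto
 have "inv x \<in> fst ` Gr" using subring_inv[OF pemb_domain[OF g]] x by force
 then obtain w where w: "(inv x, w) \<in> Gr" by auto
 have "(x \<otimes> inv x, \<zero> \<otimes> w) \<in> Gr" using pemb_ops(2)[OF g x(1) w] .
 hence "(\<one>, \<zero>) \<in> Gr" using xc x(2) field_Units pemb_carrier[OF g] w by auto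
 moreover have "(\<one>, \<one>) \<in> Gr" using g subringE(3)[OF K_subring] unfolding pemb_def by blast
 ultimately show False using pemb_functional[OF g] by force
qed

lemma pemb_converse: assumes g: "pemb Gr" shows "pemb (Gr\<inverse>)"
 unfolding pemb_def
proof (intro conjI ballI allI impI)
 interpret R: cring FF by (rule FF_cring)
 have c: "Gr \<subseteq> \<F> \<times> \<F>" by (rule pemb_carrier[OF g])
 show "subring (Gr\<inverse>) FF"
 proof (rule R.subringI)
  show "Gr\<inverse> \<subseteq> carrier FF" using c by auto
  show "\<one>\<^bsub>FF\<^esub> \<in> Gr\<inverse>" using g subringE(3)[OF K_subring] unfolding pemb_def by auto
 next
  fix h assume "h \<in> Gr\<inverse>"
  then obtain a b where h: "h = (b, a)" "(a, b) \<in> Gr" by auto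
  thus "\<ominus>\<^bsub>FF\<^esub> h \<in> Gr\<inverse>" using pemb_ops(3)[OF g h(2) h(2)] c by (auto simp: FF_minus)
 next
  fix h1 h2 assume "h1 \<in> Gr\<inverse>" "h2 \<in> Gr\<inverse>"
  then obtain a b a' b' where h: "h1 = (b, a)" "(a, b) \<in> Gr" "h2 = (b', a')" "(a', b') \<in> Gr" by auto
  show "h1 \<otimes>\<^bsub>FF\<^esub> h2 \<in> Gr\<inverse>" "h1 \<oplus>\<^bsub>FF\<^esub> h2 \<in> Gr\<inverse>" using pemb_ops(1,2)[OF g h(2,4)] h by auto
 qed
next
 fix x assume "x \<in> K" thus "(x, x) \<in> Gr\<inverse>" using g unfolding pemb_def by auto
next
 fix y assume "(\<zero>, y) \<in> Gr\<inverse>" thus "y = \<zero>" using pemb_injective[OF g] by auto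
qed

lemma pvals_FF_fst:
 assumes g: "pemb Gr" and e: "e \<in> ring.pvals FF Gr n (y, y')" shows "fst e \<in> pvals (fst ` Gr) n y"
proof -
 interpret R: cring FF by (rule FF_cring)
 obtain P where "e = R.eval P (y, y')" "set P \<subseteq> Gr" "length P = n" using e unfolding R.pvals_def by auto
 thus ?thesis unfolding pvals_def by (intro CollectI exI[of _ "map fst P"]) (auto simp: FF_eval)
qed

text \<open>Minimality of \<open>d\<close> says that the powers of \<open>y\<close> below
  \<open>d\<close> are independent over the domain. The relation shared by \<open>y\<close> and
  \<open>y'\<close> brings every element of the enlarged ring to degree below \<open>d\<close>; if
  its first component vanishes, independence kills all coefficients, hence also the second
  component.\<close>

lemma pemb_extend:
 assumes g: "pemb Gr" and y: "y \<in> \<F>" "y' \<in> \<F>"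
  and min: "\<And>k. k < d ==> y [^] k \<notin> pvals (fst ` Gr) k y"
  and P: "set P \<subseteq> Gr" "length P = d" "y [^] d = eval (map fst P) y" "y' [^] d = eval (map snd P) y'"
 shows "\<exists>Gr'. pemb Gr' \<and> Gr \<subseteq> Gr' \<and> (y, y') \<in> Gr'"
proof -
 interpret R: cring FF by (rule FF_cring)
 let ?Y = "(y, y')"
 have gs: "subring Gr FF" using g unfolding pemb_def by blast
 have gc: "Gr \<subseteq> carrier FF" using pemb_carrier[OF g] by simp
 have Y: "?Y \<in> carrier FF" using y by simp
 define A where "A = {e. \<exists>n. e \<in> R.pvals Gr n ?Y}"
 have A: "subring A FF" unfolding A_def by (rule R.pvals_subring[OF gs Y])
 have gA: "Gr \<subseteq> A" unfolding A_def using R.pvals_1[OF gs Y] by blast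
 have YA: "?Y \<in> A"
 proof -
  have "?Y [^]\<^bsub>FF\<^esub> (1::nat) \<in> R.pvals Gr (Suc 1) ?Y" by (rule R.pvals_pow[OF gs Y])
  moreover have "?Y [^]\<^bsub>FF\<^esub> (1::nat) = ?Y" using y by (simp add: FF_pow)
  ultimately show ?thesis unfolding A_def by auto
 qed
 have Yd: "?Y [^]\<^bsub>FF\<^esub> d \<in> R.pvals Gr d ?Y"
  unfolding R.pvals_def by (intro CollectI exI[of _ P]) (use P in "auto simp: FF_pow FF_eval")
 have Asub: "e \<in> R.pvals Gr d ?Y" if "e \<in> A" for e
  using that R.pvals_reduce[OF gs Y Yd] unfolding A_def by blast
 note D = pemb_domain[OF g]
 \<comment> \<open>If the first component \<open>a1\<close> of the top coefficient were nonzero,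
   dividing by it would express \<open>y ^ k\<close> by lower powers, against minimality.\<close>
 have func: "snd e = \<zero>" if "k \<le> d" "e \<in> R.pvals Gr k ?Y" "fst e = \<zero>" for k e
  using that
 proof (induction k arbitrary: e)
  case 0
  thus ?case by simp
 next
  case (Suc k)
  obtain e' a where e: "e' \<in> R.pvals Gr k ?Y" "a \<in> Gr" "e = a \<otimes>\<^bsub>FF\<^esub> ?Y [^]\<^bsub>FF\<^esub> k \<oplus>\<^bsub>FF\<^esub> e'"
   using Suc.prems(2) unfolding R.pvals_Suc'[OF gc Y] by blast
  obtain a1 a2 where a: "a = (a1, a2)" by (cases a)
  obtain e1 e2 where e': "e' = (e1, e2)" by (cases e')
  have ec: "e1 \<in> \<F>" "e2 \<in> \<F>" "a1 \<in> \<F>" "a2 \<in> \<F>"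
   using R.pvals_closed[OF gc Y e(1)] e(2) gc a e' by auto
  have ee: "e = (a1 \<otimes> y [^] k \<oplus> e1, a2 \<otimes> y' [^] k \<oplus> e2)" using e(3) a e' by (simp add: FF_pow)
  have e1: "e1 \<in> pvals (fst ` Gr) k y" using pvals_FF_fst[OF g e(1)] e' by simp
  show ?case
  proof (cases "a1 = \<zero>")
   case True
   hence "a2 = \<zero>" using e(2) a g unfolding pemb_def by blast
   hence "e = e'" using ee True e' ec y by simp
   thus ?thesis using Suc.IH[OF _ e(1)] Suc.prems by simp
  next
   case False
   have ia: "inv a1 \<in> fst ` Gr" using subring_inv[OF D _ False] e(2) a by force
   have ia': "inv a1 \<in> \<F>" "inv a1 \<otimes> a1 = \<one>" using ec(3) False field_Units by auto
   have "a1 \<otimes> y [^] k \<oplus> e1 = \<zero>" using Suc.prems(3) ee by simp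
   hence "inv a1 \<otimes> (a1 \<otimes> y [^] k \<oplus> e1) = \<zero>" using ia' by simp
   moreover have "inv a1 \<otimes> (a1 \<otimes> y [^] k \<oplus> e1) = (inv a1 \<otimes> a1) \<otimes> y [^] k \<oplus> inv a1 \<otimes> e1"
    using ia'(1) ec nat_pow_closed[OF y(1), of k] by algebra
   ultimately have "y [^] k \<oplus> inv a1 \<otimes> e1 = \<zero>" using ia' y by simp
   hence "y [^] k = \<ominus> (inv a1 \<otimes> e1)" using ia' ec y by (metis m_closed minus_equality nat_pow_closed)
   hence yk: "y [^] k = (\<ominus> (inv a1)) \<otimes> e1" using ia' ec by (simp add: l_minus)
   have "(\<ominus> (inv a1)) \<otimes> e1 \<in> pvals (fst ` Gr) k y"
    by (rule pvals_smult[OF D(1) y(1) subringE(5)[OF D(1) ia] e1])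
   thus ?thesis using min[of k] Suc.prems(1) yk by simp
  qed
 qed
 have "pemb A" unfolding pemb_def
 proof (intro conjI ballI allI impI A)
  fix x assume "x \<in> K" thus "(x, x) \<in> A" using g gA unfolding pemb_def by blast
 next
  fix z assume "(\<zero>, z) \<in> A"
  thus "z = \<zero>" using func[OF le_refl Asub, of "(\<zero>, z)"] by simp
 qed
 thus ?thesis using gA YA by blast
qed

lemma pemb_min_relation:
 assumes g: "pemb Gr" and y: "y \<in> \<F>"
 obtains d P where "\<And>k. k < d ==> y [^] k \<notin> pvals (fst ` Gr) k y" "set P \<subseteq> Gr" "length P = d" "d > 0"
  "y [^] d = eval (map fst P) y"
proof -
 note D = pemb_domain[OF g]
 have "\<exists>d. y [^] d \<in> pvals (fst ` Gr) d y"
 proof -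
  obtain P where P: "P \<noteq> []" "hd P \<noteq> \<zero>" "set P \<subseteq> Q" "eval P y = \<zero>" using algebraic_Q[OF y] by blast
  obtain a P' where aP: "P = a # P'" using P(1) by (cases P) auto
  have aK: "a \<in> K" "set P' \<subseteq> K" using P aP Q_K by auto
  have ac: "a \<in> \<F>" "inv a \<in> \<F>" "inv a \<otimes> a = \<one>" using aK K_carrier P(2) aP field_Units by auto
  have e: "eval P' y \<in> pvals (fst ` Gr) (length P') y" using eval_in_pvals[of P' "fst ` Gr" y] aK D(2) by auto
  have ec: "eval P' y \<in> \<F>" using pvals_closed[OF subringE(1)[OF D(1)] y e] .
  have yc: "y [^] length P' \<in> \<F>" using y by simp
  have "inv a \<otimes> (a \<otimes> y [^] length P' \<oplus> eval P' y) = \<zero>" using P(4) aP ac by simp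
  moreover have "inv a \<otimes> (a \<otimes> y [^] length P' \<oplus> eval P' y) = (inv a \<otimes> a) \<otimes> y [^] length P' \<oplus> inv a \<otimes> eval P' y"
   using ac(1,2) ec yc by algebra
  ultimately have "y [^] length P' \<oplus> inv a \<otimes> eval P' y = \<zero>" using ac yc by simp
  hence "y [^] length P' = (\<ominus> (inv a)) \<otimes> eval P' y" using ac ec yc by (metis m_closed minus_equality l_minus)
  moreover have "\<ominus> (inv a) \<in> fst ` Gr"
   using K_inv[OF aK(1)] P(2) aP subringE(5)[OF K_subring] D(2) by auto
  ultimately have "y [^] length P' \<in> pvals (fst ` Gr) (length P') y" using pvals_smult[OF D(1) y _ e] by simp
  thus ?thesis by blast
 qed
 define d where "d = (LEAST d. y [^] d \<in> pvals (fst ` Gr) d y)"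
 have d: "y [^] d \<in> pvals (fst ` Gr) d y" unfolding d_def by (rule LeastI_ex) fact
 have m: "y [^] k \<notin> pvals (fst ` Gr) k y" if "k < d" for k using not_less_Least that unfolding d_def by blast
 have "d > 0" using d by (cases d) auto
 obtain R where R: "set R \<subseteq> fst ` Gr" "length R = d" "y [^] d = eval R y" using d unfolding pvals_def by auto
 have "\<forall>a\<in>set R. \<exists>b. (a, b) \<in> Gr"
 proof
  fix a assume "a \<in> set R"
  hence "a \<in> fst ` Gr" using R(1) by blast
  thus "\<exists>b. (a, b) \<in> Gr" by (metis imageE prod.collapse)
 qed
 then obtain b where b: "\<And>a. a \<in> set R ==> (a, b a) \<in> Gr" by metis
 show ?thesis
  by (rule that[of d "map (\<lambda>a. (a, b a)) R"]) (use m b R \<open>d > 0\<close> in "auto simp: comp_def")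
qed

lemma pemb_total_step:
 assumes g: "pemb Gr" and y: "y \<in> \<F>" shows "\<exists>Gr' y'. pemb Gr' \<and> Gr \<subseteq> Gr' \<and> (y, y') \<in> Gr'"
proof -
 obtain d P where P: "\<And>k. k < d ==> y [^] k \<notin> pvals (fst ` Gr) k y" "set P \<subseteq> Gr" "length P = d" "d > 0"
  "y [^] d = eval (map fst P) y" using pemb_min_relation[OF g y] by metis
 have sc: "set (map snd P) \<subseteq> \<F>" using P(2) pemb_carrier[OF g] by auto
 let ?P = "\<one> # map (a_inv F) (map snd P)"
 have "set ?P \<subseteq> \<F>" using sc by auto
 then obtain y' where y': "y' \<in> \<F>" "eval ?P y' = \<zero>" using has_root[of ?P] P(3,4) by auto
 have "eval (map (a_inv F) (map snd P)) y' = \<ominus> eval (map snd P) y'" by (rule eval_map_minus[OF sc y'(1)])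
 hence "y' [^] d \<oplus> \<ominus> eval (map snd P) y' = \<zero>" using y' P(3) by (simp del: map_map)
 hence "y' [^] d = eval (map snd P) y'" using y'(1) eval_in_carrier[OF sc y'(1)]
  by (metis a_minus_def nat_pow_closed r_right_minus_eq)
 thus ?thesis using pemb_extend[OF g y y'(1) P(1) P(2,3,5)] by blast
qed

text \<open>A maximal graph is total by the extension step, and onto by the same step applied to its
  converse, which is again such a graph.\<close>

lemma pemb_maximal_gal:
 assumes g0: "pemb Gr0"
 shows "\<exists>th\<in>gal. \<forall>x y. (x, y) \<in> Gr0 --> th x = y"
proof -
 interpret R: cring FF by (rule FF_cring)
 define S where "S = {Gr. pemb Gr \<and> Gr0 \<subseteq> Gr}"
 have "\<exists>Gr\<in>S. \<forall>\<Delta>\<in>S. Gr \<subseteq> \<Delta> --> \<Delta> = Gr"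
 proof (rule subset_Zorn_nonempty)
  show "S \<noteq> {}" using g0 unfolding S_def by blast
  fix C assume C: "C \<noteq> {}" "subset.chain S C"
  have "C \<subseteq> S" using C(2) unfolding subset_chain_def by blast
  hence CS: "pemb W" "Gr0 \<subseteq> W" "subring W FF" if "W \<in> C" for W
   using that unfolding S_def pemb_def by (fast, fast, fast)
  have CS4: "(x, x) \<in> W" if "W \<in> C" "x \<in> K" for W x
   using CS(1)[OF that(1)] that(2) unfolding pemb_def by blast
  have CS5: "y = \<zero>" if "W \<in> C" "(\<zero>, y) \<in> W" for W y
   using CS(1)[OF that(1)] that(2) unfolding pemb_def by blast
  have lin: "\<And>W Y. W \<in> C ==> Y \<in> C ==> W \<subseteq> Y \<or> Y \<subseteq> W" using C(2) unfolding subset_chain_def by auto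
  have "subring (\<Union>C) FF"
  proof (rule R.subringI)
   show "\<Union>C \<subseteq> carrier FF" by (rule Union_least) (rule subringE(1)[OF CS(3)])
   obtain W where W: "W \<in> C" using C(1) by blast
   show "\<one>\<^bsub>FF\<^esub> \<in> \<Union>C" by (rule UnionI[OF W subringE(3)[OF CS(3)[OF W]]])
  next
   fix h assume "h \<in> \<Union>C"
   then obtain W where W: "W \<in> C" "h \<in> W" by blast
   show "\<ominus>\<^bsub>FF\<^esub> h \<in> \<Union>C" by (rule UnionI[OF W(1) subringE(5)[OF CS(3)[OF W(1)] W(2)]])
  next
   fix a b assume "a \<in> \<Union>C" "b \<in> \<Union>C"
   then obtain W where W: "W \<in> C" "a \<in> W" "b \<in> W" using lin by (elim UnionE) (metis subset_iff)
   show "a \<otimes>\<^bsub>FF\<^esub> b \<in> \<Union>C" by (rule UnionI[OF W(1) subringE(6)[OF CS(3)[OF W(1)] W(2,3)]])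
   show "a \<oplus>\<^bsub>FF\<^esub> b \<in> \<Union>C" by (rule UnionI[OF W(1) subringE(7)[OF CS(3)[OF W(1)] W(2,3)]])
  qed
  moreover have "\<forall>x\<in>K. (x, x) \<in> \<Union>C" using C(1) CS4 by blast
  moreover have "\<forall>y. (\<zero>, y) \<in> \<Union>C --> y = \<zero>" using CS5 by blast
  ultimately show "\<Union>C \<in> S" unfolding S_def pemb_def using C(1) CS(2) by blast
 qed
 then obtain Gr where gS: "Gr \<in> S" and mxS: "\<forall>\<Delta>\<in>S. Gr \<subseteq> \<Delta> --> \<Delta> = Gr" by (rule bexE)
 have g: "pemb Gr" "Gr0 \<subseteq> Gr" using gS unfolding S_def by simp_all
 have mx: "\<Delta> = Gr" if "pemb \<Delta>" "Gr \<subseteq> \<Delta>" for \<Delta>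
 proof -
  have "\<Delta> \<in> S" using that g(2) unfolding S_def by simp
  thus ?thesis using mxS that(2) by simp
 qed
 have tot: "\<exists>y'. (y, y') \<in> Gr" if "y \<in> \<F>" for y
  using pemb_total_step[OF g(1) that] mx by blast
 have sur: "\<exists>y. (y, y') \<in> Gr" if y': "y' \<in> \<F>" for y'
 proof -
  obtain \<Delta> y where d: "pemb \<Delta>" "Gr\<inverse> \<subseteq> \<Delta>" "(y', y) \<in> \<Delta>"
   using pemb_total_step[OF pemb_converse[OF g(1)] y'] by blast
  have "\<Delta>\<inverse> = Gr" by (rule mx[OF pemb_converse[OF d(1)]]) (use d(2) in auto)
  thus ?thesis using d(3) by auto
 qed
 define th where "th = (\<lambda>x\<in>\<F>. THE y. (x, y) \<in> Gr)"
 have th: "th x = y" if "(x, y) \<in> Gr" for x y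
 proof -
  have "x \<in> \<F>" using pemb_carrier[OF g(1)] that by auto
  thus ?thesis unfolding th_def using that pemb_functional[OF g(1)] by (auto intro!: the_equality)
 qed
 have th': "(x, th x) \<in> Gr" if "x \<in> \<F>" for x using tot[OF that] th by auto
 have "th \<in> gal" unfolding gal_def
 proof (intro CollectI conjI IntI ballI)
  show "th \<in> ring_hom F F"
  proof (rule ring_hom_memI)
   show "th x \<in> \<F>" if "x \<in> \<F>" for x using th'[OF that] pemb_carrier[OF g(1)] by auto
   show "th (x \<otimes> y) = th x \<otimes> th y" "th (x \<oplus> y) = th x \<oplus> th y" if "x \<in> \<F>" "y \<in> \<F>" for x y
    using th[OF pemb_ops(2)[OF g(1) th' th']] th[OF pemb_ops(1)[OF g(1) th' th']] that by auto
   show "th \<one> = \<one>" by (rule th) (use g(1) subringE(3)[OF K_subring] in "auto simp: pemb_def")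
  qed
  show "th \<in> Bij \<F>" unfolding Bij_def bij_betw_def
  proof (intro IntI CollectI conjI)
   show "th \<in> extensional \<F>" unfolding th_def by simp
   show "inj_on th \<F>"
   proof (rule inj_onI)
    fix x y assume xy: "x \<in> \<F>" "y \<in> \<F>" "th x = th y"
    have "(th x, x) \<in> Gr\<inverse>" "(th x, y) \<in> Gr\<inverse>" using th'[OF xy(1)] th'[OF xy(2)] xy(3) by auto
    thus "x = y" using pemb_functional[OF pemb_converse[OF g(1)]] by blast
   qed
   show "th ` \<F> = \<F>"
   proof
    show "th ` \<F> \<subseteq> \<F>" using th' pemb_carrier[OF g(1)] by auto
    show "\<F> \<subseteq> th ` \<F>"
    proof
     fix y assume "y \<in> \<F>"
     then obtain x where "(x, y) \<in> Gr" using sur by blast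
     thus "y \<in> th ` \<F>" using th pemb_carrier[OF g(1)] by force
    qed
   qed
  qed
  show "th x = x" if "x \<in> K" for x by (rule th) (use g(1) that in "auto simp: pemb_def")
 qed
 thus ?thesis using th g(2) by blast
qed

lemma natc_K: "natc n \<in> K" using natc_Z Z_sub_Q Q_K by blast

text \<open>The minimal relation of \<open>x\<close> over \<open>K\<close> has degree at least two,
  and \<open>x\<close> is a simple root: in characteristic zero, vanishing of the derivative would
  give a relation of smaller degree. So there is another root \<open>y\<close>, and the embedding
  that sends \<open>x\<close> to \<open>y\<close> extends to the whole closure.\<close>

theorem fixed_field:
 assumes x: "x \<in> \<F>" "x \<notin> K" shows "\<exists>th\<in>gal. th x \<noteq> x"
proof -
 interpret R: cring FF by (rule FF_cring)
 define Gr0 where "Gr0 = (\<lambda>a. (a, a)) ` K"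
 have g0: "pemb Gr0" unfolding pemb_def
 proof (intro conjI ballI allI impI)
  show "subring Gr0 FF"
  proof (rule R.subringI)
   show "Gr0 \<subseteq> carrier FF" using K_carrier unfolding Gr0_def by auto
   show "\<one>\<^bsub>FF\<^esub> \<in> Gr0" using subringE(3)[OF K_subring] unfolding Gr0_def by auto
  next
   fix h assume "h \<in> Gr0"
   then obtain a where a: "a \<in> K" "h = (a, a)" unfolding Gr0_def by blast
   have "a \<in> \<F>" using a K_carrier by blast
   thus "\<ominus>\<^bsub>FF\<^esub> h \<in> Gr0" using a subringE(5)[OF K_subring a(1)] unfolding Gr0_def by (simp add: FF_minus)
  next
   fix h1 h2 assume "h1 \<in> Gr0" "h2 \<in> Gr0"
   then obtain a b where a: "a \<in> K" "h1 = (a, a)" "b \<in> K" "h2 = (b, b)" unfolding Gr0_def by blast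
   show "h1 \<otimes>\<^bsub>FF\<^esub> h2 \<in> Gr0" "h1 \<oplus>\<^bsub>FF\<^esub> h2 \<in> Gr0"
    using a subringE(6,7)[OF K_subring a(1,3)] unfolding Gr0_def by auto
  qed
 qed (auto simp: Gr0_def)
 have f0: "fst ` Gr0 = K" unfolding Gr0_def by (simp add: image_image)
 obtain d P where P: "\<And>k. k < d ==> x [^] k \<notin> pvals K k x" "set P \<subseteq> Gr0" "length P = d" "d > 0"
  "x [^] d = eval (map fst P) x" using pemb_min_relation[OF g0 x(1)] unfolding f0 by metis
 have sf: "map snd P = map fst P" using P(2) unfolding Gr0_def by auto
 have PK: "set (map fst P) \<subseteq> K" using P(2) f0 by auto
 hence PF: "set (map fst P) \<subseteq> \<F>" using K_carrier by auto
 have "d \<noteq> 1"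
 proof
  assume "d = 1"
  hence "x [^] (1::nat) \<in> pvals K (Suc 0) x" using eval_in_pvals[OF PK, of x] P(3,5) by simp
  thus False using pvals_1_iff[OF K_subring x(1)] x by simp
 qed
 then obtain m where m: "d = Suc (Suc m)" using P(4) by (cases d; cases "d - 1") auto
 let ?P = "\<one> # map (a_inv F) (map fst P)"
 have Pk: "set ?P \<subseteq> K" using PK subringE(3,5)[OF K_subring] by auto
 have evP: "eval ?P z = z [^] d \<ominus> eval (map fst P) z" if "z \<in> \<F>" for z
 proof -
  have "eval (map (a_inv F) (map fst P)) z = \<ominus> eval (map fst P) z" by (rule eval_map_minus[OF PF that])
  thus ?thesis using that P(3) by (simp add: a_minus_def del: map_map)
 qed
 have Px: "eval ?P x = \<zero>" using evP[OF x(1)] P(5) eval_in_carrier[OF PF x(1)] by simp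
 have "length ?P = Suc d" "hd ?P = \<one>" using P(3) by auto
 from synthetic_derivative[OF K_subring Pk this x(1)] obtain P' where Pp: "length P' = d \<and> set P' \<subseteq> \<F> \<and> (d > 0 --> hd P' = \<one>) \<and>
  (\<forall>z\<in>\<F>. eval ?P z = (z \<ominus> x) \<otimes> eval P' z \<oplus> eval ?P x) \<and>
  (\<exists>e\<in>pvals K (d - 1) x. eval P' x = natc d \<otimes> x [^] (d - 1) \<oplus> e)" ..
 then obtain e where e: "e \<in> pvals K (d - 1) x" "eval P' x = natc d \<otimes> x [^] (d - 1) \<oplus> e" by (elim conjE bexE)
 have P': "length P' = d" "set P' \<subseteq> \<F>" "hd P' = \<one>" using Pp P(4) by simp_all
 have P'4: "eval ?P z = (z \<ominus> x) \<otimes> eval P' z \<oplus> eval ?P x" if "z \<in> \<F>" for z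
  using Pp that by blast
 have nz: "eval P' x \<noteq> \<zero>"
 proof
  assume z: "eval P' x = \<zero>"
  have dn: "natc d \<noteq> \<zero>" using char0[of d] m by auto
  have id: "inv (natc d) \<in> K" "inv (natc d) \<in> \<F>" "inv (natc d) \<otimes> natc d = \<one>"
   using K_inv[OF natc_K dn] dn field_Units by auto
  have ec: "e \<in> \<F>" using pvals_closed[OF K_carrier x(1) e(1)] .
  have xc: "x [^] (d - 1) \<in> \<F>" using x by simp
  have "natc d \<otimes> x [^] (d - 1) \<oplus> e = \<zero>" using e(2) z by metis
  hence "inv (natc d) \<otimes> (natc d \<otimes> x [^] (d - 1) \<oplus> e) = \<zero>" using id(2) r_null by metis
  moreover have "inv (natc d) \<otimes> (natc d \<otimes> x [^] (d - 1) \<oplus> e)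
   = (inv (natc d) \<otimes> natc d) \<otimes> x [^] (d - 1) \<oplus> inv (natc d) \<otimes> e"
   using id(2) ec xc natc_closed[of d] by algebra
  ultimately have "x [^] (d - 1) \<oplus> inv (natc d) \<otimes> e = \<zero>" using id xc by simp
  hence "x [^] (d - 1) = (\<ominus> (inv (natc d))) \<otimes> e" using id ec xc by (metis m_closed minus_equality l_minus)
  hence "x [^] (d - 1) \<in> pvals K (d - 1) x"
   using pvals_smult[OF K_subring x(1) subringE(5)[OF K_subring id(1)] e(1)] by simp
  thus False using P(1)[of "d - 1"] P(4) by simp
 qed
 obtain y where y: "y \<in> \<F>" "eval P' y = \<zero>" using has_root[OF P'(2,3)] P'(1) m by auto
 have yx: "y \<noteq> x" using y nz by auto
 have "eval ?P y = \<zero>" unfolding P'4[OF y(1)] Px using y x by simp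
 hence "y [^] d \<ominus> eval (map fst P) y = \<zero>" using evP[OF y(1)] by metis
 hence "y [^] d = eval (map snd P) y" unfolding sf
  using r_right_minus_eq[OF nat_pow_closed[OF y(1)] eval_in_carrier[OF PF y(1)]] by blast
 then obtain Gr where Gr: "pemb Gr" "(x, y) \<in> Gr"
  using pemb_extend[OF g0 x(1) y(1) _ P(2,3,5)] P(1) f0 by metis
 show ?thesis using pemb_maximal_gal[OF Gr(1)] Gr(2) yx by metis
qed

end

context padic_galois
begin

section \<open>The Galois group\<close>

definition "G = BijGroup \<F> \<lparr>carrier := gal\<rparr>"

lemma G_carrier [simp]: "carrier G = gal" by (simp add: G_def)

lemma gal_hom: "th \<in> gal ==> th \<in> ring_hom F F" unfolding gal_def by auto
lemma gal_Bij: "th \<in> gal ==> th \<in> Bij \<F>" unfolding gal_def by auto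
lemma gal_K: "th \<in> gal ==> x \<in> K ==> th x = x" unfolding gal_def by auto
lemma gal_ring_hom: "th \<in> gal ==> ring_hom_ring F F th"
 using gal_hom by (intro ring_hom_ringI2) (auto intro: ring_axioms)

lemma gal_closed [simp]: "th \<in> gal ==> x \<in> \<F> ==> th x \<in> \<F>"
 using ring_hom_closed[OF gal_hom] by auto
lemma gal_mult: "th \<in> gal ==> x \<in> \<F> ==> y \<in> \<F> ==> th (x \<otimes> y) = th x \<otimes> th y"
 using ring_hom_mult[OF gal_hom] by auto
lemma gal_add: "th \<in> gal ==> x \<in> \<F> ==> y \<in> \<F> ==> th (x \<oplus> y) = th x \<oplus> th y"
 using ring_hom_add[OF gal_hom] by auto
lemma gal_one: "th \<in> gal ==> th \<one> = \<one>" using ring_hom_one[OF gal_hom] by auto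
lemma gal_zero: "th \<in> gal ==> th \<zero> = \<zero>" using ring_hom_zero[OF gal_hom ring_axioms ring_axioms] by auto
lemma gal_pow: "th \<in> gal ==> x \<in> \<F> ==> th (x [^] (n::nat)) = th x [^] n"
 by (induction n) (auto simp: gal_one gal_mult)
lemma gal_minus: "th \<in> gal ==> x \<in> \<F> ==> th (\<ominus> x) = \<ominus> th x"
proof -
 assume s: "th \<in> gal" and x: "x \<in> \<F>"
 have "th (\<ominus> x) \<oplus> th x = \<zero>" using gal_add[OF s, of "\<ominus> x" x] x gal_zero[OF s] by (simp add: l_neg)
 thus ?thesis using s x by (metis a_inv_closed gal_closed minus_equality)
qed
lemma gal_diff: "th \<in> gal ==> x \<in> \<F> ==> y \<in> \<F> ==> th (x \<ominus> y) = th x \<ominus> th y"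
 by (simp add: a_minus_def gal_add gal_minus)
lemma gal_eval: "th \<in> gal ==> set P \<subseteq> \<F> ==> x \<in> \<F> ==> th (eval P x) = eval (map th P) (th x)"
 using ring_hom_ring.eval_hom'[OF gal_ring_hom] by auto
lemma gal_eval_K: "th \<in> gal ==> set P \<subseteq> K ==> x \<in> \<F> ==> th (eval P x) = eval P (th x)"
proof -
 assume s: "th \<in> gal" and P: "set P \<subseteq> K" and x: "x \<in> \<F>"
 have "map th P = P" by (rule map_idI) (use gal_K[OF s] P in auto)
 thus ?thesis using gal_eval[OF s _ x, of P] P K_carrier by auto
qed
lemma gal_inj: "th \<in> gal ==> x \<in> \<F> ==> y \<in> \<F> ==> th x = th y \<longleftrightarrow> x = y"
 using gal_Bij[of th] unfolding Bij_def bij_betw_def inj_on_def by auto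
lemma gal_eq: "th \<in> gal ==> ta \<in> gal ==> (\<And>x. x \<in> \<F> ==> th x = ta x) ==> th = ta"
 using gal_Bij[of th] gal_Bij[of ta] unfolding Bij_def by (auto intro: extensionalityI)

lemma gal_subgroup: "subgroup gal (BijGroup \<F>)"
proof (rule subgroup.intro)
 show "gal \<subseteq> carrier (BijGroup \<F>)" by (auto simp: BijGroup_def gal_Bij)
 show "\<one>\<^bsub>BijGroup \<F>\<^esub> \<in> gal"
  unfolding gal_def using K_carrier by (auto simp: BijGroup_def id_Bij intro!: ring_hom_memI)
next
 fix x y assume x: "x \<in> gal" and y: "y \<in> gal"
 have "compose \<F> x y \<in> ring_hom F F"
  by (rule ring_hom_memI) (use x y in "auto simp: compose_def gal_mult gal_add gal_one")
 moreover have "compose \<F> x y \<in> Bij \<F>" by (rule compose_Bij[OF gal_Bij[OF x] gal_Bij[OF y]])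
 moreover have "compose \<F> x y u = u" if "u \<in> K" for u
  using that K_carrier gal_K[OF x that] gal_K[OF y that] by (auto simp: compose_def)
 ultimately have "compose \<F> x y \<in> gal" unfolding gal_def by simp
 thus "x \<otimes>\<^bsub>BijGroup \<F>\<^esub> y \<in> gal" using gal_Bij[OF x] gal_Bij[OF y] by (simp add: BijGroup_def)
next
 fix x assume x: "x \<in> gal"
 have b: "x \<in> Bij \<F>" by (rule gal_Bij[OF x])
 have bb: "bij_betw x \<F> \<F>" using b unfolding Bij_def by simp
 let ?y = "\<lambda>u\<in>\<F>. inv_into \<F> x u"
 have yc: "?y u \<in> \<F>" "x (?y u) = u" if "u \<in> \<F>" for u
  using that bb by (auto simp: bij_betw_def inv_into_into f_inv_into_f)
 have yx: "?y (x u) = u" if "u \<in> \<F>" for u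
  using that bb x by (auto simp: bij_betw_def)
 have "?y \<in> ring_hom F F"
 proof (rule ring_hom_memI)
  fix u v assume uv: "u \<in> \<F>" "v \<in> \<F>"
  have "x (?y u \<otimes> ?y v) = u \<otimes> v" using gal_mult[OF x] yc uv by simp
  thus "?y (u \<otimes> v) = ?y u \<otimes> ?y v" using yx[of "?y u \<otimes> ?y v"] yc uv by auto
  have "x (?y u \<oplus> ?y v) = u \<oplus> v" using gal_add[OF x] yc uv by simp
  thus "?y (u \<oplus> v) = ?y u \<oplus> ?y v" using yx[of "?y u \<oplus> ?y v"] yc uv by auto
 qed (use yc yx[of \<one>] gal_one[OF x] in auto)
 moreover have "?y u = u" if "u \<in> K" for u using yx[of u] gal_K[OF x that] that K_carrier by auto
 ultimately show "inv\<^bsub>BijGroup \<F>\<^esub> x \<in> gal"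
  unfolding inv_BijGroup[OF b] gal_def using restrict_inv_into_Bij[OF b] by auto
qed

lemma G_group: "Group.group G"
 unfolding G_def by (rule subgroup.subgroup_is_group[OF gal_subgroup group_BijGroup])

abbreviation gmult (infixl "\<star>" 70) where "gmult \<equiv> mult G"
abbreviation ginv ("\<iota> _" [81] 80) where "ginv \<equiv> m_inv G"

lemma G_mult: "th \<in> gal ==> ta \<in> gal ==> x \<in> \<F> ==> (th \<star> ta) x = th (ta x)"
 unfolding G_def by (simp add: BijGroup_def gal_Bij compose_def)

lemma G_one: "x \<in> \<F> ==> \<one>\<^bsub>G\<^esub> x = x"
 unfolding G_def by (simp add: BijGroup_def)

lemma G_mult_closed [simp]: "th \<in> gal ==> ta \<in> gal ==> th \<star> ta \<in> gal"
 using group.is_monoid[OF G_group] monoid.m_closed[of G] by simp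

lemma G_one_closed [simp]: "\<one>\<^bsub>G\<^esub> \<in> gal"
 using group.is_monoid[OF G_group] monoid.one_closed[of G] by simp

lemma G_inv_closed [simp]: "th \<in> gal ==> \<iota> th \<in> gal"
 using group.inv_closed[OF G_group] by simp

lemma G_inv1: "th \<in> gal ==> x \<in> \<F> ==> (\<iota> th) (th x) = x"
 using G_mult[of "\<iota> th" th x] group.l_inv[OF G_group, of th] G_one by simp

lemma G_inv2: "th \<in> gal ==> x \<in> \<F> ==> th ((\<iota> th) x) = x"
 using G_mult[of th "\<iota> th" x] group.r_inv[OF G_group, of th] G_one by simp

section \<open>Galois action and valuation\<close>

lemma gal_O: "th \<in> gal ==> x \<in> Oint ==> th x \<in> Oint"
proof -
 assume s: "th \<in> gal" and x: "x \<in> Oint"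
 obtain P where P: "P \<noteq> []" "hd P = \<one>" "set P \<subseteq> Z" "eval P x = \<zero>" "x \<in> \<F>"
  using x unfolding Oint_def by blast
 have "set P \<subseteq> K" using P(3) Z_sub_Q Q_K by auto
 have "eval P (th x) = \<zero>" using gal_eval_K[OF s \<open>set P \<subseteq> K\<close> P(5)] P(4) gal_zero[OF s] by simp
 thus ?thesis unfolding Oint_def using P s by auto
qed

lemma gal_mx: "th \<in> gal ==> x \<in> mx ==> th x \<in> mx"
proof (rule ccontr)
 assume s: "th \<in> gal" and x: "x \<in> mx" and n: "th x \<notin> mx"
 have xO: "x \<in> Oint" and xc: "x \<in> \<F>" using mx_O[OF x] mx_carrier[OF x] by auto
 obtain u where u: "u \<in> Oint" "th x \<otimes> u = \<one>" using unit_iff[OF gal_O[OF s xO]] n by blast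
 let ?s = "\<iota> th"
 have s': "?s \<in> gal" using s by simp
 have "?s (th x \<otimes> u) = \<one>" using u gal_one[OF s'] by simp
 hence "x \<otimes> ?s u = \<one>" using gal_mult[OF s' gal_closed[OF s xc] O_carrier[OF u(1)]] G_inv1[OF s xc] by simp
 thus False using x gal_O[OF s' u(1)] unfolding mx_def by blast
qed

lemma gal_rcong: "th \<in> gal ==> x \<in> \<F> ==> y \<in> \<F> ==> x \<doteq> y ==> th x \<doteq> th y"
 unfolding rcong_def using gal_mx[of th "x \<ominus> y"] gal_diff[of th x y] by simp

lemma orbit_finite:
 assumes x: "x \<in> \<F>" shows "finite {th x |th. th \<in> gal}"
proof -
 obtain P where P: "P \<noteq> []" "hd P \<noteq> \<zero>" "set P \<subseteq> Q" "eval P x = \<zero>" using algebraic_Q[OF x] by blast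
 have PK: "set P \<subseteq> K" and PF: "set P \<subseteq> \<F>" using P Q_K K_carrier by auto
 obtain a P' where aP: "P = a # P'" using P(1) by (cases P) auto
 have ac: "a \<in> \<F>" "inv a \<in> \<F>" "inv a \<otimes> a = \<one>" using aP P(2) PF field_Units by auto
 let ?P = "map ((\<otimes>) (inv a)) P"
 have "set ?P \<subseteq> \<F>" using PF ac by auto
 moreover have "length ?P = Suc (length P')" "hd ?P = \<one>" using aP ac by auto
 ultimately obtain rs where rs: "set rs \<subseteq> \<F>" "\<And>z. z \<in> \<F> ==> eval ?P z = root_prod rs z"
  using monic_splits by metis
 have "{th x |th. th \<in> gal} \<subseteq> set rs"
 proof safe
  fix th assume s: "th \<in> gal"
  have sx: "th x \<in> \<F>" using s x by simp
  have "eval P (th x) = \<zero>" using gal_eval_K[OF s PK x] P(4) gal_zero[OF s] by simp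
  hence "eval ?P (th x) = \<zero>" using eval_map_mult[OF ac(2) sx PF] ac(2) by simp
  thus "th x \<in> set rs" using rs(2)[OF sx] root_prod_eq_0[OF rs(1) sx] by simp
 qed
 thus ?thesis by (rule finite_subset) simp
qed

primrec gpow :: "('a \<Rightarrow> 'a) \<Rightarrow> nat \<Rightarrow> 'a \<Rightarrow> 'a" where
 "gpow th 0 = \<one>\<^bsub>G\<^esub>" | "gpow th (Suc n) = th \<star> gpow th n"

lemma gpow_gal: "th \<in> gal ==> gpow th n \<in> gal" by (induction n) auto
lemma gpow_Suc: "th \<in> gal ==> x \<in> \<F> ==> gpow th (Suc n) x = th (gpow th n x)" by (simp add: G_mult gpow_gal)
lemma gpow_add: "th \<in> gal ==> x \<in> \<F> ==> gpow th (m + n) x = gpow th m (gpow th n x)"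
 by (induction m) (auto simp: G_mult gpow_gal G_one)

lemma gpow_fixes:
 assumes s: "th \<in> gal" and x: "x \<in> \<F>" shows "\<exists>n>0. gpow th n x = x"
proof -
 have "\<not> inj (\<lambda>n. gpow th n x)"
 proof
  assume "inj (\<lambda>n. gpow th n x)"
  hence "infinite (range (\<lambda>n. gpow th n x))" using range_inj_infinite by blast
  moreover have "range (\<lambda>n. gpow th n x) \<subseteq> {th x |th. th \<in> gal}" using gpow_gal[OF s] by auto
  ultimately show False using orbit_finite[OF x] finite_subset by blast
 qed
 then obtain i j where "i \<noteq> j" "gpow th i x = gpow th j x" unfolding inj_def by blast
 then obtain i j where ij: "i < j" "gpow th i x = gpow th j x" by (metis linorder_neqE_nat)
 have "gpow th i (gpow th (j - i) x) = gpow th i x" using gpow_add[OF s x, of i "j - i"] ij by simp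
 hence "gpow th (j - i) x = x" using gal_inj[OF gpow_gal[OF s]] gpow_gal[OF s] x by simp
 thus ?thesis using ij by (intro exI[of _ "j - i"]) simp
qed

text \<open>Automorphisms preserve the valuation: a factor \<open>t\<close> in the maximal ideal
  would accumulate under iteration, but some iterate of \<open>th\<close> fixes \<open>a\<close>, so
  that \<open>1\<close> would lie in the ideal.\<close>

lemma gal_no_mx:
 assumes s: "th \<in> gal" and a: "a \<in> \<F>" "a \<noteq> \<zero>" and t: "t \<in> mx" shows "th a \<noteq> a \<otimes> t"
proof
 assume sa: "th a = a \<otimes> t"
 have tc: "t \<in> \<F>" using mx_carrier[OF t] .
 have it: "\<exists>u\<in>mx. gpow th (Suc n) a = a \<otimes> u" for n
 proof (induction n)
  case 0
  show ?case using sa t gpow_Suc[OF s a(1), of 0] a by (auto simp: G_one)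
 next
  case (Suc n)
  then obtain u where u: "u \<in> mx" "gpow th (Suc n) a = a \<otimes> u" by blast
  have uc: "u \<in> \<F>" using mx_carrier[OF u(1)] .
  have "gpow th (Suc (Suc n)) a = th (a \<otimes> u)" using gpow_Suc[OF s a(1), of "Suc n"] u(2) by simp
  also have "\<dots> = a \<otimes> (t \<otimes> th u)" using gal_mult[OF s a(1) uc] sa a tc uc s by (simp add: m_assoc)
  finally show ?case using mx_mult[OF mx_O[OF t] gal_mx[OF s u(1)]] by blast
 qed
 obtain n where n: "n > 0" "gpow th n a = a" using gpow_fixes[OF s a(1)] by blast
 then obtain u where u: "u \<in> mx" "a = a \<otimes> u" using it[of "n - 1"] by auto
 have uc: "u \<in> \<F>" using mx_carrier[OF u(1)] .
 have "a \<otimes> \<one> = a \<otimes> u" using u(2) a by simp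
 hence "\<one> = u" using m_lcancel[OF a(2,1) one_closed uc] by blast
 thus False using u(1) one_not_mx by simp
qed

lemma gal_unit:
 assumes s: "th \<in> gal" and a: "a \<in> \<F>" "a \<noteq> \<zero>"
 shows "\<exists>u\<in>Oint. u \<notin> mx \<and> th a = a \<otimes> u"
 using O_divides[OF gal_closed[OF s a(1)] a]
proof
 assume "\<exists>t\<in>Oint. th a = a \<otimes> t"
 thus ?thesis using gal_no_mx[OF s a] by blast
next
 assume "\<exists>t\<in>mx. th a \<noteq> \<zero> \<and> a = th a \<otimes> t"
 then obtain t where t: "t \<in> mx" "a = th a \<otimes> t" by blast
 let ?s = "\<iota> th"
 have s': "?s \<in> gal" using s by simp
 have "?s a = ?s (th a \<otimes> t)" using t(2) by simp
 also have "\<dots> = a \<otimes> ?s t" using gal_mult[OF s' gal_closed[OF s a(1)] mx_carrier[OF t(1)]] G_inv1[OF s a(1)] by simp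
 finally show ?thesis using gal_no_mx[OF s' a gal_mx[OF s' t(1)]] by simp
qed

text \<open>This is the value \<open>c\<close> of the cyclotomic character of \<open>th\<close>
  modulo \<open>n\<close>, kept as a relation because \<open>c\<close> is determined only modulo
  \<open>n\<close>.\<close>

definition "acts th n c \<longleftrightarrow> (\<forall>x\<in>\<F>. x [^] (n::nat) = \<one> --> th x = x [^] (c::nat))"

lemma ex_acts: assumes s: "th \<in> gal" and n: "n > 0" shows "\<exists>c. acts th n c"
proof -
 obtain z where z: "prim z n" using ex_prim[OF n] by blast
 have zc: "z \<in> \<F>" "z [^] n = \<one>" using primD[OF z] by auto
 have "(th z) [^] n = \<one>" using gal_pow[OF s zc(1), of n] zc(2) gal_one[OF s] by simp
 then obtain c :: nat where c: "th z = z [^] c" using prim_roots[OF z gal_closed[OF s zc(1)]] by blast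
 have "th x = x [^] c" if x: "x \<in> \<F>" "x [^] n = \<one>" for x
 proof -
  obtain i :: nat where i: "x = z [^] i" using prim_roots[OF z x] by blast
  thus ?thesis using gal_pow[OF s zc(1), of i] c zc(1) by (simp add: nat_pow_pow mult.commute)
 qed
 thus ?thesis unfolding acts_def by blast
qed

lemma acts_prim: "prim z n ==> th \<in> gal ==> acts th n c \<longleftrightarrow> th z = z [^] c"
proof
 assume z: "prim z n" and s: "th \<in> gal" and e: "th z = z [^] c"
 show "acts th n c" unfolding acts_def
 proof (intro ballI impI)
  fix x assume x: "x \<in> \<F>" "x [^] n = \<one>"
  obtain i :: nat where i: "x = z [^] i" using prim_roots[OF z x] by blast
  thus "th x = x [^] c" using gal_pow[OF s, of z i] e primD(2)[OF z] by (simp add: nat_pow_pow mult.commute)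
 qed
qed (auto simp: acts_def primD)

lemma acts_cong:
 assumes z: "prim z n" and "acts th n c" "acts th n d" shows "[c = d] (mod n)"
proof -
 have "z [^] c = z [^] d" using assms primD[OF z] unfolding acts_def by metis
 thus ?thesis using prim_pow_eq[OF z] by simp
qed

lemma root_commute:
 assumes s: "th \<in> gal" "ta \<in> gal" and x: "x \<in> \<F>" "x [^] n = \<one>" "(n::nat) > 0"
 shows "th (ta x) = ta (th x)"
proof -
 obtain c d where c: "acts th n c" "acts ta n d" using ex_acts s x(3) by blast
 have "th x = x [^] c" "ta x = x [^] d" using c x unfolding acts_def by auto
 thus ?thesis using gal_pow[OF s(1) x(1)] gal_pow[OF s(2) x(1)] x by (simp add: nat_pow_pow mult.commute)
qed

lemma teich:
 assumes x: "x \<in> Oint" "x \<notin> mx"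
 obtains N \<omega> where "\<not> p dvd N" "N > 0" "\<omega> \<in> \<F>" "\<omega> [^] (N::nat) = \<one>" "x \<doteq> \<omega>"
proof -
 obtain P where P: "P \<noteq> []" "hd P \<noteq> \<zero>" "set P \<subseteq> Q" "eval P x = \<zero>" using algebraic_Q[OF O_carrier[OF x(1)]] by blast
 obtain N \<omega> where N: "\<omega> \<in> \<F>" "\<not> p dvd N" "\<omega> [^] (N::nat) = \<one>" "x \<doteq> \<omega>"
  using teichmueller[OF x P] by blast
 moreover have "N > 0" using N(2) by (cases N) auto
 ultimately show ?thesis using that by blast
qed

text \<open>Every unit is residually a root of unity, and on roots of unity automorphisms are power
  maps; hence the residual Galois group is abelian.\<close>

lemma residue_commute:
 assumes s: "th \<in> gal" "ta \<in> gal" and x: "x \<in> Oint" shows "th (ta x) \<doteq> ta (th x)"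
proof (cases "x \<in> mx")
 case True
 show ?thesis unfolding rcong_def
  by (rule mx_diff[OF gal_mx[OF s(1) gal_mx[OF s(2) True]] gal_mx[OF s(2) gal_mx[OF s(1) True]]])
next
 case False
 have xc: "x \<in> \<F>" using O_carrier[OF x] .
 obtain N w where w: "N > 0" "w \<in> \<F>" "w [^] (N::nat) = \<one>" "x \<doteq> w" using teich[OF x False] by metis
 have 1: "th (ta x) \<doteq> th (ta w)" using gal_rcong s w xc by simp
 have 2: "ta (th x) \<doteq> ta (th w)" using gal_rcong s w xc by simp
 have 3: "th (ta w) = ta (th w)" by (rule root_commute[OF s w(2,3,1)])
 show ?thesis
  by (rule rcong_trans[OF _ _ _ 1]) (use rcong_sym[OF _ _ 2] s w xc 3 in auto)
qed

section \<open>The Krull topology\<close>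

definition "Fix A = {th \<in> gal. \<forall>x\<in>A. th x = x}"

definition "Ktop = topology_generated_by
 {th <#\<^bsub>G\<^esub> Fix E |th E. th \<in> gal \<and> (subfield E F \<and> K \<subseteq> E \<and> finite_dimension K E)}"

lemma coset_Fix: "th \<in> gal ==> A \<subseteq> \<F> ==> th <#\<^bsub>G\<^esub> Fix A = {ta \<in> gal. \<forall>x\<in>A. ta x = th x}"
proof (intro subset_antisym subsetI)
 assume s: "th \<in> gal" and A: "A \<subseteq> \<F>"
 { fix ta assume "ta \<in> th <#\<^bsub>G\<^esub> Fix A"
  then obtain \<rho> where r: "\<rho> \<in> Fix A" "ta = th \<star> \<rho>" unfolding l_coset_def by auto
  thus "ta \<in> {ta \<in> gal. \<forall>x\<in>A. ta x = th x}" using s A G_mult unfolding Fix_def by auto }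
 { fix ta assume t: "ta \<in> {ta \<in> gal. \<forall>x\<in>A. ta x = th x}"
  let ?r = "\<iota> th \<star> ta"
  have "?r x = x" if "x \<in> A" for x
   using G_mult[of "\<iota> th" ta x] G_inv1[OF s, of x] s t that A by auto
  hence "?r \<in> Fix A" using s t unfolding Fix_def by auto
  moreover have "ta = th \<star> ?r"
   by (rule gal_eq) (use s t in "auto simp: G_mult G_inv2")
  ultimately show "ta \<in> th <#\<^bsub>G\<^esub> Fix A" unfolding l_coset_def by blast }
qed

text \<open>Automorphisms over \<open>K\<close> are \<open>K\<close>-linear, so a finite spanning
  set decides equality on a finite extension.\<close>

lemma Fix_span:
 assumes "finite_dimension K E" and "subfield E F"
 shows "\<exists>A. finite A \<and> A \<subseteq> \<F> \<and> (\<forall>th\<in>gal. \<forall>ta\<in>gal. (\<forall>x\<in>A. th x = ta x) --> (\<forall>x\<in>E. th x = ta x))"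
proof -
 obtain n where "dimension n K E" using assms(1) by blast
 then obtain Us where Us: "set Us \<subseteq> \<F>" "Span K Us = E" using exists_base[OF K_subfield] by blast
 have main: "th x = ta x" if s: "th \<in> gal" "ta \<in> gal" and "x \<in> Span K Vs" "set Vs \<subseteq> \<F>" "\<forall>u\<in>set Vs. th u = ta u"
  for th ta x Vs using that(3-5)
 proof (induction Vs arbitrary: x)
  case Nil
  thus ?case using gal_zero[OF s(1)] gal_zero[OF s(2)] by simp
 next
  case (Cons v Vs)
  obtain k w where k: "k \<in> K" "w \<in> Span K Vs" "x = k \<otimes> v \<oplus> w"
   using Cons.prems(1) line_extension_mem_iff by auto
  have wc: "w \<in> \<F>" using Span_in_carrier[OF K_carrier] Cons.prems(2) k(2) by auto
  have "th w = ta w" using Cons.IH[OF k(2)] Cons.prems by auto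
  moreover have "k \<in> \<F>" "v \<in> \<F>" using k K_carrier Cons.prems by auto
  ultimately show ?case unfolding k(3) using s k(1) wc Cons.prems(3) by (simp add: gal_add gal_mult gal_K)
 qed
 show ?thesis by (rule exI[of _ "set Us"]) (use Us main in auto)
qed

lemma finite_ext_of:
 assumes "finite A" "A \<subseteq> \<F>"
 shows "\<exists>E. A \<subseteq> E \<and> subfield E F \<and> K \<subseteq> E \<and> finite_dimension K E"
proof -
 obtain xs where xs: "set xs = A" using assms(1) finite_list by blast
 have alg: "(algebraic over K) x" if "x \<in> set xs" for x
 proof -
  have xc: "x \<in> \<F>" using that xs assms(2) by auto
  obtain P where P: "P \<noteq> []" "hd P \<noteq> \<zero>" "set P \<subseteq> Q" "eval P x = \<zero>" using algebraic_Q[OF xc] by blast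
  have "P \<in> carrier (K[X])" using P Q_K unfolding univ_poly_carrier[symmetric] polynomial_def by auto
  thus ?thesis using algebraicI[of P K x] P by auto
 qed
 have c: "set xs \<subseteq> \<F>" using xs assms by auto
 have "finite_dimension K (finite_extension K xs)" using finite_extension_finite_dimension(1)[OF K_subfield c alg] by blast
 moreover have "subfield (finite_extension K xs) F" using finite_extension_is_subfield[OF K_subfield c alg] by blast
 moreover have "K \<subseteq> finite_extension K xs" using finite_extension_incl[OF K_carrier c] alg by blast
 moreover have "A \<subseteq> finite_extension K xs" using finite_extension_mem[OF K_subring c] xs by blast
 ultimately show ?thesis by blast
qed

text \<open>Finite sets serve as well as finite extensions: an extension is controlled by a finite
  spanning set, and a finite set lies in a finite extension. Openness becomes a condition on
  finitely many values.\<close>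

theorem openin_Ktop:
 "openin Ktop N \<longleftrightarrow> N \<subseteq> gal \<and> (\<forall>th\<in>N. \<exists>A. finite A \<and> A \<subseteq> \<F> \<and> (\<forall>ta\<in>gal. (\<forall>x\<in>A. ta x = th x) --> ta \<in> N))"
 (is "_ \<longleftrightarrow> ?P N")
proof
 let ?B = "{th <#\<^bsub>G\<^esub> Fix E |th E. th \<in> gal \<and> (subfield E F \<and> K \<subseteq> E \<and> finite_dimension K E)}"
 assume "openin Ktop N"
 hence "generate_topology_on ?B N" unfolding Ktop_def openin_topology_generated_by_iff .
 thus "?P N"
 proof (induction rule: generate_topology_on.induct)
  case Empty
  show ?case by simp
 next
  case (Int a b)
  show ?case
  proof (intro conjI ballI)
   show "a \<inter> b \<subseteq> gal" using Int by auto
   fix th assume "th \<in> a \<inter> b"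
   hence ab: "th \<in> a" "th \<in> b" by auto
   from bspec[OF conjunct2[OF Int.IH(1)] ab(1)]
   obtain A where "finite A" "A \<subseteq> \<F>" "\<forall>ta\<in>gal. (\<forall>x\<in>A. ta x = th x) --> ta \<in> a"
    by (elim exE conjE)
   moreover from bspec[OF conjunct2[OF Int.IH(2)] ab(2)]
   obtain B where "finite B" "B \<subseteq> \<F>" "\<forall>ta\<in>gal. (\<forall>x\<in>B. ta x = th x) --> ta \<in> b"
    by (elim exE conjE)
   ultimately      show "\<exists>A. finite A \<and> A \<subseteq> \<F> \<and> (\<forall>ta\<in>gal. (\<forall>x\<in>A. ta x = th x) --> ta \<in> a \<inter> b)"
    by (intro exI[of _ "A \<union> B"]) auto
  qed
 next
  case (UN C)
  show ?case
  proof (intro conjI ballI)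
   show "\<Union>C \<subseteq> gal" using UN by blast
   fix th assume "th \<in> \<Union>C"
   then obtain k where k: "k \<in> C" "th \<in> k" by blast
   then obtain A where "finite A" "A \<subseteq> \<F>" "\<forall>ta\<in>gal. (\<forall>x\<in>A. ta x = th x) --> ta \<in> k" using UN.IH by metis
   thus "\<exists>A. finite A \<and> A \<subseteq> \<F> \<and> (\<forall>ta\<in>gal. (\<forall>x\<in>A. ta x = th x) --> ta \<in> \<Union>C)" using k(1) by blast
  qed
 next
  case (Basis s)
  then obtain \<rho> E where r: "s = \<rho> <#\<^bsub>G\<^esub> Fix E" "\<rho> \<in> gal" "subfield E F" "K \<subseteq> E" "finite_dimension K E" by blast
  have s: "s = {ta \<in> gal. \<forall>x\<in>E. ta x = \<rho> x}" unfolding r(1) by (rule coset_Fix[OF r(2) subfieldE(3)[OF r(3)]])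
  from Fix_span[OF r(5,3)] obtain A where A: "finite A" "A \<subseteq> \<F>"
   and A0: "\<forall>th\<in>gal. \<forall>ta\<in>gal. (\<forall>x\<in>A. th x = ta x) --> (\<forall>x\<in>E. th x = ta x)"
   by (elim exE conjE)
  show ?case
  proof (intro conjI ballI)
   show "s \<subseteq> gal" unfolding s by auto
   fix th assume sg: "th \<in> s"
   have "ta \<in> s" if "ta \<in> gal" "\<forall>x\<in>A. ta x = th x" for ta
   proof -
    have "th \<in> gal" using sg unfolding s by simp
    hence "\<forall>x\<in>E. ta x = th x" using A0 that by simp
    thus ?thesis using that(1) sg unfolding s by simp
   qed
   thus "\<exists>A. finite A \<and> A \<subseteq> \<F> \<and> (\<forall>ta\<in>gal. (\<forall>x\<in>A. ta x = th x) --> ta \<in> s)" using A(1,2) by blast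
  qed
 qed
next
 assume N: "?P N"
 show "openin Ktop N"
 proof (subst openin_subopen, intro ballI)
  fix th assume s: "th \<in> N"
  obtain A where A: "finite A" "A \<subseteq> \<F>" "\<And>ta. ta \<in> gal ==> \<forall>x\<in>A. ta x = th x ==> ta \<in> N" using N s by metis
  obtain E where E: "A \<subseteq> E" "subfield E F" "K \<subseteq> E" "finite_dimension K E" using finite_ext_of[OF A(1,2)] by blast
  have sg: "th \<in> gal" using N s by auto
  let ?T = "th <#\<^bsub>G\<^esub> Fix E"
  have T: "?T = {ta \<in> gal. \<forall>x\<in>E. ta x = th x}" by (rule coset_Fix[OF sg subfieldE(3)[OF E(2)]])
  have "openin Ktop ?T" unfolding Ktop_def by (rule topology_generated_by_Basis) (use sg E in blast)
  moreover have "th \<in> ?T" unfolding T using sg by simp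
  moreover have "?T \<subseteq> N" unfolding T using A(3) E(1) by blast
  ultimately show "\<exists>T. openin Ktop T \<and> th \<in> T \<and> T \<subseteq> N" by blast
 qed
qed

lemma topspace_Ktop: "topspace Ktop = gal"
proof
 show "topspace Ktop \<subseteq> gal" using openin_Ktop[of "topspace Ktop"] by simp
 have "openin Ktop gal" unfolding openin_Ktop by auto
 thus "gal \<subseteq> topspace Ktop" by (rule openin_subset)
qed

end

section \<open>A group-theoretic criterion for cyclotomic characters\<close>

text \<open>This property of \<open>s\<close> and \<open>c\<close> replaces the condition that \<open>s\<close> raises \<open>n\<close>-th roots of unity to the
power \<open>c\<close>. It only involves the topological group, so it is invariant under isomorphisms.\<close>

definition comm_crit :: "('g, 'm) monoid_scheme \<Rightarrow> 'g topology \<Rightarrow> nat \<Rightarrow> 'g \<Rightarrow> nat \<Rightarrow> bool" where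
 "comm_crit G T n s c \<longleftrightarrow> (\<forall>H f. subgroup H G -->
   (\<forall>g\<in>carrier G. \<forall>h\<in>H. g \<otimes>\<^bsub>G\<^esub> h \<otimes>\<^bsub>G\<^esub> inv\<^bsub>G\<^esub> g \<in> H) -->
   (\<forall>h\<in>H. \<forall>h'\<in>H. [f (h \<otimes>\<^bsub>G\<^esub> h') = f h + f h'] (mod int n)) -->
   openin T {h \<in> H. int n dvd f h} -->
   (\<forall>t\<in>carrier G. \<forall>a\<in>carrier G. \<forall>b\<in>carrier G. \<forall>h\<in>H.
    h = a \<otimes>\<^bsub>G\<^esub> b \<otimes>\<^bsub>G\<^esub> inv\<^bsub>G\<^esub> a \<otimes>\<^bsub>G\<^esub> inv\<^bsub>G\<^esub> b -->
    [f (s \<otimes>\<^bsub>G\<^esub> (t \<otimes>\<^bsub>G\<^esub> h \<otimes>\<^bsub>G\<^esub> inv\<^bsub>G\<^esub> t) \<otimes>\<^bsub>G\<^esub> inv\<^bsub>G\<^esub> s) - int c * f (t \<otimes>\<^bsub>G\<^esub> h \<otimes>\<^bsub>G\<^esub> inv\<^bsub>G\<^esub> t)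
     = f (s \<otimes>\<^bsub>G\<^esub> h \<otimes>\<^bsub>G\<^esub> inv\<^bsub>G\<^esub> s) - int c * f h] (mod int n)))"

section \<open>Kummer theory and the commutator criterion\<close>

context padic_galois
begin

sublocale GG: Group.group G by (rule G_group)

lemma gal_finsum: "th \<in> gal ==> finite A ==> (\<And>i. i \<in> A ==> f i \<in> \<F>) ==> th (\<Oplus>i\<in>A. f i) = (\<Oplus>i\<in>A. th (f i))"
proof -
 assume s: "th \<in> gal" and fin: "finite A" and f: "\<And>i. i \<in> A ==> f i \<in> \<F>"
 show ?thesis using fin f
 proof (induction A rule: finite_induct)
  case (insert a A)
  have 1: "(\<Oplus>i\<in>insert a A. f i) = f a \<oplus> (\<Oplus>i\<in>A. f i)" using insert by (intro finsum_insert) auto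
  have 2: "(\<Oplus>i\<in>insert a A. th (f i)) = th (f a) \<oplus> (\<Oplus>i\<in>A. th (f i))" using insert s by (intro finsum_insert) auto
  have "(\<Oplus>i\<in>A. f i) \<in> \<F>" using insert by (intro finsum_closed) auto
  thus ?case unfolding 1 2 using insert s by (simp add: gal_add)
 qed (simp add: gal_zero s)
qed

text \<open>Independence of characters with test elements restricted to \<open>E\<close>. Distinct
  automorphisms are told apart on \<open>A\<close>, and \<open>E\<close> is stable under
  multiplication by \<open>A\<close>, so the usual elimination stays inside
  \<open>E\<close>.\<close>

lemma dedekind:
 assumes "finite R" "R \<subseteq> gal" "\<And>r r'. r \<in> R ==> r' \<in> R ==> r \<noteq> r' ==> \<exists>t\<in>A. r t \<noteq> r' t"
  and E: "\<one> \<in> E" "E \<subseteq> \<F>" "\<And>t y. t \<in> A ==> y \<in> E ==> t \<otimes> y \<in> E" and A: "A \<subseteq> \<F>"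
  and "\<And>r. r \<in> R ==> c r \<in> \<F>" "\<And>y. y \<in> E ==> (\<Oplus>r\<in>R. c r \<otimes> r y) = \<zero>"
 shows "\<forall>r\<in>R. c r = \<zero>"
 using assms(1,2,3,8,9)
proof (induction R arbitrary: c rule: finite_induct)
 case (insert q R)
 have qg: "q \<in> gal" and Rg: "R \<subseteq> gal" and cq: "c q \<in> \<F>" and cR: "\<And>r. r \<in> R ==> c r \<in> \<F>"
  using insert.prems by auto
 have ins: "c q \<otimes> q y \<oplus> (\<Oplus>r\<in>R. c r \<otimes> r y) = \<zero>" if y: "y \<in> E" for y
 proof -
  have yc: "y \<in> \<F>" using y E(2) by auto
  have "(\<Oplus>r\<in>insert q R. c r \<otimes> r y) = c q \<otimes> q y \<oplus> (\<Oplus>r\<in>R. c r \<otimes> r y)"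
   by (intro finsum_insert) (use insert.hyps cq cR qg Rg yc in "auto simp: subset_iff")
  thus ?thesis using insert.prems(4)[OF y] by simp
 qed
 have R0: "c r = \<zero>" if r: "r \<in> R" for r
 proof -
  have "r \<noteq> q" using insert.hyps r by auto
  then obtain t where t: "t \<in> A" "q t \<noteq> r t" using insert.prems(2)[of q r] r by auto
  have tc: "t \<in> \<F>" using t A by auto
  \<comment> \<open>These are the coefficients left after subtracting \<open>q t\<close> times the
    relation at \<open>y\<close> from the relation at \<open>t y\<close>; the term of
    \<open>q\<close> cancels.\<close>
  let ?c = "\<lambda>r. c r \<otimes> (r t \<ominus> q t)"
  have "\<forall>r\<in>R. ?c r = \<zero>"
  proof (rule insert.IH[OF Rg])
   show "\<exists>t\<in>A. r t \<noteq> r' t" if "r \<in> R" "r' \<in> R" "r \<noteq> r'" for r r' using insert.prems(2) that by auto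
   show "?c r \<in> \<F>" if "r \<in> R" for r using cR[OF that] Rg that tc qg by auto
   fix y assume y: "y \<in> E"
   have yc: "y \<in> \<F>" using y E(2) by auto
   have rg: "r \<in> gal" if "r \<in> R" for r using Rg that by auto
   define S1 where "S1 = (\<Oplus>r\<in>R. c r \<otimes> r (t \<otimes> y))"
   define S2 where "S2 = (\<Oplus>r\<in>R. c r \<otimes> r y)"
   have Sc: "S1 \<in> \<F>" "S2 \<in> \<F>" unfolding S1_def S2_def
    using cR rg tc yc by (auto intro!: finsum_closed)
   have e1: "c q \<otimes> (q t \<otimes> q y) \<oplus> S1 = \<zero>" unfolding S1_def using ins[OF E(3)[OF t(1) y]] gal_mult[OF qg tc yc] by simp
   have e2: "c q \<otimes> q y \<oplus> S2 = \<zero>" unfolding S2_def by (rule ins[OF y])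
   have "(\<Oplus>r\<in>R. ?c r \<otimes> r y) = (\<Oplus>r\<in>R. c r \<otimes> r (t \<otimes> y) \<oplus> (\<ominus> (q t)) \<otimes> (c r \<otimes> r y))"
   proof (rule finsum_cong')
    fix r assume r: "r \<in> R"
    have cc: "c r \<in> \<F>" "r t \<in> \<F>" "q t \<in> \<F>" "r y \<in> \<F>" using cR[OF r] rg[OF r] qg tc yc by auto
    show "?c r \<otimes> r y = c r \<otimes> r (t \<otimes> y) \<oplus> (\<ominus> (q t)) \<otimes> (c r \<otimes> r y)"
     unfolding gal_mult[OF rg[OF r] tc yc] using cc by algebra
   qed (use cR rg tc yc qg in auto)
   also have "\<dots> = S1 \<oplus> (\<Oplus>r\<in>R. (\<ominus> (q t)) \<otimes> (c r \<otimes> r y))" unfolding S1_def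
    by (rule finsum_addf) (use cR rg tc yc qg in auto)
   also have "(\<Oplus>r\<in>R. (\<ominus> (q t)) \<otimes> (c r \<otimes> r y)) = (\<ominus> (q t)) \<otimes> S2" unfolding S2_def
    by (rule finsum_rdistr[symmetric]) (use insert.hyps cR rg tc yc qg in auto)
   finally have eq: "(\<Oplus>r\<in>R. ?c r \<otimes> r y) = S1 \<oplus> (\<ominus> (q t)) \<otimes> S2" .
   have qc: "q t \<in> \<F>" "q y \<in> \<F>" using qg tc yc by auto
   have "S1 \<oplus> (\<ominus> (q t)) \<otimes> S2 = (c q \<otimes> (q t \<otimes> q y) \<oplus> S1) \<ominus> q t \<otimes> (c q \<otimes> q y \<oplus> S2)"
    using Sc qc cq by algebra
   thus "(\<Oplus>r\<in>R. ?c r \<otimes> r y) = \<zero>" unfolding eq e1 e2 using qc by simp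
  qed
  hence "c r \<otimes> (r t \<ominus> q t) = \<zero>" using r by blast
  moreover have "r t \<in> \<F>" "q t \<in> \<F>" using Rg r qg tc by auto
  ultimately show ?thesis using integral[of "c r" "r t \<ominus> q t"] cR[OF r] t(2) by (auto simp: r_right_minus_eq)
 qed
 have "(\<Oplus>r\<in>R. c r \<otimes> r \<one>) = \<zero>"
  by (rule add.finprod_one_eqI) (use R0 Rg in auto)
 hence "c q \<otimes> q \<one> = \<zero>" using ins[OF E(1)] cq qg by simp
 hence "c q = \<zero>" using cq gal_one[OF qg] by simp
 thus ?case using R0 by simp
qed simp

text \<open>Hilbert 90 by a Lagrange resolvent. On the elements of \<open>H\<close> fixing
  \<open>z\<close>, sending \<open>h\<close> to \<open>z ^ f h\<close> is a character with open
  kernel. It depends only on the restriction to a finite set \<open>A\<close>, so a finite set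
  \<open>R\<close> of representatives plays the role of the finite quotient group.\<close>

lemma kummer:
 assumes z: "prim z n" and H: "subgroup H G"
  and f: "\<And>h h'. h \<in> H ==> h' \<in> H ==> [f (h \<star> h') = f h + f h'] (mod int n)"
  and N: "openin Ktop {h \<in> H. int n dvd f h}"
 shows "\<exists>a\<in>\<F>. a \<noteq> \<zero> \<and> (\<forall>h\<in>H. h z = z --> h a = z [^] nat (f h mod int n) \<otimes> a)"
proof -
 note zz = primD(1-3)[OF z]
 have n0: "int n > 0" using zz by simp
 have Hg: "H \<subseteq> gal" using subgroup.subset[OF H] by simp
 note Hcl = subgroup.m_closed[OF H] subgroup.m_inv_closed[OF H] subgroup.one_closed[OF H]
 define e where "e = (\<lambda>h. nat (f h mod int n))"
 have ie: "[int (e h) = f h] (mod int n)" for h unfolding e_def using n0 by (simp add: cong_def)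
 have e_mult: "[e (h \<star> h') = e h + e h'] (mod n)" if "h \<in> H" "h' \<in> H" for h h'
 proof -
  have "[int (e (h \<star> h')) = int (e h) + int (e h')] (mod int n)"
   using cong_trans[OF cong_trans[OF ie f[OF that]] cong_sym[OF cong_add[OF ie ie]]] .
  thus ?thesis using cong_int_iff by (metis of_nat_add)
 qed
 let ?N = "{h \<in> H. int n dvd f h}"
 have "\<one>\<^bsub>G\<^esub> \<in> ?N"
 proof -
  have "[f (\<one>\<^bsub>G\<^esub> \<star> \<one>\<^bsub>G\<^esub>) = f \<one>\<^bsub>G\<^esub> + f \<one>\<^bsub>G\<^esub>] (mod int n)" by (rule f[OF Hcl(3) Hcl(3)])
  hence "[f \<one>\<^bsub>G\<^esub> + 0 = f \<one>\<^bsub>G\<^esub> + f \<one>\<^bsub>G\<^esub>] (mod int n)" by simp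
  hence "[0 = f \<one>\<^bsub>G\<^esub>] (mod int n)" by (simp only: cong_add_lcancel)
  hence "[f \<one>\<^bsub>G\<^esub> = 0] (mod int n)" by (rule cong_sym)
  thus ?thesis using Hcl(3) by (simp add: cong_0_iff)
 qed
 moreover have "\<forall>th\<in>?N. \<exists>A. finite A \<and> A \<subseteq> \<F> \<and> (\<forall>ta\<in>gal. (\<forall>x\<in>A. ta x = th x) --> ta \<in> ?N)"
  using N unfolding openin_Ktop by (rule conjunct2)
 ultimately have "\<exists>A. finite A \<and> A \<subseteq> \<F> \<and> (\<forall>ta\<in>gal. (\<forall>x\<in>A. ta x = \<one>\<^bsub>G\<^esub> x) --> ta \<in> ?N)"
  by (rule bspec[rotated])
 then obtain A0 where A0: "finite A0" "A0 \<subseteq> \<F>" "\<forall>ta\<in>gal. (\<forall>x\<in>A0. ta x = \<one>\<^bsub>G\<^esub> x) --> ta \<in> ?N"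
  by (elim exE conjE)
 define A where "A = insert z A0"
 have A: "finite A" "A \<subseteq> \<F>" "z \<in> A" using A0 zz unfolding A_def by auto
 have AN: "ta \<in> H \<and> int n dvd f ta" if "ta \<in> gal" "\<forall>x\<in>A. ta x = x" for ta
 proof -
  have "\<forall>x\<in>A0. ta x = \<one>\<^bsub>G\<^esub> x" using that(2) A0(2) G_one unfolding A_def by (auto simp: subset_iff)
  thus ?thesis using A0(3) that(1) by blast
 qed
 define H' where "H' = {h \<in> H. h z = z}"
 have H'g: "H' \<subseteq> gal" "H' \<subseteq> H" using Hg unfolding H'_def by auto
 have H'm: "h \<star> h' \<in> H'" if "h \<in> H'" "h' \<in> H'" for h h'
  using that Hcl(1) Hg G_mult[of h h' z] zz unfolding H'_def by auto
 have e_agree: "[e h = e h'] (mod n)" if h: "h \<in> H'" "h' \<in> H'" and "\<forall>x\<in>A. h x = h' x" for h h'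
 proof -
  let ?k = "\<iota> h \<star> h'"
  have hg: "h \<in> gal" "h' \<in> gal" using h H'g by auto
  have "?k x = x" if "x \<in> A" for x
   using that A(2) hg \<open>\<forall>x\<in>A. h x = h' x\<close> G_mult[of "\<iota> h" h' x] G_inv1[OF hg(1), of x] by auto
  hence k: "?k \<in> H" "int n dvd f ?k" using AN[of ?k] hg by auto
  have "h \<star> ?k = h'" by (rule gal_eq) (use hg in "auto simp: G_mult G_inv2")
  hence "[f h' = f h + f ?k] (mod int n)" using f[of h ?k] h H'g k(1) by auto
  moreover have "[f h + f ?k = f h + 0] (mod int n)" using k(2) by (intro cong_add cong_refl) (simp add: cong_0_iff)
  ultimately have "[f h' = f h] (mod int n)" using cong_trans by fastforce
  hence "[int (e h) = int (e h')] (mod int n)" using cong_trans[OF ie cong_trans[OF cong_sym cong_sym[OF ie]]] by blast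
  thus ?thesis by (simp only: cong_int_iff)
 qed
 \<comment> \<open>The choice depends only on the values on \<open>A\<close>, so elements with equal
   values on \<open>A\<close> have the same representative.\<close>
 define rep where "rep = (\<lambda>h. SOME r. r \<in> H' \<and> (\<forall>x\<in>A. r x = h x))"
 have rep: "rep h \<in> H'" "\<forall>x\<in>A. rep h x = h x" if "h \<in> H'" for h
  using someI[of "\<lambda>r. r \<in> H' \<and> (\<forall>x\<in>A. r x = h x)" h] that unfolding rep_def by auto
 have rep_eq: "rep h = rep h'" if "\<forall>x\<in>A. h x = h' x" for h h'
 proof -
  have "(\<lambda>r. r \<in> H' \<and> (\<forall>x\<in>A. r x = h x)) = (\<lambda>r. r \<in> H' \<and> (\<forall>x\<in>A. r x = h' x))" using that by auto
  thus ?thesis unfolding rep_def by simp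
 qed
 define R where "R = rep ` H'"
 have RH: "R \<subseteq> H'" unfolding R_def using rep by auto
 have Rg: "R \<subseteq> gal" using RH H'g by auto
 have repR: "rep r = r" if "r \<in> R" for r
 proof -
  from that obtain h where "h \<in> H'" "r = rep h" unfolding R_def by blast
  thus ?thesis using rep_eq[of "rep h" h] rep by auto
 qed
 have finR: "finite R"
 proof -
  let ?T = "PiE A (\<lambda>x. {th x |th. th \<in> gal})"
  have "finite ?T" using A orbit_finite by (intro finite_PiE) auto
  have "R \<subseteq> rep ` ?T"
  proof
   fix r assume "r \<in> R"
   then obtain h where h: "h \<in> H'" "r = rep h" unfolding R_def by auto
   have "restrict h A \<in> ?T" using h H'g by auto
   moreover have "rep h = rep (restrict h A)" by (rule rep_eq) simp
   ultimately show "r \<in> rep ` ?T" using h by blast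
  qed
  thus ?thesis using \<open>finite ?T\<close> finite_subset by blast
 qed
 \<comment> \<open>\<open>E\<close> is the field fixed by all automorphisms that fix
   \<open>A\<close> pointwise. On it, automorphisms that agree on \<open>A\<close> coincide, so a
   product may be replaced by its representative.\<close>
 define E where "E = {x \<in> \<F>. \<forall>ta\<in>gal. (\<forall>x\<in>A. ta x = x) --> ta x = x}"
 have E: "\<one> \<in> E" "E \<subseteq> \<F>" "\<And>t y. t \<in> A ==> y \<in> E ==> t \<otimes> y \<in> E"
  unfolding E_def using A(2) by (auto simp: gal_one gal_mult subset_iff)
 have Eagree: "h y = h' y" if "h \<in> gal" "h' \<in> gal" "\<forall>x\<in>A. h x = h' x" "y \<in> E" for h h' y
 proof -
  let ?k = "\<iota> h \<star> h'"
  have yc: "y \<in> \<F>" using that(4) E(2) by auto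
  have "?k x = x" if "x \<in> A" for x
   using that A(2) \<open>h \<in> gal\<close> \<open>h' \<in> gal\<close> \<open>\<forall>x\<in>A. h x = h' x\<close> G_mult[of "\<iota> h" h' x] G_inv1[of h x] by auto
  hence "?k y = y" using that(1,2,4) unfolding E_def by auto
  hence "(\<iota> h) (h' y) = y" using G_mult[of "\<iota> h" h' y] that(1,2) yc by simp
  thus ?thesis using G_inv2[of h "h' y"] that(1,2) yc by simp
 qed
 \<comment> \<open>The exponent \<open>e r * (n - 1)\<close> stands for \<open>- e r\<close> modulo
   \<open>n\<close>.\<close>
 define w where "w = (\<lambda>r. z [^] (e r * (n - 1)))"
 have wc: "w r \<in> \<F>" "w r \<noteq> \<zero>" for r
  unfolding w_def using zz pow_nonzero[OF zz(2) prim_nonzero[OF z]] by auto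
 have "\<exists>y\<in>E. (\<Oplus>r\<in>R. w r \<otimes> r y) \<noteq> \<zero>"
 proof (rule ccontr)
  assume "\<not> ?thesis"
  hence "\<forall>r\<in>R. w r = \<zero>"
   by (intro dedekind[OF finR Rg _ E A(2)]) (use repR rep_eq wc in metis)+
  moreover have "rep \<one>\<^bsub>G\<^esub> \<in> R" unfolding R_def using Hcl(3) G_one zz(2) by (auto simp: H'_def)
  ultimately show False using wc by blast
 qed
 then obtain y where y: "y \<in> E" "(\<Oplus>r\<in>R. w r \<otimes> r y) \<noteq> \<zero>" by blast
 have yc: "y \<in> \<F>" using y E by auto
 define a where "a = (\<Oplus>r\<in>R. w r \<otimes> r y)"
 have rc: "w r \<otimes> r y \<in> \<F>" if "r \<in> R" for r using wc Rg that yc by auto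
 have ac: "a \<in> \<F>" unfolding a_def using rc by (intro finsum_closed) auto
 have "h a = z [^] e h \<otimes> a" if h: "h \<in> H'" for h
 proof -
  have hg: "h \<in> gal" "h z = z" using h H'g unfolding H'_def by auto
  \<comment> \<open>Left multiplication by \<open>h\<close> permutes the representatives, which
    reindexes the resolvent.\<close>
  define \<psi> where "\<psi> = (\<lambda>r. rep (h \<star> r))"
  have hr: "h \<star> r \<in> H'" if "r \<in> R" for r using H'm[OF h] RH that by auto
  have \<psi>R: "\<psi> ` R \<subseteq> R" unfolding \<psi>_def R_def using hr unfolding R_def by auto
  have inj: "inj_on \<psi> R"
  proof (rule inj_onI)
   fix r r' assume r: "r \<in> R" "r' \<in> R" "\<psi> r = \<psi> r'"
   have rg: "r \<in> gal" "r' \<in> gal" using r Rg by auto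
   have "r x = r' x" if x: "x \<in> A" for x
   proof -
    have xc: "x \<in> \<F>" using x A by auto
    have "(h \<star> r) x = (h \<star> r') x" using rep(2)[OF hr[OF r(1)]] rep(2)[OF hr[OF r(2)]] r(3) x unfolding \<psi>_def by metis
    thus ?thesis using G_mult hg(1) rg xc gal_inj[OF hg(1)] by simp
   qed
   hence "rep r = rep r'" by (intro rep_eq) auto
   thus "r = r'" using repR r by simp
  qed
  have surj: "\<psi> ` R = R" by (rule endo_inj_surj[OF finR \<psi>R inj])
  have hw: "h (w r \<otimes> r y) = z [^] e h \<otimes> (w (\<psi> r) \<otimes> (\<psi> r) y)" if r: "r \<in> R" for r
  proof -
   have rg: "r \<in> gal" using r Rg by auto
   have 1: "h (w r) = w r" unfolding w_def using gal_pow[OF hg(1) zz(2)] hg(2) by simp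
   have 2: "h (r y) = (\<psi> r) y"
    using Eagree[of "\<psi> r" "h \<star> r" y] rep[OF hr[OF r]] H'g hg(1) rg y(1) G_mult[OF hg(1) rg yc] unfolding \<psi>_def by auto
   have 3: "w r = z [^] e h \<otimes> w (\<psi> r)"
   proof -
    have "[e (\<psi> r) = e (h \<star> r)] (mod n)" unfolding \<psi>_def using rep[OF hr[OF r]] hr[OF r] by (intro e_agree) auto
    moreover have "[e (h \<star> r) = e h + e r] (mod n)" by (rule e_mult) (use h r RH H'g in auto)
    ultimately have 1: "[e (\<psi> r) = e h + e r] (mod n)" by (rule cong_trans)
    have "[e h + e (\<psi> r) * (n - 1) = e h + (e h + e r) * (n - 1)] (mod n)"
     by (intro cong_add cong_mult cong_refl 1)
    also have "e h + (e h + e r) * (n - 1) = e r * (n - 1) + e h * n"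
     using zz(1) by (cases n) (auto simp: algebra_simps)
    also have "[e r * (n - 1) + e h * n = e r * (n - 1) + 0] (mod n)" by (intro cong_add cong_refl) (simp add: cong_0_iff)
    finally have "z [^] (e r * (n - 1)) = z [^] (e h + e (\<psi> r) * (n - 1))"
     unfolding prim_pow_eq[OF z] using cong_sym by simp
    thus ?thesis unfolding w_def using zz(2) by (simp add: nat_pow_mult)
   qed
   have pc: "\<psi> r y \<in> \<F>" using \<psi>R r Rg yc by (auto simp: subset_iff image_subset_iff)
   have "h (w r \<otimes> r y) = w r \<otimes> \<psi> r y" using gal_mult[OF hg(1) wc(1)] rg yc 1 2 by simp
   also have "\<dots> = (z [^] e h \<otimes> w (\<psi> r)) \<otimes> \<psi> r y" by (subst 3) (rule refl)
   finally show ?thesis using pc wc zz(2) by (simp add: m_assoc)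
  qed
  have "h a = (\<Oplus>r\<in>R. h (w r \<otimes> r y))" unfolding a_def by (rule gal_finsum[OF hg(1) finR rc])
  also have "\<dots> = (\<Oplus>r\<in>R. z [^] e h \<otimes> (w (\<psi> r) \<otimes> (\<psi> r) y))"
   by (rule finsum_cong') (use hw rc \<psi>R zz(2) in auto)
  also have "\<dots> = z [^] e h \<otimes> (\<Oplus>r\<in>R. w (\<psi> r) \<otimes> (\<psi> r) y)"
   by (rule finsum_rdistr[symmetric]) (use finR rc \<psi>R zz(2) in auto)
  also have "(\<Oplus>r\<in>R. w (\<psi> r) \<otimes> (\<psi> r) y) = (\<Oplus>r\<in>\<psi> ` R. w r \<otimes> r y)"
   by (rule finsum_reindex[symmetric]) (use rc \<psi>R inj in auto)
  finally show ?thesis unfolding surj a_def .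
 qed
 thus ?thesis using ac y(2) unfolding H'_def e_def a_def by (intro bexI[of _ a]) (auto simp: a_def)
qed

lemma conj_app: "g \<in> gal ==> h \<in> gal ==> x \<in> \<F> ==> (g \<star> h \<star> \<iota> g) x = g (h ((\<iota> g) x))"
 by (simp add: G_mult)

text \<open>The Galois action on \<open>n\<close>-th roots of unity is abelian, so the stabilizer of
  a root is normal and contains all commutators. Commutators can thus stand for elements fixing
  \<open>z\<close> in a condition that must not mention \<open>z\<close>.\<close>

lemma root_stabilizer:
 assumes z: "z \<in> \<F>" "z [^] (n::nat) = \<one>" "n > 0"
 shows "subgroup {h \<in> gal. h z = z} G"
  and "g \<in> gal ==> h \<in> gal ==> h z = z ==> (g \<star> h \<star> \<iota> g) z = z"
  and "g \<in> gal ==> h \<in> gal ==> (g \<star> h \<star> \<iota> g \<star> \<iota> h) z = z"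
proof -
 show "subgroup {h \<in> gal. h z = z} G"
 proof (rule subgroup.intro)
  fix h assume "h \<in> {h \<in> gal. h z = z}"
  thus "\<iota> h \<in> {h \<in> gal. h z = z}" using G_inv1[of h z] z(1) by auto
 qed (use z(1) in "auto simp: G_mult G_one")
next
 assume g: "g \<in> gal" "h \<in> gal"
 have ig: "\<iota> g \<in> gal" "\<iota> h \<in> gal" using g by auto
 show "(g \<star> h \<star> \<iota> g) z = z" if "h z = z"
  using conj_app[OF g z(1)] root_commute[OF g(2) ig(1) z] G_inv2[OF g(1) z(1)] that by simp
 have "(g \<star> h \<star> \<iota> g \<star> \<iota> h) z = g (h ((\<iota> g) ((\<iota> h) z)))"
  using g ig z(1) by (simp add: G_mult)
 also have "(\<iota> g) ((\<iota> h) z) = (\<iota> h) ((\<iota> g) z)" by (rule root_commute[OF ig z])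
 finally show "(g \<star> h \<star> \<iota> g \<star> \<iota> h) z = z"
  using G_inv2[OF g(2), of "(\<iota> g) z"] G_inv2[OF g(1) z(1)] ig z(1) by simp
qed

text \<open>Let \<open>al\<close> be the Kummer generator of \<open>f\<close> and \<open>u\<close>
  the unit with \<open>th^-1 al = al u\<close>. Computing \<open>k (th^-1 al)\<close> in two ways
  shows that \<open>z\<close> to the power \<open>f (th k th^-1) - c f k\<close> is
  \<open>(k u / u) ^ c\<close>. For \<open>k = h\<close> and \<open>k = t h t^-1\<close> the
  residues of \<open>k u\<close> agree, since residual automorphisms commute, and roots of unity of
  order prime to \<open>p\<close> are determined by their residues.\<close>

theorem comm_crit_of_acts:
 assumes n: "\<not> p dvd n" and s: "th \<in> gal" and c: "acts th n c"
 shows "comm_crit G Ktop n th c"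
 unfolding comm_crit_def
proof (intro allI impI ballI)
 fix H and f :: "('a \<Rightarrow> 'a) \<Rightarrow> int" and t a b h
 assume H: "subgroup H G" and norm: "\<forall>g\<in>carrier G. \<forall>h\<in>H. g \<star> h \<star> \<iota> g \<in> H"
  and f: "\<forall>h\<in>H. \<forall>h'\<in>H. [f (h \<star> h') = f h + f h'] (mod int n)"
  and N: "openin Ktop {h \<in> H. int n dvd f h}"
  and ta: "t \<in> carrier G" "a \<in> carrier G" "b \<in> carrier G" and h: "h \<in> H"
  and hab: "h = a \<star> b \<star> \<iota> a \<star> \<iota> b"
 have n0: "n > 0" using n by (cases n) auto
 obtain z where z: "prim z n" using ex_prim[OF n0] by blast
 note zz = primD(1-3)[OF z]
 have Hg: "H \<subseteq> gal" using subgroup.subset[OF H] by simp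
 have tg: "t \<in> gal" "a \<in> gal" "b \<in> gal" "h \<in> gal" using ta h Hg by auto
 obtain al where al: "al \<in> \<F>" "al \<noteq> \<zero>" "\<And>h. h \<in> H ==> h z = z ==> h al = z [^] nat (f h mod int n) \<otimes> al"
  using kummer[OF z H _ N] f by blast
 define e where "e = (\<lambda>h. nat (f h mod int n))"
 have ie: "[int (e h) = f h] (mod int n)" for h unfolding e_def using n0 by (simp add: cong_def)
 let ?s = "\<iota> th"
 have s': "?s \<in> gal" using s by simp
 obtain u where u: "u \<in> Oint" "u \<notin> mx" "?s al = al \<otimes> u" using gal_unit[OF s' al(1,2)] by blast
 have uc: "u \<in> \<F>" using u O_carrier by auto
 let ?h2 = "t \<star> h \<star> \<iota> t"
 have h2: "?h2 \<in> H" using norm ta h by blast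
 have root: "(z [^] (i::nat)) \<in> \<F>" "(z [^] i) [^] n = \<one>" for i
 proof -
  show "(z [^] i) [^] n = \<one>" using zz primD(4)[OF z, of "i * n"] by (simp add: nat_pow_pow)
  show "(z [^] i) \<in> \<F>" using zz by auto
 qed
 have gz: "g z \<in> \<F>" "(g z) [^] n = \<one>" if "g \<in> gal" for g
  using gal_pow[OF that zz(2), of n] that zz gal_one[OF that] by auto
 note stab = root_stabilizer[OF zz(2,3) n0]
 have hz: "h z = z" unfolding hab by (rule stab(3)[OF tg(2,3)])
 have h2z: "?h2 z = z" by (rule stab(2)[OF tg(1,4) hz])
 \<comment> \<open>On roots of unity \<open>th\<close> is the \<open>c\<close>-th power map, so
   taking \<open>c\<close>-th powers turns \<open>th^-1 z\<close> back into \<open>z\<close> and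
   removes it from the relation.\<close>
 have cz: "(?s z) [^] c = z"
 proof -
  have "th z = z [^] c" using c zz unfolding acts_def by blast
  hence "?s (z [^] c) = z" using G_inv1[OF s zz(2)] by simp
  thus ?thesis using gal_pow[OF s' zz(2)] by simp
 qed
 have rel: "z [^] (e k * c) \<otimes> (k u) [^] c = z [^] e (th \<star> k \<star> \<iota> th) \<otimes> u [^] c"
  if k: "k \<in> H" "k z = z" for k
 proof -
  have kg: "k \<in> gal" using k Hg by auto
  let ?k' = "th \<star> k \<star> \<iota> th"
  have k': "?k' \<in> H" "?k' \<in> gal" using norm s k Hg by auto
  have kz: "?k' z = z" by (rule stab(2)[OF s kg k(2)])
  have ku: "k u \<in> \<F>" using kg uc by simp
  have e1: "k (?s al) = z [^] e k \<otimes> al \<otimes> k u"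
   unfolding u(3) gal_mult[OF kg al(1) uc] using al(3)[OF k] unfolding e_def by simp
  have "?k' al = z [^] e ?k' \<otimes> al" using al(3)[OF k'(1) kz] unfolding e_def .
  hence "th (k (?s al)) = z [^] e ?k' \<otimes> al" using conj_app[OF s kg al(1)] by simp
  hence "k (?s al) = ?s (z [^] e ?k' \<otimes> al)" using G_inv1[OF s, of "k (?s al)"] kg s' al(1) by simp
  also have "\<dots> = (?s z) [^] e ?k' \<otimes> (al \<otimes> u)" using gal_mult[OF s' root(1) al(1)] gal_pow[OF s' zz(2)] u(3) by simp
  finally have "(z [^] e k \<otimes> al \<otimes> k u) [^] c = ((?s z) [^] e ?k' \<otimes> (al \<otimes> u)) [^] c" unfolding e1 by simp
  moreover have "(z [^] e k \<otimes> al \<otimes> k u) [^] c = al [^] c \<otimes> (z [^] (e k * c) \<otimes> (k u) [^] c)"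
   using zz(2) al(1) ku by (simp add: nat_pow_distrib nat_pow_pow m_ac)
  moreover have "((?s z) [^] e ?k' \<otimes> (al \<otimes> u)) [^] c = al [^] c \<otimes> (((?s z) [^] c) [^] e ?k' \<otimes> u [^] c)"
   using gz(1)[OF s'] al(1) uc by (simp add: nat_pow_distrib nat_pow_pow m_ac mult.commute)
  ultimately have "al [^] c \<otimes> (z [^] (e k * c) \<otimes> (k u) [^] c) = al [^] c \<otimes> (z [^] e ?k' \<otimes> u [^] c)" unfolding cz by simp
  moreover have "al [^] c \<noteq> \<zero>" using pow_nonzero al by blast
  ultimately show ?thesis using m_lcancel[of "al [^] c"] al(1) zz(2) ku uc by simp
 qed
 have hu: "h u \<doteq> ?h2 u"
 proof -
  have ic: "\<iota> t \<in> gal" using tg by simp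
  have itu: "(\<iota> t) u \<in> Oint" "(\<iota> t) u \<in> \<F>" using gal_O[OF ic u(1)] O_carrier by auto
  have "t (h ((\<iota> t) u)) \<doteq> h (t ((\<iota> t) u))" by (rule residue_commute[OF tg(1,4) itu(1)])
  hence "?h2 u \<doteq> h u" using conj_app[OF tg(1,4) uc] G_inv2[OF tg(1) uc] by simp
  moreover have "?h2 u \<in> \<F>" "h u \<in> \<F>" using h2 Hg tg uc by auto
  ultimately show ?thesis using rcong_sym by blast
 qed
 let ?e1 = "e (th \<star> h \<star> \<iota> th)" and ?e2 = "e (th \<star> ?h2 \<star> \<iota> th)"
 define v1 v2 where "v1 = (h u) [^] c" and "v2 = (?h2 u) [^] c"
 have h2g: "?h2 \<in> gal" using h2 Hg by auto
 have v: "v1 \<in> Oint" "v2 \<in> Oint" unfolding v1_def v2_def using gal_O[OF tg(4) u(1)] gal_O[OF h2g u(1)] O_pow by auto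
 have vc: "v1 \<in> \<F>" "v2 \<in> \<F>" using v O_carrier by auto
 have v12: "v1 \<doteq> v2" unfolding v1_def v2_def
  by (rule rcong_pow[OF gal_O[OF tg(4) u(1)] gal_O[OF h2g u(1)] hu])
 have v1u: "v1 \<notin> mx"
 proof
  assume "v1 \<in> mx"
  hence "h u \<in> mx" using mx_pow gal_O[OF tg(4) u(1)] unfolding v1_def by blast
  hence "(\<iota> h) (h u) \<in> mx" using gal_mx tg(4) by simp
  thus False using G_inv1[OF tg(4) uc] u(2) by simp
 qed
 have r1: "z [^] (e h * c) \<otimes> v1 = z [^] ?e1 \<otimes> u [^] c" unfolding v1_def by (rule rel[OF h hz])
 have r2: "z [^] (e ?h2 * c) \<otimes> v2 = z [^] ?e2 \<otimes> u [^] c" unfolding v2_def by (rule rel[OF h2 h2z])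
 \<comment> \<open>Cross-multiplying the two relations eliminates \<open>u ^ c\<close> and keeps all
   exponents nonnegative.\<close>
 define Xa Ya where "Xa = z [^] (e h * c + ?e2)" and "Ya = z [^] (e ?h2 * c + ?e1)"
 have XY: "Xa \<in> \<F>" "Ya \<in> \<F>" "Xa [^] n = \<one>" "Ya [^] n = \<one>" unfolding Xa_def Ya_def using root by auto
 have XYO: "Xa \<in> Oint" "Ya \<in> Oint" using root_of_unity_O XY n0 by auto
 have "Xa \<otimes> v1 = z [^] ?e2 \<otimes> (z [^] (e h * c) \<otimes> v1)" unfolding Xa_def using zz(2) vc
  by (simp add: nat_pow_mult[symmetric] m_ac)
 also have "\<dots> = z [^] ?e1 \<otimes> (z [^] (e ?h2 * c) \<otimes> v2)" unfolding r1 r2 using zz(2) uc by (simp add: m_ac)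
 also have "\<dots> = Ya \<otimes> v2" unfolding Ya_def using zz(2) vc by (simp add: nat_pow_mult[symmetric] m_ac)
 finally have eq: "Xa \<otimes> v1 = Ya \<otimes> v2" .
 have "Ya \<otimes> v1 \<doteq> Ya \<otimes> v2" by (rule rcong_mult[OF XYO(2) v(1) XYO(2) v(2) _ v12]) (use XY in simp)
 hence m: "Ya \<otimes> v1 \<ominus> Xa \<otimes> v1 \<in> mx" unfolding eq[symmetric] rcong_def .
 have "Ya \<otimes> v1 \<ominus> Xa \<otimes> v1 = (Ya \<ominus> Xa) \<otimes> v1" using XY vc by algebra
 hence "(Ya \<ominus> Xa) \<otimes> v1 \<in> mx" using m by simp
 hence "Ya \<doteq> Xa" unfolding rcong_def using mx_prime[OF O_diff[OF XYO(2,1)] v(1)] v1u by blast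
 hence "Ya = Xa" by (rule root_of_unity_inj[OF XY(2,4,1,3) n])
 hence "[e ?h2 * c + ?e1 = e h * c + ?e2] (mod n)" unfolding Xa_def Ya_def prim_pow_eq[OF z] .
 hence "[int (e ?h2 * c + ?e1) = int (e h * c + ?e2)] (mod int n)" by (simp only: cong_int_iff)
 hence k: "[int (e ?h2) * int c + int ?e1 = int (e h) * int c + int ?e2] (mod int n)" by simp
 have "[f ?h2 * int c + f (th \<star> h \<star> \<iota> th) = int (e ?h2) * int c + int ?e1] (mod int n)"
  by (intro cong_add cong_mult cong_refl cong_sym[OF ie])
 also note k
 also have "[int (e h) * int c + int ?e2 = f h * int c + f (th \<star> ?h2 \<star> \<iota> th)] (mod int n)"
  by (intro cong_add cong_mult cong_refl ie)
 finally have fin: "[f ?h2 * int c + f (th \<star> h \<star> \<iota> th) = f h * int c + f (th \<star> ?h2 \<star> \<iota> th)] (mod int n)" .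
 have "[f ?h2 * int c + f (th \<star> h \<star> \<iota> th) - (f ?h2 * int c + f h * int c)
   = f h * int c + f (th \<star> ?h2 \<star> \<iota> th) - (f ?h2 * int c + f h * int c)] (mod int n)"
  by (intro cong_diff cong_refl fin)
 thus "[f (th \<star> ?h2 \<star> \<iota> th) - int c * f ?h2
     = f (th \<star> h \<star> \<iota> th) - int c * f h] (mod int n)"
  using cong_sym by (simp add: algebra_simps)
qed

end

section \<open>Coefficients of monic polynomials with given roots\<close>

context cring
begin

text \<open>The coefficient of degree \<open>k\<close> of the monic polynomial with list of roots \<open>rs\<close>.\<close>

fun rcoeff :: "'a list \<Rightarrow> nat \<Rightarrow> 'a" where
 "rcoeff [] k = (if k = 0 then \<one> else \<zero>)"
| "rcoeff (r # rs) 0 = \<ominus> (r \<otimes> rcoeff rs 0)"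
| "rcoeff (r # rs) (Suc k) = rcoeff rs k \<ominus> r \<otimes> rcoeff rs (Suc k)"

text \<open>The coefficients are a function of the degree, so that power maps and automorphisms can
  be applied to them one by one.\<close>

primrec psum :: "(nat \<Rightarrow> 'a) \<Rightarrow> nat \<Rightarrow> 'a \<Rightarrow> 'a" where
 "psum c 0 x = c 0"
| "psum c (Suc n) x = c (Suc n) \<otimes> x [^] Suc n \<oplus> psum c n x"

lemma rcoeff_in_subring: "subring A R ==> set rs \<subseteq> A ==> rcoeff rs k \<in> A"
proof (induction rs k rule: rcoeff.induct)
 case (1 k) thus ?case using subringE(2,3)[OF 1(1)] by simp
next
 case (2 r rs) thus ?case using subringE(5,6)[OF 2(2)] by simp
next
 case (3 r rs k) thus ?case using subringE(5,6,7)[OF 3(3)] by (simp add: a_minus_def)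
qed

lemma rcoeff_closed [simp]: "set rs \<subseteq> carrier R ==> rcoeff rs k \<in> carrier R"
 by (rule rcoeff_in_subring[OF carrier_is_subring])

lemma rcoeff_big: "set rs \<subseteq> carrier R ==> k > length rs ==> rcoeff rs k = \<zero>"
proof (induction rs k rule: rcoeff.induct)
 case (3 r rs k) thus ?case by (simp add: a_minus_def)
qed auto

lemma rcoeff_swap:
 assumes "a \<in> carrier R" "b \<in> carrier R" "set rs \<subseteq> carrier R"
 shows "rcoeff (a # b # rs) k = rcoeff (b # a # rs) k"
proof -
 consider "k = 0" | "k = Suc 0" | j where "k = Suc (Suc j)" by (metis not0_implies_Suc)
 thus ?thesis
 proof cases
  case 1
  have "\<ominus> (a \<otimes> \<ominus> (b \<otimes> rcoeff rs 0)) = \<ominus> (b \<otimes> \<ominus> (a \<otimes> rcoeff rs 0))"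
   using assms(1,2) rcoeff_closed[OF assms(3), of 0] by algebra
  thus ?thesis using 1 by simp
 next
  case 2
  have "\<ominus> (b \<otimes> rcoeff rs 0) \<ominus> a \<otimes> (rcoeff rs 0 \<ominus> b \<otimes> rcoeff rs (Suc 0))
    = \<ominus> (a \<otimes> rcoeff rs 0) \<ominus> b \<otimes> (rcoeff rs 0 \<ominus> a \<otimes> rcoeff rs (Suc 0))"
   using assms(1,2) rcoeff_closed[OF assms(3), of 0] rcoeff_closed[OF assms(3), of "Suc 0"] by algebra
  thus ?thesis using 2 by simp
 next
  case 3
  have "rcoeff rs j \<ominus> b \<otimes> rcoeff rs (Suc j) \<ominus> a \<otimes> (rcoeff rs (Suc j) \<ominus> b \<otimes> rcoeff rs (Suc (Suc j)))
    = rcoeff rs j \<ominus> a \<otimes> rcoeff rs (Suc j) \<ominus> b \<otimes> (rcoeff rs (Suc j) \<ominus> a \<otimes> rcoeff rs (Suc (Suc j)))"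
   using assms(1,2) rcoeff_closed[OF assms(3), of j] rcoeff_closed[OF assms(3), of "Suc j"]
    rcoeff_closed[OF assms(3), of "Suc (Suc j)"] by algebra
  thus ?thesis using 3 by simp
 qed
qed

lemma rcoeff_cong_tail: "(\<And>k. rcoeff rs k = rcoeff rs' k) ==> rcoeff (a # rs) k = rcoeff (a # rs') k"
 by (cases k) auto

lemma rcoeff_move:
 "set xs \<subseteq> carrier R ==> a \<in> carrier R ==> set ys \<subseteq> carrier R ==> rcoeff (xs @ a # ys) k = rcoeff (a # xs @ ys) k"
proof (induction xs arbitrary: k)
 case (Cons x xs)
 have "rcoeff (x # (xs @ a # ys)) k = rcoeff (x # (a # xs @ ys)) k"
  by (rule rcoeff_cong_tail) (use Cons in auto)
 also have "\<dots> = rcoeff (a # x # xs @ ys) k" using Cons.prems by (intro rcoeff_swap) auto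
 finally show ?case by simp
qed auto

text \<open>Coefficients are symmetric in the roots: whatever permutes the roots leaves them
  unchanged.\<close>

lemma rcoeff_mset: "set rs \<subseteq> carrier R ==> mset rs = mset rs' ==> rcoeff rs k = rcoeff rs' k"
proof (induction rs arbitrary: rs' k)
 case (Cons a rs)
 have "a \<in> set rs'" using Cons.prems(2) by (metis list.set_intros(1) set_mset_mset)
 then obtain xs ys where xy: "rs' = xs @ a # ys" by (metis split_list)
 have s: "set rs' \<subseteq> carrier R" using Cons.prems by (metis set_mset_mset)
 have m: "mset rs = mset (xs @ ys)" using Cons.prems(2) xy by simp
 have "rcoeff (a # rs) k = rcoeff (a # xs @ ys) k"
  by (rule rcoeff_cong_tail) (use Cons.IH[OF _ m] Cons.prems in auto)
 also have "\<dots> = rcoeff rs' k" unfolding xy using s xy by (intro rcoeff_move[symmetric]) auto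
 finally show ?case .
qed simp

lemma psum_closed [simp]: "(\<And>k. c k \<in> carrier R) ==> x \<in> carrier R ==> psum c n x \<in> carrier R"
 by (induction n) auto

text \<open>The last summand is the boundary term of the shifted sum; it vanishes as soon as
  \<open>n\<close> reaches the degree.\<close>

lemma psum_mult:
 assumes c: "\<And>k. c k \<in> carrier R" and x: "x \<in> carrier R" and r: "r \<in> carrier R"
  and c': "c' 0 = \<ominus> (r \<otimes> c 0)" "\<And>k. c' (Suc k) = c k \<ominus> r \<otimes> c (Suc k)"
 shows "psum c' (Suc n) x = (x \<ominus> r) \<otimes> psum c n x \<ominus> r \<otimes> c (Suc n) \<otimes> x [^] Suc n"
proof (induction n)
 case 0
 have "(c 0 \<ominus> r \<otimes> c (Suc 0)) \<otimes> x \<oplus> \<ominus> (r \<otimes> c 0) = (x \<ominus> r) \<otimes> c 0 \<ominus> r \<otimes> c (Suc 0) \<otimes> x"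
  using c[of 0] c[of "Suc 0"] x r by algebra
 thus ?case using c' x by simp
next
 case (Suc n)
 define P where "P = psum c n x"
 define Y where "Y = x [^] Suc n"
 have cl: "P \<in> carrier R" "Y \<in> carrier R" unfolding P_def Y_def using c x by auto
 have Yx: "x [^] Suc (Suc n) = Y \<otimes> x" unfolding Y_def by simp
 have "psum c' (Suc (Suc n)) x = (c (Suc n) \<ominus> r \<otimes> c (Suc (Suc n))) \<otimes> (Y \<otimes> x) \<oplus> ((x \<ominus> r) \<otimes> P \<ominus> r \<otimes> c (Suc n) \<otimes> Y)"
  unfolding psum.simps(2)[of c' "Suc n"] Suc c'(2) Yx P_def Y_def ..
 also have "\<dots> = (x \<ominus> r) \<otimes> (c (Suc n) \<otimes> Y \<oplus> P) \<ominus> r \<otimes> c (Suc (Suc n)) \<otimes> (Y \<otimes> x)"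
  using c[of "Suc n"] c[of "Suc (Suc n)"] x r cl by algebra
 finally show ?case unfolding psum.simps(2)[of c n] P_def Y_def Yx[unfolded Y_def] .
qed

end

lemma (in field) psum_rcoeff:
 "set rs \<subseteq> carrier R ==> x \<in> carrier R ==> psum (rcoeff rs) (length rs) x = root_prod rs x"
proof (induction rs)
 case (Cons r rs)
 have rc: "r \<in> carrier R" and rs: "set rs \<subseteq> carrier R" and x: "x \<in> carrier R" using Cons.prems by auto
 have "psum (rcoeff (r # rs)) (Suc (length rs)) x
  = (x \<ominus> r) \<otimes> psum (rcoeff rs) (length rs) x \<ominus> r \<otimes> rcoeff rs (Suc (length rs)) \<otimes> x [^] Suc (length rs)"
  by (rule psum_mult) (use rs x rc in auto)
 also have "rcoeff rs (Suc (length rs)) = \<zero>" by (rule rcoeff_big[OF rs]) simp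
 finally show ?case using Cons.IH[OF rs x] rc rs x by (simp add: a_minus_def)
qed simp

section \<open>The residue field\<close>

context padic_galois
begin

lemma ex_dimension: "\<exists>e. dimension e Q K" using K_fin by blast

definition "edim = (SOME e. dimension e Q K)"

lemma edim: "dimension edim Q K" unfolding edim_def using ex_dimension by (rule someI_ex)

text \<open>The \<open>edim + 1\<close> powers of \<open>x\<close> up to exponent
  \<open>edim\<close> are dependent over \<open>Q\<close>; leading zeros are dropped to obtain a
  nonzero head.\<close>

lemma K_relation:
 assumes x: "x \<in> K" shows "\<exists>P. P \<noteq> [] \<and> length P \<le> Suc edim \<and> hd P \<noteq> \<zero> \<and> set P \<subseteq> Q \<and> eval P x = \<zero>"
proof -
 have xc: "x \<in> \<F>" using x K_carrier by auto
 let ?U = "exp_base x (Suc edim)"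
 have UK: "set ?U \<subseteq> K" unfolding exp_base_def using subring_nat_pow[OF K_subring x] by auto
 have len: "length ?U = Suc edim" unfolding exp_base_def by simp
 have "\<not> independent Q ?U"
  using independent_length_le_dimension[OF Q_subfield edim _ UK] len by auto
 then obtain Ks where Ks: "length Ks = length ?U" "combine Ks ?U = \<zero>" "set Ks \<subseteq> Q" "set Ks \<noteq> {\<zero>}"
  using dependent_imp_non_trivial_combine[OF Q_subfield subset_trans[OF UK K_carrier]] by blast
 have ev: "eval Ks x = \<zero>"
  using combine_eq_eval[of Ks x] Ks(1,2) len by simp
 let ?P = "dropWhile (\<lambda>a. a = \<zero>) Ks"
 have "eval (dropWhile (\<lambda>a. a = \<zero>) A) x = eval A x" if "set A \<subseteq> \<F>" for A
  using that xc by (induction A) (simp_all add: eval_in_carrier)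
 hence "eval ?P x = \<zero>" using ev Ks(3) subfieldE(3)[OF Q_subfield] by simp
 moreover have "?P \<noteq> []"
 proof
  assume "?P = []"
  hence "\<forall>a\<in>set Ks. a = \<zero>" by (simp add: dropWhile_eq_Nil_conv)
  moreover have "Ks \<noteq> []" using Ks(1) len by auto
  ultimately show False using Ks(4) by (metis Ks(4) set_empty subset_singletonD subsetI singletonI insertI1 singleton_iff)
 qed
 moreover have "hd ?P \<noteq> \<zero>" using \<open>?P \<noteq> []\<close> hd_dropWhile by blast
 moreover have "set ?P \<subseteq> Q" using Ks(3) set_dropWhileD by fast
 moreover have "length ?P \<le> Suc edim" using Ks(1) len length_dropWhile_le[of "\<lambda>a. a = \<zero>" Ks] by simp
 ultimately show ?thesis by blast
qed

text \<open>These are the Teichmueller representatives of the nonzero residue classes of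
  \<open>K\<close>; together with zero they represent the whole residue field.\<close>

definition "Tunits = {t \<in> K. \<exists>N. \<not> p dvd N \<and> t [^] (N::nat) = \<one>}"
definition "T = insert \<zero> Tunits"

lemma Tunits_carrier: "t \<in> Tunits ==> t \<in> \<F>" unfolding Tunits_def using K_carrier by auto

lemma Tunits_O: "t \<in> Tunits ==> t \<in> Oint" "t \<in> Tunits ==> t \<notin> mx"
proof -
 have *: "t \<in> Oint \<and> t \<notin> mx" if t: "t \<in> Tunits"
 proof -
  obtain N where N: "\<not> p dvd N" "t [^] (N::nat) = \<one>" using t unfolding Tunits_def by blast
  have "N > 0" using N(1) by (cases N) auto
  thus ?thesis using root_of_unity_O[OF Tunits_carrier[OF t] N(2)] by blast
 qed
 thus "t \<in> Tunits ==> t \<in> Oint" "t \<in> Tunits ==> t \<notin> mx" by auto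
qed

lemma T_inj: "t \<in> T ==> t' \<in> T ==> t \<doteq> t' ==> t = t'"
proof -
 assume t: "t \<in> T" "t' \<in> T" and e: "t \<doteq> t'"
 have c: "t \<in> \<F>" "t' \<in> \<F>" using t Tunits_carrier unfolding T_def by auto
 show ?thesis
 proof (cases "t \<in> Tunits \<and> t' \<in> Tunits")
  case True
  then obtain N M where N: "\<not> p dvd N" "t [^] (N::nat) = \<one>" and M: "\<not> p dvd M" "t' [^] (M::nat) = \<one>"
   unfolding Tunits_def by blast
  have "t [^] (N * M) = \<one>" using N(2) c by (simp add: nat_pow_pow[symmetric])
  moreover have "t' [^] (N * M) = \<one>" using M(2) c by (subst mult.commute) (simp add: nat_pow_pow[symmetric])
  moreover have "\<not> p dvd N * M" using N(1) M(1) p_prime by (simp add: prime_dvd_mult_iff)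
  ultimately show ?thesis using root_of_unity_inj c e by blast
 next
  case False
  have "t \<in> mx \<longleftrightarrow> t' \<in> mx" by (rule rcong_mx_iff[OF c e])
  thus ?thesis using False t Tunits_O(2) mx_zero unfolding T_def by auto
 qed
qed

text \<open>The representative \<open>w\<close> lies in \<open>K\<close>: an automorphism fixes
  \<open>x\<close>, so it sends \<open>w\<close> to a congruent \<open>N\<close>-th root of unity,
  which can only be \<open>w\<close>.\<close>

lemma T_rep: assumes x: "x \<in> Oint" "x \<in> K" shows "\<exists>t\<in>T. x \<doteq> t"
proof (cases "x \<in> mx")
 case True
 thus ?thesis using rcong_mx O_carrier[OF x(1)] unfolding T_def by blast
next
 case False
 obtain N w where w: "\<not> p dvd N" "N > 0" "w \<in> \<F>" "w [^] (N::nat) = \<one>" "x \<doteq> w" using teich[OF x(1) False] by metis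
 have xc: "x \<in> \<F>" using O_carrier[OF x(1)] .
 have "w \<in> K"
 proof (rule ccontr)
  assume "w \<notin> K"
  then obtain th where s: "th \<in> gal" "th w \<noteq> w" using fixed_field[OF w(3)] by blast
  have "x \<doteq> th w" using gal_rcong[OF s(1) xc w(3,5)] gal_K[OF s(1) x(2)] by simp
  hence "th w \<doteq> w" using rcong_trans[OF _ xc w(3) rcong_sym w(5)] s(1) w(3) xc by simp
  moreover have "(th w) [^] N = \<one>" using gal_pow[OF s(1) w(3), of N] w(4) gal_one[OF s(1)] by simp
  ultimately show False using root_of_unity_inj[of "th w" N w] s w by simp
 qed
 thus ?thesis using w unfolding T_def Tunits_def by blast
qed

text \<open>Elements of \<open>K\<close> satisfy relations of degree at most \<open>edim\<close>,
  which bounds the orders of the roots of unity by \<open>p ^ edim\<close>.\<close>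

lemma finite_T: "finite T"
proof -
 have "Tunits \<subseteq> (\<Union>N\<in>{1..p ^ edim}. {x \<in> \<F>. x [^] N = \<one>})"
 proof
  fix t assume t: "t \<in> Tunits"
  have tK: "t \<in> K" using t unfolding Tunits_def by auto
  obtain P where P: "P \<noteq> []" "length P \<le> Suc edim" "hd P \<noteq> \<zero>" "set P \<subseteq> Q" "eval P t = \<zero>" using K_relation[OF tK] by blast
  obtain N w where w: "w \<in> \<F>" "N \<le> p ^ (length P - 1)" "\<not> p dvd N" "w [^] (N::nat) = \<one>" "t \<doteq> w"
   using teichmueller[OF Tunits_O[OF t] P(1,3,4,5)] by blast
  obtain M where M: "\<not> p dvd M" "t [^] (M::nat) = \<one>" using t unfolding Tunits_def by blast
  have tc: "t \<in> \<F>" using Tunits_carrier[OF t] .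
  have "t [^] (N * M) = \<one>" using M(2) tc by (subst mult.commute) (simp add: nat_pow_pow[symmetric])
  moreover have "w [^] (N * M) = \<one>" using w(4) w(1) by (simp add: nat_pow_pow[symmetric])
  moreover have "\<not> p dvd N * M" using w(3) M(1) p_prime by (simp add: prime_dvd_mult_iff)
  ultimately have "t = w" using root_of_unity_inj tc w(1,5) by blast
  moreover have "p ^ (length P - 1) \<le> p ^ edim" using P(2) prime_gt_1_nat[OF p_prime] by (intro power_increasing) auto
  moreover have "N > 0" using w(3) by (cases N) auto
  ultimately show "t \<in> (\<Union>N\<in>{1..p ^ edim}. {x \<in> \<F>. x [^] N = \<one>})" using w tc by (auto intro!: bexI[of _ N])
 qed
 moreover have "finite (\<Union>N\<in>{1..p ^ edim}. {x \<in> \<F>. x [^] N = \<one>})"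
  using finite_roots_pow[OF _ one_closed] by auto
 ultimately show ?thesis unfolding T_def using finite_subset by blast
qed

definition "q = card T"

lemma q_Tunits: "q = Suc (card Tunits)" "card Tunits > 0"
proof -
 have fin: "finite Tunits" using finite_T unfolding T_def by simp
 have "\<zero> \<notin> Tunits" using Tunits_O(2) mx_zero by blast
 thus "q = Suc (card Tunits)" unfolding q_def T_def using fin by simp
 have "\<not> p dvd 1" using p_prime not_prime_unit by blast
 hence "\<one> \<in> Tunits" unfolding Tunits_def using subringE(3)[OF K_subring] by (auto intro!: exI[of _ "1::nat"])
 thus "card Tunits > 0" using fin card_gt_0_iff by blast
qed

lemma Tunits_pow: assumes t: "t \<in> Tunits" shows "t [^] (q - 1) = \<one>"
proof -
 define TG where "TG = \<lparr>carrier = Tunits, mult = mult F, one = \<one>\<rparr>"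
 have cl: "x \<otimes> y \<in> Tunits" if xy: "x \<in> Tunits" "y \<in> Tunits" for x y
 proof -
  obtain N M where N: "\<not> p dvd N" "x [^] (N::nat) = \<one>" and M: "\<not> p dvd M" "y [^] (M::nat) = \<one>"
   using xy unfolding Tunits_def by blast
  have c: "x \<in> \<F>" "y \<in> \<F>" using xy Tunits_carrier by auto
  have "x [^] (N * M) = \<one>" using N(2) c by (simp add: nat_pow_pow[symmetric])
  moreover have "y [^] (N * M) = \<one>" using M(2) c by (subst mult.commute) (simp add: nat_pow_pow[symmetric])
  ultimately have "(x \<otimes> y) [^] (N * M) = \<one>" using c by (simp add: nat_pow_distrib)
  moreover have "\<not> p dvd N * M" using N(1) M(1) p_prime by (simp add: prime_dvd_mult_iff)
  moreover have "x \<otimes> y \<in> K" using xy subringE(6)[OF K_subring] unfolding Tunits_def by auto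
  ultimately show ?thesis unfolding Tunits_def by blast
 qed
 have "\<not> p dvd 1" using p_prime not_prime_unit by blast
 hence one: "\<one> \<in> Tunits" unfolding Tunits_def using subringE(3)[OF K_subring] by (auto intro!: exI[of _ "1::nat"])
 have TG: "comm_group TG"
 proof (rule comm_groupI)
  fix x assume x: "x \<in> carrier TG"
  hence xT: "x \<in> Tunits" by (simp add: TG_def)
  obtain N where N: "\<not> p dvd N" "x [^] (N::nat) = \<one>" using xT unfolding Tunits_def by blast
  have c: "x \<in> \<F>" using xT Tunits_carrier by auto
  obtain k where k: "N = Suc k" using N(1) by (cases N) auto
  have pk: "x [^] j \<in> Tunits" for j :: nat by (induction j) (use one cl xT in auto)
  have "x [^] k \<otimes> x = \<one>" using N(2) k by simp
  thus "\<exists>y\<in>carrier TG. y \<otimes>\<^bsub>TG\<^esub> x = \<one>\<^bsub>TG\<^esub>" using pk by (auto simp: TG_def)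
 qed (use cl one Tunits_carrier in "auto simp: TG_def m_ac")
 have pw: "x [^]\<^bsub>TG\<^esub> (n::nat) = x [^] n" for x n
  by (induction n) (auto simp: TG_def)
 have "t [^]\<^bsub>TG\<^esub> card (carrier TG) = \<one>\<^bsub>TG\<^esub>"
  by (rule comm_group.power_order_eq_one[OF TG]) (use t finite_T in "auto simp: TG_def T_def")
 thus ?thesis unfolding pw using q_Tunits by (simp add: TG_def)
qed

lemma T_pow_q: "t \<in> T ==> t [^] q = t"
proof -
 assume t: "t \<in> T"
 have q: "q = Suc (q - 1)" "q - 1 > 0" using q_Tunits by auto
 show ?thesis
 proof (cases "t = \<zero>")
  case True
  thus ?thesis using q(1) by (metis nat_pow_Suc r_null nat_pow_closed zero_closed)
 next
  case False
  hence tu: "t \<in> Tunits" using t unfolding T_def by auto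
  have "t [^] Suc (q - 1) = t" using Tunits_pow[OF tu] Tunits_carrier[OF tu] by simp
  thus ?thesis using q(1) by metis
 qed
qed

lemma T_O: "t \<in> T ==> t \<in> Oint" unfolding T_def using Tunits_O(1) by auto
lemma T_K: "t \<in> T ==> t \<in> K" unfolding T_def Tunits_def using subringE(2)[OF K_subring] by auto

lemma residue_fermat: assumes c: "c \<in> Oint" "c \<in> K" shows "c [^] q \<doteq> c"
proof -
 obtain t where t: "t \<in> T" "c \<doteq> t" using T_rep[OF c] by blast
 have cc: "c \<in> \<F>" "t \<in> \<F>" using c T_O[OF t(1)] O_carrier by auto
 have "c [^] q \<doteq> t [^] q" by (rule rcong_pow[OF c(1) T_O[OF t(1)] t(2)])
 hence "c [^] q \<doteq> t" using T_pow_q[OF t(1)] by simp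
 thus ?thesis using rcong_trans[OF nat_pow_closed[OF cc(1)] cc(2,1) _ rcong_sym[OF cc t(2)]] by blast
qed

text \<open>\<open>Tunits\<close> consists of \<open>q - 1\<close> solutions of
  \<open>x ^ (q - 1) = 1\<close>, hence of all solutions in the closure. So an element whose residue
  is fixed by the \<open>q\<close>-th power map has a representative in \<open>K\<close>.\<close>

lemma residue_fixed: assumes x: "x \<in> Oint" "x [^] q \<doteq> x" shows "\<exists>t\<in>T. x \<doteq> t"
proof (cases "x \<in> mx")
 case True
 thus ?thesis using rcong_mx O_carrier[OF x(1)] unfolding T_def by blast
next
 case False
 have xc: "x \<in> \<F>" using O_carrier[OF x(1)] .
 have q: "q = Suc (q - 1)" "q - 1 > 0" using q_Tunits by auto
 have "x [^] q = x [^] (q - 1) \<otimes> x" using q(1) by (metis nat_pow_Suc)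
 moreover have "x [^] (q - 1) \<otimes> x \<ominus> x = (x [^] (q - 1) \<ominus> \<one>) \<otimes> x"
  using nat_pow_closed[OF xc, of "q - 1"] xc by algebra
 ultimately have "(x [^] (q - 1) \<ominus> \<one>) \<otimes> x \<in> mx" using x(2) unfolding rcong_def by simp
 hence "x [^] (q - 1) \<doteq> \<one>" unfolding rcong_def
  using mx_prime[OF O_diff[OF O_pow[OF x(1)] O_one] x(1)] False by blast
 then obtain w where w: "w \<in> \<F>" "w [^] (q - 1) = \<one>" "x \<doteq> w" using teichmueller_of_pow[OF x(1) q(2)] by blast
 let ?S = "{x \<in> \<F>. x [^] (q - 1) = \<one>}"
 have fin: "finite ?S" "card ?S \<le> q - 1" using finite_roots_pow[OF q(2) one_closed] by auto
 have "Tunits \<subseteq> ?S" using Tunits_pow Tunits_carrier by auto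
 moreover have "card Tunits = q - 1" using q_Tunits by simp
 ultimately have "Tunits = ?S" using fin by (metis card_subset_eq card_mono le_antisym)
 thus ?thesis using w unfolding T_def by auto
qed

definition "OK = Oint \<inter> K"
definition "mK = mx \<inter> K"
abbreviation "RK \<equiv> F\<lparr>carrier := OK\<rparr>"

lemma OK_subring: "subring OK F" unfolding OK_def by (rule subring_inter[OF O_subring K_subring])

lemma RK_cring: "cring RK"
proof -
 interpret R: ring RK by (rule subring_is_ring[OF OK_subring])
 have "OK \<subseteq> \<F>" using subringE(1)[OF OK_subring] .
 thus ?thesis by unfold_locales (auto simp: m_comm subset_iff)
qed

lemma mK_ideal: "ideal mK RK"
proof -
 interpret R: cring RK by (rule RK_cring)
 have c: "mK \<subseteq> OK" unfolding mK_def OK_def using mx_O by auto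
 have Oc: "OK \<subseteq> \<F>" using subringE(1)[OF OK_subring] .
 show ?thesis
 proof (rule idealI)
  show "ring RK" by unfold_locales
  show "subgroup mK (add_monoid RK)"
  proof (rule group.subgroupI)
   show "Group.group (add_monoid RK)" by (rule R.add.group_axioms)
   show "mK \<subseteq> carrier (add_monoid RK)" using c by simp
   show "mK \<noteq> {}" unfolding mK_def using subringE(2)[OF K_subring] mx_zero by blast
  next
   fix a assume a: "a \<in> mK"
   have am: "\<ominus> a \<in> mK" using a mx_minus subringE(5)[OF K_subring] unfolding mK_def by auto
   have "\<ominus>\<^bsub>RK\<^esub> a = \<ominus> a"
    by (rule R.minus_equality) (use a am c Oc in "auto simp: l_neg subset_iff")
   thus "inv\<^bsub>add_monoid RK\<^esub> a \<in> mK" using am by (simp add: a_inv_def)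
  next
   fix a b assume "a \<in> mK" "b \<in> mK"
   thus "a \<otimes>\<^bsub>add_monoid RK\<^esub> b \<in> mK" using mx_add subringE(7)[OF K_subring] unfolding mK_def by auto
  qed
 next
  fix a x assume a: "a \<in> mK" and x: "x \<in> carrier RK"
  have "x \<otimes> a \<in> mK" using a x mx_mult subringE(6)[OF K_subring] unfolding mK_def OK_def by auto
  moreover have "a \<otimes> x = x \<otimes> a" using a x c Oc by (intro m_comm) auto
  ultimately show "x \<otimes>\<^bsub>RK\<^esub> a \<in> mK" "a \<otimes>\<^bsub>RK\<^esub> x \<in> mK" by simp_all
 qed
qed

lemma RK_coset: "x \<in> OK ==> y \<in> OK ==> mK +>\<^bsub>RK\<^esub> x = mK +>\<^bsub>RK\<^esub> y \<longleftrightarrow> x \<doteq> y"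
proof -
 assume x: "x \<in> OK" and y: "y \<in> OK"
 interpret R: cring RK by (rule RK_cring)
 interpret I: ideal mK RK by (rule mK_ideal)
 have c: "x \<in> \<F>" "y \<in> \<F>" using x y subringE(1)[OF OK_subring] by auto
 have "mK +>\<^bsub>RK\<^esub> x = mK +>\<^bsub>RK\<^esub> y \<longleftrightarrow> x \<in> mK +>\<^bsub>RK\<^esub> y"
  using I.a_repr_independence'[of x y] I.a_rcos_self[of x] x y by auto
 also have "\<dots> \<longleftrightarrow> (\<exists>m\<in>mK. x = m \<oplus> y)" by (auto simp: a_r_coset_def')
 also have "\<dots> \<longleftrightarrow> x \<ominus> y \<in> mK"
 proof
  assume "\<exists>m\<in>mK. x = m \<oplus> y"
  then obtain m where m: "m \<in> mK" "x = m \<oplus> y" by blast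
  have "m \<in> \<F>" using m mx_carrier unfolding mK_def by auto
  hence "x \<ominus> y = m" unfolding m(2) using c by algebra
  thus "x \<ominus> y \<in> mK" using m by simp
 next
  assume m: "x \<ominus> y \<in> mK"
  have "x = (x \<ominus> y) \<oplus> y" using c by algebra
  thus "\<exists>m\<in>mK. x = m \<oplus> y" using m by blast
 qed
 also have "\<dots> \<longleftrightarrow> x \<doteq> y" unfolding mK_def rcong_def
  using x y subringE(5,7)[OF K_subring] unfolding OK_def a_minus_def by auto
 finally show ?thesis .
qed

lemma card_residue: "card (carrier (RK Quot mK)) = q" and finite_residue: "finite (carrier (RK Quot mK))"
proof -
 have car: "carrier (RK Quot mK) = (\<lambda>x. mK +>\<^bsub>RK\<^esub> x) ` OK"
  unfolding FactRing_def by (auto simp: A_RCOSETS_def')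
 have TO: "T \<subseteq> OK" using T_O T_K unfolding OK_def by auto
 have "(\<lambda>x. mK +>\<^bsub>RK\<^esub> x) ` OK = (\<lambda>x. mK +>\<^bsub>RK\<^esub> x) ` T"
 proof
  show "(\<lambda>x. mK +>\<^bsub>RK\<^esub> x) ` OK \<subseteq> (\<lambda>x. mK +>\<^bsub>RK\<^esub> x) ` T"
  proof
   fix C assume "C \<in> (\<lambda>x. mK +>\<^bsub>RK\<^esub> x) ` OK"
   then obtain x where x: "x \<in> OK" "C = mK +>\<^bsub>RK\<^esub> x" by blast
   then obtain t where t: "t \<in> T" "x \<doteq> t" using T_rep unfolding OK_def by auto
   hence "C = mK +>\<^bsub>RK\<^esub> t" using RK_coset[of x t] x TO by auto
   thus "C \<in> (\<lambda>x. mK +>\<^bsub>RK\<^esub> x) ` T" using t by blast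
  qed
 qed (use TO in blast)
 moreover have "inj_on (\<lambda>x. mK +>\<^bsub>RK\<^esub> x) T"
 proof (rule inj_onI)
  fix t t' assume t: "t \<in> T" "t' \<in> T" "mK +>\<^bsub>RK\<^esub> t = mK +>\<^bsub>RK\<^esub> t'"
  have "t \<doteq> t'" using RK_coset[of t t'] t TO by auto
  thus "t = t'" using T_inj t by blast
 qed
 ultimately show "card (carrier (RK Quot mK)) = q" "finite (carrier (RK Quot mK))"
  unfolding car q_def using finite_T by (simp_all add: card_image)
qed

text \<open>By Sylow's theorem the additive group of the residue field contains a nontrivial element
  killed by \<open>r\<close>; it is also killed by \<open>p\<close>.\<close>

lemma q_prime_divisor:
 assumes r: "nat_prime r" "r dvd q" shows "r = p"
proof (rule ccontr)
 assume rp: "r \<noteq> p"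
 interpret R: cring RK by (rule RK_cring)
 interpret I: ideal mK RK by (rule mK_ideal)
 let ?A = "RK Quot mK"
 interpret A: ring ?A by (rule I.quotient_is_ring)
 let ?G = "add_monoid ?A"
 let ?h = "\<lambda>x. mK +>\<^bsub>RK\<^esub> x"
 have hom: "?h \<in> ring_hom RK ?A" by (rule I.rcos_ring_hom)
 have ord: "order ?G = q" unfolding order_def using card_residue by simp
 have r1: "r > 1" using prime_gt_1_nat[OF r(1)] .
 obtain m where m: "q = r ^ 1 * m" using r(2) by auto
 have "\<exists>H. subgroup H ?G \<and> card H = r ^ 1"
  by (rule sylow_thm[OF r(1) A.add.group_axioms]) (use ord m finite_residue in auto)
 then obtain H where H: "subgroup H ?G" "card H = r" by auto
 have finH: "finite H" using H(2) r1 card.infinite by (metis not_one_less_zero)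
 have oneH: "\<one>\<^bsub>?G\<^esub> \<in> H" using subgroup.one_closed[OF H(1)] .
 have "H \<noteq> {\<one>\<^bsub>?G\<^esub>}" using H(2) r1 by auto
 then obtain x where x: "x \<in> H" "x \<noteq> \<one>\<^bsub>?G\<^esub>" using oneH by blast
 have xG: "x \<in> carrier ?G" using subgroup.subset[OF H(1)] x by auto
 interpret HG: Group.group "?G\<lparr>carrier := H\<rparr>" by (rule subgroup.subgroup_is_group[OF H(1) A.add.group_axioms])
 have pw: "y [^]\<^bsub>?G\<lparr>carrier := H\<rparr>\<^esub> (k::nat) = y [^]\<^bsub>?G\<^esub> k" for y k
  unfolding nat_pow_def by simp
 have xr: "x [^]\<^bsub>?G\<^esub> r = \<one>\<^bsub>?G\<^esub>"
  using HG.pow_order_eq_1[of x] x(1) H(2) unfolding pw order_def by simp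
 have xp: "x [^]\<^bsub>?G\<^esub> p = \<one>\<^bsub>?G\<^esub>"
 proof -
  obtain c where c: "c \<in> OK" "x = ?h c" using xG unfolding FactRing_def by (auto simp: A_RCOSETS_def')
  have cF: "c \<in> \<F>" using c subringE(1)[OF OK_subring] by auto
  have nO: "natc k \<otimes> c \<in> OK" for k
   using c O_mult[OF O_natc] subringE(6)[OF K_subring natc_K] unfolding OK_def by auto
  have "x [^]\<^bsub>?G\<^esub> (k::nat) = ?h (natc k \<otimes> c)" for k
  proof (induction k)
   case 0
   have "\<zero>\<^bsub>?A\<^esub> = ?h \<zero>\<^bsub>RK\<^esub>" using ring_hom_zero[OF hom] R.ring_axioms A.ring_axioms by simp
   thus ?case using cF by simp
  next
   case (Suc k)
   have "?h (natc k \<otimes> c \<oplus>\<^bsub>RK\<^esub> c) = ?h (natc k \<otimes> c) \<oplus>\<^bsub>?A\<^esub> ?h c" by (rule ring_hom_add[OF hom]) (use nO c in auto)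
   moreover have "natc (Suc k) \<otimes> c = natc k \<otimes> c \<oplus> c" using cF by (simp add: natc_Suc l_distr a_comm)
   ultimately show ?case using Suc c(2) by simp
  qed
  hence "x [^]\<^bsub>?G\<^esub> p = ?h (\<pi> \<otimes> c)" .
  also have "\<dots> = ?h \<zero>"
  proof -
   have "\<pi> \<otimes> c \<in> mx" using mx_mult[OF _ pi_mx, of c] c cF unfolding OK_def by (simp add: m_comm)
   hence "\<pi> \<otimes> c \<doteq> \<zero>" using rcong_mx cF by simp
   thus ?thesis using RK_coset[OF nO, of \<zero> p] subringE(2)[OF OK_subring] by simp
  qed
  also have "\<dots> = \<zero>\<^bsub>?A\<^esub>" using ring_hom_zero[OF hom] R.ring_axioms A.ring_axioms by simp
  finally show ?thesis by simp
 qed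
 have "coprime p r" using rp r(1) p_prime by (metis primes_coprime)
 then obtain u v where uv: "p * u = r * v + 1" using bezout_nat[of p r] prime_gt_0_nat[OF p_prime]
  by (metis One_nat_def coprime_imp_gcd_eq_1 neq0_conv)
 have "x [^]\<^bsub>?G\<^esub> (p * u) = \<one>\<^bsub>?G\<^esub>"
  using A.add.nat_pow_pow[OF xG[simplified], of u p] xp A.add.nat_pow_one by (simp add: add_pow_def mult.commute)
 moreover have "x [^]\<^bsub>?G\<^esub> (r * v + 1) = x"
  using A.add.nat_pow_mult[OF xG[simplified], of "r * v" 1] A.add.nat_pow_pow[OF xG[simplified], of v r] xr xG A.add.nat_pow_one by (simp add: add_pow_def mult.commute)
 ultimately show False using uv x(2) by simp
qed

lemma q_prime_power: "\<exists>a. q = p ^ a"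
proof -
 have q0: "q \<noteq> 0" using q_Tunits by simp
 obtain m where m: "q = p ^ multiplicity p q * m" "\<not> p dvd m"
  using multiplicity_decompose'[of q p] q0 prime_gt_1_nat[OF p_prime] by auto
 have "m = 1"
 proof (rule ccontr)
  assume "m \<noteq> 1"
  then obtain r where r: "nat_prime r" "r dvd m" by (metis prime_factor_nat)
  hence "r dvd q" using m(1) by (metis dvd_mult)
  thus False using q_prime_divisor[OF r(1)] r(2) m(2) by simp
 qed
 thus ?thesis using m(1) by auto
qed

lemma q_gt_1: "q > 1" using q_Tunits by simp

lemma q_coprime: "\<not> p dvd N ==> coprime q N"
proof -
 assume "\<not> p dvd N"
 hence "coprime p N" using p_prime by (simp add: prime_imp_coprime)
 thus ?thesis using q_prime_power by auto
qed

section \<open>Frobenius on roots of unity\<close>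

lemma psum_frobenius:
 assumes c: "\<And>k. c k \<in> Oint" and x: "x \<in> Oint"
 shows "(psum c n x) [^] q \<doteq> psum (\<lambda>k. c k [^] q) n (x [^] q)"
proof -
 obtain a where a: "q = p ^ a" using q_prime_power by blast
 have O: "psum c n x \<in> Oint" if "\<And>k. c k \<in> Oint" "x \<in> Oint" for c n x
  by (induction n) (use that O_intros in auto)
 show ?thesis
 proof (induction n)
  case 0
  show ?case using O_carrier[OF c] by simp
 next
  case (Suc n)
  have o: "c (Suc n) \<otimes> x [^] Suc n \<in> Oint" using c x by (intro O_intros)
  have cc: "c k \<in> \<F>" "x \<in> \<F>" for k using c x O_carrier by auto
  have "(c (Suc n) \<otimes> x [^] Suc n \<oplus> psum c n x) [^] q \<doteq> (c (Suc n) \<otimes> x [^] Suc n) [^] q \<oplus> (psum c n x) [^] q"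
   unfolding a by (rule frobenius_add[OF o O[OF c x]])
  moreover have "(c (Suc n) \<otimes> x [^] Suc n) [^] q \<oplus> (psum c n x) [^] q
    \<doteq> (c (Suc n) \<otimes> x [^] Suc n) [^] q \<oplus> psum (\<lambda>k. c k [^] q) n (x [^] q)"
   by (rule rcong_add) (use Suc cc in auto)
  moreover have "(c (Suc n) \<otimes> x [^] Suc n) [^] q = c (Suc n) [^] q \<otimes> (x [^] q) [^] Suc n"
   using cc by (simp only: nat_pow_distrib nat_pow_closed nat_pow_pow mult.commute)
  ultimately show ?case
   using rcong_trans[of "(c (Suc n) \<otimes> x [^] Suc n \<oplus> psum c n x) [^] q"
    "(c (Suc n) \<otimes> x [^] Suc n) [^] q \<oplus> (psum c n x) [^] q"
    "(c (Suc n) \<otimes> x [^] Suc n) [^] q \<oplus> psum (\<lambda>k. c k [^] q) n (x [^] q)"] cc by simp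
 qed
qed

lemma psum_cong:
 assumes c: "\<And>k. c k \<in> Oint" "\<And>k. d k \<in> Oint" "\<And>k. c k \<doteq> d k" and x: "x \<in> Oint"
 shows "psum c n x \<doteq> psum d n x"
proof (induction n)
 case (Suc n)
 have cc: "c k \<in> \<F>" "d k \<in> \<F>" "x \<in> \<F>" for k using c x O_carrier by auto
 have "c (Suc n) \<otimes> x [^] Suc n \<doteq> d (Suc n) \<otimes> x [^] Suc n"
  by (rule rcong_mult[OF c(1) O_pow[OF x] c(2) O_pow[OF x] c(3) rcong_refl]) (use cc in simp)
 thus ?case using Suc cc by (simp only: psum.simps, intro rcong_add) auto
qed (use c in simp)

lemma gal_psum: "th \<in> gal ==> (\<And>k. c k \<in> \<F>) ==> x \<in> \<F> ==> th (psum c n x) = psum (\<lambda>k. th (c k)) n (th x)"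
 by (induction n) (auto simp: gal_add gal_mult gal_pow simp del: nat_pow_Suc)

lemma gal_rcoeff: "th \<in> gal ==> set rs \<subseteq> \<F> ==> th (rcoeff rs k) = rcoeff (map th rs) k"
 by (induction rs k rule: rcoeff.induct) (auto simp: gal_minus gal_diff gal_mult gal_one gal_zero)

text \<open>The \<open>q\<close>-th power map is residually additive, so applying it to the
  coefficients amounts to applying it to the roots.\<close>

lemma frobenius_rcoeff:
 assumes "set rs \<subseteq> Oint" shows "(rcoeff rs k) [^] q \<doteq> rcoeff (map (\<lambda>r. r [^] q) rs) k"
proof -
 obtain a where a: "q = p ^ a" using q_prime_power by blast
 have q0: "q > 0" using q_gt_1 by simp
 have zq: "\<zero> [^] q = \<zero>" using T_pow_q unfolding T_def by simp
 have Oc: "rcoeff rs k \<in> Oint" "rcoeff rs k \<in> \<F>" if "set rs \<subseteq> Oint" for rs k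
  using rcoeff_in_subring[OF O_subring that] O_carrier by auto
 have mO: "set (map (\<lambda>r. r [^] q) rs) \<subseteq> Oint" if "set rs \<subseteq> Oint" for rs using that O_pow by auto
 show ?thesis using assms
 proof (induction rs k rule: rcoeff.induct)
  case (1 k)
  show ?case by (simp add: zq)
 next
  case (2 r rs)
  have O: "r \<in> Oint" "set rs \<subseteq> Oint" using 2 by auto
  have c: "r \<in> \<F>" using O O_carrier by auto
  have "(\<zero> \<ominus> r \<otimes> rcoeff rs 0) [^] q \<doteq> \<zero> [^] q \<ominus> (r \<otimes> rcoeff rs 0) [^] q"
   unfolding a by (rule frobenius_diff[OF O_zero O_mult[OF O(1) Oc(1)[OF O(2)]]])
  hence 1: "(\<ominus> (r \<otimes> rcoeff rs 0)) [^] q \<doteq> \<ominus> (r [^] q \<otimes> (rcoeff rs 0) [^] q)"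
   using c Oc(2)[OF O(2)] zq by (simp add: a_minus_def nat_pow_distrib)
  have "r [^] q \<otimes> (rcoeff rs 0) [^] q \<doteq> r [^] q \<otimes> rcoeff (map (\<lambda>r. r [^] q) rs) 0"
   by (rule rcong_mult) (use O O_pow Oc mO 2 c in auto)
  hence "\<ominus> (r [^] q \<otimes> (rcoeff rs 0) [^] q) \<doteq> \<ominus> (r [^] q \<otimes> rcoeff (map (\<lambda>r. r [^] q) rs) 0)"
   using rcong_mult[OF O_minus[OF O_one] _ O_minus[OF O_one], of "r [^] q \<otimes> (rcoeff rs 0) [^] q" "r [^] q \<otimes> rcoeff (map (\<lambda>r. r [^] q) rs) 0"]
    O_mult[OF O_pow[OF O(1)] O_pow[OF Oc(1)[OF O(2)]]] O_mult[OF O_pow[OF O(1)] Oc(1)[OF mO[OF O(2)]]] c Oc(2)[OF O(2)] Oc(2)[OF mO[OF O(2)]]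
   by (simp add: l_minus)
  from rcong_trans[OF _ _ _ 1 this] show ?case using c Oc(2)[OF O(2)] Oc(2)[OF mO[OF O(2)]] by simp
 next
  case (3 r rs k)
  have O: "r \<in> Oint" "set rs \<subseteq> Oint" using 3 by auto
  have c: "r \<in> \<F>" using O O_carrier by auto
  let ?m = "map (\<lambda>r. r [^] q) rs"
  have cl: "rcoeff rs j \<in> \<F>" "rcoeff ?m j \<in> \<F>" for j using Oc(2)[OF O(2)] Oc(2)[OF mO[OF O(2)]] by auto
  have 1: "(rcoeff rs k \<ominus> r \<otimes> rcoeff rs (Suc k)) [^] q \<doteq> (rcoeff rs k) [^] q \<ominus> (r \<otimes> rcoeff rs (Suc k)) [^] q"
   unfolding a by (rule frobenius_diff[OF Oc(1)[OF O(2)] O_mult[OF O(1) Oc(1)[OF O(2)]]])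
  have "r [^] q \<otimes> (rcoeff rs (Suc k)) [^] q \<doteq> r [^] q \<otimes> rcoeff ?m (Suc k)"
   by (rule rcong_mult) (use O O_pow Oc mO 3 c in auto)
  hence m1: "r [^] q \<otimes> (rcoeff rs (Suc k)) [^] q \<ominus> r [^] q \<otimes> rcoeff ?m (Suc k) \<in> mx" unfolding rcong_def .
  have m2: "(rcoeff rs k) [^] q \<ominus> rcoeff ?m k \<in> mx" using 3 O unfolding rcong_def by simp
  define A B C D where "A = (rcoeff rs k) [^] q" and "B = r [^] q \<otimes> (rcoeff rs (Suc k)) [^] q"
   and "C = rcoeff ?m k" and "D = r [^] q \<otimes> rcoeff ?m (Suc k)"
  have ABCD: "A \<in> \<F>" "B \<in> \<F>" "C \<in> \<F>" "D \<in> \<F>"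
   unfolding A_def B_def C_def D_def using c cl by auto
  have "(A \<ominus> B) \<ominus> (C \<ominus> D) = (A \<ominus> C) \<ominus> (B \<ominus> D)" using ABCD by algebra
  hence 2: "A \<ominus> B \<doteq> C \<ominus> D" using mx_diff[OF m2 m1] unfolding rcong_def A_def B_def C_def D_def by simp
  have "(r \<otimes> rcoeff rs (Suc k)) [^] q = B" unfolding B_def using c cl by (simp add: nat_pow_distrib)
  hence "(rcoeff rs k \<ominus> r \<otimes> rcoeff rs (Suc k)) [^] q \<doteq> A \<ominus> B" using 1 unfolding A_def by simp
  from rcong_trans[OF _ _ _ this 2] show ?case unfolding C_def D_def using c cl ABCD by simp
 qed
qed

text \<open>The polynomial whose roots are the conjugates of \<open>z\<close> has coefficients in
  \<open>K\<close>, which are residually fixed by the \<open>q\<close>-th power map. So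
  \<open>z ^ q\<close> is residually a root, hence congruent to a conjugate \<open>th z\<close>,
  hence equal to it.\<close>

theorem acts_q_exists:
 assumes N: "\<not> p dvd N" shows "\<exists>th\<in>gal. acts th N q"
proof -
 have N0: "N > 0" using N by (cases N) auto
 obtain z where z: "prim z N" using ex_prim[OF N0] by blast
 note zz = primD(1-3)[OF z]
 let ?S = "{th z |th. th \<in> gal}"
 obtain rs where rs: "set rs = ?S" "distinct rs" using finite_distinct_list[OF orbit_finite[OF zz(2)]] by blast
 have root: "(th z) [^] N = \<one>" "th z \<in> \<F>" if "th \<in> gal" for th
  using gal_pow[OF that zz(2), of N] zz gal_one[OF that] that by auto
 have rc: "set rs \<subseteq> \<F>" unfolding rs(1) using root by auto
 have rO: "set rs \<subseteq> Oint" unfolding rs(1) using root root_of_unity_O(1) N0 by auto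
 let ?c = "rcoeff rs"
 have cK: "?c k \<in> K" for k
 proof (rule ccontr)
  assume "?c k \<notin> K"
  then obtain ta where t: "ta \<in> gal" "ta (?c k) \<noteq> ?c k" using fixed_field[OF rcoeff_closed[OF rc]] by blast
  have inj: "inj_on ta (set rs)" using gal_inj[OF t(1)] rc by (auto simp: inj_on_def subset_iff)
  have "ta ` set rs \<subseteq> set rs"
  proof
   fix y assume "y \<in> ta ` set rs"
   then obtain th where s: "th \<in> gal" "y = ta (th z)" unfolding rs(1) by auto
   hence "y = (ta \<star> th) z" using G_mult t zz by simp
   thus "y \<in> set rs" unfolding rs(1) using s t G_mult_closed by blast
  qed
  hence "ta ` set rs = set rs" by (intro endo_inj_surj inj) auto
  hence "mset (map ta rs) = mset rs" using rs(2) inj by (intro set_eq_iff_mset_eq_distinct[THEN iffD1]) (auto simp: distinct_map)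
  hence "rcoeff (map ta rs) k = ?c k" using rcoeff_mset[OF rc, of "map ta rs" k] by simp
  thus False using t gal_rcoeff[OF t(1) rc] by simp
 qed
 have cO: "?c k \<in> Oint" for k by (rule rcoeff_in_subring[OF O_subring rO])
 have zO: "z \<in> Oint" using root_of_unity_O(1)[OF zz(2,3,1)] .
 have "z \<in> set rs" unfolding rs(1) using G_one[OF zz(2)] G_one_closed by (metis (mono_tags, lifting) mem_Collect_eq)
 hence z0: "psum ?c (length rs) z = \<zero>" using psum_rcoeff[OF rc zz(2)] root_prod_eq_0[OF rc zz(2)] by simp
 have "(psum ?c (length rs) z) [^] q \<doteq> psum (\<lambda>k. ?c k [^] q) (length rs) (z [^] q)"
  by (rule psum_frobenius[OF cO zO])
 hence "\<zero> \<doteq> psum (\<lambda>k. ?c k [^] q) (length rs) (z [^] q)" using z0 T_pow_q[of \<zero>] unfolding T_def by simp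
 moreover have "psum (\<lambda>k. ?c k [^] q) (length rs) (z [^] q) \<doteq> psum ?c (length rs) (z [^] q)"
  by (rule psum_cong) (use cO cK zO O_pow residue_fermat in auto)
 ultimately have "\<zero> \<doteq> psum ?c (length rs) (z [^] q)"
  using rcong_trans[OF zero_closed, of "psum (\<lambda>k. ?c k [^] q) (length rs) (z [^] q)" "psum ?c (length rs) (z [^] q)"] rc zz(2) by simp
 hence "root_prod rs (z [^] q) \<in> mx"
  using rcong_mx_iff[OF zero_closed, of "root_prod rs (z [^] q)"] psum_rcoeff[OF rc, of "z [^] q"] rc zz(2) by simp
 then obtain r where r: "r \<in> set rs" "z [^] q \<doteq> r" using root_prod_mx[OF rO O_pow[OF zO]] by blast
 then obtain th where s: "th \<in> gal" "r = th z" unfolding rs(1) by auto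
 have "(z [^] q) [^] N = \<one>" using primD(4)[OF z, of "q * N"] zz(2) by (simp add: nat_pow_pow)
 hence "z [^] q = th z" using root_of_unity_inj[OF _ _ root(2,1)[OF s(1)] N] r(2) s(2) zz(2) by simp
 thus ?thesis using acts_prim[OF z s(1), of q] s(1) by auto
qed

text \<open>The roots \<open>z ^ (q ^ i)\<close> are permuted by the \<open>q\<close>-th power map,
  so the coefficients of their polynomial have residues in the residue field of \<open>K\<close>,
  and every automorphism fixes them residually. Then \<open>th z\<close> is residually a root and
  equals some \<open>z ^ (q ^ i)\<close>.\<close>

theorem acts_q_power:
 assumes N: "\<not> p dvd N" and s: "th \<in> gal" shows "\<exists>i. acts th N (q ^ i)"
proof -
 have N0: "N > 0" using N by (cases N) auto
 obtain z where z: "prim z N" using ex_prim[OF N0] by blast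
 note zz = primD(1-3)[OF z]
 define d where "d = totient N"
 have d0: "d > 0" unfolding d_def using N0 by simp
 \<comment> \<open>This closes the list of exponents \<open>q ^ i\<close> cyclically. It may contain
   repetitions, but only multisets of roots are compared.\<close>
 have qd: "[q ^ d = 1] (mod N)" unfolding d_def using q_coprime[OF N] by (rule euler_theorem)
 define rs where "rs = map (\<lambda>i. z [^] (q ^ i)) [0..<d]"
 have root: "(z [^] (j::nat)) [^] N = \<one>" "z [^] j \<in> \<F>" for j
  using primD(4)[OF z, of "j * N"] zz(2) by (auto simp: nat_pow_pow)
 have rc: "set rs \<subseteq> \<F>" unfolding rs_def using root by auto
 have rO: "set rs \<subseteq> Oint" unfolding rs_def using root root_of_unity_O(1) N0 by auto
 let ?c = "rcoeff rs"
 have cO: "?c k \<in> Oint" for k by (rule rcoeff_in_subring[OF O_subring rO])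
 have cc: "?c k \<in> \<F>" for k using cO O_carrier by auto
 have zO: "z \<in> Oint" using root_of_unity_O(1)[OF zz(2,3,1)] .
 have "mset (map (\<lambda>r. r [^] q) rs) = mset rs"
 proof -
  obtain d' where d': "d = Suc d'" using d0 by (cases d) auto
  have "map (\<lambda>r. r [^] q) rs = map (\<lambda>i. z [^] (q ^ Suc i)) [0..<d]"
   unfolding rs_def using zz(2) by (auto simp: nat_pow_pow mult.commute)
  also have "\<dots> = map (\<lambda>i. z [^] (q ^ i)) (map Suc [0..<d])" by simp
  also have "map Suc [0..<d] = [1..<d] @ [d]" unfolding d' by (simp add: map_Suc_upt)
  also have "map (\<lambda>i. z [^] (q ^ i)) ([1..<d] @ [d]) = map (\<lambda>i. z [^] (q ^ i)) [1..<d] @ [z [^] (q ^ d)]" by simp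
  finally have 1: "map (\<lambda>r. r [^] q) rs = map (\<lambda>i. z [^] (q ^ i)) [1..<d] @ [z [^] (q ^ d)]" .
  have "z [^] (q ^ d) = z [^] (1::nat)" unfolding prim_pow_eq[OF z] by (rule qd)
  hence zd: "z [^] (q ^ d) = z [^] (q ^ 0)" by simp
  have "[0..<d] = 0 # [1..<d]" using d0 by (simp add: upt_rec)
  thus ?thesis unfolding 1 zd unfolding rs_def by simp
 qed
 hence perm: "rcoeff (map (\<lambda>r. r [^] q) rs) k = ?c k" for k using rcoeff_mset[OF rc, of "map (\<lambda>r. r [^] q) rs" k] by simp
 have "\<exists>t\<in>T. ?c k \<doteq> t" for k using residue_fixed[OF cO] frobenius_rcoeff[OF rO, of k] perm by simp
 then obtain t where t: "\<And>k. t k \<in> T" "\<And>k. ?c k \<doteq> t k" by metis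
 have tc: "t k \<in> \<F>" "t k \<in> Oint" for k using T_O[OF t(1)] O_carrier by auto
 have fix_c: "th (?c k) \<doteq> ?c k" for k
 proof -
  have "th (?c k) \<doteq> th (t k)" by (rule gal_rcong[OF s cc tc(1) t(2)])
  hence 1: "th (?c k) \<doteq> t k" using gal_K[OF s T_K[OF t(1)]] by simp
  show ?thesis by (rule rcong_trans[OF gal_closed[OF s cc] tc(1) cc 1 rcong_sym[OF cc tc(1) t(2)]])
 qed
 have szc: "th z \<in> \<F>" "th z \<in> Oint" using gal_O[OF s zO] s zz(2) by auto
 have "z \<in> set rs" unfolding rs_def using d0 zz(2) by (auto intro!: image_eqI[of _ _ 0])
 hence "psum ?c (length rs) z = \<zero>" using psum_rcoeff[OF rc zz(2)] root_prod_eq_0[OF rc zz(2)] by simp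
 hence e0: "psum (\<lambda>k. th (?c k)) (length rs) (th z) = \<zero>" using gal_psum[where c="?c" and n="length rs", OF s cc zz(2)] gal_zero[OF s] by simp
 have "psum (\<lambda>k. th (?c k)) (length rs) (th z) \<doteq> psum ?c (length rs) (th z)"
  by (rule psum_cong) (use gal_O[OF s cO] cO fix_c szc in auto)
 hence "root_prod rs (th z) \<in> mx"
  using e0 rcong_mx_iff[OF zero_closed, of "root_prod rs (th z)"] psum_rcoeff[OF rc szc(1)] rc szc by simp
 then obtain r where r: "r \<in> set rs" "th z \<doteq> r" using root_prod_mx[OF rO szc(2)] by blast
 then obtain i where i: "r = z [^] (q ^ i)" unfolding rs_def by auto
 have "(th z) [^] N = \<one>" using gal_pow[OF s zz(2), of N] zz gal_one[OF s] by simp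
 hence "th z = z [^] (q ^ i)" using root_of_unity_inj[OF szc(1) _ root(2,1) N] r(2) i by simp
 thus ?thesis using acts_prim[OF z s, of "q ^ i"] by auto
qed

end

section \<open>Discreteness of the valuation on the base field\<close>

context padic_galois
begin

text \<open>This is equality of valuations; the relation and powers of \<open>p\<close> replace a
  value group.\<close>

definition sim (infix "\<approxeq>" 50) where
 "x \<approxeq> y \<longleftrightarrow> y \<in> \<F> \<and> (\<exists>u\<in>Oint. u \<notin> mx \<and> x = y \<otimes> u)"

lemma simI: "y \<in> \<F> ==> u \<in> Oint ==> u \<notin> mx ==> y \<otimes> u \<approxeq> y" unfolding sim_def by auto

lemma simE: assumes "x \<approxeq> y" obtains u where "u \<in> Oint" "u \<notin> mx" "x = y \<otimes> u" using assms unfolding sim_def by auto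

lemma sim_carrier: "x \<approxeq> y ==> x \<in> \<F> \<and> y \<in> \<F>" unfolding sim_def using O_carrier by auto

lemma unit_inverse:
 assumes "u \<in> Oint" "u \<notin> mx" obtains v where "v \<in> Oint" "v \<notin> mx" "u \<otimes> v = \<one>"
proof -
 obtain v where v: "v \<in> Oint" "u \<otimes> v = \<one>" using unit_iff assms by auto
 have "v \<notin> mx" using v(2) mx_mult[OF assms(1), of v] one_not_mx by auto
 thus ?thesis using that v by blast
qed

lemma unit_mult: "u \<in> Oint ==> u \<notin> mx ==> v \<in> Oint ==> v \<notin> mx ==> u \<otimes> v \<in> Oint \<and> u \<otimes> v \<notin> mx"
 using mx_prime O_mult by blast

lemma sim_refl [simp]: "x \<in> \<F> ==> x \<approxeq> x" using simI[of x \<one>] one_not_mx by simp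

lemma sim_sym: assumes "x \<approxeq> y" shows "y \<approxeq> x"
proof -
 obtain u where u: "u \<in> Oint" "u \<notin> mx" "x = y \<otimes> u" using assms by (rule simE)
 obtain v where v: "v \<in> Oint" "v \<notin> mx" "u \<otimes> v = \<one>" using unit_inverse[OF u(1,2)] by blast
 have "x \<otimes> v = y" using u v sim_carrier[OF assms] O_carrier by (simp add: m_assoc)
 thus ?thesis using simI[OF _ v(1,2), of x] sim_carrier[OF assms] by simp
qed

lemma sim_mult: assumes "x \<approxeq> y" "x' \<approxeq> y'" shows "x \<otimes> x' \<approxeq> y \<otimes> y'"
proof -
 obtain u where u: "u \<in> Oint" "u \<notin> mx" "x = y \<otimes> u" using assms(1) by (rule simE)
 obtain v where v: "v \<in> Oint" "v \<notin> mx" "x' = y' \<otimes> v" using assms(2) by (rule simE)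
 have "x \<otimes> x' = (y \<otimes> y') \<otimes> (u \<otimes> v)"
  unfolding u(3) v(3) using O_carrier[OF u(1)] O_carrier[OF v(1)] sim_carrier[OF assms(1)] sim_carrier[OF assms(2)]
  by (simp add: m_ac)
 thus ?thesis using simI[of "y \<otimes> y'" "u \<otimes> v"] unit_mult[OF u(1,2) v(1,2)] sim_carrier[OF assms(1)] sim_carrier[OF assms(2)] by simp
qed

lemma sim_trans [trans]: assumes "x \<approxeq> y" "y \<approxeq> z" shows "x \<approxeq> z"
proof -
 obtain u where u: "u \<in> Oint" "u \<notin> mx" "x = y \<otimes> u" using assms(1) by (rule simE)
 obtain v where v: "v \<in> Oint" "v \<notin> mx" "y = z \<otimes> v" using assms(2) by (rule simE)
 have "x = z \<otimes> (v \<otimes> u)" unfolding u(3) v(3)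
  using O_carrier[OF u(1)] O_carrier[OF v(1)] sim_carrier[OF assms(2)] by (simp add: m_assoc)
 thus ?thesis using simI[of z "v \<otimes> u"] unit_mult[OF v(1,2) u(1,2)] sim_carrier[OF assms(2)] by simp
qed

lemma sim_pow: "x \<approxeq> y ==> x [^] (n::nat) \<approxeq> y [^] n" by (induction n) (auto intro: sim_mult)

lemma sim_unit: "x \<in> Oint ==> x \<notin> mx \<longleftrightarrow> x \<approxeq> \<one>"
proof
 show "x \<approxeq> \<one>" if "x \<in> Oint" "x \<notin> mx" using simI[of \<one> x] that O_carrier by simp
 show "x \<notin> mx" if "x \<approxeq> \<one>" using that by (elim simE) (use O_carrier in simp)
qed

lemma sim_nonzero: "x \<approxeq> y ==> y \<noteq> \<zero> ==> x \<noteq> \<zero>"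
 by (drule sim_sym, elim simE) (use O_carrier in auto)

lemma sim_cancel: assumes "z \<otimes> x \<approxeq> z \<otimes> y" and c: "x \<in> \<F>" "y \<in> \<F>" "z \<in> \<F>" "z \<noteq> \<zero>" shows "x \<approxeq> y"
proof -
 obtain u where u: "u \<in> Oint" "u \<notin> mx" "z \<otimes> x = z \<otimes> y \<otimes> u" using assms(1) by (rule simE)
 have "z \<otimes> x = z \<otimes> (y \<otimes> u)" using u(3) c O_carrier[OF u(1)] by (simp add: m_assoc)
 hence "x = y \<otimes> u" using m_lcancel[of z x "y \<otimes> u"] c O_carrier[OF u(1)] by simp
 thus ?thesis using simI[OF c(2) u(1,2)] by simp
qed

lemma sim_cases:
 assumes x: "x \<in> \<F>" "x \<noteq> \<zero>" and y: "y \<in> \<F>" "y \<noteq> \<zero>"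
 obtains "x \<approxeq> y" | t where "t \<in> mx" "x = y \<otimes> t" | t where "t \<in> mx" "y = x \<otimes> t"
 using O_divides[OF x(1) y] y(1) unfolding sim_def by blast

lemma sim_add: "y \<in> \<F> ==> t \<in> mx ==> y \<oplus> y \<otimes> t \<approxeq> y"
proof -
 assume y: "y \<in> \<F>" and t: "t \<in> mx"
 have tc: "t \<in> \<F>" using t mx_carrier by auto
 have "\<one> \<oplus> t \<notin> mx"
 proof
  assume "\<one> \<oplus> t \<in> mx"
  hence "(\<one> \<oplus> t) \<ominus> t \<in> mx" using t by (rule mx_diff)
  moreover have "(\<one> \<oplus> t) \<ominus> t = \<one>" using tc by algebra
  ultimately show False using one_not_mx by simp
 qed
 moreover have "\<one> \<oplus> t \<in> Oint" using t mx_O O_add by simp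
 ultimately have "y \<otimes> (\<one> \<oplus> t) \<approxeq> y" using simI y by simp
 thus ?thesis using y tc by (simp add: r_distr)
qed

lemma pi_pow_sim: assumes "\<pi> [^] (A::nat) \<approxeq> \<pi> [^] (B::nat)" shows "A = B"
proof -
 have ne: False if "\<pi> [^] (A::nat) \<approxeq> \<pi> [^] (B::nat)" "A < B" for A B
 proof -
  from that(2) obtain d where d: "B = A + Suc d" using less_iff_Suc_add by auto
  have "\<pi> [^] A \<otimes> \<one> \<approxeq> \<pi> [^] A \<otimes> \<pi> [^] Suc d" using that(1) d by (simp add: nat_pow_mult[symmetric] m_ac)
  hence "\<one> \<approxeq> \<pi> [^] Suc d" by (rule sim_cancel) (use pow_nonzero pi_nonzero in auto)
  hence "\<pi> [^] Suc d \<notin> mx" using sim_unit[OF O_pow[OF O_natc]] sim_sym by blast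
  moreover have "\<pi> [^] Suc d \<in> mx" using mx_mult[OF O_pow[OF O_natc] pi_mx] by simp
  ultimately show False by blast
 qed
 show ?thesis using ne[of A B] ne[of B A] assms sim_sym linorder_neqE_nat by blast
qed

lemma Q_carrier: "Q \<subseteq> \<F>" using Q_K K_carrier by blast

lemma Q_sim: assumes x: "x \<in> Q" "x \<noteq> \<zero>" shows "\<exists>(A::nat) (B::nat). x \<otimes> \<pi> [^] A \<approxeq> \<pi> [^] B"
proof -
 obtain u u' k where u: "u \<in> Z" "u' \<in> Z" "u \<otimes> u' = \<one>" "x = u \<otimes> \<pi> [^] (k::nat) \<or> x \<otimes> \<pi> [^] k = u" using Q_val[OF x] by blast
 have "u \<in> Oint" "u' \<in> Oint" using u Z_O by auto
 hence u1: "u \<approxeq> \<one>" "u \<in> \<F>" using sim_unit unit_iff u(3) O_carrier by blast+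
 from u(4) show ?thesis
 proof
  assume "x = u \<otimes> \<pi> [^] k"
  hence "x \<otimes> \<pi> [^] (0::nat) \<approxeq> \<pi> [^] k" using sim_mult[OF u1(1), of "\<pi> [^] k" "\<pi> [^] k"] u1 by simp
  thus ?thesis by blast
 next
  assume "x \<otimes> \<pi> [^] k = u"
  hence "x \<otimes> \<pi> [^] k \<approxeq> \<pi> [^] (0::nat)" using u1 by simp
  thus ?thesis by blast
 qed
qed

text \<open>A sum of terms with pairwise different valuations has the valuation of one of the terms.\<close>

lemma eval_sim:
 assumes x: "x \<in> \<F>" "x \<noteq> \<zero>" and P: "set P \<subseteq> Q"
 shows "(\<exists>i j a b. i < j \<and> j < length P \<and> a \<in> Q - {\<zero>} \<and> b \<in> Q - {\<zero>} \<and> a \<otimes> x [^] (i::nat) \<approxeq> b \<otimes> x [^] (j::nat)) \<or>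
  (set P \<subseteq> {\<zero>} \<and> eval P x = \<zero>) \<or> (\<exists>i<length P. \<exists>a\<in>Q - {\<zero>}. eval P x \<approxeq> a \<otimes> x [^] i)"
 using P
proof (induction P)
 case (Cons c P)
 have cc: "c \<in> Q" "c \<in> \<F>" and PQ: "set P \<subseteq> Q" "set P \<subseteq> \<F>" using Cons.prems Q_carrier by auto
 define e where "e = eval P x"
 have ec: "e \<in> \<F>" unfolding e_def using eval_in_carrier PQ(2) x(1) by simp
 define m where "m = c \<otimes> x [^] length P"
 have mc: "m \<in> \<F>" unfolding m_def using cc x by simp
 have ev: "eval (c # P) x = m \<oplus> e" unfolding m_def e_def by simp
 from Cons.IH[OF PQ(1)] consider (bad) "\<exists>i j a b. i < j \<and> j < length P \<and> a \<in> Q - {\<zero>} \<and> b \<in> Q - {\<zero>} \<and> a \<otimes> x [^] (i::nat) \<approxeq> b \<otimes> x [^] (j::nat)"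
  | (zero) "set P \<subseteq> {\<zero>}" "e = \<zero>" | (dom) "\<exists>i<length P. \<exists>a\<in>Q - {\<zero>}. e \<approxeq> a \<otimes> x [^] i" unfolding e_def by blast
 thus ?case
 proof cases
  case bad
  then obtain i j a b where "i < j \<and> j < length P \<and> a \<in> Q - {\<zero>} \<and> b \<in> Q - {\<zero>} \<and> a \<otimes> x [^] (i::nat) \<approxeq> b \<otimes> x [^] (j::nat)" by blast
  thus ?thesis by (intro disjI1 exI[of _ i] exI[of _ j] exI[of _ a] exI[of _ b]) auto
 next
  case zero
  show ?thesis
  proof (cases "c = \<zero>")
   case True
   thus ?thesis using zero ev x unfolding m_def by auto
  next
   case False
   have "eval (c # P) x \<approxeq> c \<otimes> x [^] length P" using zero(2) ev mc unfolding m_def by simp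
   thus ?thesis using False cc by auto
  qed
 next
  case dom
  then obtain i a where i: "i < length P" "a \<in> Q - {\<zero>}" "e \<approxeq> a \<otimes> x [^] i" by blast
  have ac: "a \<in> \<F>" "a \<otimes> x [^] i \<noteq> \<zero>" using i Q_carrier x pow_nonzero integral_iff by auto
  show ?thesis
  proof (cases "c = \<zero>")
   case True
   hence "eval (c # P) x = e" using ev ec x unfolding m_def by simp
   thus ?thesis using i by auto
  next
   case False
   have m0: "m \<noteq> \<zero>" unfolding m_def using False cc x pow_nonzero integral_iff by simp
   have e0: "e \<noteq> \<zero>" by (rule sim_nonzero[OF i(3) ac(2)])
   from mc m0 ec e0 show ?thesis
   proof (cases rule: sim_cases)
    case 1
    have "a \<otimes> x [^] i \<approxeq> c \<otimes> x [^] length P" using sim_sym[OF sim_trans[OF 1 i(3)]] unfolding m_def .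
    thus ?thesis using i(1,2) False cc(1) by (intro disjI1 exI[of _ i] exI[of _ "length P"] exI[of _ a] exI[of _ c]) auto
   next
    case (2 t)
    have "m \<oplus> e \<approxeq> e" using sim_add[OF ec 2(1)] 2(2) mc ec by (simp add: a_comm)
    thus ?thesis unfolding ev using sim_trans[OF _ i(3)] i(1,2) by (intro disjI2 exI[of _ i]) auto
   next
    case (3 t)
    have "m \<oplus> e \<approxeq> m" using sim_add[OF mc 3(1)] 3(2) by simp
    thus ?thesis unfolding ev using False cc unfolding m_def by (intro disjI2 exI[of _ "length P"]) auto
   qed
  qed
 qed
qed simp

text \<open>In a relation of degree at most \<open>edim\<close> over \<open>Q\<close> two terms must
  have equal valuation, as otherwise a single term would dominate the vanishing sum. Hence some
  multiple \<open>d\<close> of the valuation of \<open>x\<close> is an integer multiple of that of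
  \<open>p\<close>: the ramification is bounded.\<close>

lemma K_pow_sim:
 assumes x: "x \<in> K" "x \<noteq> \<zero>"
 shows "\<exists>(d::nat) (A::nat) (B::nat). 0 < d \<and> d \<le> edim \<and> x [^] d \<otimes> \<pi> [^] A \<approxeq> \<pi> [^] B"
proof -
 have xc: "x \<in> \<F>" using x K_carrier by auto
 obtain P where P: "P \<noteq> []" "length P \<le> Suc edim" "hd P \<noteq> \<zero>" "set P \<subseteq> Q" "eval P x = \<zero>" using K_relation[OF x(1)] by blast
 have "\<not> set P \<subseteq> {\<zero>}" using P(1,3) hd_in_set by blast
 moreover have "\<not> (\<exists>i<length P. \<exists>a\<in>Q - {\<zero>}. eval P x \<approxeq> a \<otimes> x [^] i)"
 proof
  assume "\<exists>i<length P. \<exists>a\<in>Q - {\<zero>}. eval P x \<approxeq> a \<otimes> x [^] i"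
  then obtain i a where i: "a \<in> Q - {\<zero>}" "\<zero> \<approxeq> a \<otimes> x [^] (i::nat)" unfolding P(5) by blast
  have "a \<otimes> x [^] i = \<zero>" using sim_nonzero[OF i(2)] by blast
  thus False using i(1) Q_carrier xc x(2) pow_nonzero integral_iff by auto
 qed
 ultimately obtain i j a b where ij: "i < j" "j < length P" "a \<in> Q" "a \<noteq> \<zero>" "b \<in> Q" "b \<noteq> \<zero>" "a \<otimes> x [^] (i::nat) \<approxeq> b \<otimes> x [^] (j::nat)"
  using eval_sim[OF xc x(2) P(4)] by blast
 define d where "d = j - i"
 have d: "0 < d" "d \<le> edim" "j = i + d" using ij P(2) unfolding d_def by auto
 have abc: "a \<in> \<F>" "b \<in> \<F>" using ij Q_carrier by auto
 have "x [^] i \<otimes> a \<approxeq> x [^] i \<otimes> (b \<otimes> x [^] d)" using ij(7) abc xc unfolding d(3) by (simp add: nat_pow_mult[symmetric] m_ac)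
 hence ab: "a \<approxeq> b \<otimes> x [^] d" by (rule sim_cancel) (use abc xc x pow_nonzero in auto)
 obtain A B where AB: "a \<otimes> \<pi> [^] (A::nat) \<approxeq> \<pi> [^] (B::nat)" using Q_sim ij(3,4) by blast
 obtain C D where CD: "b \<otimes> \<pi> [^] (C::nat) \<approxeq> \<pi> [^] (D::nat)" using Q_sim ij(5,6) by blast
 have "x [^] d \<otimes> \<pi> [^] (D + A) = \<pi> [^] D \<otimes> (x [^] d \<otimes> \<pi> [^] A)" using xc by (simp add: nat_pow_mult[symmetric] m_ac)
 also have "\<dots> \<approxeq> (b \<otimes> \<pi> [^] C) \<otimes> (x [^] d \<otimes> \<pi> [^] A)" by (rule sim_mult[OF sim_sym[OF CD]]) (use xc in simp)
 also have "(b \<otimes> \<pi> [^] C) \<otimes> (x [^] d \<otimes> \<pi> [^] A) = (b \<otimes> x [^] d) \<otimes> (\<pi> [^] C \<otimes> \<pi> [^] A)" using xc abc by (simp add: m_ac)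
 also have "\<dots> \<approxeq> a \<otimes> (\<pi> [^] C \<otimes> \<pi> [^] A)" by (rule sim_mult[OF sim_sym[OF ab]]) simp
 also have "a \<otimes> (\<pi> [^] C \<otimes> \<pi> [^] A) = (a \<otimes> \<pi> [^] A) \<otimes> \<pi> [^] C" using abc by (simp add: m_ac)
 also have "\<dots> \<approxeq> \<pi> [^] B \<otimes> \<pi> [^] C" by (rule sim_mult[OF AB]) simp
 also have "\<pi> [^] B \<otimes> \<pi> [^] C = \<pi> [^] (B + C)" by (simp add: nat_pow_mult)
 finally show ?thesis using d(1,2) by (intro exI conjI)
qed

lemma edim_pos: "0 < edim"
 using K_pow_sim[of \<one>] subringE(3)[OF K_subring] by force

text \<open>The valuation of \<open>w\<close> is \<open>s / M\<close> times that of
  \<open>p\<close>. Some \<open>d\<close> at most \<open>edim\<close> clears its denominator, so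
  \<open>M\<close> divides \<open>s d\<close>.\<close>

lemma root_of_pi_power_bound:
 assumes w: "w \<in> K" "w [^] (M::nat) = \<pi> [^] (s::nat)" and s: "s > 0" shows "M \<le> edim * s"
proof -
 have wc: "w \<in> \<F>" using w K_carrier by auto
 have M0: "M > 0" using w(2) s pi_pow_sim[of 0 s] by (cases M) auto
 have w0: "w \<noteq> \<zero>"
 proof
  assume "w = \<zero>"
  hence "\<pi> [^] s = \<zero>" using w(2) M0 by (cases M) auto
  thus False using pow_nonzero[OF _ pi_nonzero] by simp
 qed
 obtain d A B where d: "0 < d" "d \<le> edim" "w [^] (d::nat) \<otimes> \<pi> [^] (A::nat) \<approxeq> \<pi> [^] (B::nat)" using K_pow_sim[OF w(1) w0] by blast
 have "(w [^] d \<otimes> \<pi> [^] A) [^] M = (w [^] M) [^] d \<otimes> \<pi> [^] (A * M)" using wc by (simp add: nat_pow_distrib nat_pow_pow mult.commute)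
 hence "(w [^] d \<otimes> \<pi> [^] A) [^] M = \<pi> [^] (s * d + A * M)" unfolding w(2) by (simp add: nat_pow_pow nat_pow_mult)
 hence "\<pi> [^] (s * d + A * M) \<approxeq> \<pi> [^] (B * M)" using sim_pow[OF d(3), of M] by (simp add: nat_pow_pow)
 hence "s * d + A * M = B * M" by (rule pi_pow_sim)
 hence "M dvd s * d" by (metis dvd_triv_right dvd_add_left_iff)
 hence "M \<le> s * d" using s d(1) by (intro dvd_imp_le) auto
 also have "\<dots> \<le> edim * s" using d(2) by (simp add: mult.commute)
 finally show ?thesis .
qed

text \<open>The factorial is a common multiple of all exponents \<open>d\<close> in
  \<open>K_pow_sim\<close>, so the same power of every nonzero element of \<open>OK\<close> is a
  unit times a power of \<open>p\<close>. The resulting \<open>vval\<close> is a valuation that need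
  not be normalized.\<close>

definition "vexp = (fact edim :: nat)"

lemma ex_vval: assumes x: "x \<in> OK" "x \<noteq> \<zero>" shows "\<exists>m::nat. x [^] vexp \<approxeq> \<pi> [^] m"
proof -
 have xK: "x \<in> K" "x \<in> Oint" "x \<in> \<F>" using x O_carrier unfolding OK_def by auto
 obtain d A B where d: "0 < d" "d \<le> edim" "x [^] (d::nat) \<otimes> \<pi> [^] (A::nat) \<approxeq> \<pi> [^] (B::nat)" using K_pow_sim[OF xK(1) x(2)] by blast
 obtain r where r: "vexp = d * r" unfolding vexp_def using dvd_fact d by (metis Suc_leI One_nat_def dvdE)
 have 1: "x [^] vexp \<otimes> \<pi> [^] (A * r) \<approxeq> \<pi> [^] (B * r)" using sim_pow[OF d(3), of r] xK(3) unfolding r by (simp add: nat_pow_distrib nat_pow_pow)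
 show ?thesis
 proof (cases "A * r \<le> B * r")
  case True
  then obtain m where m: "B * r = A * r + m" using le_Suc_ex by blast
  have "\<pi> [^] (A * r) \<otimes> x [^] vexp \<approxeq> \<pi> [^] (A * r) \<otimes> \<pi> [^] m" using 1 xK(3) unfolding m by (simp add: nat_pow_mult m_comm add.commute)
  hence "x [^] vexp \<approxeq> \<pi> [^] m" by (rule sim_cancel) (use xK pow_nonzero pi_nonzero in auto)
  thus ?thesis ..
 next
  case False
  then obtain m where m: "A * r = B * r + Suc m" using less_iff_Suc_add[of "B * r" "A * r"] by auto
  have "\<pi> [^] (B * r) \<otimes> (x [^] vexp \<otimes> \<pi> [^] Suc m) \<approxeq> \<pi> [^] (B * r) \<otimes> \<one>"
   using 1 xK(3) unfolding m by (simp add: nat_pow_mult[symmetric] m_ac del: nat_pow_Suc)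
  hence "x [^] vexp \<otimes> \<pi> [^] Suc m \<approxeq> \<one>" by (rule sim_cancel) (use xK pow_nonzero pi_nonzero in auto)
  moreover have "x [^] vexp \<otimes> \<pi> [^] Suc m \<in> mx"
   using mx_mult[OF O_mult[OF O_pow[OF xK(2)] O_pow[OF O_natc]] pi_mx] xK(3) by (simp add: m_assoc)
  ultimately show ?thesis using sim_unit mx_O by blast
 qed
qed

definition "vval x = (SOME m::nat. x [^] vexp \<approxeq> \<pi> [^] m)"

lemma vval: "x \<in> OK ==> x \<noteq> \<zero> ==> x [^] vexp \<approxeq> \<pi> [^] vval x"
 unfolding vval_def by (rule someI_ex[OF ex_vval])

lemma vval_mult: assumes "x \<in> OK" "x \<noteq> \<zero>" "y \<in> OK" "y \<noteq> \<zero>" shows "vval (x \<otimes> y) = vval x + vval y"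
proof -
 have c: "x \<in> \<F>" "y \<in> \<F>" using assms subringE(1)[OF OK_subring] by auto
 have xy: "x \<otimes> y \<in> OK" "x \<otimes> y \<noteq> \<zero>" using assms c subringE(6)[OF OK_subring] integral_iff by auto
 have "\<pi> [^] vval (x \<otimes> y) \<approxeq> (x \<otimes> y) [^] vexp" by (rule sim_sym[OF vval[OF xy]])
 also have "(x \<otimes> y) [^] vexp = x [^] vexp \<otimes> y [^] vexp" using c by (simp add: nat_pow_distrib)
 also have "\<dots> \<approxeq> \<pi> [^] vval x \<otimes> \<pi> [^] vval y" by (rule sim_mult[OF vval[OF assms(1,2)] vval[OF assms(3,4)]])
 also have "\<pi> [^] vval x \<otimes> \<pi> [^] vval y = \<pi> [^] (vval x + vval y)" by (simp add: nat_pow_mult)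
 finally show ?thesis by (rule pi_pow_sim)
qed

lemma vval_pos: assumes "x \<in> mK" "x \<noteq> \<zero>" shows "0 < vval x"
proof (rule ccontr)
 assume "\<not> ?thesis"
 hence "x [^] vexp \<approxeq> \<one>" using vval[of x] assms mx_O unfolding mK_def OK_def by auto
 moreover have "x \<in> mx" using assms unfolding mK_def by auto
 hence "x [^] vexp \<in> mx"
 proof -
  obtain r where "vexp = Suc r" unfolding vexp_def using fact_nonzero not0_implies_Suc by blast
  thus ?thesis using mx_mult[OF O_pow[OF mx_O] \<open>x \<in> mx\<close>, of x r] \<open>x \<in> mx\<close> by simp
 qed
 ultimately show False using sim_unit mx_O by blast
qed

lemma K_quotient:
 assumes "x \<in> K" "y \<in> K" "y \<noteq> \<zero>" "x = y \<otimes> t" "t \<in> \<F>" shows "t \<in> K"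
proof -
 have yc: "y \<in> \<F>" "inv y \<in> \<F>" "inv y \<otimes> y = \<one>" using assms K_carrier field_Units by auto
 have "t = inv y \<otimes> x" unfolding assms(4) using yc assms(5) m_assoc[of "inv y" y t] by simp
 thus ?thesis using subringE(6)[OF K_subring K_inv[OF assms(2,3)] assms(1)] by simp
qed

text \<open>A uniformizer in the form used for computing valuations; \<open>uniformizer_iff\<close>
  links it to generators of the maximal ideal.\<close>

definition unif where "unif w \<longleftrightarrow> w \<in> mK \<and> w \<noteq> \<zero> \<and> (\<forall>x\<in>OK. x \<noteq> \<zero> --> (\<exists>k::nat. x \<approxeq> w [^] k))"

text \<open>Take a nonzero nonunit of least \<open>vval\<close>. If it divides \<open>x\<close>, the
  quotient has smaller \<open>vval\<close> and induction applies; if a nonunit \<open>x\<close>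
  divided it strictly, minimality would fail.\<close>

theorem ex_unif: "\<exists>w. unif w"
proof -
 have "\<pi> \<in> mK" unfolding mK_def using pi_mx natc_K by auto
 hence "\<exists>w. w \<in> mK \<and> w \<noteq> \<zero>" using pi_nonzero by blast
 then obtain w where w: "w \<in> mK" "w \<noteq> \<zero>" "\<And>y. y \<in> mK ==> y \<noteq> \<zero> ==> vval w \<le> vval y"
  using ex_has_least_nat[of "\<lambda>w. w \<in> mK \<and> w \<noteq> \<zero>" _ vval] by blast
 have wc: "w \<in> \<F>" "w \<in> OK" "w \<in> K" using w mx_O O_carrier unfolding mK_def OK_def by auto
 have quot: "t \<in> mK" if "t \<in> mx" "x \<in> K" "y \<in> K" "y \<noteq> \<zero>" "x = y \<otimes> t" for x y t
  using K_quotient[OF that(2-5) mx_carrier] that(1) unfolding mK_def by simp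
 have "\<exists>k::nat. x \<approxeq> w [^] k" if "x \<in> OK" "x \<noteq> \<zero>" for x
  using that
 proof (induction "vval x" arbitrary: x rule: less_induct)
  case less
  have xc: "x \<in> \<F>" "x \<in> K" "x \<in> Oint" using less.prems O_carrier unfolding OK_def by auto
  show ?case
  proof (cases "x \<in> mx")
   case False
   hence "x \<approxeq> w [^] (0::nat)" using sim_unit xc by simp
   thus ?thesis ..
  next
   case True
   from xc(1) less.prems(2) wc(1) w(2) show ?thesis
   proof (cases rule: sim_cases)
    case 1
    hence "x \<approxeq> w [^] (1::nat)" using wc by simp
    thus ?thesis ..
   next
    case (2 t)
    have t: "t \<in> mK" "t \<noteq> \<zero>" "t \<in> OK" using quot[OF 2(1) xc(2) wc(3) w(2) 2(2)] less.prems(2) 2 wc mx_O unfolding mK_def OK_def by auto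
    have "vval t < vval x" unfolding 2(2) using vval_mult[OF wc(2) w(2) t(3,2)] vval_pos[OF w(1,2)] by simp
    then obtain k :: nat where "t \<approxeq> w [^] k" using less.hyps[OF _ t(3,2)] by blast
    hence "w \<otimes> t \<approxeq> w \<otimes> w [^] k" by (intro sim_mult) (use wc in auto)
    hence "x \<approxeq> w [^] Suc k" using 2(2) wc by (simp add: m_comm)
    thus ?thesis ..
   next
    case (3 t)
    have t: "t \<in> mK" "t \<noteq> \<zero>" "t \<in> OK" using quot[OF 3(1) wc(3) xc(2) less.prems(2) 3(2)] w(2) 3 xc mx_O unfolding mK_def OK_def by auto
    have "vval x < vval w" unfolding 3(2) using vval_mult[OF less.prems t(3,2)] vval_pos[OF t(1,2)] by simp
    moreover have "x \<in> mK" using True xc unfolding mK_def by simp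
    ultimately show ?thesis using w(3)[of x] less.prems(2) by simp
   qed
  qed
 qed
 thus ?thesis using w unfolding unif_def by blast
qed

end

section \<open>Recovering the cyclotomic character from the criterion\<close>

lemma prime_power_dvd_cancel:
 fixes x y :: int
 assumes l: "nat_prime l" and d: "int l ^ (k + j) dvd x * y" and y: "\<not> int l ^ j dvd y"
 shows "int l ^ k dvd x"
proof (cases "x = 0")
 case False
 have y0: "y \<noteq> 0" using y by auto
 have l': "normalization_semidom_class.prime (int l)" using l by simp
 have "\<not> is_unit (int l)" using l' not_prime_unit by blast
 note dvd = power_dvd_iff_le_multiplicity[OF _ this]
 have "k + j \<le> multiplicity (int l) (x * y)" using d dvd[of "x * y" "k + j"] False y0 by simp
 also have "\<dots> = multiplicity (int l) x + multiplicity (int l) y"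
  using prime_elem_multiplicity_mult_distrib[of "int l" x y] l' False y0 by (simp add: prime_def)
 finally have "k \<le> multiplicity (int l) x" using y dvd[OF y0, of j] by simp
 thus ?thesis using dvd[OF False] by simp
qed simp

context padic_galois
begin

lemma acts_dvd: "acts th n c ==> m dvd n ==> acts th m c"
 unfolding acts_def by (auto elim!: dvdE simp: nat_pow_pow[symmetric])

lemma acts_of_cong:
 assumes "n > 0" "acts th n c" "[c = d] (mod n)" shows "acts th n d"
 unfolding acts_def
proof (intro ballI impI)
 fix x assume x: "x \<in> \<F>" "x [^] n = \<one>"
 obtain w where w: "prim w n" using ex_prim assms by blast
 obtain i :: nat where i: "x = w [^] i" using prim_roots[OF w x] by blast
 have "w [^] (i * c) = w [^] (i * d)" unfolding prim_pow_eq[OF w] by (intro cong_mult cong_refl assms)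
 hence "x [^] c = x [^] d" unfolding i using primD(2)[OF w] by (simp add: nat_pow_pow)
 thus "th x = x [^] d" using assms(2) x unfolding acts_def by simp
qed

text \<open>The criterion is tested on the Kummer cocycle \<open>C\<close> of an \<open>n\<close>-th
  root of \<open>p\<close>, restricted to the stabilizer of a primitive root \<open>z\<close>, with
  \<open>t\<close> acting on \<open>z\<close> by the \<open>q\<close>-th power. It then says that
  \<open>l ^ k\<close> divides \<open>(D th - c) (q - 1) C h\<close> for a commutator
  \<open>h\<close>. Neither \<open>q - 1\<close> nor a suitable \<open>C h\<close> is divisible by
  \<open>l ^ j\<close>, so the two factors cost at most \<open>2 j\<close> in the exponent.\<close>

theorem acts_of_comm_crit:
 assumes l: "nat_prime l" "l \<noteq> p" and j: "l ^ j > edim * (q - 1)" and k: "2 * j \<le> k"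
  and s: "th \<in> gal" and crit: "comm_crit G Ktop (l ^ k) th c"
 shows "acts th (l ^ (k - 2 * j)) c"
proof -
 define n where "n = l ^ k"
 have lp: "\<not> p dvd l ^ i" for i
  using l p_prime by (metis prime_dvd_power primes_dvd_imp_eq)
 have pn: "\<not> p dvd n" unfolding n_def by (rule lp)
 have l0: "l > 0" using l prime_gt_0_nat by blast
 have n0: "n > 0" unfolding n_def using l0 by simp
 obtain z where z: "prim z n" using ex_prim[OF n0] by blast
 note zz = primD(1-3)[OF z]
 obtain v where v: "v \<in> \<F>" "v [^] n = \<pi>" using ex_root_pow[OF n0, of \<pi>] by auto
 have v0: "v \<noteq> \<zero>"
 proof
  assume "v = \<zero>"
  hence "v [^] n = \<zero>" using n0 by (cases n) auto
  thus False using v pi_nonzero by simp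
 qed
 have zc: "z [^] (i::nat) \<in> \<F>" for i using zz by simp
 have zpe: "z [^] a = z [^] b \<longleftrightarrow> [a = b] (mod n)" for a b by (rule prim_pow_eq[OF z])
 have "\<exists>i. \<forall>\<sigma>'\<in>gal. \<sigma>' v = z [^] (i \<sigma>' :: nat) \<otimes> v"
 proof (rule bchoice, rule ballI)
  fix g assume g: "g \<in> gal"
  have iv: "inv v \<in> \<F>" "inv v \<otimes> v = \<one>" using v v0 field_Units by auto
  have gv: "g v \<in> \<F>" "(g v) [^] n = \<pi>" using g v gal_pow[OF g v(1), of n] gal_K[OF g natc_K] by auto
  have "(g v \<otimes> inv v) [^] n = v [^] n \<otimes> (inv v) [^] n" using gv v iv by (simp add: nat_pow_distrib)
  also have "\<dots> = (v \<otimes> inv v) [^] n" by (rule nat_pow_distrib[OF v(1) iv(1), symmetric])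
  finally have "(g v \<otimes> inv v) [^] n = \<one>" using iv m_comm[OF v(1) iv(1)] by simp
  then obtain i where "g v \<otimes> inv v = z [^] (i::nat)" using prim_roots[OF z m_closed[OF gv(1) iv(1)]] by blast
  hence "z [^] i \<otimes> v = g v" using gv iv v by (metis m_assoc r_one)
  thus "\<exists>i. g v = z [^] (i::nat) \<otimes> v" by metis
 qed
 then obtain e where e: "\<And>g. g \<in> gal ==> g v = z [^] (e g :: nat) \<otimes> v" by blast
 have "\<exists>ch. \<forall>g\<in>gal. acts g n (ch g)" by (rule bchoice) (use ex_acts n0 in blast)
 then obtain ch where ch: "\<And>g. g \<in> gal ==> acts g n (ch g)" by blast
 have chz: "g z = z [^] ch g" if "g \<in> gal" for g using ch[OF that] zz unfolding acts_def by blast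
 \<comment> \<open>\<open>D\<close> is the cyclotomic character modulo \<open>n\<close> and
   \<open>C\<close> the Kummer cocycle of \<open>v\<close>, both as integers because they are
   subtracted below.\<close>
 define C D where "C g = int (e g)" and "D g = int (ch g)" for g
 have D1: "[D h = 1] (mod int n)" if "h \<in> gal" "h z = z" for h
 proof -
  have "z [^] ch h = z [^] (1::nat)" using chz[OF that(1)] that(2) zz by simp
  hence "[ch h = 1] (mod n)" unfolding zpe .
  thus ?thesis unfolding D_def using cong_int_iff[of "ch h" 1 n] by simp
 qed
 have coc: "[C (g \<star> h) = D g * C h + C g] (mod int n)" if g: "g \<in> gal" "h \<in> gal" for g h
 proof -
  have "z [^] e (g \<star> h) \<otimes> v = g (z [^] e h \<otimes> v)" using e[OF G_mult_closed[OF g]] e[OF g(2)] G_mult[OF g v(1)] by simp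
  also have "\<dots> = (g z) [^] e h \<otimes> g v" using gal_mult[OF g(1) zc v(1)] gal_pow[OF g(1) zz(2)] by simp
  also have "\<dots> = z [^] (ch g * e h + e g) \<otimes> v" unfolding chz[OF g(1)] e[OF g(1)]
   using zz v by (simp add: nat_pow_pow nat_pow_mult[symmetric] m_assoc)
  finally have "z [^] e (g \<star> h) = z [^] (ch g * e h + e g)" using m_rcancel[OF v0 v(1) zc zc] by simp
  hence "[e (g \<star> h) = ch g * e h + e g] (mod n)" unfolding zpe .
  hence "[int (e (g \<star> h)) = int (ch g * e h + e g)] (mod int n)" by (simp only: cong_int_iff)
  thus ?thesis unfolding C_def D_def by simp
 qed
 define H where "H = {h \<in> gal. h z = z}"
 note stab = root_stabilizer[OF zz(2,3) n0]
 have H: "subgroup H G" unfolding H_def by (rule stab(1))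
 have Hg: "h \<in> gal" "h z = z" if "h \<in> H" for h using that unfolding H_def by auto
 have norm: "g \<star> h \<star> \<iota> g \<in> H" if "g \<in> gal" "h \<in> H" for g h
  using stab(2)[OF that(1)] Hg[OF that(2)] that(1) unfolding H_def by simp
 have fhom: "[C (h \<star> h') = C h + C h'] (mod int n)" if h: "h \<in> H" "h' \<in> H" for h h'
 proof -
  have "[D h * C h' + C h = 1 * C h' + C h] (mod int n)" by (intro cong_add cong_mult cong_refl D1 Hg h)
  from cong_trans[OF coc[OF Hg(1)[OF h(1)] Hg(1)[OF h(2)]] this] show ?thesis by (simp add: add.commute)
 qed
 have op: "openin Ktop {h \<in> H. int n dvd C h}"
  unfolding openin_Ktop
 proof (intro conjI ballI)
  fix g assume g: "g \<in> {h \<in> H. int n dvd C h}"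
  have gg: "g \<in> gal" "g z = z" "int n dvd C g" using g Hg by auto
  show "\<exists>A. finite A \<and> A \<subseteq> \<F> \<and> (\<forall>ta\<in>gal. (\<forall>x\<in>A. ta x = g x) --> ta \<in> {h \<in> H. int n dvd C h})"
  proof (intro exI[of _ "{z, v}"] conjI ballI impI)
   fix ta assume t: "ta \<in> gal" "\<forall>x\<in>{z, v}. ta x = g x"
   have "z [^] e ta \<otimes> v = z [^] e g \<otimes> v" using t e[OF t(1)] e[OF gg(1)] by simp
   hence "z [^] e ta = z [^] e g" using m_rcancel[OF v0 v(1) zc zc] by simp
   hence "[e ta = e g] (mod n)" unfolding zpe .
   hence "n dvd e ta" using gg(3) unfolding C_def by (simp add: cong_dvd_iff)
   thus "ta \<in> {h \<in> H. int n dvd C h}" using t gg unfolding H_def C_def by simp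
  qed (use zz v in auto)
 qed (use Hg in auto)
 \<comment> \<open>The cocycle rule is evaluated on the two factorizations of \<open>g h\<close>,
   the other one being \<open>(g h g^-1) g\<close>.\<close>
 have Cconj: "[C (g \<star> h \<star> \<iota> g) = D g * C h] (mod int n)" if g: "g \<in> gal" "h \<in> H" for g h
 proof -
  let ?h = "g \<star> h \<star> \<iota> g"
  have hh: "h \<in> gal" "?h \<in> H" "?h \<in> gal" using norm[OF g] Hg g by auto
  have "?h \<star> g = g \<star> h" using g hh GG.m_assoc[of "g \<star> h" "\<iota> g" g] by simp
  hence "[D ?h * C g + C ?h = D g * C h + C g] (mod int n)"
   using cong_trans[OF cong_sym[OF coc[OF hh(3) g(1)]]] coc[OF g(1) hh(1)] by simp
  moreover have "[D ?h * C g + C ?h = 1 * C g + C ?h] (mod int n)" by (intro cong_add cong_mult cong_refl D1 Hg hh)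
  ultimately have "[1 * C g + C ?h = D g * C h + C g] (mod int n)" using cong_trans[OF cong_sym] by blast
  hence "[C g + C ?h = C g + D g * C h] (mod int n)" by (simp add: add.commute)
  thus ?thesis by (simp only: cong_add_lcancel)
 qed
 obtain ta where t: "ta \<in> gal" "acts ta n q" using acts_q_exists[OF pn] by blast
 have Dt: "[D ta = int q] (mod int n)"
  unfolding D_def using acts_cong[OF z ch[OF t(1)] t(2)] by (simp add: cong_int_iff)
 have comm: "[C (g \<star> ta \<star> \<iota> g \<star> \<iota> ta) = D g * C ta + C g - (int q * C g + C ta)] (mod int n)"
  and commH: "g \<star> ta \<star> \<iota> g \<star> \<iota> ta \<in> H" if g: "g \<in> gal" for g
 proof -
  let ?h = "g \<star> ta \<star> \<iota> g \<star> \<iota> ta"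
  show hH: "?h \<in> H" using stab(3)[OF g t(1)] g t(1) unfolding H_def by simp
  have hg: "?h \<in> gal" using Hg hH by blast
  have "?h \<star> (ta \<star> g) = g \<star> ta"
  proof (rule gal_eq)
   fix x assume x: "x \<in> \<F>"
   show "(?h \<star> (ta \<star> g)) x = (g \<star> ta) x" using g t(1) x by (simp add: G_mult G_inv1)
  qed (use g t(1) in auto)
  hence "[D ?h * C (ta \<star> g) + C ?h = D g * C ta + C g] (mod int n)"
   using cong_trans[OF cong_sym[OF coc[OF hg, of "ta \<star> g"]]] coc[OF g t(1)] t(1) g by simp
  moreover have "[D ?h * C (ta \<star> g) + C ?h = 1 * (int q * C g + C ta) + C ?h] (mod int n)"
  proof -
   have "[D ta * C g + C ta = int q * C g + C ta] (mod int n)" by (intro cong_add cong_mult cong_refl Dt)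
   from cong_trans[OF coc[OF t(1) g] this] show ?thesis by (intro cong_add cong_mult cong_refl D1 Hg hH)
  qed
  ultimately have "[1 * (int q * C g + C ta) + C ?h = D g * C ta + C g] (mod int n)" using cong_trans[OF cong_sym] by blast
  hence "[1 * (int q * C g + C ta) + C ?h - (int q * C g + C ta) = D g * C ta + C g - (int q * C g + C ta)] (mod int n)"
   by (intro cong_diff cong_refl)
  thus "[C ?h = D g * C ta + C g - (int q * C g + C ta)] (mod int n)" by simp
 qed
 define M where "M = l ^ j"
 have nM: "n = l ^ (k - j) * M" unfolding n_def M_def using k by (simp add: power_add[symmetric])
 have M0: "M > 0" unfolding M_def using l0 by simp
 have q1: "q - 1 > 0" using q_gt_1 by simp
 \<comment> \<open>If \<open>C\<close> were divisible by \<open>M\<close> on all commutators with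
   \<open>ta\<close>, then \<open>(q - 1) C\<close> would be a coboundary modulo \<open>M\<close>.
   Correcting \<open>x0 ^ (q - 1)\<close> accordingly gives an element \<open>w\<close> of
   \<open>K\<close> with \<open>w ^ M = p ^ (q - 1)\<close>, against the bounded ramification, as
   \<open>M > edim * (q - 1)\<close>.\<close>
 have "\<exists>g\<in>gal. \<not> int M dvd C (g \<star> ta \<star> \<iota> g \<star> \<iota> ta)"
 proof (rule ccontr)
  assume "\<not> ?thesis"
  hence all: "int M dvd C (g \<star> ta \<star> \<iota> g \<star> \<iota> ta)" if "g \<in> gal" for g using that by blast
  define r where "r = l ^ (k - j)"
  define x0 y where "x0 = v [^] r" and "y = z [^] r"
  have xyc: "x0 \<in> \<F>" "y \<in> \<F>" unfolding x0_def y_def using v zz by auto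
  have x0M: "x0 [^] M = \<pi>" unfolding x0_def using v nM by (simp add: nat_pow_pow r_def)
  have yM: "y [^] M = \<one>" unfolding y_def using zz nM by (simp add: nat_pow_pow r_def)
  have ype: "y [^] a = y [^] b" if "[a = b] (mod M)" for a b :: nat
  proof -
   have "[r * a = r * b] (mod n)" using that unfolding cong_def nM r_def[symmetric]
    by (metis mult_mod_right)
   thus ?thesis unfolding y_def using zz(2) zpe by (simp add: nat_pow_pow)
  qed
  \<comment> \<open>\<open>M - 1\<close> stands for \<open>-1\<close> modulo \<open>M\<close>: the
    second factor divides out the coboundary of \<open>C ta\<close>.\<close>
  define w where "w = x0 [^] (q - 1) \<otimes> y [^] (e ta * (M - 1))"
  have wc: "w \<in> \<F>" unfolding w_def using xyc by simp
  have "g w = w" if g: "g \<in> gal" for g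
  proof -
   have gx: "g x0 = y [^] e g \<otimes> x0"
    unfolding x0_def y_def gal_pow[OF g v(1)] e[OF g] using zz v by (simp add: nat_pow_distrib nat_pow_pow mult.commute)
   have gy: "g y = y [^] ch g"
    unfolding y_def gal_pow[OF g zz(2)] chz[OF g] using zz by (simp add: nat_pow_pow mult.commute)
   have "g w = (g x0) [^] (q - 1) \<otimes> (g y) [^] (e ta * (M - 1))"
    unfolding w_def using gal_mult[OF g] gal_pow[OF g] xyc by simp
   also have "\<dots> = x0 [^] (q - 1) \<otimes> y [^] (e g * (q - 1) + ch g * (e ta * (M - 1)))"
    unfolding gx gy using xyc by (simp add: nat_pow_distrib nat_pow_pow nat_pow_mult[symmetric] m_ac)
   also have "y [^] (e g * (q - 1) + ch g * (e ta * (M - 1))) = y [^] (e ta * (M - 1))"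
   proof (rule ype)
    have "int M dvd int n" using nM by simp
    hence "[C (g \<star> ta \<star> \<iota> g \<star> \<iota> ta) = D g * C ta + C g - (int q * C g + C ta)] (mod int M)"
     using comm[OF g] cong_dvd_modulus by blast
    hence "int M dvd D g * C ta + C g - (int q * C g + C ta)" using all[OF g] cong_dvd_iff by blast
    moreover have "int (e g * (q - 1) + ch g * (e ta * (M - 1))) - int (e ta * (M - 1))
      = int M * (D g * C ta - C ta) - (D g * C ta + C g - (int q * C g + C ta))"
    proof -
     have "int (M - 1) = int M - 1" "int (q - 1) = int q - 1" using M0 q1 by (simp_all add: of_nat_diff)
     thus ?thesis unfolding C_def D_def of_nat_add of_nat_mult by (simp only:) (simp add: algebra_simps)
    qed
    ultimately have "int M dvd int (e g * (q - 1) + ch g * (e ta * (M - 1))) - int (e ta * (M - 1))" by simp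
    hence "[int (e g * (q - 1) + ch g * (e ta * (M - 1))) = int (e ta * (M - 1))] (mod int M)"
     unfolding cong_iff_dvd_diff .
    thus "[e g * (q - 1) + ch g * (e ta * (M - 1)) = e ta * (M - 1)] (mod M)" by (simp only: cong_int_iff)
   qed
   finally show ?thesis unfolding w_def .
  qed
  hence wK: "w \<in> K" using fixed_field[OF wc] by blast
  have "w [^] M = (x0 [^] M) [^] (q - 1) \<otimes> (y [^] M) [^] (e ta * (M - 1))"
   unfolding w_def using xyc by (simp add: nat_pow_distrib nat_pow_pow mult.commute)
  hence "w [^] M = \<pi> [^] (q - 1)" unfolding x0M yM by simp
  hence "M \<le> edim * (q - 1)" using root_of_pi_power_bound[OF wK _ q1] by blast
  thus False using j unfolding M_def by simp
 qed
 then obtain g where g: "g \<in> gal" and ng: "\<not> int M dvd C (g \<star> ta \<star> \<iota> g \<star> \<iota> ta)" by blast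
 define h where "h = g \<star> ta \<star> \<iota> g \<star> \<iota> ta"
 have hH: "h \<in> H" unfolding h_def by (rule commH[OF g])
 let ?h2 = "ta \<star> h \<star> \<iota> ta"
 have h2: "?h2 \<in> H" by (rule norm[OF t(1) hH])
 have "[C (th \<star> ?h2 \<star> \<iota> th) - int c * C ?h2 = C (th \<star> h \<star> \<iota> th) - int c * C h] (mod int n)"
  using crit[unfolded comm_crit_def, rule_format, of H C ta g ta h] H norm fhom op g t(1) hH h_def
  unfolding n_def by simp
 moreover have "[C ?h2 = int q * C h] (mod int n)"
  by (rule cong_trans[OF Cconj[OF t(1) hH] cong_mult[OF Dt cong_refl]])
 moreover have "[C (th \<star> ?h2 \<star> \<iota> th) = D th * (int q * C h)] (mod int n)"
  by (rule cong_trans[OF Cconj[OF s h2] cong_mult[OF cong_refl calculation(2)]])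
 moreover have "[C (th \<star> h \<star> \<iota> th) = D th * C h] (mod int n)" by (rule Cconj[OF s hH])
 ultimately have "[D th * (int q * C h) - int c * (int q * C h) = D th * C h - int c * C h] (mod int n)"
  by (meson cong_trans cong_sym cong_diff cong_mult cong_refl)
 hence "int n dvd (D th * (int q * C h) - int c * (int q * C h)) - (D th * C h - int c * C h)" unfolding cong_iff_dvd_diff .
 moreover have "(D th * (int q * C h) - int c * (int q * C h)) - (D th * C h - int c * C h) = ((D th - int c) * int (q - 1)) * C h"
  using q1 by (simp add: of_nat_diff algebra_simps)
 ultimately have d1: "int l ^ ((k - 2 * j + j) + j) dvd ((D th - int c) * int (q - 1)) * C h" using k unfolding n_def by simp
 have "int l ^ (k - 2 * j + j) dvd (D th - int c) * int (q - 1)"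
  by (rule prime_power_dvd_cancel[OF l(1) d1]) (use ng in "simp add: h_def M_def")
 moreover have "\<not> int l ^ j dvd int (q - 1)"
 proof
  assume "int l ^ j dvd int (q - 1)"
  hence "l ^ j dvd q - 1" by (metis of_nat_dvd_iff of_nat_power)
  hence "l ^ j \<le> q - 1" using q1 by (rule dvd_imp_le)
  moreover have "q - 1 \<le> edim * (q - 1)" using edim_pos by (cases edim) auto
  ultimately show False using j by linarith
 qed
 ultimately have "int l ^ (k - 2 * j) dvd D th - int c" by (rule prime_power_dvd_cancel[OF l(1)])
 hence "[int (ch th) = int c] (mod int (l ^ (k - 2 * j)))" unfolding D_def cong_iff_dvd_diff by simp
 hence cg: "[ch th = c] (mod l ^ (k - 2 * j))" by (simp only: cong_int_iff)
 have "n = l ^ (k - 2 * j) * l ^ (2 * j)" unfolding n_def using k by (simp add: power_add[symmetric])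
 hence "acts th (l ^ (k - 2 * j)) (ch th)" using acts_dvd[OF ch[OF s]] by simp
 thus ?thesis using acts_of_cong[OF _ _ cg] l0 by simp
qed

end

section \<open>Integers that agree modulo all integers prime to given primes\<close>

text \<open>\<open>N\<close> is the prime-to-\<open>p\<close> part of \<open>R ^ M - 1\<close>, so
  exponents of \<open>R\<close> count modulo \<open>M\<close>. If \<open>Q\<close> is congruent to
  \<open>R ^ r\<close> with \<open>r\<close> small, both are below \<open>N\<close> and equal. If
  \<open>r\<close> is large, \<open>Q * R ^ (M - r)\<close> is congruent to \<open>1\<close>
  although it lies strictly between \<open>1\<close> and \<open>N\<close>. For this \<open>N\<close>
  must be large, so the \<open>p\<close>-part of \<open>R ^ M - 1\<close> must stay bounded, which
  dictates the choice of \<open>M\<close>.\<close>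

lemma power_of_cong_powers:
 fixes Q R :: nat
 assumes p: "nat_prime p" and Q: "Q \<ge> 2" and R: "R \<ge> 2"
  and H: "\<And>N. \<not> p dvd N ==> coprime N R ==> \<exists>i. [Q = R ^ i] (mod N)"
 shows "\<exists>i. Q = R ^ i"
proof -
 \<comment> \<open>\<open>P\<close> exceeds \<open>R\<close>, so \<open>R\<close> is not congruent
   to \<open>1\<close> modulo \<open>P\<close>.\<close>
 define P where "P = p ^ R"
 have p2: "p \<ge> 2" using prime_ge_2_nat[OF p] .
 have PR: "P > R" "P > 0" unfolding P_def using p2 power_gt_expt[of p R] by auto
 define c where "c = P * Q"
 \<comment> \<open>\<open>M\<close> is \<open>1\<close> modulo \<open>totient P\<close>. If
   \<open>p\<close> does not divide \<open>R\<close>, then \<open>R ^ M\<close> is congruent to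
   \<open>R\<close> modulo \<open>P\<close>, so \<open>P\<close> does not divide
   \<open>R ^ M - 1\<close>. The factor \<open>2 * c + 4\<close> makes \<open>R ^ (M - 1)\<close>
   outweigh \<open>P * Q * R ^ e\<close>, where \<open>e\<close> is about
   \<open>M / 2\<close>.\<close>
 define M where "M = 1 + (2 * c + 4) * totient P"
 have tot: "totient P > 0" using PR by simp
 have "2 * c + 4 \<le> (2 * c + 4) * totient P" using tot by (cases "totient P") auto
 hence M: "M \<ge> 2 * c + 5" unfolding M_def by linarith
 define e where "e = M div 2"
 have e: "e \<ge> c + 2" "2 * e \<le> M" "M \<le> 2 * e + 1" unfolding e_def using M by auto
 have RM: "R ^ M - 1 \<ge> R ^ (M - 1)" "R ^ M - 1 > 0"
 proof -
  have "R ^ M = R * R ^ (M - 1)" using M by (metis One_nat_def Suc_pred add_pos_nonneg le_0_eq not_gr_zero power_Suc zero_neq_numeral add_is_0)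
  moreover have "R * R ^ (M - 1) \<ge> 2 * R ^ (M - 1)" using R by simp
  moreover have "R ^ (M - 1) \<ge> 1" using R by simp
  ultimately show "R ^ M - 1 \<ge> R ^ (M - 1)" "R ^ M - 1 > 0" by linarith+
 qed
 define v where "v = multiplicity p (R ^ M - 1)"
 obtain N where N: "R ^ M - 1 = p ^ v * N" "\<not> p dvd N"
  using multiplicity_decompose'[of "R ^ M - 1" p] RM(2) p2 unfolding v_def by auto
 have vP: "p ^ v \<le> P"
 proof (cases "p dvd R")
  case True
  have "\<not> p dvd R ^ M - 1"
  proof
   assume "p dvd R ^ M - 1"
   moreover have "p dvd R ^ M" using M by (intro dvd_trans[OF True dvd_power]) simp
   ultimately have "p dvd R ^ M - (R ^ M - 1)" using dvd_diff_nat by blast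
   moreover have "R ^ M - (R ^ M - 1) = 1" using RM(2) by linarith
   ultimately show False using p2 by simp
  qed
  hence "v = 0" unfolding v_def by (rule not_dvd_imp_multiplicity_0)
  thus ?thesis using PR by simp
 next
  case False
  have "\<not> p ^ R dvd R ^ M - 1"
  proof
   assume d: "p ^ R dvd R ^ M - 1"
   have "coprime R P" unfolding P_def using False p prime_imp_coprime[of p R] by (simp add: coprime_commute)
   hence "[R ^ totient P = 1] (mod P)" by (rule euler_theorem)
   hence "[R * (R ^ totient P) ^ (2 * c + 4) = R * 1 ^ (2 * c + 4)] (mod P)" by (intro cong_mult cong_pow cong_refl)
   moreover have "R ^ M = R ^ 1 * R ^ (totient P * (2 * c + 4))" unfolding M_def by (simp only: power_add[of R 1] mult.commute)
   hence "R ^ M = R * (R ^ totient P) ^ (2 * c + 4)" by (simp only: power_mult power_one_right)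
   ultimately have "[R ^ M = R] (mod P)" by simp
   moreover have "[1 + (R ^ M - 1) = 1 + 0] (mod P)" using d unfolding P_def by (intro cong_add cong_refl) (simp add: cong_0_iff)
   moreover have "1 + (R ^ M - 1) = R ^ M" using RM(2) by linarith
   ultimately have "[R ^ M = R] (mod P)" "[R ^ M = 1] (mod P)" by simp_all
   hence "[R = 1] (mod P)" using cong_trans cong_sym by blast
   hence "R = 1" using cong_less_modulus_unique_nat[of R 1 P] PR(1) R by simp
   thus False using R by simp
  qed
  hence "v < R" unfolding v_def using power_dvd_iff_le_multiplicity[of "R ^ M - 1" p R] RM(2) p2 by (simp add: not_le)
  thus ?thesis unfolding P_def using p2 by (simp add: power_increasing)
 qed
 have big: "Q * R ^ e < N"
 proof -
  have "c < 2 ^ c" by (rule less_exp)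
  also have "(2::nat) ^ c \<le> R ^ c" using R by (rule power_mono) simp
  also have "R ^ c \<le> R ^ (M - 1 - e)" using R e by (intro power_increasing) linarith+
  finally have "c * R ^ e < R ^ (M - 1 - e) * R ^ e" using R by simp
  also have "R ^ (M - 1 - e) * R ^ e = R ^ (M - 1)" using e by (simp add: power_add[symmetric])
  also have "\<dots> \<le> p ^ v * N" using RM(1) N(1) by simp
  also have "\<dots> \<le> P * N" using vP by simp
  finally have "P * (Q * R ^ e) < P * N" unfolding c_def by (simp add: mult.assoc)
  thus ?thesis using PR by simp
 qed
 have NRM: "[R ^ M = 1] (mod N)"
 proof -
  have "[1 + (R ^ M - 1) = 1 + 0] (mod N)" using N(1) by (intro cong_add cong_refl) (simp add: cong_0_iff)
  moreover have "1 + (R ^ M - 1) = R ^ M" using RM(2) by linarith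
  ultimately show ?thesis by simp
 qed
 have "coprime N R"
 proof -
  have "coprime (R ^ M) N" using cong_imp_coprime[OF cong_sym[OF NRM]] by simp
  thus ?thesis using M by (simp add: coprime_commute)
 qed
 then obtain i where i: "[Q = R ^ i] (mod N)" using H[OF N(2)] by blast
 define r where "r = i mod M"
 have rM: "r < M" unfolding r_def using M by simp
 have "[R ^ i = R ^ r] (mod N)"
 proof -
  have "[(R ^ M) ^ (i div M) * R ^ r = 1 ^ (i div M) * R ^ r] (mod N)" by (intro cong_mult cong_pow cong_refl NRM)
  moreover have "(R ^ M) ^ (i div M) * R ^ r = R ^ i" unfolding r_def by (simp add: power_mult[symmetric] power_add[symmetric])
  ultimately show ?thesis by simp
 qed
 hence r: "[Q = R ^ r] (mod N)" using i cong_trans by blast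
 show ?thesis
 proof (cases "r \<le> e")
  case True
  have "R ^ r \<le> R ^ e" using True R by (intro power_increasing) auto
  also have "\<dots> \<le> Q * R ^ e" using Q by simp
  finally have 1: "R ^ r < N" using big by linarith
  have "Q * 1 \<le> Q * R ^ e" using R by (intro mult_left_mono) auto
  hence "Q < N" using big by linarith
  hence "Q = R ^ r" using cong_less_modulus_unique_nat[OF r] 1 by simp
  thus ?thesis ..
 next
  case False
  hence "M - r \<le> e" using e by linarith
  hence "R ^ (M - r) \<le> R ^ e" using R by (intro power_increasing) auto
  hence 1: "Q * R ^ (M - r) < N" using big by (meson le_less_trans mult_le_mono2)
  have "[Q * R ^ (M - r) = R ^ r * R ^ (M - r)] (mod N)" by (intro cong_mult cong_refl r)
  moreover have "R ^ r * R ^ (M - r) = R ^ M" using rM by (simp add: power_add[symmetric])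
  ultimately have 2: "[Q * R ^ (M - r) = 1] (mod N)" using NRM cong_trans by auto
  have "R ^ (M - r) \<ge> 1" using R by simp
  hence 3: "Q * R ^ (M - r) \<ge> 2" using Q mult_le_mono[of 2 Q 1 "R ^ (M - r)"] by simp
  hence "1 < N" using 1 by linarith
  hence "Q * R ^ (M - r) = 1" using cong_less_modulus_unique_nat[OF 2 1] by simp
  thus ?thesis using Q by simp
 qed
qed

section \<open>Invariance under isomorphisms of Galois groups\<close>

text \<open>Subgroups and functions on the target are pulled back; continuity of the isomorphism
  keeps the kernel open.\<close>

lemma comm_crit_iso:
 assumes G: "Group.group G" and H: "Group.group H" and a: "\<alpha> \<in> iso G H" "homeomorphic_map S T \<alpha>" "topspace S = carrier G"
  and s: "s \<in> carrier G" and crit: "comm_crit G S n s c"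
 shows "comm_crit H T n (\<alpha> s) c"
 unfolding comm_crit_def
proof (intro allI impI ballI)
 interpret G: Group.group G by fact
 interpret H: Group.group H by fact
 interpret A: group_hom G H \<alpha> using a(1) by unfold_locales (simp add: iso_def)
 have surj: "\<alpha> ` carrier G = carrier H" using a(1) by (simp add: iso_def bij_betw_def)
 have cm: "continuous_map S T \<alpha>" using a(2) by (rule homeomorphic_imp_continuous_map)
 fix W f t x y h
 assume W: "subgroup W H" and norm: "\<forall>g\<in>carrier H. \<forall>h\<in>W. g \<otimes>\<^bsub>H\<^esub> h \<otimes>\<^bsub>H\<^esub> inv\<^bsub>H\<^esub> g \<in> W"
  and f: "\<forall>h\<in>W. \<forall>h'\<in>W. [f (h \<otimes>\<^bsub>H\<^esub> h') = f h + f h'] (mod int n)"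
  and op: "openin T {h \<in> W. int n dvd f h}"
  and t: "t \<in> carrier H" "x \<in> carrier H" "y \<in> carrier H" and h: "h \<in> W"
  and hxy: "h = x \<otimes>\<^bsub>H\<^esub> y \<otimes>\<^bsub>H\<^esub> inv\<^bsub>H\<^esub> x \<otimes>\<^bsub>H\<^esub> inv\<^bsub>H\<^esub> y"
 obtain t' x' y' where t': "t' \<in> carrier G" "x' \<in> carrier G" "y' \<in> carrier G" "t = \<alpha> t'" "x = \<alpha> x'" "y = \<alpha> y'"
  using t unfolding surj[symmetric] by auto
 define W' where "W' = {g \<in> carrier G. \<alpha> g \<in> W}"
 have W': "subgroup W' G"
  by (rule subgroup.intro) (auto simp: W'_def subgroup.m_closed[OF W] subgroup.m_inv_closed[OF W] subgroup.one_closed[OF W])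
 define h' where "h' = x' \<otimes>\<^bsub>G\<^esub> y' \<otimes>\<^bsub>G\<^esub> inv\<^bsub>G\<^esub> x' \<otimes>\<^bsub>G\<^esub> inv\<^bsub>G\<^esub> y'"
 have h': "h' \<in> carrier G" "\<alpha> h' = h" unfolding h'_def hxy using t' by auto
 have "{w \<in> W'. int n dvd f (\<alpha> w)} = {w \<in> topspace S. \<alpha> w \<in> {h \<in> W. int n dvd f h}}"
  unfolding W'_def a(3) by auto
 hence op': "openin S {w \<in> W'. int n dvd f (\<alpha> w)}" using openin_continuous_map_preimage[OF cm op] by simp
 have "[f (\<alpha> (s \<otimes>\<^bsub>G\<^esub> (t' \<otimes>\<^bsub>G\<^esub> h' \<otimes>\<^bsub>G\<^esub> inv\<^bsub>G\<^esub> t') \<otimes>\<^bsub>G\<^esub> inv\<^bsub>G\<^esub> s)) - int c * f (\<alpha> (t' \<otimes>\<^bsub>G\<^esub> h' \<otimes>\<^bsub>G\<^esub> inv\<^bsub>G\<^esub> t'))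
     = f (\<alpha> (s \<otimes>\<^bsub>G\<^esub> h' \<otimes>\<^bsub>G\<^esub> inv\<^bsub>G\<^esub> s)) - int c * f (\<alpha> h')] (mod int n)"
  by (rule crit[unfolded comm_crit_def, rule_format, of W' "\<lambda>g. f (\<alpha> g)" t' x' y' h'])
   (use W' op' f norm t' h' h h'_def in "auto simp: W'_def")
 thus "[f (\<alpha> s \<otimes>\<^bsub>H\<^esub> (t \<otimes>\<^bsub>H\<^esub> h \<otimes>\<^bsub>H\<^esub> inv\<^bsub>H\<^esub> t) \<otimes>\<^bsub>H\<^esub> inv\<^bsub>H\<^esub> \<alpha> s) - int c * f (t \<otimes>\<^bsub>H\<^esub> h \<otimes>\<^bsub>H\<^esub> inv\<^bsub>H\<^esub> t)
     = f (\<alpha> s \<otimes>\<^bsub>H\<^esub> h \<otimes>\<^bsub>H\<^esub> inv\<^bsub>H\<^esub> \<alpha> s) - int c * f h] (mod int n)"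
  using t' h' s by simp
qed

section \<open>Power maps on the residue field of the closure\<close>

context padic_galois
begin

lemma acts_coprime_mult:
 assumes "coprime m n" "m > 0" "n > 0" "th \<in> gal" "acts th m c" "acts th n c" shows "acts th (m * n) c"
proof -
 obtain x y where x: "prim x m" and y: "prim y n" using ex_prim assms by blast
 note c = primD(2)[OF x] primD(2)[OF y]
 have "th (x \<otimes> y) = (x \<otimes> y) [^] c"
  using assms(5,6) acts_prim[OF x assms(4)] acts_prim[OF y assms(4)] gal_mult[OF assms(4) c] c by (simp add: nat_pow_distrib)
 thus ?thesis using acts_prim[OF prim_mult[OF x y assms(1)] assms(4)] by simp
qed

text \<open>Residually \<open>th\<close> is the \<open>c\<close>-th power map: \<open>c = 1\<close>
  describes inertia and \<open>c = q\<close> Frobenius elements.\<close>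

definition "respow th c \<longleftrightarrow> (\<forall>x\<in>Oint. th x \<ominus> x [^] (c::nat) \<in> mx)"

text \<open>Roots of unity of order prime to \<open>p\<close> are determined by their residues,
  which gives one direction, and they represent all units, which gives the other. On nonunits both
  sides are residually zero, since \<open>c > 0\<close>.\<close>

lemma respow_acts:
 assumes s: "th \<in> gal" and c: "c > 0" shows "respow th c \<longleftrightarrow> (\<forall>N. \<not> p dvd N --> acts th N c)"
proof
 assume r: "respow th c"
 show "\<forall>N. \<not> p dvd N --> acts th N c" unfolding acts_def
 proof (intro allI impI ballI)
  fix N x assume N: "\<not> p dvd N" and x: "x \<in> \<F>" "x [^] N = \<one>"
  have N0: "N > 0" using N by (cases N) auto
  have xO: "x \<in> Oint" by (rule root_of_unity_O[OF x N0])
  have "(th x) [^] N = \<one>" using gal_pow[OF s x(1), of N] x gal_one[OF s] by simp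
  moreover have "(x [^] c) [^] N = \<one>" using x by (metis nat_pow_pow mult.commute nat_pow_one)
  moreover have "th x \<doteq> x [^] c" using r xO unfolding respow_def rcong_def by blast
  ultimately show "th x = x [^] c" using root_of_unity_inj N x s by simp
 qed
next
 assume a: "\<forall>N. \<not> p dvd N --> acts th N c"
 show "respow th c" unfolding respow_def rcong_def[symmetric]
 proof (intro ballI)
  fix x assume x: "x \<in> Oint"
  have xc: "x \<in> \<F>" using O_carrier x by auto
  show "th x \<doteq> x [^] c"
  proof (cases "x \<in> mx")
   case True
   obtain d where d: "c = Suc d" using c not0_implies_Suc by blast
   have "x [^] c \<in> mx" using mx_mult[OF O_pow[OF x] True, of d] d by simp
   thus ?thesis unfolding rcong_def using mx_diff gal_mx[OF s True] by blast
  next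
   case False
   obtain N w where w: "\<not> p dvd N" "w \<in> \<F>" "w [^] (N::nat) = \<one>" "x \<doteq> w" "N > 0" using teich[OF x False] by blast
   have wO: "w \<in> Oint" by (rule root_of_unity_O[OF w(2,3,5)])
   have "th x \<doteq> th w" by (rule gal_rcong[OF s xc w(2,4)])
   moreover have "th w = w [^] c" using a w unfolding acts_def by blast
   moreover have "w [^] c \<doteq> x [^] c" by (rule rcong_pow[OF wO x rcong_sym[OF xc w(2,4)]])
   ultimately show ?thesis using rcong_trans[of "th x" "w [^] c" "x [^] c"] s xc w(2) by simp
  qed
 qed
qed

end

section \<open>Two base fields with isomorphic Galois groups\<close>

locale padic_galois_iso = A: padic_galois F p Z Q K + B: padic_galois F' p' Z' Q' K'
 for F :: "('a, 'm) ring_scheme" (structure) and p Z Q K and F' :: "('b, 'n) ring_scheme" and p' Z' Q' K' +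
 fixes \<alpha> :: "('a \<Rightarrow> 'a) \<Rightarrow> ('b \<Rightarrow> 'b)"
 assumes iso: "\<alpha> \<in> iso A.G B.G" and homeo: "homeomorphic_map A.Ktop B.Ktop \<alpha>"
begin

lemma map_gal: "th \<in> A.gal ==> \<alpha> th \<in> B.gal"
 using iso unfolding iso_def bij_betw_def by auto

text \<open>The criterion is applied at the higher level \<open>k = m + 2 * j\<close>, so that the
  loss leaves exactly \<open>m\<close>. The exponent \<open>c'\<close> found there may differ from
  \<open>c\<close>, but they agree modulo \<open>l ^ m\<close>.\<close>

lemma acts_prime_power:
 assumes l: "nat_prime l" "l \<noteq> p" "l \<noteq> p'" and s: "th \<in> A.gal" and a: "A.acts th (l ^ m) c"
 shows "B.acts (\<alpha> th) (l ^ m) c"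
proof -
 \<comment> \<open>Since \<open>l ^ j > j\<close>, the number to be exceeded can itself serve as the
   exponent.\<close>
 define j where "j = B.edim * (B.q - 1)"
 have l2: "l \<ge> 2" using prime_ge_2_nat[OF l(1)] .
 have j: "l ^ j > B.edim * (B.q - 1)" unfolding j_def[symmetric] using l2 by (intro power_gt_expt) simp
 define k where "k = m + 2 * j"
 have k0: "l ^ k > 0" using l2 by simp
 obtain c' where c': "A.acts th (l ^ k) c'" using A.ex_acts[OF s k0] by blast
 have "\<not> p dvd l ^ k" using l A.p_prime by (metis prime_dvd_power primes_dvd_imp_eq)
 hence "comm_crit A.G A.Ktop (l ^ k) th c'" using A.comm_crit_of_acts s c' by blast
 hence "comm_crit B.G B.Ktop (l ^ k) (\<alpha> th) c'"
  using comm_crit_iso[OF A.G_group B.G_group iso homeo] s A.topspace_Ktop by simp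
 moreover have "2 * j \<le> k" unfolding k_def by simp
 ultimately have "B.acts (\<alpha> th) (l ^ (k - 2 * j)) c'"
  using B.acts_of_comm_crit[OF l(1,3) j _ map_gal[OF s]] by blast
 hence 1: "B.acts (\<alpha> th) (l ^ m) c'" unfolding k_def by simp
 have m0: "l ^ m > 0" using l2 by simp
 obtain z where z: "A.prim z (l ^ m)" using A.ex_prim[OF m0] by blast
 have "A.acts th (l ^ m) c'" using A.acts_dvd[OF c'] unfolding k_def by (simp add: power_add)
 hence "[c' = c] (mod l ^ m)" using A.acts_cong[OF z _ a] by blast
 thus ?thesis by (rule B.acts_of_cong[OF m0 1])
qed

lemma acts_transfer:
 assumes s: "th \<in> A.gal" shows "\<not> p dvd N ==> \<not> p' dvd N ==> A.acts th N c ==> B.acts (\<alpha> th) N c"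
proof (induction N rule: less_induct)
 case (less N)
 have N0: "N > 0" using less.prems(1) by (cases N) auto
 show ?case
 proof (cases "N = 1")
  case True
  thus ?thesis unfolding B.acts_def using B.gal_one[OF map_gal[OF s]] by auto
 next
  case False
  then obtain l where l: "nat_prime l" "l dvd N" using prime_factor_nat by blast
  have l': "l \<noteq> p" "l \<noteq> p'" using l(2) less.prems by auto
  define m where "m = multiplicity l N"
  obtain n where n: "N = l ^ m * n" "\<not> l dvd n"
   using multiplicity_decompose'[of N l] N0 prime_gt_1_nat[OF l(1)] unfolding m_def by auto
  have m0: "m > 0" unfolding m_def using l N0 by (simp add: prime_multiplicity_gt_zero_iff)
  have n0: "n > 0" using N0 n(1) by simp
  have l1: "1 < l" using prime_gt_1_nat[OF l(1)] .
  have "n < N" using n0 one_less_power[OF l1 m0] unfolding n(1) by simp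
  moreover have "\<not> p dvd n" "\<not> p' dvd n" using less.prems n(1) by auto
  moreover have "A.acts th n c" "A.acts th (l ^ m) c" using A.acts_dvd[OF less.prems(3)] n(1) by auto
  ultimately have "B.acts (\<alpha> th) n c" "B.acts (\<alpha> th) (l ^ m) c"
   using less.IH acts_prime_power[OF l(1) l' s] by blast+
  moreover have "coprime (l ^ m) n" using prime_imp_coprime[OF l(1) n(2)] by simp
  ultimately show ?thesis unfolding n(1) using B.acts_coprime_mult map_gal[OF s] n0 l1 by simp
 qed
qed

text \<open>An automorphism acting by the power \<open>A.q\<close> on \<open>N\<close>-th roots of
  unity goes to one acting by \<open>A.q\<close>, whereas every automorphism over the second field
  acts by a power of \<open>B.q\<close>.\<close>

lemma q_power: "\<exists>i. A.q = B.q ^ i"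
proof (rule power_of_cong_powers[OF A.p_prime])
 show "2 \<le> A.q" "2 \<le> B.q" using A.q_gt_1 B.q_gt_1 by auto
 fix N assume N: "\<not> p dvd N" "coprime N B.q"
 have N0: "N > 0" using N by (cases N) auto
 have "p' dvd B.q"
 proof -
  obtain a where a: "B.q = p' ^ a" using B.q_prime_power by blast
  hence "a \<noteq> 0" using B.q_gt_1 by (cases a) auto
  thus ?thesis using a by simp
 qed
 hence N': "\<not> p' dvd N" using N(2) B.p_prime by (metis coprime_common_divisor not_prime_unit)
 obtain th where t: "th \<in> A.gal" "A.acts th N A.q" using A.acts_q_exists[OF N(1)] by blast
 obtain i where i: "B.acts (\<alpha> th) N (B.q ^ i)" using B.acts_q_power[OF N' map_gal[OF t(1)]] by blast
 obtain z where z: "B.prim z N" using B.ex_prim[OF N0] by blast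
 show "\<exists>i. [A.q = B.q ^ i] (mod N)" using B.acts_cong[OF z acts_transfer[OF t(1) N(1) N' t(2)] i] by blast
qed

end

lemma iso_inverse:
 assumes "\<alpha> \<in> iso G H" "homeomorphic_map S T \<alpha>" "topspace S = carrier G" "Group.group G"
 shows "inv_into (carrier G) \<alpha> \<in> iso H G" "homeomorphic_map T S (inv_into (carrier G) \<alpha>)"
proof -
 show "inv_into (carrier G) \<alpha> \<in> iso H G" using group.iso_set_sym assms(1,4) by blast
 obtain g where g: "homeomorphic_maps S T \<alpha> g" using assms(2) homeomorphic_map_maps by blast
 have "homeomorphic_map T S g" using g homeomorphic_maps_map by blast
 thus "homeomorphic_map T S (inv_into (carrier G) \<alpha>)"
 proof (rule homeomorphic_map_eq)
  fix y assume y: "y \<in> topspace T"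
  have "\<alpha> (g y) = y" "g y \<in> carrier G" using g y assms(3) unfolding homeomorphic_maps_def continuous_map_def by auto
  moreover have "inj_on \<alpha> (carrier G)" using assms(1) by (simp add: iso_def bij_betw_def)
  ultimately show "g y = inv_into (carrier G) \<alpha> y" by (metis inv_into_f_f)
 qed
qed

context padic_galois_iso
begin

lemma inverse: "padic_galois_iso F' p' Z' Q' K' F p Z Q K (inv_into A.gal \<alpha>)"
 using iso_inverse[OF iso homeo _ A.G_group] A.topspace_Ktop
 by unfold_locales auto

lemma q_eq: "A.q = B.q"
proof -
 obtain i where i: "A.q = B.q ^ i" using q_power by blast
 obtain j where j: "B.q = A.q ^ j" using padic_galois_iso.q_power[OF inverse] by blast
 have "i \<noteq> 0" "j \<noteq> 0" using i j A.q_gt_1 B.q_gt_1 by (auto intro!: gr0I)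
 hence "B.q \<le> A.q" "A.q \<le> B.q" using i j A.q_gt_1 B.q_gt_1 self_le_power[of B.q i] self_le_power[of A.q j] by auto
 thus ?thesis by simp
qed

lemma p_eq: "p = p'"
proof -
 obtain a b where a: "A.q = p ^ a" "B.q = p' ^ b" using A.q_prime_power B.q_prime_power by blast
 have "a \<noteq> 0" using a A.q_gt_1 by (auto intro!: gr0I)
 hence "p dvd p' ^ b" using a q_eq by (metis dvd_power neq0_conv)
 thus ?thesis using A.p_prime B.p_prime by (metis prime_dvd_power primes_dvd_imp_eq)
qed

text \<open>As the residue characteristics agree, orders prime to both are all orders prime to
  \<open>p\<close>, and these decide the residual action.\<close>

theorem respow_transfer:
 assumes "th \<in> A.gal" "c > 0" "A.respow th c" shows "B.respow (\<alpha> th) c"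
 using assms acts_transfer[OF assms(1)] p_eq unfolding A.respow_acts[OF assms(1,2)] B.respow_acts[OF map_gal[OF assms(1)] assms(2)]
 by simp

end

section \<open>Degrees of Galois elements on the residue field\<close>

context padic_galois
begin

text \<open>Residually \<open>th\<close> is the power map with the fractional exponent
  \<open>a / b\<close>. This covers negative powers of Frobenius without inverting power
  maps.\<close>

definition "rpow th a b \<longleftrightarrow> th \<in> gal \<and> (\<forall>x\<in>Oint. th (x [^] (b::nat)) \<doteq> x [^] (a::nat))"

lemma rpow_mult:
 assumes s: "rpow th a b" and t: "rpow ta c d" shows "rpow (th \<star> ta) (a * c) (b * d)"
 unfolding rpow_def
proof (intro conjI ballI)
 have g: "th \<in> gal" "ta \<in> gal" using s t unfolding rpow_def by auto
 thus "th \<star> ta \<in> gal" by simp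
 fix x assume x: "x \<in> Oint"
 have xc: "x \<in> \<F>" using x O_carrier by auto
 have "ta (x [^] d) \<doteq> x [^] c" using t x unfolding rpow_def by blast
 hence "(ta (x [^] d)) [^] b \<doteq> (x [^] c) [^] b" by (rule rcong_pow[OF gal_O[OF g(2) O_pow[OF x]] O_pow[OF x]])
 hence 1: "th ((ta (x [^] d)) [^] b) \<doteq> th ((x [^] c) [^] b)" by (rule gal_rcong[OF g(1), rotated 2]) (use xc g in auto)
 have 2: "th ((x [^] c) [^] b) \<doteq> (x [^] c) [^] a" using s O_pow[OF x] unfolding rpow_def by blast
 have "(th \<star> ta) (x [^] (b * d)) = th ((ta (x [^] d)) [^] b)"
  using g xc gal_pow[OF g(2), of "x [^] d" b] by (simp add: G_mult nat_pow_pow mult.commute)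
 moreover have "(x [^] c) [^] a = x [^] (a * c)" using xc by (simp add: nat_pow_pow mult.commute)
 ultimately show "(th \<star> ta) (x [^] (b * d)) \<doteq> x [^] (a * c)"
  using rcong_trans[OF _ _ _ 1 2] g xc by simp
qed

lemma rpow_inv: assumes s: "rpow th a b" shows "rpow (\<iota> th) b a"
 unfolding rpow_def
proof (intro conjI ballI)
 have g: "th \<in> gal" using s unfolding rpow_def by auto
 thus ig: "\<iota> th \<in> gal" by simp
 fix x assume x: "x \<in> Oint"
 have xc: "x \<in> \<F>" using x O_carrier by auto
 have "th (x [^] b) \<doteq> x [^] a" using s x unfolding rpow_def by blast
 hence "x [^] a \<doteq> th (x [^] b)" by (rule rcong_sym[rotated 2]) (use g xc in auto)
 hence "(\<iota> th) (x [^] a) \<doteq> (\<iota> th) (th (x [^] b))" by (rule gal_rcong[OF ig, rotated 2]) (use g xc in auto)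
 thus "(\<iota> th) (x [^] a) \<doteq> x [^] b" using G_inv1[OF g, of "x [^] b"] xc by simp
qed

lemma rpow_respow: "th \<in> gal ==> rpow th a 1 \<longleftrightarrow> respow th a"
 unfolding rpow_def respow_def rcong_def using O_carrier by auto

text \<open>The \<open>q\<close>-th power map is injective on the residue field, so a common factor
  \<open>q ^ k\<close> cancels.\<close>

lemma rpow_reduce:
 assumes s: "rpow th (a * q ^ k) (b * q ^ k)" shows "rpow th a b"
 unfolding rpow_def
proof (intro conjI ballI)
 show g: "th \<in> gal" using s unfolding rpow_def by auto
 obtain r where r: "q = p ^ r" using q_prime_power by blast
 fix x assume x: "x \<in> Oint"
 have xc: "x \<in> \<F>" using x O_carrier by auto
 have O: "th (x [^] b) \<in> Oint" "x [^] a \<in> Oint" using gal_O[OF g] O_pow[OF x] by auto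
 have c: "th (x [^] b) \<in> \<F>" "x [^] a \<in> \<F>" using O O_carrier by auto
 have "th (x [^] (b * q ^ k)) \<doteq> x [^] (a * q ^ k)" using s x unfolding rpow_def by blast
 hence "(th (x [^] b)) [^] (p ^ (r * k)) \<doteq> (x [^] a) [^] (p ^ (r * k))"
  using gal_pow[OF g, of "x [^] b" "q ^ k"] xc unfolding r by (simp add: nat_pow_pow power_mult)
 hence m: "(th (x [^] b)) [^] (p ^ (r * k)) \<ominus> (x [^] a) [^] (p ^ (r * k)) \<in> mx" unfolding rcong_def .
 have "(th (x [^] b) \<ominus> x [^] a) [^] (p ^ (r * k)) \<in> mx"
  using rcong_mx_iff[OF _ _ frobenius_diff[OF O, of "r * k"]] m c by simp
 thus "th (x [^] b) \<doteq> x [^] a" unfolding rcong_def using mx_pow O_diff[OF O] by blast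
qed

text \<open>Composition with an inverse reduces to the identity, for which the exponents
  \<open>q ^ (a + d)\<close> and \<open>q ^ (b + c)\<close> must agree on roots of unity. A
  primitive root of order \<open>N = q ^ m - 1\<close> with \<open>m\<close> larger than both
  exponents tells these powers apart.\<close>

lemma rpow_unique:
 assumes s: "rpow th (q ^ a) (q ^ b)" and t: "rpow th (q ^ c) (q ^ d)" shows "a + d = b + c"
proof -
 have "rpow (th \<star> \<iota> th) (q ^ a * q ^ d) (q ^ b * q ^ c)" by (rule rpow_mult[OF s rpow_inv[OF t]])
 moreover have "th \<in> gal" using s unfolding rpow_def by auto
 ultimately have r: "rpow \<one>\<^bsub>G\<^esub> (q ^ (a + d)) (q ^ (b + c))" by (simp add: power_add)
 define m where "m = a + d + (b + c) + 1"
 define N where "N = q ^ m - 1"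
 have q2: "q \<ge> 2" using q_gt_1 by simp
 have lt: "q ^ e < N" if "e < m" "0 < e" for e
 proof -
  have "q ^ e * q \<le> q ^ m" using that q2 power_increasing[of "Suc e" m q] by (simp add: mult.commute)
  moreover have "q ^ e * 2 \<le> q ^ e * q" using q2 by simp
  moreover have "q ^ e \<ge> q ^ 1" using that q2 by (intro power_increasing) auto
  hence "q ^ e \<ge> 2" using q2 by simp
  ultimately show ?thesis unfolding N_def by linarith
 qed
 have pN: "\<not> p dvd N"
 proof
  assume "p dvd N"
  obtain r' where r': "q = p ^ r'" using q_prime_power by blast
  hence "r' \<noteq> 0" using q2 by (cases r') auto
  hence "p dvd q ^ m" unfolding r' m_def by (simp add: power_mult[symmetric])
  hence "p dvd q ^ m - N" using \<open>p dvd N\<close> by (rule dvd_diff_nat)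
  moreover have "q ^ m - N = 1" unfolding N_def using q2 by simp
  ultimately show False using prime_gt_1_nat[OF p_prime] by simp
 qed
 hence N0: "N > 0" by (cases N) auto
 obtain z where z: "prim z N" using ex_prim[OF N0] by blast
 note zz = primD(1-3)[OF z]
 have root: "(z [^] (i::nat)) \<in> \<F>" "(z [^] i) [^] N = \<one>" for i
  using zz primD(4)[OF z, of "i * N"] by (auto simp: nat_pow_pow)
 have "\<one>\<^bsub>G\<^esub> (z [^] (q ^ (b + c))) \<doteq> z [^] (q ^ (a + d))"
  using r root_of_unity_O(1)[OF zz(2,3,1)] unfolding rpow_def by blast
 hence "z [^] (q ^ (b + c)) = z [^] (q ^ (a + d))" using G_one root root_of_unity_inj[OF _ _ _ _ pN] by simp
 hence cg: "[q ^ (b + c) = q ^ (a + d)] (mod N)" using prim_pow_eq[OF z] by blast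
 show ?thesis
 proof (cases "a + d = 0 \<and> b + c = 0")
  case False
  have m2: "m \<ge> 2" using False unfolding m_def by auto
  have lt': "q ^ e < N" if "e < m" for e
  proof (cases "e = 0")
   case True
   have "1 < q ^ 1" using q2 by simp
   thus ?thesis using lt[of 1] m2 True by simp
  qed (use lt that in auto)
  have "q ^ (b + c) = q ^ (a + d)"
   by (rule cong_less_modulus_unique_nat[OF cg]) (use lt'[of "b + c"] lt'[of "a + d"] in "auto simp: m_def")
  thus ?thesis using q2 by simp
 qed auto
qed

text \<open>The degree is the power of the \<open>q\<close>-Frobenius that \<open>th\<close> induces
  on the residue field; only elements of integral degree have one.\<close>

definition "degr th n \<longleftrightarrow> (\<exists>a b. n = int a - int b \<and> rpow th (q ^ a) (q ^ b))"

lemma degE: assumes "degr th n" obtains a b where "n = int a - int b" "rpow th (q ^ a) (q ^ b)"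
 using assms unfolding degr_def by (elim exE conjE)

lemma deg_gal: "degr th n ==> th \<in> gal" unfolding degr_def rpow_def by auto

lemma deg_unique: "degr th n ==> degr th m ==> n = m"
 using rpow_unique by (elim degE) force

lemma deg_mult: "degr th n ==> degr ta m ==> degr (th \<star> ta) (n + m)"
proof -
 assume nm: "degr th n" "degr ta m"
 obtain a b where a: "n = int a - int b" "rpow th (q ^ a) (q ^ b)" using nm(1) by (rule degE)
 obtain c d where c: "m = int c - int d" "rpow ta (q ^ c) (q ^ d)" using nm(2) by (rule degE)
 note n = a c
 have "rpow (th \<star> ta) (q ^ (a + c)) (q ^ (b + d))" using rpow_mult[OF n(2,4)] by (simp add: power_add)
 thus ?thesis unfolding degr_def n by (intro exI[of _ "a + c"] exI[of _ "b + d"]) simp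
qed

lemma deg_inv: "degr th n ==> degr (\<iota> th) (- n)"
proof -
 assume "degr th n"
 then obtain a b where n: "n = int a - int b" "rpow th (q ^ a) (q ^ b)" by (rule degE)
 show ?thesis unfolding degr_def n using rpow_inv[OF n(2)] by (intro exI[of _ b] exI[of _ a]) simp
qed

lemma deg_one: "degr \<one>\<^bsub>G\<^esub> 0"
 unfolding degr_def rpow_def by (intro exI[of _ 0]) (use G_one O_carrier in auto)

text \<open>Cancelling common powers of \<open>q\<close> leaves one of the two exponents zero.
  Degrees, and with them inertia and Frobenius elements, thus become statements about
  \<open>respow\<close>, which the isomorphism preserves.\<close>

lemma deg_respow: "degr th n \<longleftrightarrow> th \<in> gal \<and> respow (if 0 \<le> n then th else \<iota> th) (q ^ nat \<bar>n\<bar>)"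
proof
 assume d: "degr th n"
 have g: "th \<in> gal" by (rule deg_gal[OF d])
 obtain a b where n: "n = int a - int b" "rpow th (q ^ a) (q ^ b)" using d by (rule degE)
 show "th \<in> gal \<and> respow (if 0 \<le> n then th else \<iota> th) (q ^ nat \<bar>n\<bar>)"
 proof (cases "b \<le> a")
  case True
  hence "rpow th (q ^ (a - b) * q ^ b) (1 * q ^ b)" using n(2) by (simp add: power_add[symmetric])
  hence "rpow th (q ^ (a - b)) 1" by (rule rpow_reduce)
  moreover have "nat \<bar>n\<bar> = a - b" "0 \<le> n" using True n(1) by auto
  ultimately show ?thesis using g rpow_respow by simp
 next
  case False
  hence "rpow (\<iota> th) (q ^ (b - a) * q ^ a) (1 * q ^ a)" using rpow_inv[OF n(2)] by (simp add: power_add[symmetric])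
  hence "rpow (\<iota> th) (q ^ (b - a)) 1" by (rule rpow_reduce)
  moreover have "nat \<bar>n\<bar> = b - a" "\<not> 0 \<le> n" using False n(1) by auto
  ultimately show ?thesis using g rpow_respow[of "\<iota> th"] by simp
 qed
next
 assume r: "th \<in> gal \<and> respow (if 0 \<le> n then th else \<iota> th) (q ^ nat \<bar>n\<bar>)"
 show "degr th n"
 proof (cases "0 \<le> n")
  case True
  hence "rpow th (q ^ nat n) (q ^ 0)" using r rpow_respow by simp
  thus ?thesis unfolding degr_def using True by (intro exI[of _ "nat n"] exI[of _ 0]) simp
 next
  case False
  have "rpow (\<iota> th) (q ^ nat (- n)) (q ^ 0)" using r False rpow_respow[of "\<iota> th"] by simp
  from rpow_inv[OF this] have "rpow th (q ^ 0) (q ^ nat (- n))" using r GG.inv_inv by simp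
  thus ?thesis unfolding degr_def using False by (intro exI[of _ 0] exI[of _ "nat (- n)"]) simp
 qed
qed

lemma deg_nat_pow: "degr th n ==> degr (th [^]\<^bsub>G\<^esub> (k::nat)) (int k * n)"
proof (induction k)
 case 0
 show ?case using deg_one by simp
next
 case (Suc k)
 from deg_mult[OF Suc.IH[OF Suc.prems] Suc.prems] show ?case by (simp add: algebra_simps)
qed

lemma deg_int_pow: "degr th n ==> degr (th [^]\<^bsub>G\<^esub> (k::int)) (k * n)"
proof -
 assume d: "degr th n"
 show ?thesis
 proof (cases "k < 0")
  case True
  hence "th [^]\<^bsub>G\<^esub> k = \<iota> (th [^]\<^bsub>G\<^esub> nat (- k))" by (simp only: int_pow_def2 if_True)
  moreover have "- (int (nat (- k)) * n) = k * n" using True by simp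
  ultimately show ?thesis using deg_inv[OF deg_nat_pow[OF d, of "nat (- k)"]] by (simp only:)
 next
  case False
  hence "th [^]\<^bsub>G\<^esub> k = th [^]\<^bsub>G\<^esub> nat k" by (simp only: int_pow_def2 if_False)
  moreover have "int (nat k) * n = k * n" using False by simp
  ultimately show ?thesis using deg_nat_pow[OF d, of "nat k"] by (simp only:)
 qed
qed

definition "inert = {th. degr th 0}"

lemma inert_subgroup: "subgroup inert G"
proof (rule subgroup.intro)
 show "\<iota> h \<in> inert" if "h \<in> inert" for h using that deg_inv[of h 0] unfolding inert_def by simp
 show "h \<star> k \<in> inert" if "h \<in> inert" "k \<in> inert" for h k using that deg_mult[of h 0 k 0] unfolding inert_def by simp
qed (use deg_gal deg_one in "auto simp: inert_def")

lemma inert_iff: "th \<in> inert \<longleftrightarrow> th \<in> gal \<and> (\<forall>x\<in>Oint. th x \<doteq> x)"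
 unfolding inert_def mem_Collect_eq deg_respow respow_def rcong_def using O_carrier by auto

lemma inert_normal: "normal inert G"
proof (rule GG.normal_invI[OF inert_subgroup])
 fix g h assume g: "g \<in> carrier G" and h: "h \<in> inert"
 have gg: "g \<in> gal" "h \<in> gal" "\<iota> g \<in> gal" using g h inert_iff by auto
 show "g \<star> h \<star> \<iota> g \<in> inert"
  unfolding inert_iff
 proof (intro conjI ballI)
  fix x assume x: "x \<in> Oint"
  have xc: "x \<in> \<F>" using x O_carrier by auto
  have "h ((\<iota> g) x) \<doteq> (\<iota> g) x" using h gal_O[OF gg(3) x] inert_iff by blast
  hence "g (h ((\<iota> g) x)) \<doteq> g ((\<iota> g) x)" by (rule gal_rcong[OF gg(1), rotated 2]) (use gg xc in auto)
  thus "(g \<star> h \<star> \<iota> g) x \<doteq> x" using conj_app[OF gg(1,2) xc] G_inv2[OF gg(1) xc] by simp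
 qed (use gg in auto)
qed

end

section \<open>The Weil group\<close>

text \<open>Elements are algebraic over \<open>Q\<close> by the tower of \<open>Q\<close>,
  \<open>K\<close> and the extension of \<open>K\<close> generated by the element, both steps being
  finite.\<close>

lemma padic_galois_of_padic_field:
 assumes "padic_field KK"
 shows "\<exists>Z Q. padic_galois (alg_cl KK) (res_char KK) Z Q (base_field KK) \<and> Z = qp_emb KK ` Zp (res_char KK)"
proof -
 define F p K e where "F = alg_cl KK" and "p = res_char KK" and "K = base_field KK" and "e = qp_emb KK"
 have p: "nat_prime p" and ac: "algebraic_closure F K" and e: "e \<in> ring_hom (Qp p) F" "e ` carrier (Qp p) \<subseteq> K"
  and fin: "ring.finite_dimension F (e ` carrier (Qp p)) K"
  using assms unfolding padic_field_def F_def p_def K_def e_def by auto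
 interpret A: algebraic_closure F K by (rule ac)
 obtain Z Q where ZQ: "padic_base F p Z Q" "Z = e ` Zp p" "Q = e ` carrier (Qp p)"
  using padic_emb_of_Qp_hom[OF p A.field_axioms e(1)] by blast
 interpret B: padic_base F p Z Q by (rule ZQ(1))
 have QK: "Q \<subseteq> K" and KQ: "A.finite_dimension Q K" using e(2) fin ZQ(3) by auto
 have Ks: "subfield K F" by (rule A.subfield_axioms)
 have "padic_galois F p Z Q K"
 proof unfold_locales
  fix x assume x: "x \<in> carrier F"
  have alg: "(A.algebraic over K) x" by (rule A.algebraic_extension[OF x])
  let ?E = "A.simple_extension K x"
  have "A.finite_dimension K ?E" using A.finite_dimensionI[OF A.dimension_simple_extension[OF Ks x alg]] .
  hence "A.finite_dimension Q ?E" using A.telescopic_base_dim(1)[OF B.Q_subfield Ks KQ] by blast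
  moreover have "x \<in> ?E" by (rule A.simple_extension_mem[OF subfieldE(1)[OF Ks] x])
  ultimately have "(A.algebraic over Q) x"
   using A.finite_dimension_imp_algebraic[OF B.Q_subfield A.simple_extension_is_subring[OF subfieldE(1)[OF Ks] x]] by blast
  then obtain P where P: "P \<in> carrier (Q[X]\<^bsub>F\<^esub>)" "P \<noteq> []" "A.eval P x = \<zero>\<^bsub>F\<^esub>"
   using A.algebraicE[OF subfieldE(1)[OF B.Q_subfield] x] by blast
  thus "\<exists>P. P \<noteq> [] \<and> hd P \<noteq> \<zero>\<^bsub>F\<^esub> \<and> set P \<subseteq> Q \<and> A.eval P x = \<zero>\<^bsub>F\<^esub>"
   unfolding univ_poly_carrier[symmetric] polynomial_def by auto
 next
  fix P assume P: "set P \<subseteq> carrier F" "hd P = \<one>\<^bsub>F\<^esub>" "1 < length P"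
  have Pp: "P \<in> carrier (poly_ring F)" using P unfolding univ_poly_carrier[symmetric] polynomial_def by auto
  have "size (A.roots P) = length P - 1" using A.roots_over_carrier[OF Pp] unfolding A.splitted_def by simp
  hence "A.roots P \<noteq> {#}" using P(3) by auto
  then obtain a where "a \<in># A.roots P" by blast
  hence "A.is_root P a" using A.roots_mem_iff_is_root[OF Pp] by simp
  thus "\<exists>x\<in>carrier F. A.eval P x = \<zero>\<^bsub>F\<^esub>" unfolding A.is_root_def by blast
 next
  show "Q \<subseteq> K" "A.finite_dimension Q K" by fact+
 qed
 thus ?thesis using ZQ(2) unfolding F_def p_def K_def e_def by blast
qed

text \<open>The components of a \<open>padic_ext\<close> are identified with the data of the
  preceding locales, so that each defined notion can be rewritten once and for all.\<close>

locale padic_record = padic_galois F p Z Q K for F :: "'a ring" (structure) and p Z Q K +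
 fixes KK :: "'a padic_ext"
 assumes rec: "alg_cl KK = F" "res_char KK = p" "base_field KK = K" and Z_rec: "qp_emb KK ` Zp p = Z"
begin

abbreviation "WK \<equiv> weil_group KK"

lemma galois_group_eq: "galois_group KK = G"
 unfolding galois_group_def G_def gal_def rec ..

lemma galois_topology_eq: "galois_topology KK = Ktop"
 unfolding galois_topology_def Ktop_def galois_group_eq finite_ext_def fixing_subgroup_def Fix_def rec by simp

lemma integers_cl_eq: "integers_cl KK = F\<lparr>carrier := Oint\<rparr>"
 unfolding integers_cl_def Oint_def rec Z_rec ..

lemma nonunits_integers_cl: "nonunits (integers_cl KK) = mx"
 unfolding nonunits_def integers_cl_eq Units_def mx_def using O_carrier m_comm by auto

lemma integers_eq: "integers KK = RK"
 unfolding integers_def integers_cl_eq OK_def rec by simp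

lemma nonunits_integers: "nonunits (integers KK) = mK"
proof -
 have "x \<in> mx" if x: "x \<in> Oint" "x \<in> K" and n: "\<not> (\<exists>y\<in>OK. y \<otimes> x = \<one> \<and> x \<otimes> y = \<one>)" for x
 proof (rule ccontr)
  assume "x \<notin> mx"
  then obtain y where y: "y \<in> Oint" "x \<otimes> y = \<one>" using unit_iff x by blast
  have c: "x \<in> \<F>" "y \<in> \<F>" using x y O_carrier by auto
  have x0: "x \<noteq> \<zero>" using y c by auto
  have "inv x = y" using comm_inv_char[OF c y(2)] .
  hence "y \<in> K" using K_inv[OF x(2) x0] by simp
  moreover have "y \<otimes> x = \<one>" using y(2) m_comm[OF c] by simp
  ultimately show False using n y unfolding OK_def by blast
 qed
 note nonunit = this
 have eq: "nonunits (integers KK) = {x \<in> OK. \<not> (\<exists>y\<in>OK. y \<otimes> x = \<one> \<and> x \<otimes> y = \<one>)}"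
  unfolding nonunits_def integers_eq Units_def by auto
 show ?thesis
 proof (intro equalityI subsetI)
  fix x assume "x \<in> nonunits (integers KK)"
  thus "x \<in> mK" using nonunit[of x] unfolding eq mK_def OK_def by simp
 next
  fix x assume x: "x \<in> mK"
  hence xO: "x \<in> Oint" "x \<in> mx" "x \<in> K" using mx_O unfolding mK_def by auto
  hence "\<not> (\<exists>y\<in>Oint. x \<otimes> y = \<one>)" using unit_iff by blast
  thus "x \<in> nonunits (integers KK)" unfolding eq OK_def using xO by blast
 qed
qed

lemma residue_card_eq: "residue_card KK = q"
 unfolding residue_card_def nonunits_integers using card_residue unfolding integers_eq by simp

lemma inertia_eq: "inertia KK = inert"
 unfolding inertia_def galois_group_eq nonunits_integers_cl unfolding integers_cl_eq rec by (auto simp: inert_iff rcong_def)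

lemma frobenius_iff: "frobenius_element KK ph \<longleftrightarrow> degr ph 1"
 unfolding frobenius_element_def galois_group_eq nonunits_integers_cl unfolding integers_cl_eq residue_card_eq rec deg_respow respow_def by simp

text \<open>The \<open>n\<close>-th power of a Frobenius coset of inertia is the set of elements of
  degree \<open>n\<close>. The existence of a Frobenius element is carried along because the
  definition of the Weil group refers to one.\<close>

lemma weil_iff: "w \<in> carrier WK \<longleftrightarrow> (\<exists>ph. degr ph 1) \<and> (\<exists>n. degr w n)"
proof -
 interpret N: normal inert G by (rule inert_normal)
 have coset: "inert #>\<^bsub>G\<^esub> w = (inert #>\<^bsub>G\<^esub> ph) [^]\<^bsub>G Mod inert\<^esub> n \<longleftrightarrow> degr w n"
  if w: "w \<in> gal" and f: "degr ph 1" for w ph and n :: int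
 proof -
  have fg: "ph \<in> gal" using deg_gal f by blast
  have fn: "degr (ph [^]\<^bsub>G\<^esub> n) n" using deg_int_pow[OF f, of n] by simp
  have fng: "ph [^]\<^bsub>G\<^esub> n \<in> gal" using deg_gal fn by blast
  have "(inert #>\<^bsub>G\<^esub> ph) [^]\<^bsub>G Mod inert\<^esub> n = inert #>\<^bsub>G\<^esub> (ph [^]\<^bsub>G\<^esub> n)"
   by (rule N.FactGroup_int_pow) (use fg in simp)
  moreover have "inert #>\<^bsub>G\<^esub> w = inert #>\<^bsub>G\<^esub> (ph [^]\<^bsub>G\<^esub> n) \<longleftrightarrow> w \<in> inert #>\<^bsub>G\<^esub> (ph [^]\<^bsub>G\<^esub> n)"
  proof
   assume "inert #>\<^bsub>G\<^esub> w = inert #>\<^bsub>G\<^esub> (ph [^]\<^bsub>G\<^esub> n)"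
   thus "w \<in> inert #>\<^bsub>G\<^esub> (ph [^]\<^bsub>G\<^esub> n)" using GG.rcos_self[OF _ inert_subgroup, of w] w by simp
  next
   assume "w \<in> inert #>\<^bsub>G\<^esub> (ph [^]\<^bsub>G\<^esub> n)"
   from GG.repr_independence[OF this _ inert_subgroup] show "inert #>\<^bsub>G\<^esub> w = inert #>\<^bsub>G\<^esub> (ph [^]\<^bsub>G\<^esub> n)" using fng by simp
  qed
  moreover have "w \<in> inert #>\<^bsub>G\<^esub> (ph [^]\<^bsub>G\<^esub> n) \<longleftrightarrow> degr w n"
  proof
   assume "w \<in> inert #>\<^bsub>G\<^esub> (ph [^]\<^bsub>G\<^esub> n)"
   then obtain h where h: "h \<in> inert" "w = h \<star> (ph [^]\<^bsub>G\<^esub> n)" unfolding r_coset_def by blast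
   thus "degr w n" using deg_mult[OF _ fn, of h 0] unfolding inert_def by simp
  next
   assume d: "degr w n"
   have "degr (w \<star> \<iota> (ph [^]\<^bsub>G\<^esub> n)) 0" using deg_mult[OF d deg_inv[OF fn]] by simp
   moreover have "w = (w \<star> \<iota> (ph [^]\<^bsub>G\<^esub> n)) \<star> (ph [^]\<^bsub>G\<^esub> n)"
    using w fng GG.m_assoc[of w "\<iota> (ph [^]\<^bsub>G\<^esub> n)" "ph [^]\<^bsub>G\<^esub> n"] by simp
   ultimately show "w \<in> inert #>\<^bsub>G\<^esub> (ph [^]\<^bsub>G\<^esub> n)" unfolding r_coset_def inert_def by blast
  qed
  ultimately show ?thesis by simp
 qed
 have "w \<in> carrier WK \<longleftrightarrow>
   w \<in> gal \<and> (\<exists>ph. \<exists>n::int. degr ph 1 \<and> inert #>\<^bsub>G\<^esub> w = (inert #>\<^bsub>G\<^esub> ph) [^]\<^bsub>G Mod inert\<^esub> n)"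
  unfolding weil_group_def galois_group_eq inertia_eq frobenius_iff by simp
 also have "\<dots> \<longleftrightarrow> w \<in> gal \<and> (\<exists>ph. \<exists>n::int. degr ph 1 \<and> degr w n)" by (intro conj_cong refl ex_cong1 coset)
 finally show ?thesis using deg_gal by blast
qed

lemma weil_gal: "w \<in> carrier WK ==> w \<in> gal" using weil_iff deg_gal by blast

lemma weil_mult: "mult WK = mult G" "\<one>\<^bsub>WK\<^esub> = \<one>\<^bsub>G\<^esub>"
 unfolding weil_group_def galois_group_eq by simp_all

definition "WB = {w <#\<^bsub>G\<^esub> V |w V. w \<in> carrier WK \<and> openin (subtopology Ktop inert) V}"

lemma weil_topology_eq: "weil_topology KK = topology_generated_by WB"
 unfolding weil_topology_def WB_def galois_group_eq galois_topology_eq inertia_eq ..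

lemma WB_gal: "U \<in> WB ==> U \<subseteq> gal"
proof -
 assume "U \<in> WB"
 then obtain w V where w: "U = w <#\<^bsub>G\<^esub> V" "w \<in> gal" "openin (subtopology Ktop inert) V" unfolding WB_def using weil_gal by blast
 have "V \<subseteq> gal" using openin_subset[OF w(3)] topspace_Ktop by auto
 thus ?thesis unfolding w(1) l_coset_def using w(2) by auto
qed

end

section \<open>Transfer of degrees, inertia and Weil groups\<close>

locale padic_record_iso = A: padic_record F p Z Q K KK + B: padic_record F' p' Z' Q' K' LL + padic_galois_iso F p Z Q K F' p' Z' Q' K' \<alpha>
 for F :: "'a ring" (structure) and p Z Q K KK and F' :: "'b ring" and p' Z' Q' K' LL and \<alpha>
begin

text \<open>A negative degree is rephrased for the inverse automorphism, so that only power maps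
  with natural exponents are transferred.\<close>

lemma deg_transfer: assumes d: "A.degr th n" shows "B.degr (\<alpha> th) n"
proof -
 interpret h: group_hom A.G B.G \<alpha> using iso A.G_group B.G_group by unfold_locales (simp_all add: iso_def group_def)
 have g: "th \<in> A.gal" using A.deg_gal[OF d] .
 have q0: "A.q ^ k > 0" for k using A.q_gt_1 by simp
 have "B.respow (\<alpha> (if 0 \<le> n then th else inv\<^bsub>A.G\<^esub> th)) (A.q ^ nat \<bar>n\<bar>)"
  by (rule respow_transfer[OF _ q0]) (use d g in "auto simp: A.deg_respow")
 moreover have "\<alpha> (inv\<^bsub>A.G\<^esub> th) = inv\<^bsub>B.G\<^esub> \<alpha> th" using h.hom_inv g by simp
 ultimately show ?thesis unfolding B.deg_respow using map_gal[OF g] q_eq by (auto split: if_splits)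
qed

lemma weil_transfer: "w \<in> carrier (weil_group KK) ==> \<alpha> w \<in> carrier (weil_group LL)"
 unfolding A.weil_iff B.weil_iff using deg_transfer by blast

lemma inert_transfer: "w \<in> A.inert ==> \<alpha> w \<in> B.inert"
 unfolding A.inert_def B.inert_def using deg_transfer by blast

lemma record_inverse: "padic_record_iso F' p' Z' Q' K' LL F p Z Q K KK (inv_into A.gal \<alpha>)"
 using inverse unfolding padic_record_iso_def by (simp add: A.padic_record_axioms B.padic_record_axioms)

lemma map_inverse: "th \<in> A.gal ==> inv_into A.gal \<alpha> (\<alpha> th) = th" "ta \<in> B.gal ==> \<alpha> (inv_into A.gal \<alpha> ta) = ta"
 using iso unfolding iso_def bij_betw_def by (auto simp: f_inv_into_f)

text \<open>The isomorphism preserves the Krull topology, inertia and the Weil group, which are the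
  ingredients of the basic open sets. Applied to the inverse isomorphism as well, this gives the
  homeomorphism.\<close>

lemma WB_transfer: assumes U: "U \<in> A.WB" shows "\<alpha> ` U \<in> B.WB"
proof -
 interpret I: padic_record_iso F' p' Z' Q' K' LL F p Z Q K KK "inv_into A.gal \<alpha>" by (rule record_inverse)
 obtain w V where w: "U = w <#\<^bsub>A.G\<^esub> V" "w \<in> carrier (weil_group KK)" "openin (subtopology A.Ktop A.inert) V" using U unfolding A.WB_def by blast
 obtain V0 where V0: "openin A.Ktop V0" "V = V0 \<inter> A.inert" using w(3) openin_subtopology by metis
 have sub: "V0 \<subseteq> A.gal" using openin_subset[OF V0(1)] A.topspace_Ktop by simp
 have wg: "w \<in> A.gal" using A.weil_gal w(2) .
 have "\<alpha> (w \<otimes>\<^bsub>A.G\<^esub> v) = \<alpha> w \<otimes>\<^bsub>B.G\<^esub> \<alpha> v" if "v \<in> V" for v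
  using iso hom_mult[of \<alpha> A.G B.G w v] wg that V0(2) sub by (auto simp: iso_def)
 hence 1: "\<alpha> ` U = \<alpha> w <#\<^bsub>B.G\<^esub> (\<alpha> ` V)" unfolding w(1) l_coset_def by (auto simp: image_iff)
 have "\<alpha> ` V = \<alpha> ` V0 \<inter> B.inert"
 proof (intro equalityI subsetI)
  fix y assume "y \<in> \<alpha> ` V0 \<inter> B.inert"
  then obtain x where x: "x \<in> V0" "y = \<alpha> x" "\<alpha> x \<in> B.inert" by blast
  have "inv_into A.gal \<alpha> (\<alpha> x) \<in> A.inert" by (rule I.inert_transfer[OF x(3)])
  thus "y \<in> \<alpha> ` V" using x sub map_inverse(1)[of x] unfolding V0(2) by auto
 qed (use V0(2) inert_transfer in auto)
 moreover have "openin B.Ktop (\<alpha> ` V0)" using homeomorphic_imp_open_map[OF homeo] V0(1) unfolding open_map_def by blast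
 ultimately have "openin (subtopology B.Ktop B.inert) (\<alpha> ` V)" unfolding openin_subtopology by blast
 thus ?thesis unfolding 1 B.WB_def using weil_transfer[OF w(2)] by blast
qed

lemma weil_continuous: "continuous_map (weil_topology KK) (weil_topology LL) \<alpha>"
proof -
 interpret I: padic_record_iso F' p' Z' Q' K' LL F p Z Q K KK "inv_into A.gal \<alpha>" by (rule record_inverse)
 have ts: "topspace (weil_topology KK) = \<Union>A.WB" unfolding A.weil_topology_eq topology_generated_by_topspace ..
 show ?thesis
  unfolding B.weil_topology_eq continuous_on_generated_topo_iff
 proof (intro conjI allI impI)
  fix U assume U: "U \<in> B.WB"
  have i: "inv_into A.gal \<alpha> ` U \<in> A.WB" by (rule I.WB_transfer[OF U])
  have "\<alpha> -` U \<inter> topspace (weil_topology KK) = inv_into A.gal \<alpha> ` U"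
  proof (intro equalityI subsetI)
   fix x assume x: "x \<in> \<alpha> -` U \<inter> topspace (weil_topology KK)"
   have "x \<in> A.gal" using x A.WB_gal unfolding ts by blast
   thus "x \<in> inv_into A.gal \<alpha> ` U" using x map_inverse(1)[of x] by (intro image_eqI[of _ _ "\<alpha> x"]) auto
  next
   fix x assume x: "x \<in> inv_into A.gal \<alpha> ` U"
   hence "x \<in> \<Union>A.WB" using i by blast
   moreover have "\<alpha> x \<in> U" using x B.WB_gal[OF U] map_inverse(2) by auto
   ultimately show "x \<in> \<alpha> -` U \<inter> topspace (weil_topology KK)" unfolding ts by simp
  qed
  thus "openin (weil_topology KK) (\<alpha> -` U \<inter> topspace (weil_topology KK))"
   using i unfolding A.weil_topology_eq by (simp add: topology_generated_by_Basis)
 next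
  show "\<alpha> ` topspace (weil_topology KK) \<subseteq> \<Union>B.WB" unfolding ts using WB_transfer by blast
 qed
qed

lemma weil_iso: "\<alpha> \<in> iso (weil_group KK) (weil_group LL)"
proof -
 interpret I: padic_record_iso F' p' Z' Q' K' LL F p Z Q K KK "inv_into A.gal \<alpha>" by (rule record_inverse)
 have "\<alpha> \<in> hom (weil_group KK) (weil_group LL)"
  using iso weil_transfer A.weil_gal unfolding hom_def iso_def A.weil_mult B.weil_mult by auto
 moreover have "bij_betw \<alpha> (carrier (weil_group KK)) (carrier (weil_group LL))"
  by (rule bij_betw_byWitness[of _ "inv_into A.gal \<alpha>"])
   (use map_inverse A.weil_gal B.weil_gal weil_transfer I.weil_transfer in auto)
 ultimately show ?thesis unfolding iso_def by simp
qed

lemma weil_homeomorphic: "homeomorphic_map (weil_topology KK) (weil_topology LL) \<alpha>"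
proof -
 interpret I: padic_record_iso F' p' Z' Q' K' LL F p Z Q K KK "inv_into A.gal \<alpha>" by (rule record_inverse)
 have "homeomorphic_maps (weil_topology KK) (weil_topology LL) \<alpha> (inv_into A.gal \<alpha>)"
  unfolding homeomorphic_maps_def
 proof (intro conjI ballI)
  fix x assume "x \<in> topspace (weil_topology KK)"
  hence "x \<in> A.gal" using A.WB_gal unfolding A.weil_topology_eq topology_generated_by_topspace by blast
  thus "inv_into A.gal \<alpha> (\<alpha> x) = x" by (rule map_inverse)
 next
  fix x assume "x \<in> topspace (weil_topology LL)"
  hence "x \<in> B.gal" using B.WB_gal unfolding B.weil_topology_eq topology_generated_by_topspace by blast
  thus "\<alpha> (inv_into A.gal \<alpha> x) = x" by (rule map_inverse)
 qed (rule weil_continuous I.weil_continuous)+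
 thus ?thesis unfolding homeomorphic_map_maps by blast
qed

end

section \<open>Normalized valuation\<close>

context padic_galois
begin

lemma unifD: assumes "unif w" shows "w \<in> mK" "w \<noteq> \<zero>" "w \<in> OK" "w \<in> K" "w \<in> mx" "w \<in> \<F>"
 using assms mx_O O_carrier unfolding unif_def mK_def OK_def by auto

lemma unif_pow_nonzero: "unif w ==> w [^] (k::nat) \<in> \<F> \<and> w [^] k \<noteq> \<zero>"
 using pow_nonzero unifD(2,6) by simp

lemma unif_pow_sim: assumes w: "unif w" and s: "w [^] (A::nat) \<approxeq> w [^] (B::nat)" shows "A = B"
proof -
 note ww = unifD[OF w]
 have 1: "(w [^] k) [^] vexp \<approxeq> \<pi> [^] (vval w * k)" for k :: nat
 proof -
  have "(w [^] k) [^] vexp = (w [^] vexp) [^] k" using ww(6) by (simp add: nat_pow_pow mult.commute)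
  thus ?thesis using sim_pow[OF vval[OF ww(3,2)], of k] by (simp add: nat_pow_pow)
 qed
 have "\<pi> [^] (vval w * A) \<approxeq> \<pi> [^] (vval w * B)"
  by (rule sim_trans[OF sim_sym[OF 1] sim_trans[OF sim_pow[OF s] 1]])
 hence "vval w * A = vval w * B" by (rule pi_pow_sim)
 thus ?thesis using vval_pos[OF ww(1,2)] by simp
qed

definition "val w x n \<longleftrightarrow> x \<otimes> w [^] nat (- n) \<approxeq> w [^] nat n"

lemma ex_val: assumes w: "unif w" and x: "x \<in> K" "x \<noteq> \<zero>" shows "\<exists>n. val w x n"
proof -
 note ww = unifD[OF w]
 have xc: "x \<in> \<F>" using x K_carrier by auto
 have small: "\<exists>k::nat. y \<approxeq> w [^] k" if "y \<in> OK" "y \<noteq> \<zero>" for y using w that unfolding unif_def by blast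
 from O_divides[OF xc one_closed one_not_zero] show ?thesis
 proof
  assume "\<exists>t\<in>Oint. x = \<one> \<otimes> t"
  hence "x \<in> OK" using x O_carrier unfolding OK_def by auto
  then obtain k :: nat where "x \<approxeq> w [^] k" using small x(2) by blast
  thus ?thesis unfolding val_def using xc by (intro exI[of _ "int k"]) simp
 next
  assume "\<exists>t\<in>mx. x \<noteq> \<zero> \<and> \<one> = x \<otimes> t"
  then obtain t where t: "t \<in> mx" "x \<otimes> t = \<one>" by metis
  have tc: "t \<in> \<F>" using t(1) mx_carrier by auto
  have "inv x = t" using comm_inv_char[OF xc tc t(2)] .
  hence "t \<in> OK" using K_inv[OF x] t(1) mx_O unfolding OK_def by auto
  moreover have "t \<noteq> \<zero>" using t(2) xc by auto
  ultimately obtain k :: nat where k: "t \<approxeq> w [^] k" using small by blast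
  have "x \<otimes> w [^] k \<approxeq> x \<otimes> t" by (rule sim_mult[OF sim_refl[OF xc] sim_sym[OF k]])
  thus ?thesis unfolding val_def t(2) by (intro exI[of _ "- int k"]) simp
 qed
qed

lemma val_unique: assumes w: "unif w" and x: "x \<in> \<F>" and n: "val w x n" "val w x m" shows "n = m"
proof -
 note wc = unifD(6)[OF w]
 have "w [^] (nat n + nat (- m)) = w [^] nat (- m) \<otimes> w [^] nat n" using wc by (simp add: nat_pow_mult add.commute)
 also have "\<dots> \<approxeq> w [^] nat (- m) \<otimes> (x \<otimes> w [^] nat (- n))"
  by (rule sim_mult[OF sim_refl sim_sym[OF n(1)[unfolded val_def]]]) (use wc in simp)
 also have "w [^] nat (- m) \<otimes> (x \<otimes> w [^] nat (- n)) = w [^] nat (- n) \<otimes> (x \<otimes> w [^] nat (- m))" using wc x by (simp add: m_ac)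
 also have "\<dots> \<approxeq> w [^] nat (- n) \<otimes> w [^] nat m" by (rule sim_mult[OF sim_refl n(2)[unfolded val_def]]) (use wc in simp)
 also have "w [^] nat (- n) \<otimes> w [^] nat m = w [^] (nat m + nat (- n))" using wc by (simp add: nat_pow_mult add.commute)
 finally have "nat n + nat (- m) = nat m + nat (- n)" by (rule unif_pow_sim[OF w])
 thus ?thesis by linarith
qed

lemma sim_one: "x \<approxeq> \<one> ==> x \<in> Oint \<and> x \<notin> mx"
 by (elim simE) (use O_carrier in simp)

lemma sim_O: "x \<approxeq> y ==> y \<in> Oint ==> x \<in> Oint"
 by (elim simE) (use O_mult in simp)

lemma K_pow: "x \<in> K ==> x [^] (k::nat) \<in> K" by (rule subring_nat_pow[OF K_subring])

end

section \<open>Uniformizers and the order function\<close>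

context padic_record
begin

lemma Units_integers: "u \<in> Units (integers KK) \<longleftrightarrow> u \<in> K \<and> u \<approxeq> \<one>"
proof -
 have "Units (integers KK) \<subseteq> OK" unfolding integers_eq Units_def by auto
 hence "Units (integers KK) = OK - mK" using nonunits_integers unfolding nonunits_def integers_eq by auto
 thus ?thesis using sim_unit sim_one unfolding OK_def mK_def by auto
qed

text \<open>Two generators of the maximal ideal divide each other, so they differ by a unit;
  conversely every nonunit of \<open>OK\<close> is divisible by a positive power of
  \<open>w\<close>.\<close>

lemma uniformizer_iff: assumes w: "unif w" shows "uniformizer KK v \<longleftrightarrow> v \<in> K \<and> v \<approxeq> w"
proof -
 note ww = unifD[OF w]
 have PI: "PIdl\<^bsub>integers KK\<^esub> v = {x \<otimes> v |x. x \<in> OK}" for v unfolding integers_eq cgenideal_def by simp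
 have good: "{x \<otimes> v |x. x \<in> OK} = mK" if v: "v \<in> K" "v \<approxeq> w" for v
 proof (intro equalityI subsetI)
  have vO: "v \<in> Oint" "v \<in> \<F>" using sim_O[OF v(2)] ww O_carrier mx_O by auto
  have vm: "v \<in> mx" using v(2) by (elim simE) (use ww mx_mult[of _ w] O_carrier m_comm in auto)
  have v0: "v \<noteq> \<zero>" by (rule sim_nonzero[OF v(2) ww(2)])
  {
   fix z assume "z \<in> {x \<otimes> v |x. x \<in> OK}"
   then obtain x where x: "z = x \<otimes> v" "x \<in> OK" by blast
   thus "z \<in> mK" using mx_mult[OF _ vm, of x] subringE(6)[OF K_subring _ v(1), of x] unfolding OK_def mK_def by auto
  }
  fix z assume z: "z \<in> mK"
  hence zz: "z \<in> OK" "z \<in> mx" "z \<in> K" "z \<in> \<F>" using mx_O O_carrier unfolding OK_def mK_def by auto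
  have "\<exists>t\<in>Oint. z = v \<otimes> t"
  proof (cases "z = \<zero>")
   case True
   thus ?thesis using vO(2) by (intro bexI[of _ \<zero>]) auto
  next
   case False
   then obtain k :: nat where k: "z \<approxeq> w [^] k" using w zz unfolding unif_def by blast
   have "k \<noteq> 0"
   proof
    assume "k = 0"
    thus False using sim_one[of z] k zz(2) by simp
   qed
   then obtain j where j: "k = Suc j" using not0_implies_Suc by blast
   have "w [^] j \<otimes> w \<approxeq> w [^] j \<otimes> v" by (rule sim_mult[OF sim_refl sim_sym[OF v(2)]]) (use ww in simp)
   hence "z \<approxeq> w [^] j \<otimes> v" using sim_trans[OF k, of "w [^] j \<otimes> v"] unfolding j by simp
   then obtain u where u: "u \<in> Oint" "z = w [^] j \<otimes> v \<otimes> u" by (rule simE)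
   have "z = v \<otimes> (w [^] j \<otimes> u)" unfolding u(2) using ww(6) vO(2) O_carrier[OF u(1)] by (simp add: m_ac)
   thus ?thesis using O_mult[OF O_pow[OF mx_O[OF ww(5)]] u(1)] by blast
  qed
  then obtain t where t: "t \<in> Oint" "z = v \<otimes> t" by blast
  have "t \<in> K" by (rule K_quotient[OF zz(3) v(1) v0 t(2) O_carrier[OF t(1)]])
  thus "z \<in> {x \<otimes> v |x. x \<in> OK}" using t m_comm[OF vO(2) O_carrier[OF t(1)]] unfolding OK_def by blast
 qed
 show ?thesis
 proof
  assume "uniformizer KK v"
  hence v: "v \<in> OK" "{x \<otimes> v |x. x \<in> OK} = mK" unfolding uniformizer_def PI nonunits_integers unfolding integers_eq by auto
  have vc: "v \<in> K" "v \<in> \<F>" using v(1) O_carrier unfolding OK_def by auto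
  have "w \<in> {x \<otimes> v |x. x \<in> OK}" using ww(1) v(2) by simp
  then obtain x where x: "w = x \<otimes> v" "x \<in> OK" by blast
  have "\<one> \<otimes> v \<in> {x \<otimes> v |x. x \<in> OK}" using subringE(3)[OF OK_subring] by blast
  hence "v \<in> mK" using v(2) vc by simp
  hence "v \<in> {x \<otimes> w |x. x \<in> OK}" using good[OF ww(4) sim_refl[OF ww(6)]] by simp
  then obtain y where y: "v = y \<otimes> w" "y \<in> OK" by blast
  have c: "x \<in> \<F>" "y \<in> \<F>" "x \<in> Oint" "y \<in> Oint" using x y O_carrier unfolding OK_def by auto
  have "w \<otimes> \<one> = w \<otimes> (y \<otimes> x)" using x(1) unfolding y(1) using c ww(6) by (simp add: m_ac)
  hence "y \<otimes> x = \<one>" using m_lcancel[of w \<one> "y \<otimes> x"] ww c by simp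
  hence "y \<notin> mx" using unit_iff[OF c(4)] c(3) by blast
  hence "w \<otimes> y \<approxeq> w" by (intro simI ww c)
  thus "v \<in> K \<and> v \<approxeq> w" using vc y(1) m_comm[OF c(2) ww(6)] by simp
 next
  assume v: "v \<in> K \<and> v \<approxeq> w"
  have "v \<in> Oint" using sim_O v ww(5) mx_O by blast
  thus "uniformizer KK v" unfolding uniformizer_def PI nonunits_integers unfolding integers_eq using good v unfolding OK_def by simp
 qed
qed

text \<open>Any other uniformizer has the valuation of \<open>w\<close>, so a representation of
  \<open>x\<close> by it has the same exponent; this makes the definite description in
  \<open>ord_val\<close> unique.\<close>

lemma ord_val_eq: assumes w: "unif w" and x: "x \<in> K" "x \<noteq> \<zero>" and n: "val w x n" shows "ord_val KK x = n"
 unfolding ord_val_def rec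
proof (rule the_equality)
 note ww = unifD[OF w]
 have xc: "x \<in> \<F>" using x K_carrier by auto
 have un: "uniformizer KK w" using uniformizer_iff[OF w] ww by simp
 show "\<exists>\<pi> u. uniformizer KK \<pi> \<and> u \<in> Units (integers KK) \<and> x = u \<otimes> \<pi> [^] n"
 proof (cases "n < 0")
  case True
  define b where "b = nat (- n)"
  have nb: "w [^] n = inv (w [^] b)" unfolding b_def int_pow_def2 using True by (rule if_P)
  have ib: "w [^] b \<in> \<F>" "inv (w [^] b) \<in> \<F>" "w [^] b \<otimes> inv (w [^] b) = \<one>"
   using unif_pow_nonzero[OF w, of b] field_Units by auto
  have "x \<otimes> w [^] b \<approxeq> \<one>" using n True unfolding val_def b_def by simp
  moreover have "x \<otimes> w [^] b \<in> K" by (rule subringE(6)[OF K_subring x(1) K_pow[OF ww(4)]])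
  moreover have "x = (x \<otimes> w [^] b) \<otimes> inv (w [^] b)" using xc ib by (simp add: m_assoc)
  ultimately show ?thesis using un unfolding Units_integers[symmetric] nb[symmetric] by (metis Units_integers)
 next
  case False
  define a where "a = nat n"
  have na: "w [^] n = w [^] a" unfolding a_def int_pow_def2 using False by (rule if_not_P)
  have ia: "w [^] a \<in> \<F>" "w [^] a \<noteq> \<zero>" "inv (w [^] a) \<in> \<F>" "inv (w [^] a) \<otimes> w [^] a = \<one>"
   using unif_pow_nonzero[OF w, of a] field_Units by auto
  define u where "u = x \<otimes> inv (w [^] a)"
  have uc: "u \<in> \<F>" "u \<in> K" unfolding u_def using xc ia subringE(6)[OF K_subring x(1) K_inv[OF K_pow[OF ww(4)] ia(2)]] by auto
  have xu: "x = u \<otimes> w [^] a" unfolding u_def using xc ia by (simp add: m_assoc)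
  have "w [^] a \<otimes> u \<approxeq> w [^] a \<otimes> \<one>" using n False xu xc ia(1) uc(1) unfolding val_def a_def by (simp add: m_comm)
  hence "u \<approxeq> \<one>" by (rule sim_cancel) (use uc ia in auto)
  hence "u \<in> Units (integers KK)" using uc(2) Units_integers by simp
  thus ?thesis using un xu unfolding na[symmetric] by blast
 qed
 fix m :: int assume "\<exists>\<pi> u. uniformizer KK \<pi> \<and> u \<in> Units (integers KK) \<and> x = u \<otimes> \<pi> [^] m"
 then obtain v u where v: "uniformizer KK v" "u \<in> Units (integers KK)" "x = u \<otimes> v [^] m" by blast
 have vw: "v \<in> K" "v \<approxeq> w" using v(1) uniformizer_iff[OF w] by auto
 have u: "u \<approxeq> \<one>" "u \<in> K" using v(2) Units_integers by auto
 have c: "v \<in> \<F>" "u \<in> \<F>" using vw u K_carrier by auto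
 have v0: "v \<noteq> \<zero>" by (rule sim_nonzero[OF vw(2) ww(2)])
 have vm: "v [^] m \<in> \<F> \<and> v [^] m \<otimes> v [^] nat (- m) = v [^] nat m"
 proof (cases "m < 0")
  case True
  have "v [^] nat (- m) \<in> Units F" using pow_nonzero[OF c(1) v0] c field_Units by simp
  moreover have "v [^] m = inv (v [^] nat (- m))" unfolding int_pow_def2 using True by (rule if_P)
  moreover have "nat m = 0" using True by simp
  ultimately show ?thesis using Units_l_inv Units_inv_closed by (simp only: nat_pow_0)
 next
  case False
  have "v [^] m = v [^] nat m" unfolding int_pow_def2 using False by (rule if_not_P)
  moreover have "nat (- m) = 0" using False by simp
  moreover have "v [^] nat m \<in> \<F>" using c(1) by simp
  ultimately show ?thesis using c by simp
 qed
 have "x \<otimes> w [^] nat (- m) \<approxeq> x \<otimes> v [^] nat (- m)" by (rule sim_mult[OF sim_refl[OF xc] sim_pow[OF sim_sym[OF vw(2)]]])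
 also have "x \<otimes> v [^] nat (- m) = u \<otimes> v [^] nat m" unfolding v(3) using vm c by (simp add: m_assoc)
 also have "\<dots> \<approxeq> \<one> \<otimes> w [^] nat m" by (rule sim_mult[OF u(1) sim_pow[OF vw(2)]])
 also have "\<one> \<otimes> w [^] nat m = w [^] nat m" using ww by simp
 finally have "val w x m" unfolding val_def .
 thus "m = n" using val_unique[OF w xc _ n] by blast
qed

lemma mult_group_carrier: "carrier (mult_group KK) = K - {\<zero>}"
proof -
 have "field (F\<lparr>carrier := K\<rparr>)" by (rule subfield_iff(2)[OF K_subfield])
 thus ?thesis unfolding mult_group_def rec using field.field_Units by (simp add: units_of_carrier field.field_Units)
qed

lemma mult_group_mult: "mult (mult_group KK) = mult F"
 unfolding mult_group_def rec units_of_def by simp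

section \<open>Abelianization of the Weil group\<close>

abbreviation "W \<equiv> carrier WK"

lemma weil_group_eq: "WK = G\<lparr>carrier := W\<rparr>"
 unfolding weil_group_def galois_group_eq by simp

text \<open>Near \<open>th\<close> the Weil topology is the Krull topology on the coset of
  \<open>th\<close> modulo inertia, which explains the condition on
  \<open>\<iota> th \<star> ta\<close>.\<close>

lemma weil_open_nbhd:
 assumes "openin (weil_topology KK) N" "th \<in> N"
 shows "\<exists>A. finite A \<and> A \<subseteq> \<F> \<and> (\<forall>ta\<in>gal. (\<forall>x\<in>A. ta x = th x) --> \<iota> th \<star> ta \<in> inert --> ta \<in> N)"
proof -
 have "generate_topology_on WB N" using assms(1) unfolding weil_topology_eq openin_topology_generated_by_iff .
 thus ?thesis using assms(2)
 proof (induction arbitrary: th rule: generate_topology_on.induct)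
  case (Int a b)
  obtain A where A: "finite A" "A \<subseteq> \<F>" "\<forall>ta\<in>gal. (\<forall>x\<in>A. ta x = th x) --> \<iota> th \<star> ta \<in> inert --> ta \<in> a"
   using Int.IH(1)[of th] Int.prems by (elim IntE exE conjE meta_mp) auto
  obtain B where B: "finite B" "B \<subseteq> \<F>" "\<forall>ta\<in>gal. (\<forall>x\<in>B. ta x = th x) --> \<iota> th \<star> ta \<in> inert --> ta \<in> b"
   using Int.IH(2)[of th] Int.prems by (elim IntE exE conjE meta_mp) auto
  show ?case using A B by (intro exI[of _ "A \<union> B"]) auto
 next
  case (UN C)
  then obtain k where k: "k \<in> C" "th \<in> k" by blast
  obtain A where "finite A" "A \<subseteq> \<F>" "\<forall>ta\<in>gal. (\<forall>x\<in>A. ta x = th x) --> \<iota> th \<star> ta \<in> inert --> ta \<in> k"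
   using UN.IH[OF k] by (elim exE conjE)
  thus ?case using k(1) by (intro exI[of _ A]) blast
 next
  case (Basis s)
  then obtain w V where w: "s = w <#\<^bsub>G\<^esub> V" "w \<in> gal" "openin (subtopology Ktop inert) V" unfolding WB_def using weil_gal by blast
  obtain V0 where V0: "openin Ktop V0" "V = V0 \<inter> inert" using w(3) openin_subtopology by metis
  obtain v where v: "v \<in> V" "th = w \<star> v" using Basis.prems unfolding w(1) l_coset_def by blast
  have v': "v \<in> V0" "v \<in> inert" "v \<in> gal" using v(1) V0(2) inert_iff by auto
  have tg: "th \<in> gal" unfolding v(2) using w(2) v'(3) by simp
  obtain A where A: "finite A" "A \<subseteq> \<F>" "\<forall>ta\<in>gal. (\<forall>x\<in>A. ta x = v x) --> ta \<in> V0"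
   using bspec[OF conjunct2[OF V0(1)[unfolded openin_Ktop]] v'(1)] by (elim exE conjE)
  show ?case
  proof (intro exI[of _ A] conjI ballI impI A(1,2))
   fix ta assume t: "ta \<in> gal" "\<forall>x\<in>A. ta x = th x" "\<iota> th \<star> ta \<in> inert"
   define r where "r = \<iota> w \<star> ta"
   have rg: "r \<in> gal" unfolding r_def using w(2) t(1) by simp
   have "\<forall>x\<in>A. r x = v x"
   proof
    fix x assume x: "x \<in> A"
    have xc: "x \<in> \<F>" using x A(2) by auto
    have "r x = (\<iota> w) (w (v x))" unfolding r_def using t(1,2) x xc w(2) v'(3) v(2) by (simp add: G_mult)
    thus "r x = v x" using G_inv1[OF w(2)] v'(3) xc by simp
   qed
   hence "r \<in> V0" using A(3) rg by blast
   moreover have "r = v \<star> (\<iota> th \<star> ta)"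
    by (rule gal_eq) (use rg w(2) v'(3) t(1) tg in "auto simp: r_def v(2) G_mult GG.inv_mult_group G_inv2")
   hence "r \<in> inert" using subgroup.m_closed[OF inert_subgroup v'(2) t(3)] by simp
   moreover have "ta = w \<star> r" by (rule gal_eq) (use rg w(2) t(1) in "auto simp: r_def G_mult G_inv2")
   ultimately show "ta \<in> s" unfolding w(1) l_coset_def V0(2) by blast
  qed
 qed simp
qed

lemma weil_nbhd_open:
 assumes c: "c \<in> W" and A: "finite A" "A \<subseteq> \<F>"
 shows "openin (weil_topology KK) (c <#\<^bsub>G\<^esub> {ta \<in> inert. \<forall>x\<in>A. ta x = x})"
proof -
 have "openin Ktop {ta \<in> gal. \<forall>x\<in>A. ta x = x}"
  unfolding openin_Ktop
 proof (intro conjI ballI)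
  fix th assume "th \<in> {ta \<in> gal. \<forall>x\<in>A. ta x = x}"
  thus "\<exists>B. finite B \<and> B \<subseteq> \<F> \<and> (\<forall>ta\<in>gal. (\<forall>x\<in>B. ta x = th x) --> ta \<in> {ta \<in> gal. \<forall>x\<in>A. ta x = x})"
   using A by (intro exI[of _ A]) auto
 qed auto
 moreover have "{ta \<in> inert. \<forall>x\<in>A. ta x = x} = {ta \<in> gal. \<forall>x\<in>A. ta x = x} \<inter> inert" using inert_iff by auto
 ultimately have "openin (subtopology Ktop inert) {ta \<in> inert. \<forall>x\<in>A. ta x = x}" unfolding openin_subtopology by blast
 thus ?thesis unfolding weil_topology_eq WB_def using c by (intro topology_generated_by_Basis) blast
qed

context
 fixes ph assumes frob: "degr ph 1"
begin

lemma W_iff: "w \<in> W \<longleftrightarrow> (\<exists>n. degr w n)" using weil_iff frob by blast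

lemma W_subgroup: "subgroup W G"
proof (rule subgroup.intro)
 show "W \<subseteq> carrier G" using weil_gal by auto
 show "x \<star> y \<in> W" if "x \<in> W" "y \<in> W" for x y using that unfolding W_iff by (elim exE) (rule exI, rule deg_mult)
 show "\<one>\<^bsub>G\<^esub> \<in> W" unfolding W_iff using deg_one by (rule exI)
 show "\<iota> x \<in> W" if "x \<in> W" for x using that unfolding W_iff by (elim exE) (rule exI, rule deg_inv)
qed

lemma weil_group_group: "Group.group WK"
 using subgroup.subgroup_is_group[OF W_subgroup G_group] weil_group_eq by simp

lemma weil_inv: "w \<in> W ==> inv\<^bsub>WK\<^esub> w = \<iota> w"
 using GG.m_inv_consistent[OF W_subgroup, of w] weil_group_eq by simp

lemma inert_W: "subgroup inert WK"
proof -
 have "inert \<subseteq> W" unfolding inert_def using W_iff by blast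
 thus ?thesis using GG.subgroup_incl[OF inert_subgroup W_subgroup] weil_group_eq by simp
qed

definition "D = derived WK W"
definition "C = weil_topology KK closure_of D"

lemma D_subgroup: "subgroup D WK"
 unfolding D_def by (rule group.derived_is_subgroup[OF weil_group_group]) simp

lemma D_inert: "D \<subseteq> inert"
 unfolding D_def derived_def
proof (rule group.generate_subgroup_incl[OF weil_group_group _ inert_W], intro subsetI)
 fix x assume "x \<in> derived_set WK W"
 then obtain a b where ab: "a \<in> W" "b \<in> W" "x = a \<star> b \<star> \<iota> a \<star> \<iota> b"
  using weil_inv unfolding weil_mult by auto
 obtain n m where "degr a n" "degr b m" using ab W_iff by blast
 hence "degr x (n + m + - n + - m)" unfolding ab(3) by (intro deg_mult deg_inv)
 thus "x \<in> inert" unfolding inert_def by simp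
qed

text \<open>Commutators have degree zero, so \<open>D\<close> lies in inertia, and its closure does
  too because cosets of inertia are open. Within inertia, closeness means agreement on finite
  sets.\<close>

lemma C_iff: "c \<in> C \<longleftrightarrow> c \<in> inert \<and> (\<forall>A. finite A --> A \<subseteq> \<F> --> (\<exists>d\<in>D. \<forall>x\<in>A. d x = c x))"
proof
 assume cC: "c \<in> C"
 have "c \<in> \<Union>WB" using cC unfolding C_def in_closure_of weil_topology_eq topology_generated_by_topspace by blast
 then obtain w V where w: "c \<in> w <#\<^bsub>G\<^esub> V" "w \<in> W" "openin (subtopology Ktop inert) V" unfolding WB_def by blast
 then obtain v where v: "v \<in> V" "c = w \<star> v" unfolding l_coset_def by blast
 have "v \<in> inert" using v(1) openin_subset[OF w(3)] by auto
 hence cW: "c \<in> W" unfolding v(2) using subgroup.m_closed[OF W_subgroup w(2)] subgroup.subset[OF inert_W] by auto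
 have cg: "c \<in> gal" by (rule weil_gal[OF cW])
 have near: "\<exists>d\<in>D. \<exists>ta\<in>inert. (\<forall>x\<in>A. ta x = x) \<and> d = c \<star> ta" if A: "finite A" "A \<subseteq> \<F>" for A
 proof -
  let ?N = "c <#\<^bsub>G\<^esub> {ta \<in> inert. \<forall>x\<in>A. ta x = x}"
  have "\<one>\<^bsub>G\<^esub> \<in> {ta \<in> inert. \<forall>x\<in>A. ta x = x}" using subgroup.one_closed[OF inert_subgroup] G_one A(2) by auto
  hence "c \<star> \<one>\<^bsub>G\<^esub> \<in> ?N" unfolding l_coset_def by blast
  hence "c \<in> ?N" using cg by simp
  hence "\<exists>d. d \<in> D \<and> d \<in> ?N" using cC weil_nbhd_open[OF cW A] unfolding C_def in_closure_of by blast
  thus ?thesis unfolding l_coset_def by blast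
 qed
 obtain d ta where d: "d \<in> D" "ta \<in> inert" "d = c \<star> ta" using near[of "{}"] by auto
 have tg: "ta \<in> gal" using d(2) inert_iff by blast
 have "c = d \<star> \<iota> ta" unfolding d(3) using cg tg by (simp add: GG.m_assoc)
 moreover have "d \<star> \<iota> ta \<in> inert"
  using subgroup.m_closed[OF inert_subgroup _ subgroup.m_inv_closed[OF inert_subgroup d(2)], of d] d(1) D_inert by blast
 ultimately have "c \<in> inert" by simp
 moreover have "\<exists>d\<in>D. \<forall>x\<in>A. d x = c x" if A: "finite A" "A \<subseteq> \<F>" for A
 proof -
  obtain d ta where d: "d \<in> D" "ta \<in> inert" "\<forall>x\<in>A. ta x = x" "d = c \<star> ta" using near[OF A] by blast
  have "ta \<in> gal" using d(2) inert_iff by blast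
  hence "\<forall>x\<in>A. d x = c x" unfolding d(4) using d(3) A(2) cg by (auto simp: G_mult subset_iff)
  thus ?thesis using d(1) by blast
 qed
 ultimately show "c \<in> inert \<and> (\<forall>A. finite A --> A \<subseteq> \<F> --> (\<exists>d\<in>D. \<forall>x\<in>A. d x = c x))" by blast
next
 assume c: "c \<in> inert \<and> (\<forall>A. finite A --> A \<subseteq> \<F> --> (\<exists>d\<in>D. \<forall>x\<in>A. d x = c x))"
 have cW: "c \<in> W" using c subgroup.subset[OF inert_W] by auto
 have "c \<star> \<one>\<^bsub>G\<^esub> \<in> c <#\<^bsub>G\<^esub> {ta \<in> inert. \<forall>x\<in>{}. ta x = x}"
  unfolding l_coset_def using subgroup.one_closed[OF inert_subgroup] by blast
 hence "c \<in> topspace (weil_topology KK)" using openin_subset[OF weil_nbhd_open[OF cW, of "{}"]] weil_gal[OF cW] by auto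
 moreover have "\<exists>y. y \<in> D \<and> y \<in> N" if N: "c \<in> N" "openin (weil_topology KK) N" for N
 proof -
  obtain A where A: "finite A" "A \<subseteq> \<F>" "\<forall>ta\<in>gal. (\<forall>x\<in>A. ta x = c x) --> \<iota> c \<star> ta \<in> inert --> ta \<in> N"
   using weil_open_nbhd[OF N(2,1)] by (elim exE conjE)
  obtain d where d: "d \<in> D" "\<forall>x\<in>A. d x = c x" using c A by blast
  have di: "d \<in> inert" using d(1) D_inert by auto
  have "\<iota> c \<star> d \<in> inert"
   using subgroup.m_closed[OF inert_subgroup subgroup.m_inv_closed[OF inert_subgroup] di, of c] c by blast
  hence "d \<in> N" using A(3) d(2) di inert_iff by blast
  thus ?thesis using d(1) by blast
 qed
 ultimately show "c \<in> C" unfolding C_def in_closure_of by blast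
qed

text \<open>The approximation of \<open>c\<close> is taken on the image of \<open>A\<close> under
  the inverse of \<open>c\<close>, respectively under \<open>c'\<close>, because this is where the
  inverse or the product evaluates it.\<close>

lemma C_subgroup: "subgroup C WK"
proof (rule subgroup.intro)
 have Cg: "c \<in> W" "c \<in> inert" "c \<in> gal" if "c \<in> C" for c using that C_iff subgroup.subset[OF inert_W] inert_iff by auto
 have Dg: "d \<in> gal" "d \<in> W" if "d \<in> D" for d using that D_inert inert_iff subgroup.subset[OF D_subgroup] by auto
 show "C \<subseteq> carrier WK" using Cg by auto
 show "\<one>\<^bsub>WK\<^esub> \<in> C"
  unfolding C_iff weil_mult using subgroup.one_closed[OF inert_subgroup] subgroup.one_closed[OF D_subgroup] unfolding weil_mult by blast
 fix c assume c: "c \<in> C"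
 show "inv\<^bsub>WK\<^esub> c \<in> C"
  unfolding weil_inv[OF Cg(1)[OF c]] C_iff
 proof (intro conjI allI impI)
  show "\<iota> c \<in> inert" using subgroup.m_inv_closed[OF inert_subgroup Cg(2)[OF c]] .
  fix A assume A: "finite A" "A \<subseteq> \<F>"
  have ic: "\<iota> c \<in> gal" using Cg(3)[OF c] by simp
  have "finite ((\<iota> c) ` A)" "(\<iota> c) ` A \<subseteq> \<F>" using A ic by (auto simp: subset_iff)
  then obtain d where d: "d \<in> D" "\<forall>x\<in>(\<iota> c) ` A. d x = c x" using c C_iff by blast
  have "(\<iota> d) x = (\<iota> c) x" if x: "x \<in> A" for x
  proof -
   have xc: "x \<in> \<F>" using x A by auto
   have "d ((\<iota> c) x) = x" using d(2) x G_inv2[OF Cg(3)[OF c] xc] by simp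
   thus ?thesis using G_inv1[OF Dg(1)[OF d(1)], of "(\<iota> c) x"] ic xc by simp
  qed
  moreover have "\<iota> d \<in> D" using subgroup.m_inv_closed[OF D_subgroup d(1)] weil_inv[OF Dg(2)[OF d(1)]] by simp
  ultimately show "\<exists>d\<in>D. \<forall>x\<in>A. d x = (\<iota> c) x" by blast
 qed
 fix c' assume c': "c' \<in> C"
 show "c \<otimes>\<^bsub>WK\<^esub> c' \<in> C"
  unfolding weil_mult C_iff
 proof (intro conjI allI impI)
  show "c \<star> c' \<in> inert" using subgroup.m_closed[OF inert_subgroup Cg(2)[OF c] Cg(2)[OF c']] .
  fix A assume A: "finite A" "A \<subseteq> \<F>"
  have "finite (c' ` A)" "c' ` A \<subseteq> \<F>" using A Cg(3)[OF c'] by (auto simp: subset_iff)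
  then obtain d where d: "d \<in> D" "\<forall>x\<in>c' ` A. d x = c x" using c C_iff by blast
  obtain d' where d': "d' \<in> D" "\<forall>x\<in>A. d' x = c' x" using c' C_iff A by blast
  have "(d \<star> d') x = (c \<star> c') x" if x: "x \<in> A" for x
   using x A(2) d(2) d'(2) Dg(1)[OF d(1)] Dg(1)[OF d'(1)] Cg(3)[OF c] Cg(3)[OF c'] by (auto simp: G_mult subset_iff)
  moreover have "d \<star> d' \<in> D" using subgroup.m_closed[OF D_subgroup d(1) d'(1)] unfolding weil_mult .
  ultimately show "\<exists>d\<in>D. \<forall>x\<in>A. d x = (c \<star> c') x" by blast
 qed
qed

lemma weil_ab_eq: "weil_ab KK = WK Mod C" unfolding weil_ab_def C_def D_def ..

section \<open>The norm character\<close>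

context
 fixes s art assumes s: "s = 1 \<or> s = (- 1::int)" and art: "local_reciprocity s KK art"
begin

lemma art_bij: "bij_betw art (K - {\<zero>}) (rcosets\<^bsub>WK\<^esub> C)"
 using art unfolding local_reciprocity_def iso_def mult_group_carrier weil_ab_eq carrier_FactGroup FactGroup_def by simp

lemma art_coset: "x \<in> K - {\<zero>} ==> art x \<in> rcosets\<^bsub>WK\<^esub> C"
 using art_bij unfolding bij_betw_def by blast

lemma art_W: "x \<in> K - {\<zero>} ==> w \<in> art x ==> w \<in> W"
 using group.rcosets_part_G[OF weil_group_group C_subgroup] art_coset by blast

lemma art_nonempty: assumes "x \<in> K - {\<zero>}" obtains w where "w \<in> art x"
proof -
 obtain a where a: "a \<in> W" "art x = C #>\<^bsub>WK\<^esub> a" using art_coset[OF assms] unfolding RCOSETS_def by blast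
 have "a \<in> art x" unfolding a(2) by (rule group.rcos_self[OF weil_group_group a(1) C_subgroup])
 thus ?thesis using that by blast
qed

lemma art_mult: "x \<in> K - {\<zero>} ==> y \<in> K - {\<zero>} ==> art (x \<otimes> y) = {v \<star> w |v w. v \<in> art x \<and> w \<in> art y}"
proof -
 assume x: "x \<in> K - {\<zero>}" "y \<in> K - {\<zero>}"
 have "art \<in> hom (mult_group KK) (weil_ab KK)" using art unfolding local_reciprocity_def iso_def by simp
 hence "art (x \<otimes>\<^bsub>mult_group KK\<^esub> y) = art x \<otimes>\<^bsub>weil_ab KK\<^esub> art y"
  by (rule hom_mult) (use x mult_group_carrier in auto)
 thus ?thesis unfolding mult_group_mult weil_ab_eq FactGroup_def by (auto simp: set_mult_def weil_mult)
qed

lemma art_uniformizer: assumes v: "uniformizer KK v" "v \<in> K - {\<zero>}" and w: "w \<in> art v" shows "degr w s"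
proof -
 interpret WG: Group.group "WK" by (rule weil_group_group)
 have wW: "w \<in> W" by (rule art_W[OF v(2) w])
 have "frobenius_element KK (w [^]\<^bsub>WK\<^esub> s)" using art v(1) w unfolding local_reciprocity_def by blast
 hence f: "degr (w [^]\<^bsub>WK\<^esub> s) 1" unfolding frobenius_iff .
 from s show ?thesis
 proof
  assume s1: "s = 1"
  have "w [^]\<^bsub>WK\<^esub> s = w" unfolding s1 using wW WG.int_pow_1 by simp
  thus ?thesis using f s1 by simp
 next
  assume s1: "s = - 1"
  have "w [^]\<^bsub>WK\<^esub> s = inv\<^bsub>WK\<^esub> w"
   unfolding s1 using wW WG.int_pow_neg[of w 1] WG.int_pow_1 by simp
  hence "degr (\<iota> w) 1" using f weil_inv[OF wW] by simp
  hence "degr (\<iota> (\<iota> w)) (- 1)" by (rule deg_inv)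
  thus ?thesis using weil_gal[OF wW] s1 by simp
 qed
qed

lemma Kx_mult: "x \<in> K - {\<zero>} ==> y \<in> K - {\<zero>} ==> x \<otimes> y \<in> K - {\<zero>}"
 using subringE(6)[OF K_subring, of x y] integral_iff[of x y] K_carrier by auto

lemma Kx_pow: "x \<in> K - {\<zero>} ==> x [^] (k::nat) \<in> K - {\<zero>}"
 using K_pow[of x k] pow_nonzero[of x k] K_carrier by auto

text \<open>Reciprocity prescribes degrees only on uniformizers. With \<open>a\<close> and
  \<open>b\<close> the positive and negative parts of the valuation \<open>m\<close>, the element
  \<open>y\<close> with \<open>y w ^ a = x w ^ (b + 1)\<close> is again a uniformizer. Comparing
  degrees on both sides shows that the degree is \<open>s\<close> times the valuation.\<close>

lemma art_degree:
 assumes w: "unif w" and x: "x \<in> K - {\<zero>}" and m: "val w x m" and v: "v \<in> art x"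
 shows "degr v (s * m)"
proof -
 note ww = unifD[OF w]
 have wK: "w \<in> K - {\<zero>}" using ww by simp
 have xc: "x \<in> \<F>" using x K_carrier by auto
 define a b where "a = nat m" and "b = nat (- m)"
 have xb: "x \<otimes> w [^] b \<approxeq> w [^] a" using m unfolding val_def a_def b_def .
 have ia: "w [^] a \<in> \<F>" "w [^] a \<noteq> \<zero>" "inv (w [^] a) \<in> \<F>" "inv (w [^] a) \<otimes> w [^] a = \<one>"
  using unif_pow_nonzero[OF w, of a] field_Units by auto
 define y where "y = x \<otimes> w [^] Suc b \<otimes> inv (w [^] a)"
 have iK: "inv (w [^] a) \<in> K - {\<zero>}" using K_inv[OF K_pow[OF ww(4)] ia(2)] ia by auto
 have yK: "y \<in> K - {\<zero>}" unfolding y_def by (rule Kx_mult[OF Kx_mult[OF x Kx_pow[OF wK]] iK])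
 have yc: "y \<in> \<F>" using yK K_carrier by auto
 have yx: "y \<otimes> w [^] a = x \<otimes> w [^] Suc b" unfolding y_def using ia xc ww(6) by (simp add: m_assoc)
 have "w [^] a \<otimes> y = (x \<otimes> w [^] b) \<otimes> w" using yx ia yc xc ww(6) by (simp add: m_ac)
 also have "\<dots> \<approxeq> w [^] a \<otimes> w" by (rule sim_mult[OF xb sim_refl[OF ww(6)]])
 finally have "y \<approxeq> w" by (rule sim_cancel) (use ia yc ww in auto)
 hence uy: "uniformizer KK y" using uniformizer_iff[OF w] yK by simp
 have uw: "uniformizer KK w" using uniformizer_iff[OF w] ww by simp
 \<comment> \<open>One contribution \<open>s\<close> comes from \<open>y\<close> and one from each
   factor \<open>w\<close>.\<close>
 have all: "\<forall>g\<in>art (y \<otimes> w [^] k). degr g (s * int (Suc k))" for k :: nat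
 proof (induction k)
  case 0
  show ?case using art_uniformizer[OF uy yK] yc by simp
 next
  case (Suc k)
  show ?case
  proof
   fix g assume g: "g \<in> art (y \<otimes> w [^] Suc k)"
   have "y \<otimes> w [^] Suc k = (y \<otimes> w [^] k) \<otimes> w" using yc ww(6) by (simp add: m_assoc)
   hence "g \<in> {v \<star> v' |v v'. v \<in> art (y \<otimes> w [^] k) \<and> v' \<in> art w}"
    using g art_mult[OF Kx_mult[OF yK Kx_pow[OF wK, of k]] wK] by simp
   then obtain c d where cd: "c \<in> art (y \<otimes> w [^] k)" "d \<in> art w" "g = c \<star> d" by blast
   have "degr g (s * int (Suc k) + s)" unfolding cd(3) by (rule deg_mult) (use Suc.IH cd art_uniformizer[OF uw wK] in auto)
   thus "degr g (s * int (Suc (Suc k)))" by (simp add: algebra_simps)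
  qed
 qed
 obtain w0 where w0: "w0 \<in> art w" using art_nonempty[OF wK] by blast
 have dw0: "degr w0 s" by (rule art_uniformizer[OF uw wK w0])
 have mem: "v \<star> w0 [^]\<^bsub>G\<^esub> k \<in> art (x \<otimes> w [^] k)" for k :: nat
 proof (induction k)
  case 0
  show ?case using v xc weil_gal[OF art_W[OF x v]] by simp
 next
  case (Suc k)
  have "x \<otimes> w [^] Suc k = (x \<otimes> w [^] k) \<otimes> w" using xc ww(6) by (simp add: m_assoc)
  moreover have "v \<star> w0 [^]\<^bsub>G\<^esub> Suc k = (v \<star> w0 [^]\<^bsub>G\<^esub> k) \<star> w0"
   using weil_gal[OF art_W[OF x v]] deg_gal[OF dw0]
    GG.m_assoc[of v "w0 [^]\<^bsub>G\<^esub> k" w0] GG.nat_pow_closed[of w0 k] by simp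
  ultimately show ?case using art_mult[OF Kx_mult[OF x Kx_pow[OF wK, of k]] wK] Suc.IH w0 by auto
 qed
 have "degr (v \<star> w0 [^]\<^bsub>G\<^esub> Suc b) (s * int (Suc a))" using all[of a] mem[of "Suc b"] unfolding yx by blast
 moreover have w0b: "degr (w0 [^]\<^bsub>G\<^esub> Suc b) (int (Suc b) * s)" by (rule deg_nat_pow[OF dw0])
 ultimately have "degr ((v \<star> w0 [^]\<^bsub>G\<^esub> Suc b) \<star> \<iota> (w0 [^]\<^bsub>G\<^esub> Suc b)) (s * int (Suc a) + - (int (Suc b) * s))"
  by (intro deg_mult deg_inv)
 moreover have "(v \<star> w0 [^]\<^bsub>G\<^esub> Suc b) \<star> \<iota> (w0 [^]\<^bsub>G\<^esub> Suc b) = v"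
  using weil_gal[OF art_W[OF x v]] deg_gal[OF w0b] GG.m_assoc[of v "w0 [^]\<^bsub>G\<^esub> Suc b" "\<iota> (w0 [^]\<^bsub>G\<^esub> Suc b)"]
  by (simp del: nat_pow_Suc)
 moreover have "s * int (Suc a) + - (int (Suc b) * s) = s * m"
 proof -
  have m: "m = int a - int b" unfolding a_def b_def by simp
  show ?thesis by (subst m) (simp add: algebra_simps)
 qed
 ultimately show ?thesis by simp
qed

text \<open>The cosets are disjoint and \<open>art\<close> is injective, so \<open>v\<close> lies in
  \<open>art x\<close> for exactly one \<open>x\<close>, which resolves the definite description.
  The degree of \<open>v\<close> is \<open>s\<close> times the valuation of \<open>x\<close>, and
  \<open>s * s = 1\<close> recovers the valuation.\<close>

lemma norm_degree: assumes v: "v \<in> W" shows "\<exists>n. degr v n \<and> norm_character KK art v = real q powi (- (s * n))"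
proof -
 interpret WG: Group.group "WK" by (rule weil_group_group)
 have "C #>\<^bsub>WK\<^esub> v \<in> rcosets\<^bsub>WK\<^esub> C" using v unfolding RCOSETS_def by blast
 hence "C #>\<^bsub>WK\<^esub> v \<in> art ` (K - {\<zero>})" using bij_betw_imp_surj_on[OF art_bij] by simp
 then obtain x where x: "x \<in> K - {\<zero>}" "art x = C #>\<^bsub>WK\<^esub> v" by (elim imageE) simp
 have vx: "v \<in> art x" unfolding x(2) by (rule WG.rcos_self[OF v C_subgroup])
 have the: "(THE x. x \<in> carrier (mult_group KK) \<and> v \<in> art x) = x"
  unfolding mult_group_carrier
 proof (rule the_equality)
  fix y assume y: "y \<in> K - {\<zero>} \<and> v \<in> art y"
  have "pairwise disjnt (rcosets\<^bsub>WK\<^esub> C)" by (rule WG.rcos_disjoint[OF C_subgroup])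
  hence "art y = art x" using y vx art_coset x(1) unfolding pairwise_def disjnt_def by blast
  thus "y = x" using art_bij y x(1) unfolding bij_betw_def inj_on_def by blast
 qed (use x vx in blast)
 obtain w where w: "unif w" using ex_unif by blast
 obtain m where m: "val w x m" using ex_val[OF w] x(1) by blast
 have "degr v (s * m)" by (rule art_degree[OF w x(1) m vx])
 moreover have "norm_character KK art v = real q powi (- m)"
  unfolding norm_character_def the residue_card_eq using ord_val_eq[OF w _ _ m] x(1) by simp
 moreover have "s * (s * m) = m" using s by auto
 ultimately show ?thesis by (intro exI[of _ "s * m"] conjI) (simp_all only:)
qed

end

end

end

section \<open>The Weil-Deligne group\<close>

context padic_record_iso
begin

text \<open>With the same sign convention \<open>s\<close> on both sides, both norm characters are
  the same function of the degree and of \<open>q\<close>, and these are preserved.\<close>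

lemma norm_transfer:
 assumes s: "s = 1 \<or> s = (- 1::int)" and a: "local_reciprocity s KK artK" "local_reciprocity s LL artL"
  and w: "w \<in> carrier (weil_group KK)"
 shows "norm_character LL artL (\<alpha> w) = norm_character KK artK w"
proof -
 obtain ph where f: "A.degr ph 1" using w A.weil_iff by blast
 obtain n where n: "A.degr w n" "norm_character KK artK w = real A.q powi (- (s * n))"
  using A.norm_degree[OF f s a(1) w] by blast
 obtain m where m: "B.degr (\<alpha> w) m" "norm_character LL artL (\<alpha> w) = real B.q powi (- (s * m))"
  using B.norm_degree[OF deg_transfer[OF f] s a(2) weil_transfer[OF w]] by blast
 have "m = n" by (rule B.deg_unique[OF m(1) deg_transfer[OF n(1)]])
 thus ?thesis using m n q_eq by simp
qed

text \<open>The two actions on the complex numbers correspond because the norm characters do, so the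
  identity is the right map on the second component.\<close>

lemma weil_deligne_iso:
 assumes s: "s = 1 \<or> s = (- 1::int)" and a: "local_reciprocity s KK artK" "local_reciprocity s LL artL"
 shows "map_prod \<alpha> id \<in> iso (weil_deligne_group KK artK) (weil_deligne_group LL artL)"
proof -
 have hom: "\<alpha> \<in> hom (weil_group KK) (weil_group LL)" and bij: "bij_betw \<alpha> (carrier (weil_group KK)) (carrier (weil_group LL))"
  using weil_iso unfolding iso_def by auto
 have "map_prod \<alpha> id \<in> hom (weil_deligne_group KK artK) (weil_deligne_group LL artL)"
  using hom weil_transfer norm_transfer[OF s a] unfolding hom_def weil_deligne_group_def by auto
 moreover have "bij_betw (map_prod \<alpha> id) (carrier (weil_group KK) \<times> (UNIV :: complex set)) (carrier (weil_group LL) \<times> UNIV)"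
  using bij unfolding bij_betw_def inj_on_def by (auto simp: image_iff) force
 ultimately show ?thesis unfolding iso_def by (simp add: weil_deligne_group_def)
qed

lemma weil_deligne_homeomorphic:
 "homeomorphic_map (weil_deligne_topology KK) (weil_deligne_topology LL) (map_prod \<alpha> id)"
proof -
 obtain g where g: "homeomorphic_maps (weil_topology KK) (weil_topology LL) \<alpha> g" using weil_homeomorphic homeomorphic_map_maps by blast
 have "homeomorphic_maps euclidean euclidean (id :: complex \<Rightarrow> complex) id" unfolding homeomorphic_maps_def by simp
 hence "homeomorphic_maps (weil_deligne_topology KK) (weil_deligne_topology LL) (map_prod \<alpha> id) (map_prod g id)"
  unfolding weil_deligne_topology_def map_prod_def using g by (simp only: homeomorphic_maps_prod) simp
 thus ?thesis using homeomorphic_map_maps by blast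
qed

end

theorem proposition7p1p2:
 fixes K :: "'a padic_ext" and L :: "'b padic_ext"
  and \<alpha> :: "('a \<Rightarrow> 'a) \<Rightarrow> ('b \<Rightarrow> 'b)"
 assumes "padic_field K" and "padic_field L"
  and "top_group_iso (galois_group K) (galois_topology K) (galois_group L) (galois_topology L) \<alpha>"
 shows "(top_group_iso (weil_group K) (weil_topology K) (weil_group L) (weil_topology L) \<alpha> \<and>
      (\<forall>\<phi>. frobenius_element K \<phi> \<longrightarrow> frobenius_element L (\<alpha> \<phi>))) \<and>
     (\<forall>s artK artL. s \<in> {1, -1} \<and> local_reciprocity s K artK \<and> local_reciprocity s L artL \<longrightarrow>
      top_group_iso (weil_deligne_group K artK) (weil_deligne_topology K)
       (weil_deligne_group L artL) (weil_deligne_topology L) (map_prod \<alpha> id) \<and>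
      (\<forall>z. wd_frobenius_element K z \<longrightarrow> wd_frobenius_element L (map_prod \<alpha> id z)))"
proof -
 obtain Z Q where A: "padic_galois (alg_cl K) (res_char K) Z Q (base_field K)" "Z = qp_emb K ` Zp (res_char K)"
  using padic_galois_of_padic_field[OF assms(1)] by blast
 obtain Z' Q' where B: "padic_galois (alg_cl L) (res_char L) Z' Q' (base_field L)" "Z' = qp_emb L ` Zp (res_char L)"
  using padic_galois_of_padic_field[OF assms(2)] by blast
 interpret A: padic_record "alg_cl K" "res_char K" Z Q "base_field K" K
  using A by (intro padic_record.intro padic_record_axioms.intro) auto
 interpret B: padic_record "alg_cl L" "res_char L" Z' Q' "base_field L" L
  using B by (intro padic_record.intro padic_record_axioms.intro) auto
 interpret padic_record_iso "alg_cl K" "res_char K" Z Q "base_field K" K "alg_cl L" "res_char L" Z' Q' "base_field L" L \<alpha>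
  by unfold_locales (use assms(3) in "auto simp: top_group_iso_def A.galois_group_eq B.galois_group_eq A.galois_topology_eq B.galois_topology_eq")
 have frob: "frobenius_element L (\<alpha> \<phi>)" if "frobenius_element K \<phi>" for \<phi>
  using that deg_transfer unfolding A.frobenius_iff B.frobenius_iff by blast
 show ?thesis
  unfolding top_group_iso_def wd_frobenius_element_def
  using weil_iso weil_homeomorphic weil_deligne_iso weil_deligne_homeomorphic frob by auto
qed

end
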